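(* Let $G=\mathbf{Spin}_5$ and let $B$ be a Borel subgroup of $G$. Then every Schubert variety $X_{wB}$ in $G/B$ ($w\in W$) is a spherical $L(w)$-variety.
   Context: Everything is over $\mathbb{C}$; $\mathbf{Spin}_5$ is the simply connected simple group of type $\mathrm{B}_2$. $T\subset B$ is a maximal torus, $W=N_G(T)/T$ is the Weyl group, and for $w\in W$, $X_{wB}$ is the Zariski closure of $BwB/B$ in $G/B$. $P(w)=\mathrm{Stab}_G(X_{wB})$ is the stabilizer under left multiplication (a parabolic subgroup containing $B$), and $L(w)$ is the Levi subgroup of $P(w)$ containing $T$. For a connected reductive group $H$, a normal variety $Y$ with an algebraic $H$-action is a spherical $H$-variety if a Borel subgroup of $H$ has a dense open orbit in $Y$. *)

theory Defs
  imports
    "HOL-Analysis.Analysis"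
    "HOL-Library.Numeral_Type"
    "HOL-Algebra.Solvable_Groups"
    "HOL-Algebra.Left_Coset"
    "HOL-Algebra.Group_Action"
begin

section \<open>Linear algebraic groups over the complex numbers\<close>

inductive_set poly_fun :: "(complex^'n^'n \<Rightarrow> complex) set" where
  const: "(\<lambda>_. c) \<in> poly_fun"
| entry: "(\<lambda>A. A $ i $ j) \<in> poly_fun"
| add: "f \<in> poly_fun \<Longrightarrow> g \<in> poly_fun \<Longrightarrow> (\<lambda>A. f A + g A) \<in> poly_fun"
| mult: "f \<in> poly_fun \<Longrightarrow> g \<in> poly_fun \<Longrightarrow> (\<lambda>A. f A * g A) \<in> poly_fun"

definition zariski :: "(complex^'n^'n) topology" where
  "zariski = topology (\<lambda>U. \<exists>F \<subseteq> poly_fun. U = {A. \<exists>f\<in>F. f A \<noteq> 0})"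

lemma openin_zariski:
  fixes U :: "(complex^'n^'n) set"
  shows "openin zariski U \<longleftrightarrow> (\<exists>F \<subseteq> poly_fun. U = {A. \<exists>f\<in>F. f A \<noteq> 0})"
proof -
  have "istopology (\<lambda>U. \<exists>F \<subseteq> poly_fun. U = {A :: complex^'n^'n. \<exists>f\<in>F. f A \<noteq> 0})"
    unfolding istopology_def
  proof (intro conjI allI impI)
    fix S T :: "(complex^'n^'n) set"
    assume "\<exists>F \<subseteq> poly_fun. S = {A. \<exists>f\<in>F. f A \<noteq> 0}" "\<exists>F \<subseteq> poly_fun. T = {A. \<exists>f\<in>F. f A \<noteq> 0}"
    then obtain F F' where F: "F \<subseteq> poly_fun" "S = {A. \<exists>f\<in>F. f A \<noteq> 0}"
      and F': "F' \<subseteq> poly_fun" "T = {A. \<exists>f\<in>F'. f A \<noteq> 0}"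
      by (elim exE conjE)
    have "(\<lambda>(f, g) A. f A * g A) ` (F \<times> F') \<subseteq> poly_fun"
      using F(1) F'(1) by (auto intro!: poly_fun.mult)
    moreover have "S \<inter> T = {A. \<exists>h \<in> (\<lambda>(f, g) A. f A * g A) ` (F \<times> F'). h A \<noteq> 0}"
      unfolding F(2) F'(2) by auto
    ultimately show "\<exists>F \<subseteq> poly_fun. S \<inter> T = {A. \<exists>f\<in>F. f A \<noteq> 0}"
      by (intro exI conjI)
  next
    fix K :: "(complex^'n^'n) set set"
    assume "\<forall>S\<in>K. \<exists>F \<subseteq> poly_fun. S = {A. \<exists>f\<in>F. f A \<noteq> 0}"
    from bchoice[OF this] obtain F
      where F: "\<forall>S\<in>K. F S \<subseteq> poly_fun \<and> S = {A. \<exists>f\<in>F S. f A \<noteq> 0}" ..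
    have "(\<Union>S\<in>K. F S) \<subseteq> poly_fun"
      using F by (intro UN_least) (drule (1) bspec, elim conjE)
    moreover have "\<Union>K = {A. \<exists>f \<in> (\<Union>S\<in>K. F S). f A \<noteq> 0}"
    proof (rule subset_antisym; rule subsetI)
      fix A assume "A \<in> \<Union>K"
      then obtain S where S: "S \<in> K" "A \<in> S" by (elim UnionE)
      have "S = {A. \<exists>f\<in>F S. f A \<noteq> 0}" by (rule conjunct2[OF bspec[OF F S(1)]])
      from this S(2) have "A \<in> {A. \<exists>f\<in>F S. f A \<noteq> 0}" by (rule subst)
      with S(1) show "A \<in> {A. \<exists>f \<in> (\<Union>S\<in>K. F S). f A \<noteq> 0}" by blast
    next
      fix A assume "A \<in> {A. \<exists>f \<in> (\<Union>S\<in>K. F S). f A \<noteq> 0}"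
      then obtain S where S: "S \<in> K" "A \<in> {A. \<exists>f\<in>F S. f A \<noteq> 0}" by blast
      have "S = {A. \<exists>f\<in>F S. f A \<noteq> 0}" by (rule conjunct2[OF bspec[OF F S(1)]])
      from this[symmetric] S(2) have "A \<in> S" by (rule subst)
      with S(1) show "A \<in> \<Union>K" ..
    qed
    ultimately show "\<exists>F \<subseteq> poly_fun. \<Union>K = {A. \<exists>f\<in>F. f A \<noteq> 0}"
      by (intro exI conjI)
  qed
  then show ?thesis
    unfolding zariski_def by (simp only: topology_inverse')
qed

definition GL :: "(complex^'n^'n) monoid" where
  "GL = \<lparr>carrier = {A. invertible A}, mult = (**), one = mat 1\<rparr>"

abbreviation sub_group :: "(complex^'n^'n) set \<Rightarrow> (complex^'n^'n) monoid" where
  "sub_group H \<equiv> GL\<lparr>carrier := H\<rparr>"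

definition linear_algebraic_group :: "(complex^'n^'n) set \<Rightarrow> bool" where
  "linear_algebraic_group H \<longleftrightarrow>
     subgroup H GL \<and> closedin (subtopology zariski (carrier GL)) H"

definition connected_algebraic_group :: "(complex^'n^'n) set \<Rightarrow> bool" where
  "connected_algebraic_group H \<longleftrightarrow> linear_algebraic_group H \<and> connectedin zariski H"

definition borel_subgroup :: "(complex^'n^'n) set \<Rightarrow> (complex^'n^'n) set \<Rightarrow> bool" where
  "borel_subgroup G B \<longleftrightarrow>
     B \<subseteq> G \<and> connected_algebraic_group B \<and> solvable (sub_group B) \<and>
     (\<forall>B'. B' \<subseteq> G \<and> connected_algebraic_group B' \<and> solvable (sub_group B') \<and> B \<subseteq> B'
        \<longrightarrow> B' = B)"

text \<open>The coordinate ring of a closed subgroup \<open>H\<close> of \<open>GL\<close> is generated by the restrictions of the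
  matrix entries and of \<open>1/det\<close>.\<close>

definition coordinate_fun :: "(complex^'n^'n) set \<Rightarrow> (complex^'n^'n \<Rightarrow> complex) \<Rightarrow> bool" where
  "coordinate_fun H f \<longleftrightarrow> (\<exists>p\<in>poly_fun. \<exists>k. \<forall>A\<in>H. f A = p A / det A ^ k)"

definition algebraic_hom ::
  "(complex^'n^'n) set \<Rightarrow> (complex^'m^'m) set \<Rightarrow> (complex^'n^'n \<Rightarrow> complex^'m^'m) \<Rightarrow> bool" where
  "algebraic_hom H K \<phi> \<longleftrightarrow>
     \<phi> \<in> hom (sub_group H) (sub_group K) \<and> (\<forall>i j. coordinate_fun H (\<lambda>A. \<phi> A $ i $ j))"

definition algebraic_iso ::
  "(complex^'n^'n) set \<Rightarrow> (complex^'m^'m) set \<Rightarrow> (complex^'n^'n \<Rightarrow> complex^'m^'m) \<Rightarrow> bool" where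
  "algebraic_iso H K \<phi> \<longleftrightarrow>
     algebraic_hom H K \<phi> \<and> bij_betw \<phi> H K \<and> algebraic_hom K H (inv_into H \<phi>)"

text \<open>The standard torus of dimension \<open>card S\<close>, embedded in the diagonal matrices of \<open>GL\<close>.\<close>

definition diagonal_torus :: "'n set \<Rightarrow> (complex^'n^'n) set" where
  "diagonal_torus S =
     {A \<in> carrier GL. (\<forall>i j. i \<noteq> j \<longrightarrow> A $ i $ j = 0) \<and> (\<forall>i. i \<notin> S \<longrightarrow> A $ i $ i = 1)}"

text \<open>A torus contained in \<open>GL\<close> has dimension at most the size of the matrices, so the
  tori \<open>diagonal_torus S\<close> of the same matrix size represent all possible isomorphism types.\<close>

definition torus :: "(complex^'n^'n) set \<Rightarrow> bool" where
  "torus T \<longleftrightarrow> linear_algebraic_group T \<and>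
     (\<exists>(S :: 'n set) \<phi>. algebraic_iso (diagonal_torus S) T \<phi>)"

definition maximal_torus :: "(complex^'n^'n) set \<Rightarrow> (complex^'n^'n) set \<Rightarrow> bool" where
  "maximal_torus G T \<longleftrightarrow>
     T \<subseteq> G \<and> torus T \<and> (\<forall>T'. T' \<subseteq> G \<and> torus T' \<and> T \<subseteq> T' \<longrightarrow> T' = T)"

definition weyl_group :: "(complex^'n^'n) set \<Rightarrow> (complex^'n^'n) set \<Rightarrow> (complex^'n^'n) set monoid" where
  "weyl_group G T = sub_group (normalizer (sub_group G) T) Mod T"

definition unipotent :: "complex^'n^'n \<Rightarrow> bool" where
  "unipotent A \<longleftrightarrow> (\<exists>k. (((**) (A - mat 1)) ^^ k) (mat 1) = 0)"

text \<open>The largest closed connected normal unipotent subgroup, obtained as the union of all of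
  them.\<close>

definition unipotent_radical :: "(complex^'n^'n) set \<Rightarrow> (complex^'n^'n) set" where
  "unipotent_radical P =
     \<Union> {U. connected_algebraic_group U \<and> U \<lhd> sub_group P \<and> (\<forall>A\<in>U. unipotent A)}"

definition connected_reductive :: "(complex^'n^'n) set \<Rightarrow> bool" where
  "connected_reductive H \<longleftrightarrow> connected_algebraic_group H \<and> unipotent_radical H = {mat 1}"

definition levi_subgroup :: "(complex^'n^'n) set \<Rightarrow> (complex^'n^'n) set \<Rightarrow> bool" where
  "levi_subgroup P L \<longleftrightarrow>
     linear_algebraic_group L \<and> L \<subseteq> P \<and>
     L <#>\<^bsub>GL\<^esub> unipotent_radical P = P \<and> L \<inter> unipotent_radical P = {mat 1}"

section \<open>The variety of left cosets\<close>

text \<open>Regular functions on a locally closed set of matrices are those which are locally quotients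
  of polynomials.\<close>

definition regular_on :: "(complex^'n^'n) set \<Rightarrow> (complex^'n^'n \<Rightarrow> complex) \<Rightarrow> bool" where
  "regular_on U f \<longleftrightarrow>
     (\<forall>x\<in>U. \<exists>V. \<exists>p\<in>poly_fun. \<exists>q\<in>poly_fun. openin zariski V \<and> x \<in> V \<and>
        (\<forall>y \<in> V \<inter> U. q y \<noteq> 0 \<and> f y = p y / q y))"

text \<open>\<open>G/B\<close> is the set of left cosets with the quotient topology; a function on an open
  subset is regular iff its pullback to \<open>G\<close> is.\<close>

definition coset_preimage ::
  "(complex^'n^'n) set \<Rightarrow> (complex^'n^'n) set \<Rightarrow> (complex^'n^'n) set set \<Rightarrow> (complex^'n^'n) set" where
  "coset_preimage G B U = {g \<in> G. g <#\<^bsub>GL\<^esub> B \<in> U}"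

definition coset_space ::
  "(complex^'n^'n) set \<Rightarrow> (complex^'n^'n) set \<Rightarrow> (complex^'n^'n) set topology" where
  "coset_space G B = topology (\<lambda>U. U \<subseteq> lcosets\<^bsub>sub_group G\<^esub> B \<and>
     openin (subtopology zariski G) (coset_preimage G B U))"

lemma openin_coset_space:
  "openin (coset_space G B) U \<longleftrightarrow>
     U \<subseteq> lcosets\<^bsub>sub_group G\<^esub> B \<and> openin (subtopology zariski G) (coset_preimage G B U)"
proof -
  have "istopology (\<lambda>U. U \<subseteq> lcosets\<^bsub>sub_group G\<^esub> B \<and>
     openin (subtopology zariski G) (coset_preimage G B U))"
    unfolding istopology_def
  proof (intro conjI allI impI)
    fix S T
    assume S: "S \<subseteq> lcosets\<^bsub>sub_group G\<^esub> B \<and> openin (subtopology zariski G) (coset_preimage G B S)"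
      and T: "T \<subseteq> lcosets\<^bsub>sub_group G\<^esub> B \<and> openin (subtopology zariski G) (coset_preimage G B T)"
    have "coset_preimage G B (S \<inter> T) = coset_preimage G B S \<inter> coset_preimage G B T"
      unfolding coset_preimage_def by auto
    then show "openin (subtopology zariski G) (coset_preimage G B (S \<inter> T))"
      using S T by (simp add: openin_Int)
    show "S \<inter> T \<subseteq> lcosets\<^bsub>sub_group G\<^esub> B"
      using S by auto
  next
    fix K
    assume K: "\<forall>S\<in>K. S \<subseteq> lcosets\<^bsub>sub_group G\<^esub> B \<and>
      openin (subtopology zariski G) (coset_preimage G B S)"
    have "coset_preimage G B (\<Union>K) = (\<Union>S\<in>K. coset_preimage G B S)"
      unfolding coset_preimage_def by auto
    then show "openin (subtopology zariski G) (coset_preimage G B (\<Union>K))"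
      using K by auto
    show "\<Union>K \<subseteq> lcosets\<^bsub>sub_group G\<^esub> B"
      using K by auto
  qed
  then show ?thesis
    unfolding coset_space_def by (simp only: topology_inverse')
qed

definition regular_on_cosets ::
  "(complex^'n^'n) set \<Rightarrow> (complex^'n^'n) set \<Rightarrow> (complex^'n^'n) set set \<Rightarrow>
     ((complex^'n^'n) set \<Rightarrow> complex) \<Rightarrow> bool" where
  "regular_on_cosets G B U f \<longleftrightarrow> regular_on (coset_preimage G B U) (\<lambda>g. f (g <#\<^bsub>GL\<^esub> B))"

text \<open>The (reduced) structure sheaf of a closed subset \<open>Y\<close> of \<open>G/B\<close>: \<open>f\<close> is regular on the open
  subset \<open>U\<close> of \<open>Y\<close> iff it is locally the restriction of a regular function on an open subset
  of \<open>G/B\<close>.\<close>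

definition regular_on_subvariety ::
  "(complex^'n^'n) set \<Rightarrow> (complex^'n^'n) set \<Rightarrow> (complex^'n^'n) set set \<Rightarrow>
     (complex^'n^'n) set set \<Rightarrow> ((complex^'n^'n) set \<Rightarrow> complex) \<Rightarrow> bool" where
  "regular_on_subvariety G B Y U f \<longleftrightarrow>
     openin (subtopology (coset_space G B) Y) U \<and>
     (\<forall>y\<in>U. \<exists>V h. openin (coset_space G B) V \<and> y \<in> V \<and> regular_on_cosets G B V h \<and>
        (\<forall>z \<in> V \<inter> U. f z = h z))"

definition irreducible_subvariety ::
  "(complex^'n^'n) set \<Rightarrow> (complex^'n^'n) set \<Rightarrow> (complex^'n^'n) set set \<Rightarrow> bool" where
  "irreducible_subvariety G B Y \<longleftrightarrow>
     closedin (coset_space G B) Y \<and> Y \<noteq> {} \<and>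
     (\<forall>C D. closedin (coset_space G B) C \<and> closedin (coset_space G B) D \<and> Y = C \<union> D
        \<longrightarrow> Y = C \<or> Y = D)"

text \<open>\<open>Y\<close> is normal if every local ring \<open>O\<^bsub>Y,y\<^esub>\<close> is integrally closed in its field of fractions, the
  function field of the irreducible variety \<open>Y\<close>. Elements of that field are given by a regular
  function \<open>f\<close> on a nonempty open set \<open>U\<close>, elements of \<open>O\<^bsub>Y,y\<^esub>\<close> by regular functions on open
  neighbourhoods of \<open>y\<close>; the coefficients \<open>a i\<close> of a monic equation for \<open>f\<close> may be taken on a common
  neighbourhood \<open>V\<close>.\<close>

definition normal_subvariety ::
  "(complex^'n^'n) set \<Rightarrow> (complex^'n^'n) set \<Rightarrow> (complex^'n^'n) set set \<Rightarrow> bool" where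
  "normal_subvariety G B Y \<longleftrightarrow>
     irreducible_subvariety G B Y \<and>
     (\<forall>y\<in>Y. \<forall>U f. U \<noteq> {} \<and> regular_on_subvariety G B Y U f \<and>
        (\<exists>V (n::nat) a. y \<in> V \<and> (\<forall>i<n. regular_on_subvariety G B Y V (a i)) \<and>
           openin (subtopology (coset_space G B) Y) V \<and>
           (\<forall>z \<in> U \<inter> V. f z ^ n + (\<Sum>i<n. a i z * f z ^ i) = 0))
        \<longrightarrow> (\<exists>V g. y \<in> V \<and> regular_on_subvariety G B Y V g \<and> (\<forall>z \<in> U \<inter> V. g z = f z)))"

text \<open>\<open>H\<close> acts on \<open>G/B\<close> by left multiplication, which is an algebraic action; so is its restriction to
  an \<open>H\<close>-stable closed subvariety \<open>Y\<close>.\<close>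

definition spherical_subvariety ::
  "(complex^'n^'n) set \<Rightarrow> (complex^'n^'n) set \<Rightarrow> (complex^'n^'n) set \<Rightarrow>
     (complex^'n^'n) set set \<Rightarrow> bool" where
  "spherical_subvariety G B H Y \<longleftrightarrow>
     connected_reductive H \<and> H \<subseteq> G \<and>
     normal_subvariety G B Y \<and> (\<forall>h\<in>H. \<forall>y\<in>Y. h <#\<^bsub>GL\<^esub> y \<in> Y) \<and>
     (\<exists>K. borel_subgroup H K \<and> (\<exists>y\<in>Y. let orbit = (\<lambda>k. k <#\<^bsub>GL\<^esub> y) ` K in
        openin (subtopology (coset_space G B) Y) orbit \<and>
        Abstract_Topology.closure_of (subtopology (coset_space G B) Y) orbit = Y))"

text \<open>An element \<open>w\<close> of the Weyl group is itself a coset of \<open>T\<close>, hence a set of matrices, and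
  \<open>BwB\<close> is a product of sets.\<close>

definition schubert_variety ::
  "(complex^'n^'n) set \<Rightarrow> (complex^'n^'n) set \<Rightarrow> (complex^'n^'n) set \<Rightarrow> (complex^'n^'n) set set" where
  "schubert_variety G B w =
     Abstract_Topology.closure_of (coset_space G B)
       ((\<lambda>g. g <#\<^bsub>GL\<^esub> B) ` (B <#>\<^bsub>GL\<^esub> w <#>\<^bsub>GL\<^esub> B))"

definition schubert_stabilizer ::
  "(complex^'n^'n) set \<Rightarrow> (complex^'n^'n) set \<Rightarrow> (complex^'n^'n) set \<Rightarrow> (complex^'n^'n) set" where
  "schubert_stabilizer G B w =
     {g \<in> G. (\<lambda>y. g <#\<^bsub>GL\<^esub> y) ` schubert_variety G B w = schubert_variety G B w}"

section \<open>The spin group\<close>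

text \<open>The complex Clifford algebra of the quadratic form \<open>\<Sum>i. v\<^sub>i\<^sup>2\<close> has the basis
  \<open>e\<^sub>P = e\<^sub>p \<cdots> e\<^sub>q\<close> (factors in increasing order, \<open>P = {p < \<dots> < q}\<close>), and \<open>e\<^sub>P e\<^sub>Q\<close> is
  \<open>\<plusminus> e\<^sub>R\<close> for the symmetric difference \<open>R\<close> of \<open>P\<close> and \<open>Q\<close>, by \<open>e\<^sub>i e\<^sub>j = - e\<^sub>j e\<^sub>i\<close> for \<open>i \<noteq> j\<close>
  and \<open>e\<^sub>i e\<^sub>i = 1\<close>.\<close>

type_synonym 'n clifford = "complex^('n set)"

definition clifford_mult :: "'n::{finite,linorder} clifford \<Rightarrow> 'n clifford \<Rightarrow> 'n clifford" where
  "clifford_mult x y = (\<chi> R. \<Sum>(P, Q) \<in> {(P, Q). (P - Q) \<union> (Q - P) = R}.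
     (-1) ^ card {(p, q). p \<in> P \<and> q \<in> Q \<and> q < p} * x $ P * y $ Q)"

definition clifford_one :: "'n::{finite,linorder} clifford" where
  "clifford_one = axis {} 1"

text \<open>The anti-automorphism that fixes all vectors reverses the order of the factors of \<open>e\<^sub>P\<close>.\<close>

definition clifford_rev :: "'n::{finite,linorder} clifford \<Rightarrow> 'n clifford" where
  "clifford_rev x = (\<chi> P. (-1) ^ (card P choose 2) * x $ P)"

definition clifford_even :: "'n::{finite,linorder} clifford set" where
  "clifford_even = {x. \<forall>P. odd (card P) \<longrightarrow> x $ P = 0}"

definition clifford_vectors :: "'n::{finite,linorder} clifford set" where
  "clifford_vectors = {x. \<forall>P. card P \<noteq> 1 \<longrightarrow> x $ P = 0}"

definition spin_elements :: "'n::{finite,linorder} clifford set" where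
  "spin_elements = {x \<in> clifford_even. clifford_mult x (clifford_rev x) = clifford_one \<and>
     (\<forall>v\<in>clifford_vectors. clifford_mult (clifford_mult x v) (clifford_rev x) \<in> clifford_vectors)}"

text \<open>The spin group as a linear group, via the left regular representation of the Clifford
  algebra (which is faithful).\<close>

definition spin_group :: "(complex^('n::{finite,linorder} set)^('n set)) set" where
  "spin_group = (\<lambda>x. matrix (clifford_mult x)) ` spin_elements"

abbreviation Spin5 :: "(complex^(5 set)^(5 set)) set" where
  "Spin5 \<equiv> spin_group"

end

theory Submission
  imports Defs "HOL-Computational_Algebra.Polynomial_Factorial"
    "HOL-Computational_Algebra.Field_as_Ring" "HOL-Computational_Algebra.Fundamental_Theorem_Algebra"
begin

text \<open>The spin representation identifies the spin group with the symplectic group \<open>Sp4\<close> of four by four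
  matrices, because the gamma matrices can be chosen self-adjoint for the symplectic form. By the Lie--Kolchin
  theorem the pair \<open>T \<subseteq> B\<close> is conjugate to the diagonal and the upper triangular matrices. Each of the eight
  Schubert varieties is then given by the vanishing of some entries and two by two minors of
  the first two columns. It meets the opposite big cell in an affine space or, for one of the
  two threefolds, in the product of a line and a quadric cone \<open>y\<^sub>3\<^sup>2 = y\<^sub>2 y\<^sub>4\<close>, the quotient of the plane by
  \<open>\<plusminus>1\<close>; this gives normality because polynomial rings are factorial. The stabiliser is a standard parabolic
  subgroup, \<open>L\<close> is its standard Levi subgroup since it contains \<open>T\<close>, and the complement of an explicit
  semi-invariant hypersurface is a single orbit of the Borel subgroup of \<open>L\<close>.\<close>

section \<open>Polynomial functions and the Zariski topology\<close>

text \<open>No step refers to dimensions. \<open>Psi\<close> embeds the four by four matrices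
  polynomially and multiplicatively, and \<open>rho\<close> reads the entries back polynomially.
  Conjugating such a pair by a symplectic matrix gives another one, so a given pair T, B becomes
  standard by changing the embedding, not the group. Lie--Kolchin triangularises a torus but does
  not diagonalise it; for this, averages over N-torsion are used, which need only roots of unity and
  a degree bound. Radical and Levi subgroup are specified by abstract conditions, so each must be
  pinned down: the radical by traces of products of conjugates, the Levi subgroup by a torus element
  with trivial centraliser in the unipotent radical. The Weyl group is not enumerated: a
  representative is treated as a symplectic matrix and sorted into eight cases by the vanishing of
  entries and minors. Every chart starts from four-space, whatever the dimension of the Schubert
  variety, so that one factorial ring serves all cases; \<open>descends\<close> returns from there
  to the variety.\<close>

lemma poly_fun_compose:
  assumes "p \<in> poly_fun"
    and "\<And>c. Q (\<lambda>_. c)"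
    and "\<And>f g. Q f \<Longrightarrow> Q g \<Longrightarrow> Q (\<lambda>x. f x + g x)"
    and "\<And>f g. Q f \<Longrightarrow> Q g \<Longrightarrow> Q (\<lambda>x. f x * g x)"
    and "\<And>i j. Q (\<lambda>x. \<phi> x $ i $ j)"
  shows "Q (\<lambda>x. p (\<phi> x))"
  \<comment> \<open>The class \<open>Q\<close> is left abstract because the same closure argument
    serves for fractions on a set, univariate polynomials, coordinate functions and polynomials in
    four variables.\<close>
  using assms(1) by induction (use assms in auto)

lemma poly_fun_comp:
  assumes "p \<in> poly_fun" "\<And>i j. (\<lambda>x. \<phi> x $ i $ j) \<in> poly_fun"
  shows "(\<lambda>x. p (\<phi> x)) \<in> poly_fun"
  by (rule poly_fun_compose[OF assms(1)]) (auto intro: poly_fun.intros assms(2))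

lemma poly_fun_cmult: "f \<in> poly_fun \<Longrightarrow> (\<lambda>A. c * f A) \<in> poly_fun"
  by (rule poly_fun.mult[OF poly_fun.const])

lemma poly_fun_uminus: "f \<in> poly_fun \<Longrightarrow> (\<lambda>A. - f A) \<in> poly_fun"
  using poly_fun_cmult[of f "-1"] by simp

lemma poly_fun_diff: "f \<in> poly_fun \<Longrightarrow> g \<in> poly_fun \<Longrightarrow> (\<lambda>A. f A - g A) \<in> poly_fun"
  using poly_fun.add[OF _ poly_fun_uminus, of f g] by simp

lemma poly_fun_sum: "(\<And>i. i \<in> I \<Longrightarrow> f i \<in> poly_fun) \<Longrightarrow> (\<lambda>A. \<Sum>i\<in>I. f i A) \<in> poly_fun"
  by (induction I rule: infinite_finite_induct) (auto intro: poly_fun.intros)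

lemma poly_fun_prod: "(\<And>i. i \<in> I \<Longrightarrow> f i \<in> poly_fun) \<Longrightarrow> (\<lambda>A. \<Prod>i\<in>I. f i A) \<in> poly_fun"
  by (induction I rule: infinite_finite_induct) (auto intro: poly_fun.intros)

lemma poly_fun_power: "f \<in> poly_fun \<Longrightarrow> (\<lambda>A. f A ^ k) \<in> poly_fun"
  by (induction k) (auto intro: poly_fun.intros)

lemmas poly_fun_intros = poly_fun.intros poly_fun_cmult poly_fun_uminus poly_fun_diff poly_fun_sum
  poly_fun_prod poly_fun_power

lemma matrix_mult_entry: "(A ** B) $ i $ j = (\<Sum>k\<in>UNIV. A $ i $ k * B $ k $ j)"
  by (simp add: matrix_matrix_mult_def)

lemma poly_fun_matrix_mult:
  assumes "\<And>i j. (\<lambda>x. f x $ i $ j) \<in> poly_fun" "\<And>i j. (\<lambda>x. g x $ i $ j) \<in> poly_fun"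
  shows "(\<lambda>x. (f x ** g x) $ i $ j) \<in> poly_fun"
  unfolding matrix_matrix_mult_def using assms by (auto intro!: poly_fun_intros)

lemma poly_fun_det:
  assumes "\<And>i j. (\<lambda>x. f x $ i $ j) \<in> poly_fun"
  shows "(\<lambda>x. det (f x)) \<in> poly_fun"
  unfolding det_def using assms by (intro poly_fun_intros) auto

lemma poly_fun_vec:
  "(\<lambda>h. (h *v w) $ i) \<in> poly_fun"
  unfolding matrix_vector_mult_def by (simp, intro poly_fun_sum poly_fun.mult) (auto intro: poly_fun.intros)

lemma poly_fun_vec':
  "(\<lambda>h. (n *v (h *v w)) $ i) \<in> poly_fun"
  unfolding matrix_vector_mult_def[of n] by (simp, intro poly_fun_sum poly_fun_cmult poly_fun_vec)

lemma closedin_zariski: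
  "closedin zariski C \<longleftrightarrow> (\<exists>F \<subseteq> poly_fun. C = {A. \<forall>f\<in>F. f A = 0})"
proof -
  have top: "topspace (zariski :: (complex^'n^'n) topology) = UNIV"
    unfolding topspace_def using openin_zariski[of UNIV]
    by (auto intro!: exI[of _ UNIV] exI[of _ "{\<lambda>_. 1}"] intro: poly_fun.const)
  have "closedin zariski C \<longleftrightarrow> (\<exists>F \<subseteq> poly_fun. - C = {A. \<exists>f\<in>F. f A \<noteq> 0})"
    by (simp add: closedin_def top openin_zariski Compl_eq_Diff_UNIV)
  also have "\<dots> \<longleftrightarrow> (\<exists>F \<subseteq> poly_fun. C = {A. \<forall>f\<in>F. f A = 0})"
    by (intro ex_cong1 conj_cong refl) blast
  finally show ?thesis .
qed

lemma topspace_zariski [simp]: "topspace zariski = UNIV"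
proof -
  have "closedin (zariski :: (complex^'n^'n) topology) UNIV"
    unfolding closedin_zariski by (intro exI[of _ "{}"]) auto
  then show ?thesis
    using closedin_subset by blast
qed

lemma closedin_zariskiI:
  "F \<subseteq> poly_fun \<Longrightarrow> C = {A. \<forall>f\<in>F. f A = 0} \<Longrightarrow> closedin zariski C"
  unfolding closedin_zariski by blast

lemma closedin_zariski_zero: "f \<in> poly_fun \<Longrightarrow> closedin zariski {A. f A = 0}"
  by (rule closedin_zariskiI[of "{f}"]) auto

lemma closedin_zariski_eq:
  "f \<in> poly_fun \<Longrightarrow> g \<in> poly_fun \<Longrightarrow> closedin zariski {A. f A = g A}"
  using closedin_zariski_zero[OF poly_fun_diff, of f g] by simp

lemma openin_zariski_nonzero: "f \<in> poly_fun \<Longrightarrow> openin zariski {A. f A \<noteq> 0}"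
  unfolding openin_zariski by (intro exI[of _ "{f}"]) auto

lemma openin_zariski_basic:
  assumes "openin zariski U" "x \<in> U"
  obtains f where "f \<in> poly_fun" "f x \<noteq> 0" "\<And>y. f y \<noteq> 0 \<Longrightarrow> y \<in> U"
  using assms unfolding openin_zariski by blast

text \<open>A polynomial composed with \<open>\<phi>\<close> is a fraction with nonvanishing
  denominator on \<open>S\<close>, so its zero set there is that of the numerator. Denominators are
  allowed because the entries of an inverse matrix have the denominator \<open>det\<close>.\<close>

lemma continuous_map_zariski:
  fixes \<phi> :: "complex^'n^'n \<Rightarrow> complex^'m^'m"
  assumes "\<And>i j. \<exists>p\<in>poly_fun. \<exists>q\<in>poly_fun. \<forall>A\<in>S. q A \<noteq> 0 \<and> \<phi> A $ i $ j = p A / q A"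
  shows "continuous_map (subtopology zariski S) zariski \<phi>"
proof -
  define Q where "Q = (\<lambda>f. \<exists>p\<in>poly_fun. \<exists>q\<in>poly_fun. \<forall>A\<in>S. q A \<noteq> 0 \<and> f A = p A / q A)"
  have Q: "Q (\<lambda>x. p (\<phi> x))" if "p \<in> poly_fun" for p
  proof (rule poly_fun_compose[OF that])
    show "Q (\<lambda>_. c)" for c
      unfolding Q_def by (rule bexI[of _ "\<lambda>_. c"], rule bexI[of _ "\<lambda>_. 1"]) (auto intro: poly_fun.intros)
    show "Q (\<lambda>x. f x + g x)" if fg: "Q f" "Q g" for f g
    proof -
      obtain p q p' q' where h: "p \<in> poly_fun" "q \<in> poly_fun" "p' \<in> poly_fun" "q' \<in> poly_fun"
        "\<forall>A\<in>S. q A \<noteq> 0 \<and> f A = p A / q A" "\<forall>A\<in>S. q' A \<noteq> 0 \<and> g A = p' A / q' A"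
        using fg unfolding Q_def by blast
      show ?thesis unfolding Q_def
        by (rule bexI[of _ "\<lambda>A. p A * q' A + p' A * q A"], rule bexI[of _ "\<lambda>A. q A * q' A"])
          (use h in \<open>auto intro!: poly_fun.intros simp: add_frac_eq\<close>)
    qed
    show "Q (\<lambda>x. f x * g x)" if fg: "Q f" "Q g" for f g
    proof -
      obtain p q p' q' where h: "p \<in> poly_fun" "q \<in> poly_fun" "p' \<in> poly_fun" "q' \<in> poly_fun"
        "\<forall>A\<in>S. q A \<noteq> 0 \<and> f A = p A / q A" "\<forall>A\<in>S. q' A \<noteq> 0 \<and> g A = p' A / q' A"
        using fg unfolding Q_def by blast
      show ?thesis unfolding Q_def
        by (rule bexI[of _ "\<lambda>A. p A * p' A"], rule bexI[of _ "\<lambda>A. q A * q' A"])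
          (use h in \<open>auto intro!: poly_fun.intros simp: add_frac_eq\<close>)
    qed
    show "Q (\<lambda>x. \<phi> x $ i $ j)" for i j
      unfolding Q_def by (rule assms)
  qed
  show ?thesis
    unfolding continuous_map_closedin
  proof (intro conjI allI impI)
    fix C :: "(complex^'m^'m) set" assume "closedin zariski C"
    then obtain F where F: "F \<subseteq> poly_fun" "C = {A. \<forall>f\<in>F. f A = 0}"
      unfolding closedin_zariski by blast
    have "\<exists>p\<in>poly_fun. \<forall>A\<in>S. f (\<phi> A) = 0 \<longleftrightarrow> p A = 0" if f: "f \<in> F" for f
    proof -
      have "f \<in> poly_fun" using f F by blast
      from Q[OF this] show ?thesis unfolding Q_def by (metis divide_eq_0_iff)
    qed
    then obtain P where P: "\<forall>f\<in>F. P f \<in> poly_fun \<and> (\<forall>A\<in>S. f (\<phi> A) = 0 \<longleftrightarrow> P f A = 0)"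
      by metis
    have "closedin zariski {A. \<forall>f\<in>P ` F. f A = 0}"
      using P by (intro closedin_zariskiI[of "P ` F"]) auto
    moreover have "{x \<in> topspace (subtopology zariski S). \<phi> x \<in> C} = {A. \<forall>f\<in>P ` F. f A = 0} \<inter> S"
      using P unfolding F by auto
    ultimately show "closedin (subtopology zariski S) {x \<in> topspace (subtopology zariski S). \<phi> x \<in> C}"
      by (auto simp: closedin_subtopology)
  qed (auto)
qed

lemma continuous_map_zariski_poly:
  assumes "\<And>i j. (\<lambda>A. \<phi> A $ i $ j) \<in> poly_fun"
  shows "continuous_map zariski zariski \<phi>"
proof -
  have "\<exists>p\<in>poly_fun. \<exists>q\<in>poly_fun. \<forall>A\<in>UNIV. q A \<noteq> 0 \<and> \<phi> A $ i $ j = p A / q A" for i j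
    by (rule bexI[of _ "\<lambda>A. \<phi> A $ i $ j"], rule bexI[of _ "\<lambda>_. 1"]) (auto intro: assms poly_fun.const)
  from continuous_map_zariski[of UNIV \<phi>, OF this] show ?thesis by simp
qed

lemma connectedin_zariski_image:
  assumes "connectedin zariski S"
    "\<And>i j. \<exists>p\<in>poly_fun. \<exists>q\<in>poly_fun. \<forall>A\<in>S. q A \<noteq> 0 \<and> \<phi> A $ i $ j = p A / q A"
  shows "connectedin zariski (\<phi> ` S)"
  using connectedin_continuous_map_image[OF continuous_map_zariski[OF assms(2)], where S = S] assms(1)
  by (simp add: connectedin_subtopology)

lemma connectedin_zariski_image_poly:
  assumes "connectedin zariski S" "\<And>i j. (\<lambda>A. \<phi> A $ i $ j) \<in> poly_fun"
  shows "connectedin zariski (\<phi> ` S)"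
  using connectedin_continuous_map_image[OF continuous_map_zariski_poly[OF assms(2)]] assms(1) by simp

lemma continuous_on_poly_fun: "p \<in> poly_fun \<Longrightarrow> continuous_on S p"
  by (induction rule: poly_fun.induct) (auto intro!: continuous_intros)

lemma closed_zariski: "closedin zariski C \<Longrightarrow> closed C"
proof -
  assume "closedin zariski C"
  then obtain F where F: "F \<subseteq> poly_fun" "C = {A. \<forall>f\<in>F. f A = 0}"
    unfolding closedin_zariski by blast
  have "closed {A. f A = 0}" if "f \<in> F" for f
    using that F(1) by (intro closed_Collect_eq continuous_on_poly_fun continuous_on_const) auto
  moreover have "C = (\<Inter>f\<in>F. {A. f A = 0})" using F by auto
  ultimately show ?thesis by auto
qed

text \<open>Zariski closed sets are closed in the usual topology. Hence groups that are parametrised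
  by complex numbers can be proved connected by ordinary path or convexity arguments.\<close>

lemma connectedin_zariski_of_connected:
  fixes S :: "(complex^'n^'n) set"
  assumes "connected S" shows "connectedin zariski S"
proof -
  have "continuous_map euclidean zariski (\<lambda>x :: complex^'n^'n. x)"
    unfolding continuous_map_closedin by (auto dest: closed_zariski)
  from connectedin_continuous_map_image[OF this, of S] assms show ?thesis by simp
qed

text \<open>The finitely many other members of the cover have a closed union, which together with
  \<open>C i\<close> would separate \<open>H\<close>. In the application the \<open>C i\<close> are
  the level sets of an eigenvalue.\<close>

lemma connectedin_finite_closed_cover:
  assumes "connectedin X H" "finite I" "\<And>i. i \<in> I \<Longrightarrow> closedin X (C i)"
    and "H \<subseteq> (\<Union>i\<in>I. C i)" "\<And>i j. i \<in> I \<Longrightarrow> j \<in> I \<Longrightarrow> i \<noteq> j \<Longrightarrow> C i \<inter> C j \<inter> H = {}"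
    and "x \<in> H" "x \<in> C i" "i \<in> I"
  shows "H \<subseteq> C i"
proof (rule ccontr)
  assume "\<not> H \<subseteq> C i"
  then have ne: "(\<Union>j\<in>I - {i}. C j) \<inter> H \<noteq> {}" using assms(4) by auto
  have "closedin X (\<Union>j\<in>I - {i}. C j)" using assms(2,3) by (intro closedin_Union) auto
  moreover have "C i \<inter> (\<Union>j\<in>I - {i}. C j) \<inter> H = {}" using assms(5)[OF assms(8)] by blast
  moreover have "H \<subseteq> C i \<union> (\<Union>j\<in>I - {i}. C j)" using assms(4) by blast
  ultimately show False
    using assms(1,3,6,7,8) ne unfolding connectedin_closedin by blast
qed

section \<open>The general linear group\<close>

lemma GL_simps [simp]:
  "carrier GL = {A. invertible A}" "mult GL = (**)" "one GL = mat 1"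
  by (simp_all add: GL_def)

lemma group_GL: "group GL"
proof (rule groupI)
  fix x :: "complex^'n^'n" assume "x \<in> carrier GL"
  then obtain y where "x ** y = mat 1" "y ** x = mat 1" by (auto simp: invertible_def)
  then show "\<exists>y\<in>carrier GL. y \<otimes>\<^bsub>GL\<^esub> x = \<one>\<^bsub>GL\<^esub>" by (auto simp: invertible_def)
qed (auto simp: invertible_mult matrix_mul_assoc invertible_def[of "mat 1"])

interpretation GL: group "GL :: (complex^'n^'n) monoid"
  by (rule group_GL)

lemma inv_GL_unique: "A ** B = mat 1 \<Longrightarrow> inv\<^bsub>GL\<^esub> A = B"
  by (metis GL.inv_equality GL_simps invertible_right_inverse matrix_left_right_inverse mem_Collect_eq)

lemma inv_GL: "invertible A \<Longrightarrow> A ** inv\<^bsub>GL\<^esub> A = mat 1" "invertible A \<Longrightarrow> inv\<^bsub>GL\<^esub> A ** A = mat 1"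
  using GL.r_inv[of A] GL.l_inv[of A] by auto

lemma inv_GL_rational:
  fixes i j :: "'n::finite"
  shows "\<exists>p\<in>poly_fun. \<forall>A::complex^'n^'n. invertible A \<longrightarrow> (inv\<^bsub>GL\<^esub> A) $ i $ j = p A / det A"
proof -
  let ?p = "\<lambda>A::complex^'n^'n. det (\<chi> k l. if l = i then axis j 1 $ k else A $ k $ l)"
  have "(inv\<^bsub>GL\<^esub> A) $ i $ j = ?p A / det A" if "invertible A" for A :: "complex^'n^'n"
  proof -
    have "A *v (inv\<^bsub>GL\<^esub> A *v axis j 1) = axis j 1"
      using inv_GL(1)[OF that] by (simp add: matrix_vector_mul_assoc)
    with cramer[of A "inv\<^bsub>GL\<^esub> A *v axis j 1" "axis j 1"] that
    have "inv\<^bsub>GL\<^esub> A *v axis j 1 = (\<chi> k. det(\<chi> i l. if l=k then axis j 1 $i else A$i$l) / det A)"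
      by (simp add: invertible_det_nz)
    then have "(inv\<^bsub>GL\<^esub> A *v axis j 1) $ i = ?p A / det A" by simp
    moreover have "(inv\<^bsub>GL\<^esub> A *v axis j 1) $ i = (inv\<^bsub>GL\<^esub> A) $ i $ j"
      by (simp add: matrix_vector_mult_def axis_def if_distrib cong: if_cong)
    ultimately show ?thesis by simp
  qed
  moreover have "?p \<in> poly_fun"
  proof (rule poly_fun_det)
    fix k l
    show "(\<lambda>A. (\<chi> k l. if l = i then axis j 1 $ k else A $ k $ l) $ k $ l) \<in> poly_fun"
      by (cases "l = i") (simp_all add: poly_fun.const poly_fun.entry)
  qed
  ultimately show ?thesis by (intro bexI[of _ ?p]) simp_all
qed

section \<open>The Lie--Kolchin theorem\<close>

text \<open>With \<open>a\<close> fixed the commutator is a rational function of \<open>b\<close>;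
  the image contains 1, at \<open>b\<close> = 1. Thus each commutator is joined to 1 inside the
  derived group.\<close>

lemma connectedin_commutators:
  fixes H :: "(complex^'n^'n) set"
  assumes H: "subgroup H GL" "connectedin zariski H" and a: "a \<in> H"
  shows "connectedin zariski ((\<lambda>b. a ** b ** inv\<^bsub>GL\<^esub> a ** inv\<^bsub>GL\<^esub> b) ` H)"
proof (rule connectedin_zariski_image[OF H(2)])
  fix i j :: 'n
  have sub: "\<And>b. b \<in> H \<Longrightarrow> invertible b" using subgroup.subset[OF H(1)] by auto
  have "\<forall>m. \<exists>p\<in>poly_fun. \<forall>A::complex^'n^'n. invertible A \<longrightarrow> (inv\<^bsub>GL\<^esub> A) $ m $ j = p A / det A"
    using inv_GL_rational by blast
  then obtain P where P: "\<And>m. P m \<in> poly_fun"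
    "\<And>m A. invertible (A::complex^'n^'n) \<Longrightarrow> (inv\<^bsub>GL\<^esub> A) $ m $ j = P m A / det A" by metis
  have pf: "(\<lambda>b. (a ** b ** inv\<^bsub>GL\<^esub> a) $ i $ m) \<in> poly_fun" for m
    by (intro poly_fun_matrix_mult poly_fun.const poly_fun.entry)
  show "\<exists>p\<in>poly_fun. \<exists>q\<in>poly_fun. \<forall>A\<in>H. q A \<noteq> 0 \<and>
       (a ** A ** inv\<^bsub>GL\<^esub> a ** inv\<^bsub>GL\<^esub> A) $ i $ j = p A / q A"
    by (rule bexI[of _ "\<lambda>b. \<Sum>m\<in>UNIV. (a ** b ** inv\<^bsub>GL\<^esub> a) $ i $ m * P m b"], rule bexI[of _ det])
      (use sub P in \<open>auto intro!: poly_fun_sum poly_fun.mult pf poly_fun_det poly_fun.entry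
         simp: invertible_det_nz matrix_mult_entry[of "a ** b ** inv\<^bsub>GL\<^esub> a" for b] sum_divide_distrib\<close>)
qed

text \<open>Each element lies in a connected subset of the derived group that contains 1, by
  induction over the generation of the element. For a product \<open>h1 ** h2\<close> the set of
  \<open>h1\<close> is glued to the translate by \<open>h1\<close> of the set of \<open>h2\<close>;
  they meet in \<open>h1\<close>.\<close>

lemma connectedin_derived:
  fixes H :: "(complex^'n^'n) set"
  assumes H: "subgroup H GL" "connectedin zariski H"
  shows "connectedin zariski (derived GL H)"
proof -
  have sub: "H \<subseteq> carrier GL" by (rule subgroup.subset[OF H(1)])
  have D: "subgroup (derived GL H) GL" by (rule GL.derived_is_subgroup[OF sub])
  have com: "\<exists>S. connectedin zariski S \<and> mat 1 \<in> S \<and> x \<in> S \<and> S \<subseteq> derived GL H"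
    if x: "x \<in> derived_set GL H" for x
  proof -
    obtain a b where ab: "a \<in> H" "b \<in> H" "x = a ** b ** inv\<^bsub>GL\<^esub> a ** inv\<^bsub>GL\<^esub> b" using x by auto
    let ?S = "(\<lambda>b. a ** b ** inv\<^bsub>GL\<^esub> a ** inv\<^bsub>GL\<^esub> b) ` H"
    have "mat 1 \<in> ?S"
    proof (rule image_eqI[of _ _ "mat 1"])
      have "inv\<^bsub>GL\<^esub> (mat 1) = (mat 1 :: complex^'n^'n)" by (rule inv_GL_unique) simp
      then show "mat 1 = a ** mat 1 ** inv\<^bsub>GL\<^esub> a ** inv\<^bsub>GL\<^esub> (mat 1)"
        using inv_GL(1)[of a] ab(1) sub by (simp add: subset_iff)
    qed (use subgroup.one_closed[OF H(1)] in simp)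
    moreover have "?S \<subseteq> derived GL H"
      unfolding derived_def using ab(1) by (auto intro!: generate.incl) 
    ultimately show ?thesis using connectedin_commutators[OF H ab(1)] ab by blast
  qed
  have inv_com: "inv\<^bsub>GL\<^esub> x \<in> derived_set GL H" if x: "x \<in> derived_set GL H" for x
  proof -
    obtain a b where ab: "a \<in> H" "b \<in> H" "x = a ** b ** inv\<^bsub>GL\<^esub> a ** inv\<^bsub>GL\<^esub> b" using x by auto
    have "invertible a" "invertible b" using ab sub by auto
    have "x ** (b ** a ** inv\<^bsub>GL\<^esub> b ** inv\<^bsub>GL\<^esub> a) = a ** b ** inv\<^bsub>GL\<^esub> a ** (inv\<^bsub>GL\<^esub> b ** b) ** a ** inv\<^bsub>GL\<^esub> b ** inv\<^bsub>GL\<^esub> a"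
      unfolding ab(3) by (simp only: matrix_mul_assoc)
    also have "\<dots> = a ** b ** (inv\<^bsub>GL\<^esub> a ** a) ** inv\<^bsub>GL\<^esub> b ** inv\<^bsub>GL\<^esub> a"
      using inv_GL[OF \<open>invertible b\<close>] by (simp add: matrix_mul_assoc)
    also have "\<dots> = a ** (b ** inv\<^bsub>GL\<^esub> b) ** inv\<^bsub>GL\<^esub> a"
      using inv_GL[OF \<open>invertible a\<close>] by (simp add: matrix_mul_assoc)
    also have "\<dots> = mat 1"
      using inv_GL[OF \<open>invertible a\<close>] inv_GL[OF \<open>invertible b\<close>] by simp
    finally have "inv\<^bsub>GL\<^esub> x = b ** a ** inv\<^bsub>GL\<^esub> b ** inv\<^bsub>GL\<^esub> a" by (rule inv_GL_unique)
    then show ?thesis using ab by auto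
  qed
  have conn: "\<exists>S. connectedin zariski S \<and> mat 1 \<in> S \<and> x \<in> S \<and> S \<subseteq> derived GL H"
    if x: "x \<in> derived GL H" for x
    using x unfolding derived_def
  proof induction
    case one
    have "mat 1 \<in> derived GL H" using subgroup.one_closed[OF D] by simp
    then show ?case unfolding derived_def
      by (intro exI[of _ "{mat 1}"]) (auto simp: connectedin_sing)
  next
    case (incl h) then show ?case using com[of h] unfolding derived_def by blast
  next
    case (inv h) then show ?case using com[OF inv_com, of h] unfolding derived_def by blast
  next
    case (eng h1 h2)
    then obtain S1 S2 where S: "connectedin zariski S1" "mat 1 \<in> S1" "h1 \<in> S1" "S1 \<subseteq> derived GL H"
      "connectedin zariski S2" "mat 1 \<in> S2" "h2 \<in> S2" "S2 \<subseteq> derived GL H"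
      unfolding derived_def by blast
    have "connectedin zariski ((**) h1 ` S2)"
      by (rule connectedin_zariski_image_poly[OF S(5)]) (intro poly_fun_matrix_mult poly_fun.const poly_fun.entry)
    moreover have "h1 \<in> S1 \<inter> (**) h1 ` S2" using S(3,6) by (auto intro!: image_eqI[of _ _ "mat 1"])
    ultimately have "connectedin zariski (S1 \<union> (**) h1 ` S2)" using S(1) connectedin_Un by blast
    moreover have "(**) h1 ` S2 \<subseteq> derived GL H"
      using subgroup.m_closed[OF D] S(3,4,8) by auto
    ultimately show ?case
      using S by (intro exI[of _ "S1 \<union> (**) h1 ` S2"]) (auto simp: derived_def)
  qed
  then have *: "\<And>x. x \<in> derived GL H \<Longrightarrow> \<exists>S. connectedin zariski S \<and> mat 1 \<in> S \<and> x \<in> S \<and> S \<subseteq> derived GL H"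
    by blast
  have "derived GL H = \<Union>{S. connectedin zariski S \<and> mat 1 \<in> S \<and> S \<subseteq> derived GL H}"
    using conn by blast
  moreover have "connectedin zariski (\<Union>{S. connectedin zariski S \<and> mat 1 \<in> S \<and> S \<subseteq> derived GL H})"
    by (rule connectedin_Union) auto
  ultimately show ?thesis by simp
qed

section \<open>Eigenvalues and annihilating polynomials\<close>

lemma univariate_poly_fun:
  assumes "p \<in> poly_fun" "\<And>i j. \<exists>P. \<forall>s. \<phi> s $ i $ j = poly P s"
  shows "\<exists>P :: complex poly. \<forall>s. p (\<phi> s) = poly P s"
proof -
  show ?thesis
  proof (rule poly_fun_compose[OF assms(1), where Q = "\<lambda>f. \<exists>P. \<forall>s. f s = poly P s"])
    show "\<exists>P. \<forall>s. c = poly P s" for c by (rule exI[of _ "[:c:]"]) simp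
    show "\<exists>P. \<forall>s. f s + g s = poly P s" if "\<exists>P. \<forall>s. f s = poly P s" "\<exists>P. \<forall>s. g s = poly P s"
      for f g :: "complex \<Rightarrow> complex" using that by (metis poly_add)
    show "\<exists>P. \<forall>s. f s * g s = poly P s" if "\<exists>P. \<forall>s. f s = poly P s" "\<exists>P. \<forall>s. g s = poly P s"
      for f g :: "complex \<Rightarrow> complex" using that by (metis poly_mult)
  qed (use assms(2) in auto)
qed

text \<open>The polynomial det(1 - s A) in s has value 1 at 0, so it is visibly not zero. Its roots
  are the inverses of the nonzero eigenvalues; the eigenvalue 0 is added by hand.\<close>

lemma finite_eigenvalues:
  fixes A :: "complex^'n^'n"
  shows "finite {c. \<exists>v. v \<noteq> 0 \<and> A *v v = c *s v}"
proof -
  have "\<exists>P. \<forall>s. (mat 1 - (\<chi> i j. s * A $ i $ j)) $ i $ j = poly P s" for i j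
    by (rule exI[of _ "[:mat 1 $ i $ j, - A $ i $ j:]"]) simp
  from univariate_poly_fun[OF poly_fun_det[where f = "\<lambda>x. x"] this]
  obtain P where P: "\<And>s. det (mat 1 - (\<chi> i j. s * A $ i $ j)) = poly P s"
    using poly_fun.entry by fastforce
  have "poly P 0 = 1" using P[of 0]
    by (metis (mono_tags, lifting) det_I diff_zero mult_zero_left vec_eq_iff vec_lambda_beta zero_index)
  then have "P \<noteq> 0" by auto
  then have fin: "finite {s. poly P s = 0}" by (rule poly_roots_finite)
  have "{c. \<exists>v. v \<noteq> 0 \<and> A *v v = c *s v} \<subseteq> insert 0 (inverse ` {s. poly P s = 0})"
  proof
    fix c assume "c \<in> {c. \<exists>v. v \<noteq> 0 \<and> A *v v = c *s v}"
    then obtain v where v: "v \<noteq> 0" "A *v v = c *s v" by blast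
    show "c \<in> insert 0 (inverse ` {s. poly P s = 0})"
    proof (cases "c = 0")
      case False
      let ?M = "mat 1 - (\<chi> i j. inverse c * A $ i $ j)"
      have "(\<chi> i j. inverse c * A $ i $ j) *v v = inverse c *s (A *v v)"
        by (simp add: vec_eq_iff matrix_vector_mult_def sum_distrib_left mult.assoc)
      then have "?M *v v = 0" using v False by (simp add: matrix_vector_mult_diff_rdistrib)
      then have "det ?M = 0" using v
        by (metis invertible_det_nz matrix_left_invertible_ker invertible_left_inverse)
      then show ?thesis using P[of "inverse c"] False by (auto intro!: image_eqI[of _ _ "inverse c"])
    qed simp
  qed
  then show ?thesis using fin by (meson finite.insertI finite_imageI finite_subset)
qed

text \<open>This is the vector p(A) v, computed by Horner's scheme.\<close>

definition poly_apply :: "complex^'n^'n \<Rightarrow> complex^'n \<Rightarrow> complex poly \<Rightarrow> complex^'n" where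
  "poly_apply A v p = fold_coeffs (\<lambda>a x. a *s v + A *v x) p 0"

lemma poly_apply_0 [simp]: "poly_apply A v 0 = 0"
  by (simp add: poly_apply_def)

lemma poly_apply_pCons [simp]: "poly_apply A v (pCons a p) = a *s v + A *v poly_apply A v p"
  by (cases "a = 0 \<and> p = 0") (auto simp: poly_apply_def)

lemma poly_apply_add: "poly_apply A v (p + q) = poly_apply A v p + poly_apply A v q"
  by (induction p q rule: poly_induct2)
    (auto simp: matrix_vector_right_distrib vector_sadd_rdistrib algebra_simps)

lemma poly_apply_smult: "poly_apply A v (smult c p) = c *s poly_apply A v p"
  by (induction p) (auto simp: vector_smult_assoc vector_add_ldistrib vector_scalar_commute)

lemma poly_apply_sum: "poly_apply A v (sum f I) = (\<Sum>i\<in>I. poly_apply A v (f i))"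
  by (induction I rule: infinite_finite_induct) (auto simp: poly_apply_add)

lemma poly_apply_monom: "poly_apply A v (monom c i) = c *s ((\<lambda>x. A *v x) ^^ i) v"
  by (induction i) (auto simp: monom_0 monom_Suc vector_scalar_commute)

lemma poly_apply_in:
  assumes "vec.subspace W" "v \<in> W" "\<And>w. w \<in> W \<Longrightarrow> A *v w \<in> W"
  shows "poly_apply A v p \<in> W"
  by (induction p) (use assms in \<open>auto simp: vec.subspace_0 intro!: vec.subspace_add vec.subspace_scale\<close>)

lemma ex_annihilating_poly:
  fixes A :: "complex^'n^'n"
  shows "\<exists>p. p \<noteq> 0 \<and> poly_apply A v p = 0"
proof -
  let ?f = "\<lambda>i. ((\<lambda>x. A *v x) ^^ i) v"
  show ?thesis
  proof (cases "inj_on ?f {..CARD('n)}")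
    \<comment> \<open>Linear dependence is a notion for sets, so a repetition among the iterates has
      to be turned into a polynomial separately.\<close>
    case False
    then obtain i j where ij: "i \<noteq> j" "?f i = ?f j" unfolding inj_on_def by blast
    have "monom 1 i + monom (-1::complex) j \<noteq> 0"
      using ij(1) by (metis add_eq_0_iff add.inverse_inverse coeff_monom minus_monom one_neq_zero)
    moreover have "poly_apply A v (monom 1 i + monom (-1) j) = 0"
      using ij(2) by (simp add: poly_apply_add poly_apply_monom)
    ultimately show ?thesis by blast
  next
    case True
    let ?S = "?f ` {..CARD('n)}"
    have "vec.dependent ?S"
    proof (rule ccontr)
      assume "\<not> vec.dependent ?S"
      from vec.independent_bound_general[OF this] have "card ?S \<le> CARD('n)"
        using dim_subset_UNIV_cart_gen[of ?S] by linarith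
      then show False using card_image[OF True] by simp
    qed
    then obtain u where u: "\<exists>x\<in>?S. u x \<noteq> 0" "(\<Sum>x\<in>?S. u x *s x) = 0"
      using vec.dependent_finite[of ?S] by blast
    let ?p = "\<Sum>i\<le>CARD('n). monom (u (?f i)) i"
    have "poly_apply A v ?p = (\<Sum>i\<le>CARD('n). u (?f i) *s ?f i)"
      by (simp add: poly_apply_sum poly_apply_monom)
    also have "\<dots> = 0" using u(2) by (simp add: sum.reindex[OF True])
    finally have "poly_apply A v ?p = 0" .
    moreover obtain i where i: "i \<le> CARD('n)" "u (?f i) \<noteq> 0" using u(1) by auto
    have "coeff ?p i = u (?f i)" using i(1) by (simp add: coeff_sum if_distrib cong: if_cong)
    then have "?p \<noteq> 0" using i(2) by (metis coeff_0)
    ultimately show ?thesis by blast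
  qed
qed

text \<open>Take an annihilating polynomial p of least degree for a nonzero \<open>v\<close> in
  \<open>W\<close>, and a root z. For p = (X - z) q the vector q(A) v is nonzero by minimality, lies
  in \<open>W\<close>, and is killed by A - z.\<close>

lemma eigenvector_in_invariant_subspace:
  fixes A :: "complex^'n^'n"
  assumes W: "vec.subspace W" "W \<noteq> {0}" "\<And>w. w \<in> W \<Longrightarrow> A *v w \<in> W"
  shows "\<exists>w\<in>W. w \<noteq> 0 \<and> (\<exists>c. A *v w = c *s w)"
proof -
  obtain v where v: "v \<in> W" "v \<noteq> 0" using W(1,2) vec.subspace_0 by fastforce
  define p where "p = (ARG_MIN degree p. p \<noteq> 0 \<and> poly_apply A v p = 0)"
  have "p \<noteq> 0 \<and> poly_apply A v p = 0"
    unfolding p_def using ex_annihilating_poly[of A v] by (metis (mono_tags, lifting) arg_min_natI)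
  then have p: "p \<noteq> 0" "poly_apply A v p = 0" by auto
  have min: "degree p \<le> degree q" if "q \<noteq> 0" "poly_apply A v q = 0" for q
    unfolding p_def using arg_min_nat_le[of "\<lambda>p. p \<noteq> 0 \<and> poly_apply A v p = 0" q degree] that by auto
  have "degree p \<noteq> 0"
  proof
    assume "degree p = 0"
    then obtain a where "p = [:a:]" by (meson degree_eq_zeroE)
    then show False using p v by auto
  qed
  then have "\<not> constant (poly p)" by (simp add: constant_degree)
  then obtain z where "poly p z = 0" using fundamental_theorem_of_algebra by blast
  then obtain q where q: "p = [:-z, 1:] * q" by (metis dvdE poly_eq_0_iff_dvd)
  have q0: "q \<noteq> 0" using p(1) q by auto
  have "degree p = degree [:-z, 1:] + degree q" unfolding q using q0 by (intro degree_mult_eq) auto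
  then have "degree q < degree p" by simp
  then have nz: "poly_apply A v q \<noteq> 0" using min[OF q0] by linarith
  have "p = smult (-z) q + pCons 0 q" using q by simp
  then have "poly_apply A v p = (-z) *s poly_apply A v q + A *v poly_apply A v q"
    by (simp only: poly_apply_add poly_apply_smult poly_apply_pCons) simp
  then have "A *v poly_apply A v q = z *s poly_apply A v q"
    using p(2) by (simp add: vector_smult_lneg add_eq_0_iff2)
  then show ?thesis using nz poly_apply_in[OF W(1) v(1) W(3)] by blast
qed

text \<open>As h varies in \<open>H\<close>, the eigenvalue of \<open>n\<close> at
  \<open>h *v w\<close> takes finitely many values, and each value is attained on a closed set.
  Connectedness leaves only the value at h = 1.\<close>

lemma eigenvalue_constant:
  fixes n :: "complex^'n^'n"
  assumes H: "connectedin zariski H" "mat 1 \<in> H"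
    and w: "n *v w = c *s w"
    and ev: "\<And>h. h \<in> H \<Longrightarrow> h *v w \<noteq> 0 \<and> (\<exists>d. n *v (h *v w) = d *s (h *v w))"
    and h: "h \<in> H"
  shows "n *v (h *v w) = c *s (h *v w)"
proof -
  let ?I = "{d. \<exists>v. v \<noteq> 0 \<and> n *v v = d *s v}"
  let ?C = "\<lambda>d. {h. n *v (h *v w) = d *s (h *v w)}"
  have "H \<subseteq> ?C c"
  proof (rule connectedin_finite_closed_cover[OF H(1) finite_eigenvalues[of n], where x = "mat 1"])
    fix d
    have "?C d = {h. \<forall>f\<in>range (\<lambda>i h. (n *v (h *v w)) $ i - d * (h *v w) $ i). f h = 0}"
      by (auto simp: vec_eq_iff)
    then show "closedin zariski (?C d)"
      by (rule closedin_zariskiI[rotated])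
        (auto intro!: poly_fun_diff poly_fun_cmult poly_fun_vec poly_fun_vec')
  next
    show "H \<subseteq> (\<Union>d\<in>?I. ?C d)" using ev by blast
    show "?C i \<inter> ?C j \<inter> H = {}" if "i \<noteq> j" for i j
    proof -
      have False if "h \<in> H" "n *v (h *v w) = i *s (h *v w)" "n *v (h *v w) = j *s (h *v w)" for h
        using ev[OF that(1)] that(2,3) \<open>i \<noteq> j\<close> by (metis vector_mul_rcancel)
      then show ?thesis by blast
    qed
    show "mat 1 \<in> ?C c" using w by simp
    show "c \<in> ?I" using ev[OF H(2)] w by auto
  qed (rule H(2))
  then show ?thesis using h by blast
qed

text \<open>Induction on the derived length. A character of the derived group has a nonzero weight
  space, which \<open>H\<close> preserves. In a minimal \<open>H\<close>-stable subspace of it every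
  element of \<open>H\<close> acts as a scalar, so any nonzero vector there is a common
  eigenvector.\<close>

lemma lie_kolchin_derived:
  fixes H :: "(complex^'n^'n) set"
  assumes "subgroup H GL" "connectedin zariski H" "(derived GL ^^ k) H = {mat 1}"
  shows "\<exists>v. v \<noteq> 0 \<and> (\<forall>h\<in>H. \<exists>c. h *v v = c *s v)"
  using assms
proof (induction k arbitrary: H)
  case 0
  obtain j :: 'n where True by simp
  have "axis j (1::complex) \<noteq> 0" by (simp add: axis_eq_0_iff)
  then show ?case using 0 by (intro exI[of _ "axis j 1"]) (auto intro: exI[of _ 1])
next
  case (Suc k)
  note H = Suc.prems(1,2)
  have inv: "\<And>h. h \<in> H \<Longrightarrow> invertible h" using subgroup.subset[OF H(1)] by auto
  have one: "mat 1 \<in> H" using subgroup.one_closed[OF H(1)] by simp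
  have inj: "h *v w \<noteq> 0" if "h \<in> H" "w \<noteq> 0" for h w
    using inv[OF that(1)] that(2) by (metis invertible_left_inverse matrix_left_invertible_ker)
  let ?D = "derived GL H"
  have D: "subgroup ?D GL" by (rule GL.derived_is_subgroup[OF subgroup.subset[OF H(1)]])
  have DH: "?D \<subseteq> H" by (rule GL.derived_incl[OF order_refl H(1)])
  have "\<exists>v. v \<noteq> 0 \<and> (\<forall>h\<in>?D. \<exists>c. h *v v = c *s v)"
    by (rule Suc.IH[OF D connectedin_derived[OF H]]) (use Suc.prems(3) in \<open>simp add: funpow_swap1\<close>)
  then obtain v ch where v: "v \<noteq> 0" "\<And>h. h \<in> ?D \<Longrightarrow> h *v v = ch h *s v" by metis
  define W0 where "W0 = {w. \<forall>n\<in>?D. n *v w = ch n *s w}"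
  have W0: "vec.subspace W0"
    unfolding W0_def vec.subspace_def
    by (auto simp: matrix_vector_right_distrib vector_add_ldistrib vector_scalar_commute
        vector_smult_assoc mult.commute)
  have comm: "a ** b ** inv\<^bsub>GL\<^esub> a ** inv\<^bsub>GL\<^esub> b \<in> ?D" if "a \<in> H" "b \<in> H" for a b
    unfolding derived_def using that by (auto intro!: generate.incl)
  \<comment> \<open>For n in the derived group, n h w = h (h^-1 n h) w is again a multiple of h w,
    because conjugates stay in the derived group. The multiple could depend on h;
    \<open>eigenvalue_constant\<close> excludes this.\<close>
  have stable: "h *v w \<in> W0" if h: "h \<in> H" and w: "w \<in> W0" for h w
  proof (cases "w = 0")
    case True then show ?thesis using vec.subspace_0[OF W0] by simp
  next
    case False
    have "n *v (h *v w) = ch n *s (h *v w)" if n: "n \<in> ?D" for n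
    proof (rule eigenvalue_constant[OF H(2) one _ _ h])
      show "n *v w = ch n *s w" using w n unfolding W0_def by blast
    next
      fix h assume h: "h \<in> H"
      have nH: "n \<in> H" using n DH by blast
      have ih: "inv\<^bsub>GL\<^esub> h \<in> H" by (rule subgroup.m_inv_closed[OF H(1) h])
      let ?m = "inv\<^bsub>GL\<^esub> h ** n ** h"
      have "inv\<^bsub>GL\<^esub> h ** n ** inv\<^bsub>GL\<^esub> (inv\<^bsub>GL\<^esub> h) ** inv\<^bsub>GL\<^esub> n \<in> ?D" by (rule comm[OF ih nH])
      moreover have "inv\<^bsub>GL\<^esub> (inv\<^bsub>GL\<^esub> h) = h" using inv[OF h] by (intro inv_GL_unique inv_GL)
      ultimately have "?m ** inv\<^bsub>GL\<^esub> n ** n \<in> ?D"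
        using subgroup.m_closed[OF D _ n] by simp
      then have m: "?m \<in> ?D"
        using inv_GL(2)[OF inv[OF nH]] by (simp add: matrix_mul_assoc[symmetric])
      have "n ** h = h ** ?m"
        using inv_GL(1)[OF inv[OF h]] by (simp add: matrix_mul_assoc)
      then have "n *v (h *v w) = h *v (?m *v w)" by (simp add: matrix_vector_mul_assoc)
      also have "?m *v w = ch ?m *s w" using w m unfolding W0_def by blast
      finally show "h *v w \<noteq> 0 \<and> (\<exists>d. n *v (h *v w) = d *s (h *v w))"
        using inj[OF h False] by (auto simp: vector_scalar_commute)
    qed
    then show ?thesis unfolding W0_def by blast
  qed
  \<comment> \<open>A \<open>good\<close> subspace of least dimension is chosen, so that each
    eigenspace of an element of \<open>H\<close> in it, being again \<open>good\<close>, is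
    everything.\<close>
  define good where "good W \<longleftrightarrow> vec.subspace W \<and> W \<noteq> {0} \<and> W \<subseteq> W0 \<and> (\<forall>h\<in>H. \<forall>w\<in>W. h *v w \<in> W)" for W
  have "good W0" unfolding good_def using W0 stable v unfolding W0_def by auto
  from ex_has_least_nat[of good, OF this, of vec.dim]
  obtain W where W: "good W" and min: "\<And>V. good V \<Longrightarrow> vec.dim W \<le> vec.dim V" by blast
  have Ws: "vec.subspace W" "W \<noteq> {0}" "W \<subseteq> W0" "\<And>h w. h \<in> H \<Longrightarrow> w \<in> W \<Longrightarrow> h *v w \<in> W"
    using W unfolding good_def by auto
  obtain x where x: "x \<in> W" "x \<noteq> 0" using Ws(1,2) vec.subspace_0 by fastforce
  have "\<exists>c. a *v x = c *s x" if a: "a \<in> H" for a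
  proof -
    obtain u c where u: "u \<in> W" "u \<noteq> 0" "a *v u = c *s u"
      using eigenvector_in_invariant_subspace[OF Ws(1,2) Ws(4)[OF a]] by blast
    let ?E = "{y \<in> W. a *v y = c *s y}"
    have E: "vec.subspace ?E"
      using Ws(1) unfolding vec.subspace_def
      by (auto simp: matrix_vector_right_distrib vector_add_ldistrib vector_scalar_commute
        vector_smult_assoc mult.commute)
    have Est: "b *v y \<in> ?E" if b: "b \<in> H" and y: "y \<in> ?E" for b y
    proof (cases "y = 0")
      case False
      have "a *v (b *v y) = c *s (b *v y)"
      proof (rule eigenvalue_constant[OF H(2) one _ _ b])
        show "a *v y = c *s y" using y by simp
        fix h assume h: "h \<in> H"
        let ?m = "a ** h ** inv\<^bsub>GL\<^esub> a ** inv\<^bsub>GL\<^esub> h"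
        \<comment> \<open>Here a h = [a, h] h a, and [a, h] acts on the weight space by a scalar. So
          a maps h y to a multiple of h y for every eigenvector y of a, and the eigenvalue is again
          constant in h.\<close>
        have "?m ** (h ** a) = a ** h ** inv\<^bsub>GL\<^esub> a ** (inv\<^bsub>GL\<^esub> h ** h) ** a"
          by (simp only: matrix_mul_assoc)
        also have "\<dots> = a ** h ** (inv\<^bsub>GL\<^esub> a ** a)"
          using inv_GL(2)[OF inv[OF h]] by (simp add: matrix_mul_assoc)
        also have "\<dots> = a ** h" using inv_GL(2)[OF inv[OF a]] by simp
        finally have "a *v (h *v y) = ?m *v (h *v (a *v y))" by (simp add: matrix_vector_mul_assoc)
        also have "\<dots> = c *s (?m *v (h *v y))" using y by (simp add: vector_scalar_commute)
        also have "?m *v (h *v y) = ch ?m *s (h *v y)"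
          using Ws(3) Ws(4)[OF h, of y] y comm[OF a h] unfolding W0_def by blast
        finally show "h *v y \<noteq> 0 \<and> (\<exists>d. a *v (h *v y) = d *s (h *v y))"
          using inj[OF h False] by (auto simp: vector_smult_assoc)
      qed
      then show ?thesis using Ws(4)[OF b] y by simp
    qed (use y in simp)
    have "good ?E" unfolding good_def using E Est u Ws(3) by blast
    from min[OF this] have "vec.dim W \<le> vec.dim ?E" .
    then have "?E = W" by (intro vec.subspace_dim_equal E Ws(1)) auto
    then show ?thesis using x(1) by blast
  qed
  then show ?case using x(2) by blast
qed

lemma derived_sub_group:
  assumes "subgroup H GL"
  shows "(derived (sub_group H) ^^ k) H = (derived GL ^^ k) H"
proof -
  have "(derived (sub_group H) ^^ k) H = (derived GL ^^ k) H \<and> (derived GL ^^ k) H \<subseteq> H"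
  proof (induction k)
    case (Suc k)
    then show ?case using GL.derived_consistent[OF _ assms] GL.derived_incl[OF _ assms] by auto
  qed auto
  then show ?thesis by blast
qed

theorem lie_kolchin:
  fixes H :: "(complex^'n^'n) set"
  assumes "subgroup H GL" "connectedin zariski H" "solvable (sub_group H)"
  shows "\<exists>v. v \<noteq> 0 \<and> (\<forall>h\<in>H. \<exists>c. h *v v = c *s v)"
proof -
  interpret S: group "sub_group H" by (rule subgroup.subgroup_is_group[OF assms(1) group_GL])
  obtain k where k: "(derived (sub_group H) ^^ k) H = {mat 1}"
    using assms(3) S.solvable_iff_trivial_derived_seq by auto
  show ?thesis
    using lie_kolchin_derived[OF assms(1,2)] k derived_sub_group[OF assms(1)] by auto
qed

section \<open>Four by four matrices and the symplectic group\<close>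

definition mat4 :: "'a \<Rightarrow> 'a \<Rightarrow> 'a \<Rightarrow> 'a \<Rightarrow> 'a \<Rightarrow> 'a \<Rightarrow> 'a \<Rightarrow> 'a \<Rightarrow> 'a \<Rightarrow> 'a \<Rightarrow> 'a \<Rightarrow> 'a \<Rightarrow> 'a \<Rightarrow> 'a \<Rightarrow> 'a \<Rightarrow> 'a \<Rightarrow> 'a^4^4"
  where "mat4 a b c d e f g h i j k l m n p q = (\<chi> r s.
     if r = 1 then (if s = 1 then a else if s = 2 then b else if s = 3 then c else d)
     else if r = 2 then (if s = 1 then e else if s = 2 then f else if s = 3 then g else h)
     else if r = 3 then (if s = 1 then i else if s = 2 then j else if s = 3 then k else l)
     else (if s = 1 then m else if s = 2 then n else if s = 3 then p else q))"

lemma mat4_nth [simp]: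
  "mat4 a b c d e f g h i j k l m n p q $ 1 $ 1 = a" "mat4 a b c d e f g h i j k l m n p q $ 1 $ 2 = b"
  "mat4 a b c d e f g h i j k l m n p q $ 1 $ 3 = c" "mat4 a b c d e f g h i j k l m n p q $ 1 $ 4 = d"
  "mat4 a b c d e f g h i j k l m n p q $ 2 $ 1 = e" "mat4 a b c d e f g h i j k l m n p q $ 2 $ 2 = f"
  "mat4 a b c d e f g h i j k l m n p q $ 2 $ 3 = g" "mat4 a b c d e f g h i j k l m n p q $ 2 $ 4 = h"
  "mat4 a b c d e f g h i j k l m n p q $ 3 $ 1 = i" "mat4 a b c d e f g h i j k l m n p q $ 3 $ 2 = j"
  "mat4 a b c d e f g h i j k l m n p q $ 3 $ 3 = k" "mat4 a b c d e f g h i j k l m n p q $ 3 $ 4 = l"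
  "mat4 a b c d e f g h i j k l m n p q $ 4 $ 1 = m" "mat4 a b c d e f g h i j k l m n p q $ 4 $ 2 = n"
  "mat4 a b c d e f g h i j k l m n p q $ 4 $ 3 = p" "mat4 a b c d e f g h i j k l m n p q $ 4 $ 4 = q"
  by (simp_all add: mat4_def)

lemma mat4_eq_iff: "A = B \<longleftrightarrow>
   A $ 1 $ 1 = B $ 1 $ 1 \<and> A $ 1 $ 2 = B $ 1 $ 2 \<and> A $ 1 $ 3 = B $ 1 $ 3 \<and> A $ 1 $ 4 = B $ 1 $ 4 \<and>
   A $ 2 $ 1 = B $ 2 $ 1 \<and> A $ 2 $ 2 = B $ 2 $ 2 \<and> A $ 2 $ 3 = B $ 2 $ 3 \<and> A $ 2 $ 4 = B $ 2 $ 4 \<and>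
   A $ 3 $ 1 = B $ 3 $ 1 \<and> A $ 3 $ 2 = B $ 3 $ 2 \<and> A $ 3 $ 3 = B $ 3 $ 3 \<and> A $ 3 $ 4 = B $ 3 $ 4 \<and>
   A $ 4 $ 1 = B $ 4 $ 1 \<and> A $ 4 $ 2 = B $ 4 $ 2 \<and> A $ 4 $ 3 = B $ 4 $ 3 \<and> A $ 4 $ 4 = B $ 4 $ 4"
  for A B :: "'a^4^4"
  by (auto simp: vec_eq_iff forall_4)

lemma mult4: "(A ** B) $ i $ j = A $ i $ 1 * B $ 1 $ j + A $ i $ 2 * B $ 2 $ j + A $ i $ 3 * B $ 3 $ j + A $ i $ 4 * B $ 4 $ j"
  for A B :: "'a::semiring_1^4^4"
  by (simp add: matrix_mult_entry sum_4)

lemma mat_nth: "mat c $ i $ j = (if i = j then c else 0)"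
  by (simp add: mat_def)

definition smat :: "complex \<Rightarrow> complex^'n^'n \<Rightarrow> complex^'n^'n" where
  "smat c A = (\<chi> i j. c * A $ i $ j)"

lemma smat_nth [simp]: "smat c A $ i $ j = c * A $ i $ j"
  by (simp add: smat_def)

lemma smat_simps [simp]:
  "smat c A ** B = smat c (A ** B)" "A ** smat c B = smat c (A ** B)" "smat c (smat d A) = smat (c * d) A"
  "smat 1 A = A" "smat 0 A = 0"
  by (simp_all add: vec_eq_iff matrix_mult_entry sum_distrib_left mult_ac)

text \<open>With this antidiagonal form the standard flag is isotropic, so the Borel subgroup can be
  taken upper triangular and \<open>adj\<close> preserves triangularity.\<close>

definition J4 :: "complex^4^4" where
  "J4 = mat4 0 0 0 1  0 0 1 0  0 (-1) 0 0  (-1) 0 0 0"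

definition Sp4 :: "(complex^4^4) set" where
  "Sp4 = {A. transpose A ** J4 ** A = J4}"

text \<open>Since the square of \<open>J4\<close> is -1, this is the adjoint for the symplectic
  form, \<open>J4\<close> inverse times transpose times \<open>J4\<close>. It is polynomial in A and
  equals the inverse on \<open>Sp4\<close>.\<close>

definition adj :: "complex^4^4 \<Rightarrow> complex^4^4" where
  "adj A = smat (-1) (J4 ** transpose A ** J4)"

lemma J4_J4: "J4 ** J4 = smat (-1) (mat 1)"
  by (simp add: J4_def mat4_eq_iff mult4 mat_nth)

lemma transpose_nth [simp]: "transpose A $ i $ j = A $ j $ i"
  by (simp add: transpose_def)

lemma adj_mult: "adj (A ** B) = adj B ** adj A"
proof -
  have "adj B ** adj A = smat 1 (J4 ** transpose B ** (J4 ** J4) ** transpose A ** J4)"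
    by (simp add: adj_def matrix_mul_assoc)
  also have "\<dots> = adj (A ** B)" by (simp add: J4_J4 adj_def matrix_transpose_mul matrix_mul_assoc)
  finally show ?thesis by simp
qed

lemma adj_adj: "adj (adj A) = A"
  by (simp add: mat4_eq_iff adj_def mult4 J4_def)

lemma Sp4_adj: "A \<in> Sp4 \<longleftrightarrow> adj A ** A = mat 1"
proof
  assume "A \<in> Sp4"
  then have "adj A ** A = smat (-1) (J4 ** J4)" by (simp add: Sp4_def adj_def matrix_mul_assoc[symmetric])
  then show "adj A ** A = mat 1" by (simp add: J4_J4)
next
  assume *: "adj A ** A = mat 1"
  have "transpose A ** J4 ** A = smat (-1) (J4 ** J4) ** (transpose A ** J4 ** A)"
    by (simp add: J4_J4)
  also have "\<dots> = J4 ** (adj A ** A)" by (simp add: adj_def matrix_mul_assoc)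
  finally show "A \<in> Sp4" using * by (simp add: Sp4_def)
qed

lemma Sp4_adj': "A \<in> Sp4 \<longleftrightarrow> A ** adj A = mat 1"
  by (simp add: Sp4_adj matrix_left_right_inverse)

section \<open>The spin representation of the even Clifford algebra\<close>

text \<open>The gamma matrices are self-adjoint for the symplectic form \<open>J4\<close>, so that Clifford reversal
  corresponds to the symplectic adjoint.\<close>

definition gam :: "5 \<Rightarrow> complex^4^4" where
  "gam i = (if i = 0 then mat4 1 0 0 0  0 (-1) 0 0  0 0 (-1) 0  0 0 0 1
    else if i = 1 then mat4 0 1 0 0  1 0 0 0  0 0 0 1  0 0 1 0
    else if i = 2 then mat4 0 (-\<i>) 0 0  \<i> 0 0 0  0 0 0 (-\<i>)  0 0 \<i> 0
    else if i = 3 then mat4 0 0 1 0  0 0 0 (-1)  1 0 0 0  0 (-1) 0 0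
    else mat4 0 0 (-\<i>) 0  0 0 0 \<i>  \<i> 0 0 0  0 (-\<i>) 0 0)"

lemma UNIV_5: "UNIV = set [0, 1, 2, 3, 4 :: 5]"
  by (rule sym, rule card_subset_eq) simp_all

lemma sorted_5: "sorted_wrt (<) [0, 1, 2, 3, 4 :: 5]"
  by (simp add: less_bit1_def bit1.Rep_numeral bit1.Rep_0 bit1.Rep_1)

lemma exhaust_5: "x = 0 \<or> x = 1 \<or> x = 2 \<or> x = 3 \<or> x = (4 :: 5)"
  using UNIV_5 by auto

lemma gam_sq: "gam i ** gam i = mat 1"
  using exhaust_5[of i] by (auto simp: gam_def mat4_eq_iff mult4 mat_nth)

lemma gam_anticomm: "i \<noteq> j \<Longrightarrow> gam i ** gam j = smat (-1) (gam j ** gam i)"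
  using exhaust_5[of i] exhaust_5[of j] by (auto simp: gam_def mat4_eq_iff mult4 mat_nth)

lemma adj_gam: "adj (gam i) = gam i"
  using exhaust_5[of i] by (auto simp: gam_def mat4_eq_iff mult4 adj_def J4_def)

lemma trace_gam: "trace (gam i) = 0"
  using exhaust_5[of i] by (auto simp: gam_def trace_def sum_4)

section \<open>Signs of products of basis elements\<close>

definition inv_sign :: "'a::linorder \<Rightarrow> 'a \<Rightarrow> complex" where
  "inv_sign p q = (if q < p then -1 else 1)"

text \<open>As a double product of factors of square 1, the sign is multiplicative in each argument
  with respect to symmetric difference, which a power of -1 does not show.\<close>

definition clifford_sign :: "'a::{finite,linorder} set \<Rightarrow> 'a set \<Rightarrow> complex" where
  "clifford_sign P Q = (\<Prod>p\<in>P. \<Prod>q\<in>Q. inv_sign p q)"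

definition symdiff :: "'a set \<Rightarrow> 'a set \<Rightarrow> 'a set" where
  "symdiff P Q = (P - Q) \<union> (Q - P)"

lemma symdiff_cancel [simp]: "symdiff P (symdiff P Q) = Q" "symdiff P P = {}" "symdiff P {} = P" "symdiff {} P = P"
  by (auto simp: symdiff_def)

lemma symdiff_assoc: "symdiff (symdiff P Q) R = symdiff P (symdiff Q R)"
  by (auto simp: symdiff_def)

lemma symdiff_commute: "symdiff P Q = symdiff Q P"
  by (auto simp: symdiff_def)

lemma inv_sign_sq [simp]: "inv_sign p q * inv_sign p q = 1" by (simp add: inv_sign_def)

lemma clifford_sign_card:
  "(-1) ^ card {(p, q). p \<in> P \<and> q \<in> Q \<and> q < p} = clifford_sign P Q"
proof -
  have "clifford_sign P Q = (\<Prod>x\<in>P \<times> Q. if snd x < fst x then -1 else 1)"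
    by (simp add: clifford_sign_def inv_sign_def prod.cartesian_product split_def)
  also have "\<dots> = (-1) ^ card (P \<times> Q \<inter> {x. snd x < fst x})"
    by (simp add: prod.If_cases)
  also have "P \<times> Q \<inter> {x. snd x < fst x} = {(p, q). p \<in> P \<and> q \<in> Q \<and> q < p}" by auto
  finally show ?thesis by simp
qed

lemma prod_symdiff:
  fixes f :: "'a::finite \<Rightarrow> complex"
  assumes "\<And>x. f x * f x = 1"
  shows "prod f (symdiff P Q) = prod f P * prod f Q"
proof -
  have sq: "prod f (P \<inter> Q) * prod f (P \<inter> Q) = 1"
    using assms by (simp add: prod.distrib[symmetric])
  have "prod f P = prod f (P - Q) * prod f (P \<inter> Q)"
    by (subst prod.union_disjoint[symmetric]) (auto intro: prod.cong)
  moreover have "prod f Q = prod f (Q - P) * prod f (P \<inter> Q)"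
    by (subst prod.union_disjoint[symmetric]) (auto intro: prod.cong)
  moreover have "prod f (symdiff P Q) = prod f (P - Q) * prod f (Q - P)"
    unfolding symdiff_def by (rule prod.union_disjoint) auto
  ultimately show ?thesis using sq by (simp add: mult_ac)
qed

lemma prod_inv_sign_sq: "(\<Prod>q\<in>Q. inv_sign p q) * (\<Prod>q\<in>Q. inv_sign p q) = 1"
  by (simp add: prod.distrib[symmetric])

lemma clifford_sign_symdiff:
  "clifford_sign (symdiff P P') Q = clifford_sign P Q * clifford_sign P' Q"
  "clifford_sign P (symdiff Q Q') = clifford_sign P Q * clifford_sign P Q'"
  by (simp_all add: clifford_sign_def prod_symdiff prod_inv_sign_sq prod.distrib)

lemma clifford_sign_sq: "clifford_sign P Q * clifford_sign P Q = 1"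
  by (simp add: clifford_sign_def prod.distrib[symmetric] prod_inv_sign_sq)

lemma clifford_sign_empty [simp]: "clifford_sign {} Q = 1" "clifford_sign P {} = 1"
  by (simp_all add: clifford_sign_def)

lemma clifford_mult_nth:
  "clifford_mult x y $ R = (\<Sum>P\<in>UNIV. clifford_sign P (symdiff P R) * x $ P * y $ symdiff P R)"
proof -
  have "clifford_mult x y $ R = (\<Sum>(P, Q) \<in> {(P, Q). symdiff P Q = R}. clifford_sign P Q * x $ P * y $ Q)"
    by (simp add: clifford_mult_def clifford_sign_card symdiff_def)
  also have "\<dots> = (\<Sum>P\<in>UNIV. clifford_sign P (symdiff P R) * x $ P * y $ symdiff P R)"
    by (rule sum.reindex_bij_witness[of _ "\<lambda>P. (P, symdiff P R)" fst]) auto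
  finally show ?thesis .
qed

lemma symdiff_reindex: "(\<Sum>Q\<in>UNIV. f (symdiff P Q)) = (\<Sum>Q\<in>UNIV. f Q)" for P :: "'a::finite set"
  by (rule sum.reindex_bij_witness[of _ "symdiff P" "symdiff P"]) auto

text \<open>A bimultiplicative sign is a 2-cocycle on the group of subsets under symmetric
  difference, and associativity of a twisted group algebra is the cocycle identity.\<close>

lemma clifford_assoc: "clifford_mult (clifford_mult x y) z = clifford_mult x (clifford_mult y z)"
proof -
  have "clifford_mult (clifford_mult x y) z $ R = clifford_mult x (clifford_mult y z) $ R" for R
  proof -
    have "clifford_mult (clifford_mult x y) z $ R = (\<Sum>S\<in>UNIV. \<Sum>P\<in>UNIV.
       clifford_sign S (symdiff S R) * clifford_sign P (symdiff P S) * x $ P * y $ symdiff P S * z $ symdiff S R)"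
      by (simp add: clifford_mult_nth sum_distrib_left sum_distrib_right mult_ac)
    also have "\<dots> = (\<Sum>P\<in>UNIV. \<Sum>S\<in>UNIV.
       clifford_sign S (symdiff S R) * clifford_sign P (symdiff P S) * x $ P * y $ symdiff P S * z $ symdiff S R)"
      by (rule sum.swap)
    \<comment> \<open>Substituting S = \<open>symdiff P T\<close> makes T the index of the
      coefficient of \<open>y\<close>, as on the other side of the equation.\<close>
    also have "\<dots> = (\<Sum>P\<in>UNIV. \<Sum>T\<in>UNIV.
       clifford_sign (symdiff P T) (symdiff (symdiff P T) R) * clifford_sign P (symdiff P (symdiff P T))
         * x $ P * y $ symdiff P (symdiff P T) * z $ symdiff (symdiff P T) R)"
      by (rule sum.cong[OF refl], rule symdiff_reindex[symmetric])
    also have "\<dots> = (\<Sum>P\<in>UNIV. \<Sum>T\<in>UNIV.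
       clifford_sign P (symdiff P R) * clifford_sign T (symdiff T (symdiff P R)) * x $ P * y $ T * z $ symdiff T (symdiff P R))"
    proof (intro sum.cong refl)
      fix P T
      have e: "symdiff (symdiff P T) R = symdiff T (symdiff P R)"
        by (metis symdiff_assoc symdiff_commute)
      have "clifford_sign P T * clifford_sign P T * clifford_sign P (symdiff P R) = clifford_sign P (symdiff P R)"
        by (simp add: clifford_sign_sq)
      then show "clifford_sign (symdiff P T) (symdiff (symdiff P T) R) * clifford_sign P (symdiff P (symdiff P T))
         * x $ P * y $ symdiff P (symdiff P T) * z $ symdiff (symdiff P T) R
        = clifford_sign P (symdiff P R) * clifford_sign T (symdiff T (symdiff P R)) * x $ P * y $ T * z $ symdiff T (symdiff P R)"
        unfolding e by (simp add: clifford_sign_symdiff(1)) (simp add: clifford_sign_symdiff(2) mult_ac)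
    qed
    also have "\<dots> = clifford_mult x (clifford_mult y z) $ R"
      by (simp add: clifford_mult_nth sum_distrib_left sum_distrib_right mult_ac)
    finally show ?thesis .
  qed
  then show ?thesis by (simp add: vec_eq_iff)
qed

section \<open>Ordered products of gamma matrices\<close>

definition gam_sel :: "5 set \<Rightarrow> 5 \<Rightarrow> complex^4^4" where
  "gam_sel P i = (if i \<in> P then gam i else mat 1)"

text \<open>All indices of the list contribute, those outside \<open>P\<close> by the identity
  matrix. Inductions can therefore run over the list while \<open>P\<close> stays fixed.\<close>

definition gam_list :: "5 list \<Rightarrow> 5 set \<Rightarrow> complex^4^4" where
  "gam_list xs P = foldr (\<lambda>x A. gam_sel P x ** A) xs (mat 1)"

definition Gam :: "5 set \<Rightarrow> complex^4^4" where
  "Gam = gam_list [0, 1, 2, 3, 4]"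

lemma gam_list_simps [simp]:
  "gam_list [] P = mat 1" "gam_list (x # xs) P = gam_sel P x ** gam_list xs P"
  by (simp_all add: gam_list_def)

lemma gam_list_append: "gam_list (xs @ ys) P = gam_list xs P ** gam_list ys P"
  by (induction xs) (simp_all add: matrix_mul_assoc)

lemma gam_list_cong: "(\<And>x. x \<in> set xs \<Longrightarrow> x \<in> P \<longleftrightarrow> x \<in> Q) \<Longrightarrow> gam_list xs P = gam_list xs Q"
  by (induction xs) (simp_all add: gam_sel_def)

lemma gam_list_commute:
  "x \<notin> set ys \<Longrightarrow> distinct ys \<Longrightarrow> gam_list ys P ** gam x = smat ((-1) ^ card (P \<inter> set ys)) (gam x ** gam_list ys P)"
proof (induction ys)
  case (Cons y ys)
  then have IH: "gam_list ys P ** gam x = smat ((-1) ^ card (P \<inter> set ys)) (gam x ** gam_list ys P)" by simp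
  show ?case
  proof (cases "y \<in> P")
    case True
    then have "P \<inter> set (y # ys) = insert y (P \<inter> set ys)" "y \<notin> P \<inter> set ys" using Cons.prems by auto
    then have c: "card (P \<inter> set (y # ys)) = Suc (card (P \<inter> set ys))" by simp
    have "gam_list (y # ys) P ** gam x = gam y ** (gam_list ys P ** gam x)"
      using True by (simp add: gam_sel_def matrix_mul_assoc)
    also have "\<dots> = smat ((-1) ^ card (P \<inter> set ys)) ((gam y ** gam x) ** gam_list ys P)"
      unfolding IH by (simp add: matrix_mul_assoc)
    also have "gam y ** gam x = smat (-1) (gam x ** gam y)" using Cons.prems by (intro gam_anticomm) auto
    finally show ?thesis using True c by (simp add: gam_sel_def matrix_mul_assoc)
  next
    case False
    then have "P \<inter> set (y # ys) = P \<inter> set ys" by auto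
    then show ?thesis using False IH by (simp add: gam_sel_def)
  qed
qed simp

text \<open>Moving \<open>gam q\<close> leftwards to its place costs one sign for each larger index
  in \<open>P\<close>, which is the sign with \<open>{q}\<close>. At its place it either cancels the
  factor already there or fills the gap.\<close>

lemma gam_list_mult_gam:
  "sorted_wrt (<) xs \<Longrightarrow> q \<in> set xs \<Longrightarrow>
    gam_list xs P ** gam q = smat (clifford_sign (P \<inter> set xs) {q}) (gam_list xs (symdiff P {q}))"
proof (induction xs)
  case (Cons x xs)
  then have lt: "\<And>y. y \<in> set xs \<Longrightarrow> x < y" and sw: "sorted_wrt (<) xs" by auto
  have x: "x \<notin> set xs" using lt by blast
  have sgn: "clifford_sign (P \<inter> set (x # xs)) {q} =
     (if x \<in> P then inv_sign x q else 1) * clifford_sign (P \<inter> set xs) {q}"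
    using x by (auto simp: clifford_sign_def)
  show ?case
  proof (cases "q = x")
    case True
    have "distinct xs" using sw by (simp add: strict_sorted_iff)
    then have "gam_list xs P ** gam x = smat ((-1) ^ card (P \<inter> set xs)) (gam x ** gam_list xs P)"
      using x by (rule gam_list_commute[rotated])
    moreover have "clifford_sign (P \<inter> set xs) {x} = (-1) ^ card (P \<inter> set xs)"
    proof -
      have "clifford_sign (P \<inter> set xs) {x} = (\<Prod>p\<in>P \<inter> set xs. -1)"
        unfolding clifford_sign_def using lt by (intro prod.cong) (auto simp: inv_sign_def)
      then show ?thesis by simp
    qed
    moreover have "gam_list xs P = gam_list xs (symdiff P {x})"
      using x by (intro gam_list_cong) (auto simp: symdiff_def)
    moreover have "gam_sel P x ** gam x = gam_sel (symdiff P {x}) x"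
      by (auto simp: gam_sel_def symdiff_def gam_sq)
    moreover have "inv_sign x x = 1" by (simp add: inv_sign_def)
    moreover have "gam_list (x # xs) P ** gam x = gam_sel P x ** (gam_list xs P ** gam x)"
      by (simp add: matrix_mul_assoc)
    ultimately show ?thesis using sgn True by (simp add: matrix_mul_assoc)
  next
    case False
    then have q: "q \<in> set xs" using Cons.prems by simp
    have "inv_sign x q = 1" using lt[OF q] by (simp add: inv_sign_def)
    moreover have "gam_sel P x = gam_sel (symdiff P {q}) x"
      using False by (simp add: gam_sel_def symdiff_def)
    moreover have "gam_list (x # xs) P ** gam q = gam_sel P x ** (gam_list xs P ** gam q)"
      by (simp add: matrix_mul_assoc)
    ultimately show ?thesis using sgn Cons.IH[OF sw q] by simp
  qed
qed simp

lemma Gam_mult_gam: "Gam P ** gam q = smat (clifford_sign P {q}) (Gam (symdiff P {q}))"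
  using gam_list_mult_gam[OF sorted_5, of q P, folded UNIV_5 Gam_def] by simp

lemma Gam_mult_gam_list:
  "sorted_wrt (<) ys \<Longrightarrow>
    Gam P ** gam_list ys Q = smat (clifford_sign P (Q \<inter> set ys)) (Gam (symdiff P (Q \<inter> set ys)))"
proof (induction ys rule: rev_induct)
  case (snoc y ys)
  then have lt: "\<And>x. x \<in> set ys \<Longrightarrow> x < y" and IH: "Gam P ** gam_list ys Q =
    smat (clifford_sign P (Q \<inter> set ys)) (Gam (symdiff P (Q \<inter> set ys)))"
    by (auto simp: sorted_wrt_append)
  let ?Q = "Q \<inter> set ys"
  have e: "gam_list (ys @ [y]) Q = gam_list ys Q ** gam_sel Q y" by (simp add: gam_list_append)
  have e2: "Gam P ** gam_list (ys @ [y]) Q = smat (clifford_sign P ?Q) (Gam (symdiff P ?Q) ** gam_sel Q y)"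
    unfolding e by (simp add: IH matrix_mul_assoc)
  show ?case
  proof (cases "y \<in> Q")
    case True
    have y: "y \<notin> ?Q" using lt by blast
    have Q': "Q \<inter> set (ys @ [y]) = symdiff ?Q {y}" using True y by (auto simp: symdiff_def)
    have "clifford_sign ?Q {y} = 1"
      unfolding clifford_sign_def using lt by (intro prod.neutral) (auto simp: inv_sign_def dest: less_not_sym)
    then show ?thesis unfolding e2 Q'
      using True by (simp add: gam_sel_def Gam_mult_gam clifford_sign_symdiff symdiff_assoc)
  next
    case False
    then have "Q \<inter> set (ys @ [y]) = ?Q" by auto
    then show ?thesis using False e2 by (simp add: gam_sel_def)
  qed
qed simp

lemma Gam_mult: "Gam P ** Gam Q = smat (clifford_sign P Q) (Gam (symdiff P Q))"
  using Gam_mult_gam_list[OF sorted_5, of P Q, folded UNIV_5 Gam_def] by simp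

text \<open>The adjoint reverses the order of the self-adjoint factors, and reversing k
  anticommuting factors gives the sign with exponent k choose 2, the one in
  \<open>clifford_rev\<close>.\<close>

lemma adj_gam_list:
  "distinct ys \<Longrightarrow> adj (gam_list ys Q) = smat ((-1) ^ (card (Q \<inter> set ys) choose 2)) (gam_list ys Q)"
proof (induction ys rule: rev_induct)
  case Nil
  then show ?case by (simp add: adj_def J4_J4 transpose_mat numeral_2_eq_2)
next
  case (snoc y ys)
  then have IH: "adj (gam_list ys Q) = smat ((-1) ^ (card (Q \<inter> set ys) choose 2)) (gam_list ys Q)" by simp
  have e: "adj (gam_list (ys @ [y]) Q) = adj (gam_sel Q y) ** adj (gam_list ys Q)"
    by (simp add: gam_list_append adj_mult)
  show ?case
  proof (cases "y \<in> Q")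
    case True
    let ?k = "card (Q \<inter> set ys)"
    have "Q \<inter> set (ys @ [y]) = insert y (Q \<inter> set ys)" "y \<notin> Q \<inter> set ys" using True snoc.prems by auto
    then have c: "card (Q \<inter> set (ys @ [y])) = Suc ?k" by simp
    have ch: "Suc ?k choose 2 = ?k + (?k choose 2)"
      by (simp add: numeral_2_eq_2)
    have "smat ((-1) ^ ?k) (gam_list ys Q ** gam y) = gam y ** gam_list ys Q"
      using gam_list_commute[of y ys Q] snoc.prems by (simp add: power_mult_distrib[symmetric])
    then show ?thesis unfolding e IH c ch using True
      by (simp add: gam_sel_def adj_gam gam_list_append power_add) (metis (no_types, lifting) smat_simps(3) mult.commute)
  next
    case False
    then have "Q \<inter> set (ys @ [y]) = Q \<inter> set ys" by auto
    moreover have "adj (mat 1) = mat 1" by (simp add: adj_def J4_J4 transpose_mat)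
    ultimately show ?thesis using False e IH by (simp add: gam_sel_def gam_list_append)
  qed
qed

lemma adj_Gam: "adj (Gam P) = smat ((-1) ^ (card P choose 2)) (Gam P)"
  using adj_gam_list[of "[0, 1, 2, 3, 4]" P, folded UNIV_5 Gam_def] by simp

lemma Gam_singleton: "Gam {i} = gam i"
  using Gam_mult_gam[of "{}" i] by (simp add: Gam_def gam_sel_def)

lemma Gam_empty: "Gam {} = mat 1"
  by (simp add: Gam_def gam_sel_def)

section \<open>Traces and the spin representation\<close>

lemma trace_smat: "trace (smat c A) = c * trace A"
  by (simp add: trace_def sum_distrib_left)

text \<open>For i in \<open>P\<close> and \<open>P\<close> of even size, \<open>gam i\<close>
  anticommutes with \<open>Gam P\<close>: it passes an odd number of other factors. As
  \<open>gam i\<close> is an involution, the trace equals its negative.\<close>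

lemma trace_Gam: "even (card P) \<Longrightarrow> P \<noteq> {} \<Longrightarrow> trace (Gam P) = 0"
proof -
  assume ev: "even (card P)" and "P \<noteq> {}"
  then obtain i where i: "i \<in> P" by blast
  have l: "gam i ** Gam P = smat (clifford_sign {i} P) (Gam (symdiff P {i}))"
    using Gam_mult[of "{i}" P] by (simp add: Gam_singleton symdiff_commute)
  have "clifford_sign P {i} * clifford_sign {i} P = (\<Prod>p\<in>P. inv_sign p i * inv_sign i p)"
    by (simp add: clifford_sign_def prod.distrib)
  also have "\<dots> = (\<Prod>p\<in>P - {i}. inv_sign p i * inv_sign i p)"
    by (rule prod.mono_neutral_right) auto
  also have "\<dots> = (\<Prod>p\<in>P - {i}. -1)"
    by (rule prod.cong) (auto simp: inv_sign_def)
  also have "\<dots> = -1" using ev i by (cases "card P") auto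
  finally have s: "clifford_sign P {i} * clifford_sign {i} P = -1" .
  have "clifford_sign P {i} * (clifford_sign P {i} * clifford_sign {i} P) = - clifford_sign P {i}"
    unfolding s by simp
  then have s2: "clifford_sign {i} P = - clifford_sign P {i}"
    by (metis clifford_sign_sq mult.assoc mult_1)
  have c: "gam i ** Gam P = smat (-1) (Gam P ** gam i)" unfolding l Gam_mult_gam by (simp add: s2)
  have "trace (Gam P) = trace (Gam P ** gam i ** gam i)" by (simp add: matrix_mul_assoc[symmetric] gam_sq)
  also have "\<dots> = trace (gam i ** Gam P ** gam i)"
    by (metis trace_mul_sym matrix_mul_assoc)
  also have "\<dots> = - trace (Gam P ** gam i ** gam i)"
    unfolding c by (simp add: trace_smat)
  also have "\<dots> = - trace (Gam P)" by (simp add: matrix_mul_assoc[symmetric] gam_sq)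
  finally show ?thesis by simp
qed

text \<open>The source has dimension 32, the target 16. The product of all five generators acts by
  the scalar -1, so injectivity can hold only on elements of one parity.\<close>

definition spin_rep :: "5 clifford \<Rightarrow> complex^4^4" where
  "spin_rep x = (\<Sum>P\<in>UNIV. smat (x $ P) (Gam P))"

lemma spin_rep_nth: "spin_rep x $ i $ j = (\<Sum>P\<in>UNIV. x $ P * Gam P $ i $ j)"
  by (simp add: spin_rep_def)

lemma sum_matrix_mult: "(\<Sum>i\<in>I. f i) ** B = (\<Sum>i\<in>I. f i ** B)" "B ** (\<Sum>i\<in>I. f i) = (\<Sum>i\<in>I. B ** f i)"
  for B :: "complex^'n^'n" and f :: "'a \<Rightarrow> complex^'n^'n"
  by (induction I rule: infinite_finite_induct) (auto simp: vec_eq_iff matrix_mult_entry ring_distribs sum.distrib)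

lemma spin_rep_mult: "spin_rep (clifford_mult x y) = spin_rep x ** spin_rep y"
proof -
  have "spin_rep x ** spin_rep y = (\<Sum>P\<in>UNIV. \<Sum>Q\<in>UNIV. smat (x $ P * y $ Q * clifford_sign P Q) (Gam (symdiff P Q)))"
    unfolding spin_rep_def sum_matrix_mult(1) by (simp add: sum_matrix_mult(2) Gam_mult mult_ac)
  also have "\<dots> = (\<Sum>P\<in>UNIV. \<Sum>R\<in>UNIV. smat (x $ P * y $ symdiff P R * clifford_sign P (symdiff P R)) (Gam (symdiff P (symdiff P R))))"
    by (rule sum.cong[OF refl], rule symdiff_reindex[symmetric])
  also have "\<dots> = (\<Sum>R\<in>UNIV. \<Sum>P\<in>UNIV. smat (x $ P * y $ symdiff P R * clifford_sign P (symdiff P R)) (Gam R))"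
    by (simp, rule sum.swap)
  also have "\<dots> = spin_rep (clifford_mult x y)"
    by (simp add: vec_eq_iff spin_rep_def clifford_mult_nth sum_distrib_left sum_distrib_right mult_ac)
  finally show ?thesis by simp
qed

lemma adj_sum: "adj (\<Sum>i\<in>I. f i) = (\<Sum>i\<in>I. adj (f i))"
  by (simp add: mat4_eq_iff adj_def mult4 J4_def sum_negf)

lemma adj_smat: "adj (smat c A) = smat c (adj A)"
  by (simp add: mat4_eq_iff adj_def mult4 J4_def)

lemma spin_rep_rev: "spin_rep (clifford_rev x) = adj (spin_rep x)"
  by (simp add: spin_rep_def adj_sum adj_smat adj_Gam clifford_rev_def mult.commute)

lemma spin_rep_one: "spin_rep clifford_one = mat 1"
  by (simp add: spin_rep_def clifford_one_def axis_def Gam_empty if_distrib[of "\<lambda>c. smat c _"] cong: if_cong)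

lemma spin_rep_add: "spin_rep (x + y) = spin_rep x + spin_rep y"
  by (simp add: vec_eq_iff spin_rep_nth sum.distrib ring_distribs)

lemma spin_rep_scale: "spin_rep (c *s x) = smat c (spin_rep x)"
  by (simp add: vec_eq_iff spin_rep_nth sum_distrib_left mult_ac)

lemma trace_sum: "trace (\<Sum>i\<in>I. f i) = (\<Sum>i\<in>I. trace (f i))" for f :: "'a \<Rightarrow> complex^'n^'n"
  unfolding trace_def by (simp, rule sum.swap)

lemma even_card_symdiff: "even (card (symdiff P Q)) \<longleftrightarrow> (even (card P) \<longleftrightarrow> even (card Q))" for P Q :: "'a::finite set"
proof -
  have "card P = card (P - Q) + card (P \<inter> Q)" by (metis card_Diff_subset_Int card_mono finite inf_le1 le_add_diff_inverse2)
  moreover have "card Q = card (Q - P) + card (P \<inter> Q)" by (metis Int_commute card_Diff_subset_Int card_mono finite inf_le1 le_add_diff_inverse2)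
  moreover have "card (symdiff P Q) = card (P - Q) + card (Q - P)"
    unfolding symdiff_def by (rule card_Un_disjoint) auto
  ultimately show ?thesis by presburger
qed

text \<open>For \<open>P\<close> and \<open>Q\<close> of equal parity, \<open>Gam P ** Gam Q\<close>
  is up to sign an even product, whose trace vanishes unless \<open>P\<close> = \<open>Q\<close>. So
  the trace pairing recovers coefficients within a parity.\<close>

lemma spin_rep_coeff:
  assumes "\<And>P. (even (card P) \<longleftrightarrow> even (card Q)) \<or> x $ P = 0"
  shows "trace (spin_rep x ** Gam Q) = 4 * clifford_sign Q Q * x $ Q"
proof -
  have "trace (spin_rep x ** Gam Q) = (\<Sum>P\<in>UNIV. x $ P * clifford_sign P Q * trace (Gam (symdiff P Q)))"
    by (simp add: spin_rep_def sum_matrix_mult trace_sum Gam_mult trace_smat)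
  also have "\<dots> = (\<Sum>P\<in>{Q}. x $ P * clifford_sign P Q * trace (Gam (symdiff P Q)))"
  proof (rule sum.mono_neutral_right, simp, simp, rule ballI)
    fix P assume "P \<in> UNIV - {Q}"
    then have "symdiff P Q \<noteq> {}" by (auto simp: symdiff_def)
    then show "x $ P * clifford_sign P Q * trace (Gam (symdiff P Q)) = 0"
      using assms[of P] trace_Gam[of "symdiff P Q"] even_card_symdiff[of P Q] by auto
  qed
  also have "\<dots> = 4 * clifford_sign Q Q * x $ Q"
    by (simp add: Gam_empty trace_I)
  finally show ?thesis .
qed

lemma clifford_sign_nz: "clifford_sign P Q \<noteq> 0"
  using clifford_sign_sq[of P Q] by auto

lemma spin_rep_inj_parity:
  assumes "\<And>P. (even (card P) \<longleftrightarrow> b) \<or> x $ P = 0" "\<And>P. (even (card P) \<longleftrightarrow> b) \<or> y $ P = 0"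
    "spin_rep x = spin_rep y"
  shows "x = y"
proof -
  have "x $ Q = y $ Q" for Q
  proof (cases "even (card Q) \<longleftrightarrow> b")
    case True
    then have "4 * clifford_sign Q Q * x $ Q = 4 * clifford_sign Q Q * y $ Q"
      using spin_rep_coeff[of Q x] spin_rep_coeff[of Q y] assms by metis
    then show ?thesis using clifford_sign_nz[of Q Q] by simp
  next
    case False
    then show ?thesis using assms(1,2)[of Q] by auto
  qed
  then show ?thesis by (simp add: vec_eq_iff)
qed

lemma spin_rep_inj: "inj_on spin_rep clifford_even"
  by (rule inj_onI, rule spin_rep_inj_parity[where b = True]) (auto simp: clifford_even_def)

lemma clifford_mult_parity:
  assumes "\<And>P. (even (card P) \<longleftrightarrow> b) \<or> x $ P = 0" "\<And>P. (even (card P) \<longleftrightarrow> c) \<or> y $ P = 0"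
  shows "(even (card R) \<longleftrightarrow> (b \<longleftrightarrow> c)) \<or> clifford_mult x y $ R = 0"
proof (cases "even (card R) \<longleftrightarrow> (b \<longleftrightarrow> c)")
  case R: False
  have "clifford_sign P (symdiff P R) * x $ P * y $ symdiff P R = 0" for P
    using assms(1)[of P] assms(2)[of "symdiff P R"] R even_card_symdiff[of P R] by auto
  then show ?thesis unfolding clifford_mult_nth by (intro disjI2 sum.neutral) blast
qed simp

lemma clifford_even_mult:
  assumes "x \<in> clifford_even" "y \<in> clifford_even" shows "clifford_mult x y \<in> clifford_even"
proof -
  have "(even (card R) \<longleftrightarrow> (True \<longleftrightarrow> True)) \<or> clifford_mult x y $ R = 0" for R
    by (rule clifford_mult_parity) (use assms in \<open>auto simp: clifford_even_def\<close>)
  then show ?thesis by (auto simp: clifford_even_def)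
qed

lemma spin_rep_axis: "spin_rep (axis P 1) = Gam P"
  by (simp add: spin_rep_def axis_def if_distrib[of "\<lambda>c. smat c _"] cong: if_cong)

definition elem4 :: "4 \<Rightarrow> 4 \<Rightarrow> complex^4^4" where
  "elem4 i j = (\<chi> r s. if r = i \<and> s = j then 1 else 0)"

text \<open>The image is an algebra. It contains the diagonal idempotents and a matrix without zero
  entries, and cutting the latter by the idempotents gives all matrix units up to scalars.\<close>

lemma spin_rep_surj: "spin_rep ` clifford_even = UNIV"
proof -
  define I where "I = spin_rep ` clifford_even"
  have add: "A + B \<in> I" if "A \<in> I" "B \<in> I" for A B
  proof -
    obtain x y where "x \<in> clifford_even" "y \<in> clifford_even" "A = spin_rep x" "B = spin_rep y"
      using \<open>A \<in> I\<close> \<open>B \<in> I\<close> unfolding I_def by blast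
    then show ?thesis unfolding I_def
      by (intro image_eqI[of _ _ "x + y"]) (auto simp: spin_rep_add clifford_even_def)
  qed
  have sc: "smat c A \<in> I" if "A \<in> I" for A c
  proof -
    obtain x where "x \<in> clifford_even" "A = spin_rep x" using \<open>A \<in> I\<close> unfolding I_def by blast
    then show ?thesis unfolding I_def
      by (intro image_eqI[of _ _ "c *s x"]) (auto simp: spin_rep_scale clifford_even_def)
  qed
  have mult: "A ** B \<in> I" if "A \<in> I" "B \<in> I" for A B
  proof -
    obtain x y where "x \<in> clifford_even" "y \<in> clifford_even" "A = spin_rep x" "B = spin_rep y"
      using \<open>A \<in> I\<close> \<open>B \<in> I\<close> unfolding I_def by blast
    then show ?thesis unfolding I_def
      by (intro image_eqI[of _ _ "clifford_mult x y"]) (auto simp: spin_rep_mult clifford_even_mult)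
  qed
  have Gam: "Gam P \<in> I" if "even (card P)" for P
    unfolding I_def using that
    by (intro image_eqI[of _ _ "axis P 1"], simp add: spin_rep_axis) (auto simp: clifford_even_def axis_def)
  have gam2: "gam i ** gam j \<in> I" for i j
  proof -
    have "gam i ** gam j = smat (clifford_sign {i} {j}) (Gam (symdiff {i} {j}))"
      using Gam_mult[of "{i}" "{j}"] by (simp add: Gam_singleton)
    moreover have "even (card (symdiff {i} {j}))" by (simp add: even_card_symdiff)
    ultimately show ?thesis using sc Gam by simp
  qed
  have one: "mat 1 \<in> I" using Gam[of "{}"] by (simp add: Gam_empty)
  have zero: "0 \<in> I" using sc[OF one, of 0] by simp
  have sum: "(\<And>i. i \<in> K \<Longrightarrow> f i \<in> I) \<Longrightarrow> sum f K \<in> I" for f and K :: "4 set"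
    by (induction K rule: infinite_finite_induct) (use add zero in auto)
  \<comment> \<open>The product of all five gamma matrices is -1, so one generator is an even
    element up to sign; hence all of them lie in the image of the even part.\<close>
  have "gam 0 = smat (-1) ((gam 1 ** gam 2) ** (gam 3 ** gam 4))"
    by (simp add: gam_def mat4_eq_iff mult4)
  then have g0: "gam 0 \<in> I" using sc mult gam2 by metis
  have gam: "gam i \<in> I" for i
  proof -
    have "gam 0 ** (gam 0 ** gam i) = gam i" by (simp add: matrix_mul_assoc gam_sq)
    then show ?thesis using mult[OF g0 gam2[of 0 i]] by simp
  qed
  \<comment> \<open>\<open>Z\<close> is diagonal with entries 1, -1, 1, -1 and \<open>gam 0\<close>
    has 1, -1, -1, 1; the four pairs of signs differ, so these two separate the coordinates.\<close>
  define Z where "Z = smat (-\<i>) (gam 1 ** gam 2)"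
  have Z: "Z \<in> I" unfolding Z_def using sc gam2 by blast
  have diag: "elem4 i i \<in> I" for i
  proof -
    have "elem4 1 1 = smat (1/4) ((mat 1 + gam 0) ** (mat 1 + Z))"
      "elem4 2 2 = smat (1/4) ((mat 1 + smat (-1) (gam 0)) ** (mat 1 + smat (-1) Z))"
      "elem4 3 3 = smat (1/4) ((mat 1 + smat (-1) (gam 0)) ** (mat 1 + Z))"
      "elem4 4 4 = smat (1/4) ((mat 1 + gam 0) ** (mat 1 + smat (-1) Z))"
      by (simp_all add: gam_def mat4_eq_iff mult4 Z_def elem4_def mat_nth)
    then show ?thesis using exhaust_4[of i] add sc mult one g0 Z by metis
  qed
  define M where "M = mat 1 + gam 1 + gam 3 + gam 1 ** gam 3"
  have M: "M \<in> I" unfolding M_def using add one gam gam2 by metis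
  have M0: "M $ i $ j \<noteq> 0" for i j
    using exhaust_4[of i] exhaust_4[of j] by (auto simp: M_def gam_def mult4 mat_nth)
  have elem: "elem4 i j \<in> I" for i j
  proof -
    have "(elem4 i i ** M ** elem4 j j) $ r $ s = (if r = i \<and> s = j then M $ i $ j else 0)" for r s
      by (simp add: matrix_mult_entry elem4_def if_distrib if_distribR sum.If_cases cong: if_cong conj_cong)
         (auto simp: sum.If_cases Int_def)
    then have "elem4 i j = smat (1 / M $ i $ j) (elem4 i i ** M ** elem4 j j)"
      using M0[of i j] by (simp add: vec_eq_iff elem4_def)
    then show ?thesis using sc mult diag M by metis
  qed
  have "A \<in> I" for A :: "complex^4^4"
  proof -
    have "A = (\<Sum>i\<in>UNIV. \<Sum>j\<in>UNIV. smat (A $ i $ j) (elem4 i j))"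
      by (simp add: mat4_eq_iff elem4_def sum_4)
    moreover have "\<dots> \<in> I" by (intro sum sc elem)
    ultimately show ?thesis by simp
  qed
  then show ?thesis unfolding I_def by blast
qed

section \<open>The polynomial embedding of four by four matrices\<close>

definition spin_inv :: "complex^4^4 \<Rightarrow> 5 clifford" where
  "spin_inv = inv_into clifford_even spin_rep"

lemma spin_inv: "spin_inv A \<in> clifford_even" "spin_rep (spin_inv A) = A"
  unfolding spin_inv_def using spin_rep_surj by (auto intro: inv_into_into f_inv_into_f)

lemma spin_inv_unique: "x \<in> clifford_even \<Longrightarrow> spin_rep x = A \<Longrightarrow> spin_inv A = x"
  using spin_rep_inj spin_inv by (metis inj_onD)

lemma clifford_mult_axis: "clifford_mult x (axis R 1) $ P = clifford_sign (symdiff R P) R * x $ symdiff R P"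
proof -
  have e: "symdiff S P = R \<longleftrightarrow> S = symdiff R P" for S
    by (metis symdiff_cancel(1) symdiff_commute)
  have "clifford_mult x (axis R 1) $ P = (\<Sum>S\<in>UNIV. if S = symdiff R P then clifford_sign S (symdiff S P) * x $ S else 0)"
    unfolding clifford_mult_nth by (rule sum.cong) (auto simp: axis_def e)
  also have "\<dots> = clifford_sign (symdiff R P) (symdiff (symdiff R P) P) * x $ symdiff R P" by simp
  finally show ?thesis using e by metis
qed

lemma matrix_clifford_nth: "matrix (clifford_mult x) $ P $ R = clifford_sign (symdiff R P) R * x $ symdiff R P"
  by (simp add: matrix_def clifford_mult_axis)

lemma clifford_mult_matrix: "matrix (clifford_mult x) *v z = clifford_mult x z"
proof -
  have "(matrix (clifford_mult x) *v z) $ P = clifford_mult x z $ P" for P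
  proof -
    have "(matrix (clifford_mult x) *v z) $ P = (\<Sum>R\<in>UNIV. clifford_sign (symdiff R P) R * x $ symdiff R P * z $ R)"
      by (simp add: matrix_vector_mult_def matrix_clifford_nth)
    also have "\<dots> = (\<Sum>S\<in>UNIV. clifford_sign S (symdiff S P) * x $ S * z $ symdiff S P)"
      by (rule sum.reindex_bij_witness[of _ "\<lambda>S. symdiff S P" "\<lambda>R. symdiff R P"])
        (auto simp: symdiff_commute[of _ P])
    finally show ?thesis by (simp add: clifford_mult_nth)
  qed
  then show ?thesis by (simp add: vec_eq_iff)
qed

lemma matrix_clifford_mult: "matrix (clifford_mult (clifford_mult x y)) = matrix (clifford_mult x) ** matrix (clifford_mult y)"
proof -
  have "matrix (clifford_mult (clifford_mult x y)) *v z = (matrix (clifford_mult x) ** matrix (clifford_mult y)) *v z" for z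
    by (simp add: clifford_mult_matrix clifford_assoc matrix_vector_mul_assoc[symmetric])
  then show ?thesis by (simp add: matrix_eq)
qed

lemma matrix_clifford_one: "matrix (clifford_mult clifford_one) = mat 1"
  by (simp add: vec_eq_iff matrix_clifford_nth clifford_one_def axis_def mat_def)
    (metis symdiff_cancel(1,2,3) clifford_sign_empty(1))

definition spin_embed :: "complex^4^4 \<Rightarrow> complex^(5 set)^(5 set)" where
  "spin_embed A = matrix (clifford_mult (spin_inv A))"

text \<open>The column \<open>{}\<close> of the matrix of left multiplication by x lists the
  coefficients of x, since the basis element of \<open>{}\<close> is the unit. The sum is thus an
  entry of \<open>spin_rep x\<close>.\<close>

definition spin_coord :: "4 \<Rightarrow> 4 \<Rightarrow> complex^(5 set)^(5 set) \<Rightarrow> complex" where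
  "spin_coord i j M = (\<Sum>P\<in>UNIV. M $ P $ {} * Gam P $ i $ j)"

text \<open>Everything that is transported from \<open>Sp4\<close> to the spin group uses only these
  laws. The map \<open>spin_embed\<close> is one instance; its conjugates are others, and one of
  these carries the standard torus and Borel subgroup to the given ones. Compatibility with
  differences serves unipotency.\<close>

locale sp4_rep =
  fixes Psi :: "complex^4^4 \<Rightarrow> complex^'n^'n" and rho :: "4 \<Rightarrow> 4 \<Rightarrow> complex^'n^'n \<Rightarrow> complex"
  assumes Psi_mult: "Psi (A ** B) = Psi A ** Psi B"
    and Psi_one: "Psi (mat 1) = mat 1"
    and Psi_diff: "Psi (A - B) = Psi A - Psi B"
    and Psi_poly: "(\<lambda>A. Psi A $ k $ l) \<in> poly_fun"
    and rho_poly: "rho i j \<in> poly_fun"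
    and rho_Psi: "rho i j (Psi A) = A $ i $ j"

text \<open>\<open>spin_inv\<close> is defined by choice; the trace formula shows that its
  coefficients are linear in the matrix, so that the embedding is polynomial.\<close>

lemma spin_inv_nth: "spin_inv A $ P = (if even (card P) then trace (A ** Gam P) / (4 * clifford_sign P P) else 0)"
proof -
  have par: "even (card Q) \<or> spin_inv A $ Q = 0" for Q
    using spin_inv(1)[of A] by (auto simp: clifford_even_def)
  show ?thesis
  proof (cases "even (card P)")
    case True
    then show ?thesis
      using spin_rep_coeff[of P "spin_inv A"] par spin_inv(2)[of A] clifford_sign_nz[of P P] by simp
  qed (use par[of P] in simp)
qed

lemma sp4_rep_spin: "sp4_rep spin_embed spin_coord"
proof
  fix A B :: "complex^4^4" and i j :: 4 and k l :: "5 set"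
  have "spin_inv (A ** B) = clifford_mult (spin_inv A) (spin_inv B)"
    by (intro spin_inv_unique clifford_even_mult spin_inv) (simp add: spin_rep_mult spin_inv)
  then show "spin_embed (A ** B) = spin_embed A ** spin_embed B"
    by (simp add: spin_embed_def matrix_clifford_mult)
  have "spin_inv (mat 1) = clifford_one"
    by (intro spin_inv_unique spin_rep_one) (simp add: clifford_even_def clifford_one_def axis_def)
  then show "spin_embed (mat 1) = mat 1" by (simp add: spin_embed_def matrix_clifford_one)
  have "spin_inv (A - B) $ P = spin_inv A $ P - spin_inv B $ P" for P
    by (simp add: spin_inv_nth trace_def matrix_mult_entry left_diff_distrib sum_subtractf diff_divide_distrib)
  then show "spin_embed (A - B) = spin_embed A - spin_embed B"
    by (simp add: vec_eq_iff spin_embed_def matrix_clifford_nth right_diff_distrib)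
  have "(\<lambda>A. spin_inv A $ P) \<in> poly_fun" for P
  proof (cases "even (card P)")
    case True
    have "(\<lambda>A. trace (A ** Gam P) / (4 * clifford_sign P P)) \<in> poly_fun"
      unfolding trace_def divide_inverse
      by (intro poly_fun.mult poly_fun_sum poly_fun_matrix_mult poly_fun.const poly_fun.entry)
    then show ?thesis using True by (simp add: spin_inv_nth)
  qed (simp add: spin_inv_nth poly_fun.const)
  then show "(\<lambda>A. spin_embed A $ k $ l) \<in> poly_fun"
    by (simp add: spin_embed_def matrix_clifford_nth poly_fun_cmult)
  show "spin_coord i j \<in> poly_fun"
    unfolding spin_coord_def[abs_def] by (intro poly_fun_sum poly_fun.mult poly_fun.const poly_fun.entry)
  have "spin_coord i j (spin_embed A) = spin_rep (spin_inv A) $ i $ j"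
    by (simp add: spin_coord_def spin_embed_def matrix_clifford_nth spin_rep_nth)
  then show "spin_coord i j (spin_embed A) = A $ i $ j" by (simp add: spin_inv)
qed

lemma Gam_UNIV: "Gam UNIV = smat (-1) (mat 1)"
  by (simp add: Gam_def gam_sel_def gam_def mat4_eq_iff mult4 mat_nth)

text \<open>The norm condition is membership in \<open>Sp4\<close>, because reversal becomes
  \<open>adj\<close>. That vectors are preserved then follows: the conjugate of a vector is odd and
  fixed by reversal, which removes degree 3, and its trace is 0, which removes degree 5.\<close>

lemma spin_elements_iff: "x \<in> spin_elements \<longleftrightarrow> x \<in> clifford_even \<and> spin_rep x \<in> Sp4"
proof -
  have "clifford_mult (clifford_mult x v) (clifford_rev x) \<in> clifford_vectors"
    if x: "x \<in> clifford_even" "spin_rep x \<in> Sp4" and v: "v \<in> clifford_vectors" for v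
  proof -
    let ?y = "clifford_mult (clifford_mult x v) (clifford_rev x)"
    have vodd: "(even (card P) \<longleftrightarrow> False) \<or> v $ P = 0" for P
      using v unfolding clifford_vectors_def by fastforce
    have xev: "(even (card P) \<longleftrightarrow> True) \<or> x $ P = 0" for P
      using x unfolding clifford_even_def by auto
    have xrev: "(even (card P) \<longleftrightarrow> True) \<or> clifford_rev x $ P = 0" for P
      using xev[of P] by (auto simp: clifford_rev_def)
    have "(even (card P) \<longleftrightarrow> (True \<longleftrightarrow> False)) \<or> clifford_mult x v $ P = 0" for P
      by (rule clifford_mult_parity[OF xev vodd])
    from clifford_mult_parity[OF this xrev]
    have yodd: "(even (card P) \<longleftrightarrow> False) \<or> ?y $ P = 0" for P by simp
    have vrev: "clifford_rev v = v"
    proof -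
      have "clifford_rev v $ P = v $ P" for P
        using v by (cases "card P = 1") (auto simp: clifford_rev_def clifford_vectors_def numeral_2_eq_2)
      then show ?thesis by (simp add: vec_eq_iff)
    qed
    let ?A = "spin_rep x"
    have y: "spin_rep ?y = ?A ** spin_rep v ** adj ?A"
      by (simp add: spin_rep_mult spin_rep_rev)
    have "adj (spin_rep ?y) = spin_rep ?y"
      unfolding y adj_mult adj_adj using vrev by (metis matrix_mul_assoc spin_rep_rev)
    then have "spin_rep (clifford_rev ?y) = spin_rep ?y" by (simp add: spin_rep_rev)
    moreover have "(even (card P) \<longleftrightarrow> False) \<or> clifford_rev ?y $ P = 0" for P
      using yodd[of P] by (auto simp: clifford_rev_def)
    ultimately have yrev: "clifford_rev ?y = ?y"
      using yodd by (intro spin_rep_inj_parity[where b = False])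
    have y3: "?y $ P = 0" if "card P = 3" for P
    proof -
      have "(3::nat) choose 2 = 3" by (simp add: numeral_2_eq_2 numeral_3_eq_3)
      then have "clifford_rev ?y $ P = - ?y $ P" using that by (simp add: clifford_rev_def)
      then show ?thesis using yrev by simp
    qed
    have c5: "card P \<le> 5" for P :: "5 set"
      using card_mono[of UNIV P] by simp
    have U: "P = UNIV" if "card P = 5" for P :: "5 set"
      using that by (intro card_subset_eq) auto
    have zero: "trace (smat (z $ P) (Gam P)) = 0" if "z $ P = 0 \<or> card P = 1" for z P
    proof -
      have "trace (Gam P) = 0" if c1: "card P = 1"
        using c1 by (metis Gam_singleton card_1_singletonE trace_gam)
      then show ?thesis using that by (auto simp: trace_smat)
    qed
    \<comment> \<open>In degree 5 reversal has sign +1 and gives no information. But the basis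
      element of degree 5 is the only odd one with nonzero trace, and conjugation by
      \<open>spin_rep x\<close> preserves traces.\<close>
    have "trace (spin_rep v) = 0"
      unfolding spin_rep_def trace_sum
      using v by (intro sum.neutral ballI zero) (auto simp: clifford_vectors_def)
    moreover have "trace (spin_rep ?y) = trace (spin_rep v ** (adj ?A ** ?A))"
      unfolding y by (metis matrix_mul_assoc trace_mul_sym)
    ultimately have "trace (spin_rep ?y) = 0" using x(2) by (simp add: Sp4_adj)
    moreover have "trace (spin_rep ?y) = (\<Sum>P\<in>{UNIV}. trace (smat (?y $ P) (Gam P)))"
      unfolding spin_rep_def trace_sum
    proof (rule sum.mono_neutral_right, simp, simp, rule ballI)
      fix P :: "5 set" assume "P \<in> UNIV - {UNIV}"
      then have "card P \<noteq> 5" using U by auto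
      then have "even (card P) \<or> card P = 1 \<or> card P = 3" using c5[of P] by presburger
      then consider "even (card P)" | "card P = 1" | "card P = 3" by blast
      then show "trace (smat (?y $ P) (Gam P)) = 0"
        using yodd[of P] y3[of P] zero[of ?y P] by cases blast+
    qed
    ultimately have "?y $ UNIV * trace (Gam UNIV) = 0" by (simp add: trace_smat)
    then have y5: "?y $ UNIV = 0" unfolding Gam_UNIV by (simp add: trace_smat trace_I)
    show ?thesis unfolding clifford_vectors_def
    proof (intro CollectI allI impI)
      fix P :: "5 set" assume "card P \<noteq> 1"
      then have "even (card P) \<or> card P = 3 \<or> card P = 5" using c5[of P] by presburger
      then consider "even (card P)" | "card P = 3" | "card P = 5" by blast
      then show "?y $ P = 0" using yodd[of P] y3[of P] y5 U[of P] by cases auto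
    qed
  qed
  moreover have "clifford_mult x (clifford_rev x) = clifford_one \<longleftrightarrow> spin_rep x \<in> Sp4"
    if x: "x \<in> clifford_even"
  proof -
    have "clifford_mult x (clifford_rev x) \<in> clifford_even" "clifford_one \<in> (clifford_even :: 5 clifford set)"
    proof -
      have "clifford_rev x \<in> clifford_even" using x by (simp add: clifford_even_def clifford_rev_def)
      then show "clifford_mult x (clifford_rev x) \<in> clifford_even" by (rule clifford_even_mult[OF x])
    qed (simp add: clifford_even_def clifford_one_def axis_def)
    then have "clifford_mult x (clifford_rev x) = clifford_one \<longleftrightarrow>
      spin_rep (clifford_mult x (clifford_rev x)) = spin_rep clifford_one"
      using spin_rep_inj by (metis inj_onD)
    then show ?thesis by (simp add: spin_rep_mult spin_rep_rev spin_rep_one Sp4_adj')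
  qed
  ultimately show ?thesis unfolding spin_elements_def by blast
qed

theorem Spin5_eq: "Spin5 = spin_embed ` Sp4"
proof (intro equalityI subsetI)
  fix g assume "g \<in> Spin5"
  then obtain x where x: "x \<in> spin_elements" "g = matrix (clifford_mult x)" unfolding spin_group_def by blast
  then have "spin_inv (spin_rep x) = x" "spin_rep x \<in> Sp4" using spin_elements_iff by (auto intro: spin_inv_unique)
  then show "g \<in> spin_embed ` Sp4" using x by (intro image_eqI[of _ _ "spin_rep x"]) (simp_all add: spin_embed_def)
next
  fix g assume "g \<in> spin_embed ` Sp4"
  then obtain A where A: "A \<in> Sp4" "g = spin_embed A" by blast
  then have "spin_inv A \<in> spin_elements" using spin_elements_iff spin_inv by simp
  then show "g \<in> Spin5" unfolding spin_group_def using A by (auto simp: spin_embed_def)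
qed

section \<open>Subgroups of the symplectic group\<close>

lemma adj_eq: "adj A = mat4 (A$4$4) (A$3$4) (- A$2$4) (- A$1$4)  (A$4$3) (A$3$3) (- A$2$3) (- A$1$3)
   (- A$4$2) (- A$3$2) (A$2$2) (A$1$2)  (- A$4$1) (- A$3$1) (A$2$1) (A$1$1)"
  by (simp add: mat4_eq_iff adj_def mult4 J4_def)

lemma adj_nth [simp]:
  "adj A $ 1 $ 1 = A $ 4 $ 4" "adj A $ 1 $ 2 = A $ 3 $ 4" "adj A $ 1 $ 3 = - A $ 2 $ 4" "adj A $ 1 $ 4 = - A $ 1 $ 4"
  "adj A $ 2 $ 1 = A $ 4 $ 3" "adj A $ 2 $ 2 = A $ 3 $ 3" "adj A $ 2 $ 3 = - A $ 2 $ 3" "adj A $ 2 $ 4 = - A $ 1 $ 3"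
  "adj A $ 3 $ 1 = - A $ 4 $ 2" "adj A $ 3 $ 2 = - A $ 3 $ 2" "adj A $ 3 $ 3 = A $ 2 $ 2" "adj A $ 3 $ 4 = A $ 1 $ 2"
  "adj A $ 4 $ 1 = - A $ 4 $ 1" "adj A $ 4 $ 2 = - A $ 3 $ 1" "adj A $ 4 $ 3 = A $ 2 $ 1" "adj A $ 4 $ 4 = A $ 1 $ 1"
  by (simp_all add: adj_eq)

text \<open>The value of the symplectic form on columns \<open>i\<close> and \<open>j\<close> of
  \<open>A\<close>.\<close>

definition omega :: "complex^4^4 \<Rightarrow> 4 \<Rightarrow> 4 \<Rightarrow> complex" where
  "omega A i j = A$1$i * A$4$j + A$2$i * A$3$j - A$3$i * A$2$j - A$4$i * A$1$j"

lemma Sp4_omega: "A \<in> Sp4 \<longleftrightarrow> (\<forall>i j. omega A i j = J4 $ i $ j)"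
proof -
  have "(transpose A ** J4 ** A) $ i $ j = omega A i j" for i j
    by (simp add: mult4 J4_def omega_def)
  then show ?thesis by (simp add: Sp4_def vec_eq_iff)
qed

lemma omega_swap: "omega A j i = - omega A i j"
  by (simp add: omega_def)

lemma Sp4_omega6: "A \<in> Sp4 \<longleftrightarrow> omega A 1 2 = 0 \<and> omega A 1 3 = 0 \<and> omega A 1 4 = 1 \<and>
    omega A 2 3 = 1 \<and> omega A 2 4 = 0 \<and> omega A 3 4 = 0"
proof -
  have "omega A i i = 0" for i by (simp add: omega_def)
  then show ?thesis
    unfolding Sp4_omega forall_4
    by (auto simp: J4_def omega_swap[of A 2 1] omega_swap[of A 3 1] omega_swap[of A 4 1] omega_swap[of A 3 2]
      omega_swap[of A 4 2] omega_swap[of A 4 3])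
qed

lemmas Sp4_cols = Sp4_omega6[unfolded omega_def]

lemma Sp4_one: "mat 1 \<in> Sp4"
  by (simp add: Sp4_cols mat_nth)

lemma Sp4_mult: "A \<in> Sp4 \<Longrightarrow> B \<in> Sp4 \<Longrightarrow> A ** B \<in> Sp4"
proof -
  assume A: "A \<in> Sp4" "B \<in> Sp4"
  have "adj (A ** B) ** (A ** B) = adj B ** (adj A ** A) ** B" by (simp add: adj_mult matrix_mul_assoc)
  then show ?thesis using A by (simp add: Sp4_adj)
qed

lemma Sp4_adj_closed: "A \<in> Sp4 \<Longrightarrow> adj A \<in> Sp4"
  by (metis Sp4_adj Sp4_adj' adj_adj)

lemma adj_left: "A \<in> Sp4 \<Longrightarrow> adj A ** A = mat 1" and adj_right: "A \<in> Sp4 \<Longrightarrow> A ** adj A = mat 1"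
  by (simp_all add: Sp4_adj[symmetric] Sp4_adj'[symmetric])

lemma adj_cancel: "A \<in> Sp4 \<Longrightarrow> adj A ** (A ** B) = B" "A \<in> Sp4 \<Longrightarrow> A ** (adj A ** B) = B"
  by (simp_all add: matrix_mul_assoc adj_left adj_right)

lemma inv_GL_adj: "A \<in> Sp4 \<Longrightarrow> inv\<^bsub>GL\<^esub> A = adj A"
  by (intro inv_GL_unique adj_right)

lemma Sp4_invertible: "A \<in> Sp4 \<Longrightarrow> invertible A"
  using adj_left adj_right by (auto simp: invertible_def)

lemma adj_one: "adj (mat 1) = mat 1"
  by (simp add: adj_eq mat4_eq_iff mat_nth)

lemma Sp4_rows: "A \<in> Sp4 \<Longrightarrow>
   A$1$1 * A$2$4 + A$1$2 * A$2$3 - A$1$3 * A$2$2 - A$1$4 * A$2$1 = 0 \<and>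
   A$1$1 * A$3$4 + A$1$2 * A$3$3 - A$1$3 * A$3$2 - A$1$4 * A$3$1 = 0 \<and>
   A$1$1 * A$4$4 + A$1$2 * A$4$3 - A$1$3 * A$4$2 - A$1$4 * A$4$1 = 1 \<and>
   A$2$1 * A$3$4 + A$2$2 * A$3$3 - A$2$3 * A$3$2 - A$2$4 * A$3$1 = 1 \<and>
   A$2$1 * A$4$4 + A$2$2 * A$4$3 - A$2$3 * A$4$2 - A$2$4 * A$4$1 = 0 \<and>
   A$3$1 * A$4$4 + A$3$2 * A$4$3 - A$3$3 * A$4$2 - A$3$4 * A$4$1 = 0"
  using Sp4_adj_closed[of A] by (simp add: Sp4_cols adj_eq algebra_simps)

text \<open>The standard subgroups. \<open>B4\<close> is the Borel subgroup of upper triangular matrices, \<open>Pa4\<close> and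
  \<open>Pb4\<close> are the maximal parabolic subgroups stabilising the line and the plane of the standard flag;
  \<open>La4\<close>, \<open>Lb4\<close> and \<open>Ua4\<close>, \<open>Ub4\<close> are their Levi subgroups and unipotent radicals.\<close>

definition "B4 = {A \<in> Sp4. A$2$1 = 0 \<and> A$3$1 = 0 \<and> A$4$1 = 0 \<and> A$3$2 = 0 \<and> A$4$2 = 0 \<and> A$4$3 = 0}"
definition "Pa4 = {A \<in> Sp4. A$2$1 = 0 \<and> A$3$1 = 0 \<and> A$4$1 = 0 \<and> A$4$2 = 0 \<and> A$4$3 = 0}"
definition "Pb4 = {A \<in> Sp4. A$3$1 = 0 \<and> A$4$1 = 0 \<and> A$3$2 = 0 \<and> A$4$2 = 0}"
definition "T4 = {A \<in> Sp4. A$1$2 = 0 \<and> A$1$3 = 0 \<and> A$1$4 = 0 \<and> A$2$1 = 0 \<and> A$2$3 = 0 \<and> A$2$4 = 0 \<and>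
   A$3$1 = 0 \<and> A$3$2 = 0 \<and> A$3$4 = 0 \<and> A$4$1 = 0 \<and> A$4$2 = 0 \<and> A$4$3 = 0}"
definition "La4 = {A \<in> Sp4. A$1$2 = 0 \<and> A$1$3 = 0 \<and> A$1$4 = 0 \<and> A$2$1 = 0 \<and> A$2$4 = 0 \<and>
   A$3$1 = 0 \<and> A$3$4 = 0 \<and> A$4$1 = 0 \<and> A$4$2 = 0 \<and> A$4$3 = 0}"
definition "Lb4 = {A \<in> Sp4. A$1$3 = 0 \<and> A$1$4 = 0 \<and> A$2$3 = 0 \<and> A$2$4 = 0 \<and>
   A$3$1 = 0 \<and> A$3$2 = 0 \<and> A$4$1 = 0 \<and> A$4$2 = 0}"
definition "U4 = {A \<in> Sp4. A$2$1 = 0 \<and> A$3$1 = 0 \<and> A$4$1 = 0 \<and> A$3$2 = 0 \<and> A$4$2 = 0 \<and> A$4$3 = 0 \<and>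
   A$1$1 = 1 \<and> A$2$2 = 1 \<and> A$3$3 = 1 \<and> A$4$4 = 1}"
definition "Ua4 = {A \<in> Sp4. A$2$1 = 0 \<and> A$3$1 = 0 \<and> A$4$1 = 0 \<and> A$3$2 = 0 \<and> A$4$2 = 0 \<and> A$4$3 = 0 \<and>
   A$1$1 = 1 \<and> A$2$2 = 1 \<and> A$3$3 = 1 \<and> A$4$4 = 1 \<and> A$2$3 = 0}"
definition "Ub4 = {A \<in> Sp4. A$2$1 = 0 \<and> A$3$1 = 0 \<and> A$4$1 = 0 \<and> A$3$2 = 0 \<and> A$4$2 = 0 \<and> A$4$3 = 0 \<and>
   A$1$1 = 1 \<and> A$2$2 = 1 \<and> A$3$3 = 1 \<and> A$4$4 = 1 \<and> A$1$2 = 0 \<and> A$3$4 = 0}"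
definition "V4 = {A \<in> Sp4. A$2$1 = 0 \<and> A$3$1 = 0 \<and> A$4$1 = 0 \<and> A$3$2 = 0 \<and> A$4$2 = 0 \<and> A$4$3 = 0 \<and>
   A$1$1 = 1 \<and> A$2$2 = 1 \<and> A$3$3 = 1 \<and> A$4$4 = 1 \<and> A$1$2 = 0 \<and> A$3$4 = 0 \<and> A$2$3 = 0}"

lemmas subgroup4_defs = B4_def Pa4_def Pb4_def T4_def La4_def Lb4_def U4_def Ua4_def Ub4_def V4_def

text \<open>A symplectic matrix that preserves the line of the first basis vector also preserves its
  orthogonal hyperplane, where the fourth coordinate is 0.\<close>

lemma Pa4_eq: "Pa4 = {A \<in> Sp4. A$2$1 = 0 \<and> A$3$1 = 0 \<and> A$4$1 = 0}"
proof -
  have "A$4$2 = 0 \<and> A$4$3 = 0" if "A \<in> Sp4" "A$2$1 = 0" "A$3$1 = 0" "A$4$1 = 0" for A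
    using that by (auto simp: Sp4_cols)
  then show ?thesis by (auto simp: Pa4_def)
qed

lemma B4_eq: "B4 = {A \<in> Sp4. A$2$1 = 0 \<and> A$3$1 = 0 \<and> A$4$1 = 0 \<and> A$3$2 = 0}"
proof -
  have "A$4$2 = 0 \<and> A$4$3 = 0" if "A \<in> Sp4" "A$2$1 = 0" "A$3$1 = 0" "A$4$1 = 0" for A
    using that by (auto simp: Sp4_cols)
  then show ?thesis by (auto simp: B4_def)
qed

definition group4 :: "(complex^4^4) set \<Rightarrow> bool" where
  "group4 H \<longleftrightarrow> H \<subseteq> Sp4 \<and> mat 1 \<in> H \<and> (\<forall>A\<in>H. \<forall>B\<in>H. A ** B \<in> H) \<and> (\<forall>A\<in>H. adj A \<in> H)"

lemma group4_standard:
  "group4 Sp4" "group4 B4" "group4 Pa4" "group4 Pb4" "group4 T4" "group4 La4" "group4 Lb4"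
  "group4 U4" "group4 Ua4" "group4 Ub4" "group4 V4"
  unfolding group4_def
  by (auto simp: Sp4_one Sp4_mult Sp4_adj_closed) (auto simp: subgroup4_defs Sp4_one Sp4_mult Sp4_adj_closed mult4 mat_nth)

lemma closedin_zariski_conj:
  "closedin zariski {A. P A} \<Longrightarrow> closedin zariski {A. Q A} \<Longrightarrow> closedin zariski {A. P A \<and> Q A}"
  using closedin_Int by (simp add: Collect_conj_eq)

lemma closedin_Sp4: "closedin zariski Sp4"
  by (subst Collect_mem_eq[symmetric], subst Sp4_cols)
   (intro closedin_zariski_conj closedin_zariski_eq poly_fun_diff poly_fun.add poly_fun.mult poly_fun.entry poly_fun.const)

lemma closedin_standard:
  "closedin zariski B4" "closedin zariski Pa4" "closedin zariski Pb4" "closedin zariski T4"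
  "closedin zariski La4" "closedin zariski Lb4"
  "closedin zariski U4" "closedin zariski Ua4" "closedin zariski Ub4"
proof -
  have *: "closedin zariski {A. A \<in> Sp4}" using closedin_Sp4 by simp
  show "closedin zariski B4" "closedin zariski Pa4" "closedin zariski Pb4" "closedin zariski T4"
    "closedin zariski La4" "closedin zariski Lb4"
    "closedin zariski U4" "closedin zariski Ua4" "closedin zariski Ub4"
    unfolding subgroup4_defs
    by (intro * closedin_zariski_conj closedin_zariski_eq poly_fun.entry poly_fun.const)+
qed

subsection \<open>Parametrisations and connectedness\<close>

text \<open>The product of the abelian unipotent group whose lower left block has rows (e, d) and
  (f, e) with the one-parameter group in \<open>a\<close>. The products of parameters in the first
  column come from this order; \<open>upp\<close> is built in the same way.\<close>

definition low :: "complex \<Rightarrow> complex \<Rightarrow> complex \<Rightarrow> complex \<Rightarrow> complex^4^4" where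
  "low a d e f = mat4 1 0 0 0  a 1 0 0  (e + a * d) d 1 0  (f + a * e) e (- a) 1"

definition upp :: "complex \<Rightarrow> complex \<Rightarrow> complex \<Rightarrow> complex \<Rightarrow> complex^4^4" where
  "upp a d e f = mat4 1 a (e + a * d) (f + a * e)  0 1 d e  0 0 1 (- a)  0 0 0 1"

definition tor :: "complex \<Rightarrow> complex \<Rightarrow> complex^4^4" where
  "tor a b = mat4 a 0 0 0  0 b 0 0  0 0 (1 / b) 0  0 0 0 (1 / a)"

lemma low_Sp4: "low a d e f \<in> Sp4" and upp_U4: "upp a d e f \<in> U4"
  by (simp_all add: Sp4_cols low_def upp_def U4_def algebra_simps)

lemma tor_T4: "a \<noteq> 0 \<Longrightarrow> b \<noteq> 0 \<Longrightarrow> tor a b \<in> T4"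
  by (simp add: T4_def Sp4_cols tor_def)

lemma T4_tor: "A \<in> T4 \<Longrightarrow> A = tor (A$1$1) (A$2$2) \<and> A$1$1 \<noteq> 0 \<and> A$2$2 \<noteq> 0"
  by (auto simp: T4_def Sp4_cols tor_def mat4_eq_iff divide_simps mult.commute)

lemma U4_upp: "A \<in> U4 \<Longrightarrow> A = upp (A$1$2) (A$2$3) (A$2$4) (A$1$4 - A$1$2 * A$2$4)"
proof -
  assume "A \<in> U4"
  moreover from this have "A \<in> Sp4" by (simp add: U4_def)
  ultimately have "A$3$4 = - A$1$2" "A$1$3 = A$2$4 - A$2$3 * A$3$4"
    using Sp4_rows[of A] Sp4_cols[of A] by (auto simp: U4_def add_eq_0_iff2 algebra_simps)
  then show ?thesis using \<open>A \<in> U4\<close>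
    by (simp add: U4_def upp_def mat4_eq_iff)
qed

lemma connectedin_mat4_image:
  assumes "connected S" "continuous_on S a" "continuous_on S b" "continuous_on S c" "continuous_on S d"
    "continuous_on S e" "continuous_on S f" "continuous_on S g" "continuous_on S h"
    "continuous_on S i" "continuous_on S j" "continuous_on S k" "continuous_on S l"
    "continuous_on S m" "continuous_on S n" "continuous_on S p" "continuous_on S q"
  shows "connectedin zariski ((\<lambda>x. mat4 (a x) (b x) (c x) (d x) (e x) (f x) (g x) (h x) (i x) (j x)
    (k x) (l x) (m x) (n x) (p x) (q x)) ` S)"
proof -
  have "continuous_on S (\<lambda>x. mat4 (a x) (b x) (c x) (d x) (e x) (f x) (g x) (h x) (i x) (j x)
    (k x) (l x) (m x) (n x) (p x) (q x))"
    unfolding mat4_def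
  proof (intro continuous_on_vec_lambda)
    fix r s :: 4
    show "continuous_on S (\<lambda>x. if r = 1 then (if s = 1 then a x else if s = 2 then b x else if s = 3 then c x else d x)
     else if r = 2 then (if s = 1 then e x else if s = 2 then f x else if s = 3 then g x else h x)
     else if r = 3 then (if s = 1 then i x else if s = 2 then j x else if s = 3 then k x else l x)
     else (if s = 1 then m x else if s = 2 then n x else if s = 3 then p x else q x))"
      using assms(2-) by (cases "r = 1"; cases "r = 2"; cases "r = 3"; cases "s = 1"; cases "s = 2"; cases "s = 3"; simp)
  qed
  then show ?thesis using assms(1) by (intro connectedin_zariski_of_connected connected_continuous_image)
qed

text \<open>The Zariski topology on pairs is not a product topology, so the translates x Y are glued
  to X instead: each is connected and meets X in x, as 1 lies in Y.\<close>

lemma connectedin_zariski_product: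
  fixes X Y :: "(complex^'n^'n) set"
  assumes "connectedin zariski X" "connectedin zariski Y" "mat 1 \<in> Y"
  shows "connectedin zariski {x ** y | x y. x \<in> X \<and> y \<in> Y}"
proof (cases "X = {}")
  case False
  have "connectedin zariski (X \<union> (**) x ` Y)" if "x \<in> X" for x
  proof -
    have "connectedin zariski ((**) x ` Y)"
      by (rule connectedin_zariski_image_poly[OF assms(2)]) (intro poly_fun_matrix_mult poly_fun.const poly_fun.entry)
    moreover have "x \<in> X \<inter> (**) x ` Y" using that assms(3) by (auto intro!: image_eqI[of _ _ "mat 1"])
    ultimately show ?thesis using assms(1) connectedin_Un by blast
  qed
  then have "connectedin zariski (\<Union>x\<in>X. X \<union> (**) x ` Y)"
    using False by (intro connectedin_Union) auto
  moreover have "(\<Union>x\<in>X. X \<union> (**) x ` Y) = {x ** y | x y. x \<in> X \<and> y \<in> Y}"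
  proof -
    have "x \<in> {x ** y | x y. x \<in> X \<and> y \<in> Y}" if "x \<in> X" for x
      using that assms(3) by (metis (mono_tags, lifting) matrix_mul_rid mem_Collect_eq)
    then show ?thesis by auto
  qed
  ultimately show ?thesis by simp
qed (simp add: connectedin_empty)

lemma connected_nonzero_pairs: "connected ((- {0 :: complex}) \<times> (- {0 :: complex}))"
  by (intro connected_Times connected_punctured_universe) simp_all

lemma connected_T4: "connectedin zariski T4"
proof -
  let ?S = "(- {0 :: complex}) \<times> (- {0 :: complex})"
  have "connectedin zariski ((\<lambda>x. tor (fst x) (snd x)) ` ?S)"
    unfolding tor_def
    by (intro connectedin_mat4_image connected_nonzero_pairs continuous_intros) auto
  moreover have "(\<lambda>x. tor (fst x) (snd x)) ` ?S = T4"
  proof (intro equalityI subsetI)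
    fix A assume "A \<in> T4"
    then show "A \<in> (\<lambda>x. tor (fst x) (snd x)) ` ?S"
      using T4_tor[of A] by (intro image_eqI[of _ _ "(A$1$1, A$2$2)"]) auto
  qed (auto intro: tor_T4)
  ultimately show ?thesis by simp
qed

lemma connected_upp: "connectedin zariski ((\<lambda>x. upp (p x) (q x) (r x) (s x)) ` (UNIV :: (complex \<times> complex \<times> complex) set))"
  if "continuous_on UNIV p" "continuous_on UNIV q" "continuous_on UNIV r" "continuous_on UNIV s"
  unfolding upp_def by (intro connectedin_mat4_image continuous_intros that convex_connected[OF convex_UNIV])

lemma connected_U4: "connectedin zariski U4"
proof -
  let ?g = "\<lambda>x::complex \<times> complex \<times> complex \<times> complex. upp (fst x) (fst (snd x)) (fst (snd (snd x))) (snd (snd (snd x)))"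
  have "connectedin zariski (?g ` UNIV)"
    unfolding upp_def by (intro connectedin_mat4_image continuous_intros convex_connected[OF convex_UNIV])
  moreover have "?g ` UNIV = U4"
  proof (intro equalityI subsetI)
    fix A assume "A \<in> U4"
    then show "A \<in> ?g ` UNIV"
      using U4_upp[of A] by (intro image_eqI[of _ _ "(A$1$2, A$2$3, A$2$4, A$1$4 - A$1$2 * A$2$4)"]) auto
  qed (auto intro: upp_U4)
  ultimately show ?thesis by simp
qed

lemma connected_Ua4: "connectedin zariski Ua4"
proof -
  let ?g = "\<lambda>x::complex \<times> complex \<times> complex. upp (fst x) 0 (fst (snd x)) (snd (snd x))"
  have "connectedin zariski (?g ` UNIV)" by (intro connected_upp continuous_intros)
  moreover have "?g ` UNIV = Ua4"
  proof (intro equalityI subsetI)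
    fix A assume A: "A \<in> Ua4"
    then have "A \<in> U4" "A$2$3 = 0" by (auto simp: Ua4_def U4_def)
    then show "A \<in> ?g ` UNIV"
      using U4_upp[of A] by (intro image_eqI[of _ _ "(A$1$2, A$2$4, A$1$4 - A$1$2 * A$2$4)"]) auto
  next
    fix A assume "A \<in> ?g ` UNIV"
    then obtain a e f where "A = upp a 0 e f" by auto
    then show "A \<in> Ua4" using upp_U4[of a 0 e f] by (simp add: U4_def Ua4_def upp_def)
  qed
  ultimately show ?thesis by simp
qed

lemma connected_Ub4: "connectedin zariski Ub4"
proof -
  let ?g = "\<lambda>x::complex \<times> complex \<times> complex. upp 0 (fst x) (fst (snd x)) (snd (snd x))"
  have "connectedin zariski (?g ` UNIV)" by (intro connected_upp continuous_intros)
  moreover have "?g ` UNIV = Ub4"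
  proof (intro equalityI subsetI)
    fix A assume A: "A \<in> Ub4"
    then have "A \<in> U4" "A$1$2 = 0" by (auto simp: Ub4_def U4_def)
    then show "A \<in> ?g ` UNIV"
      using U4_upp[of A] by (intro image_eqI[of _ _ "(A$2$3, A$2$4, A$1$4 - A$1$2 * A$2$4)"]) auto
  next
    fix A assume "A \<in> ?g ` UNIV"
    then obtain d e f where "A = upp 0 d e f" by auto
    then show "A \<in> Ub4" using upp_U4[of 0 d e f] by (simp add: U4_def Ub4_def upp_def)
  qed
  ultimately show ?thesis by simp
qed

section \<open>The Borel subgroup, root subgroups and Levi subgroups\<close>

lemma tor_mult: "tor a b ** A = mat4 (a * A$1$1) (a * A$1$2) (a * A$1$3) (a * A$1$4)
   (b * A$2$1) (b * A$2$2) (b * A$2$3) (b * A$2$4) (A$3$1 / b) (A$3$2 / b) (A$3$3 / b) (A$3$4 / b)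
   (A$4$1 / a) (A$4$2 / a) (A$4$3 / a) (A$4$4 / a)"
  by (simp add: mat4_eq_iff mult4 tor_def)

lemma B4_diag: "A \<in> B4 \<Longrightarrow> A$1$1 * A$4$4 = 1 \<and> A$2$2 * A$3$3 = 1 \<and> A$1$1 \<noteq> 0 \<and> A$2$2 \<noteq> 0 \<and> A$3$3 \<noteq> 0 \<and> A$4$4 \<noteq> 0"
  by (auto simp: B4_def Sp4_cols)

lemma B4_decomp:
  assumes "A \<in> B4" shows "tor (A$1$1) (A$2$2) \<in> T4" "tor (1 / A$1$1) (1 / A$2$2) ** A \<in> U4"
    "A = tor (A$1$1) (A$2$2) ** (tor (1 / A$1$1) (1 / A$2$2) ** A)"
proof -
  note d = B4_diag[OF assms]
  show "tor (A$1$1) (A$2$2) \<in> T4" using d by (intro tor_T4) auto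
  have "tor (1 / A$1$1) (1 / A$2$2) \<in> Sp4" using tor_T4[of "1 / A$1$1" "1 / A$2$2"] d by (simp add: T4_def)
  then have "tor (1 / A$1$1) (1 / A$2$2) ** A \<in> Sp4" using assms by (intro Sp4_mult) (auto simp: B4_def)
  then show "tor (1 / A$1$1) (1 / A$2$2) ** A \<in> U4"
    using d assms by (simp add: U4_def B4_def tor_mult mult.commute)
  show "A = tor (A$1$1) (A$2$2) ** (tor (1 / A$1$1) (1 / A$2$2) ** A)"
    using d by (simp add: tor_mult mat4_eq_iff)
qed

lemma connected_B4: "connectedin zariski B4"
proof -
  have "connectedin zariski {x ** y | x y. x \<in> T4 \<and> y \<in> U4}"
    by (intro connectedin_zariski_product connected_T4 connected_U4) (simp add: U4_def Sp4_one mat_nth)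
  moreover have "{x ** y | x y. x \<in> T4 \<and> y \<in> U4} = B4"
  proof (intro equalityI subsetI)
    fix A assume "A \<in> B4" then show "A \<in> {x ** y | x y. x \<in> T4 \<and> y \<in> U4}"
      using B4_decomp[of A] by blast
  next
    fix A assume "A \<in> {x ** y | x y. x \<in> T4 \<and> y \<in> U4}"
    then obtain x y where A: "A = x ** y" "x \<in> T4" "y \<in> U4" by blast
    have "x \<in> B4" "y \<in> B4" using A(2,3) by (auto simp: B4_def T4_def U4_def)
    then show "A \<in> B4" using group4_standard(2) A(1) unfolding group4_def by blast
  qed
  ultimately show ?thesis by simp
qed

text \<open>\<open>xa\<close> and \<open>xb\<close> are the root subgroups of the short and the long
  simple root of the symplectic group, \<open>ya\<close> and \<open>yb\<close> those of their
  negatives.\<close>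

definition ya :: "complex \<Rightarrow> complex^4^4" where "ya s = low s 0 0 0"
definition yb :: "complex \<Rightarrow> complex^4^4" where "yb s = low 0 s 0 0"
definition xa :: "complex \<Rightarrow> complex^4^4" where "xa s = upp s 0 0 0"
definition xb :: "complex \<Rightarrow> complex^4^4" where "xb s = upp 0 s 0 0"

lemma connected_one_param:
  "connectedin zariski (range ya)" "connectedin zariski (range yb)"
  "connectedin zariski (range xa)" "connectedin zariski (range xb)"
  unfolding ya_def yb_def xa_def xb_def low_def upp_def
  by (intro connectedin_mat4_image continuous_intros convex_connected[OF convex_UNIV])+

lemma one_param_at_0: "ya 0 = mat 1" "yb 0 = mat 1" "xa 0 = mat 1" "xb 0 = mat 1"
  by (simp_all add: ya_def yb_def xa_def xb_def low_def upp_def mat4_eq_iff mat_nth)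

lemma one_param_in: "xa s \<in> Lb4" "ya s \<in> Lb4" "xb s \<in> La4" "yb s \<in> La4" "xa s \<in> B4" "xb s \<in> B4"
  "xa s \<in> Sp4" "ya s \<in> Sp4" "xb s \<in> Sp4" "yb s \<in> Sp4"
  by (simp_all add: xa_def ya_def xb_def yb_def Lb4_def La4_def B4_def Sp4_cols low_def upp_def)

text \<open>These turn out to be Borel subgroups of the Levi subgroups \<open>La4\<close> and
  \<open>Lb4\<close>.\<close>

definition "Ka4 = B4 \<inter> La4"
definition "Kb4 = B4 \<inter> Lb4"

text \<open>Gauss elimination after a preliminary upper unipotent factor: \<open>L = X Y (T X)\<close> for the one-parameter
  groups \<open>X\<close>, \<open>Y\<close> of the root and its opposite.\<close>

lemma connected_La4_Ka4: "connectedin zariski La4" "connectedin zariski Ka4"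
proof -
  let ?K = "{x ** y | x y. x \<in> T4 \<and> y \<in> range xb}"
  let ?X = "{x ** y | x y. x \<in> range xb \<and> y \<in> {x ** y | x y. x \<in> range yb \<and> y \<in> ?K}}"
  have one: "mat 1 \<in> range xb" "mat 1 \<in> range yb" "mat 1 \<in> T4"
    using one_param_at_0 group4_standard(5) by (auto simp: group4_def intro: range_eqI[of _ _ 0])
  have oneK: "mat 1 \<in> ?K" using one by (metis (mono_tags, lifting) matrix_mul_lid mem_Collect_eq)
  have oneX: "mat 1 \<in> {x ** y | x y. x \<in> range yb \<and> y \<in> ?K}"
    using oneK one by (metis (mono_tags, lifting) matrix_mul_lid mem_Collect_eq)
  have cK: "connectedin zariski ?K"
    by (intro connectedin_zariski_product connected_T4 connected_one_param one)
  have cX: "connectedin zariski ?X"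
    by (intro connectedin_zariski_product connected_one_param cK oneK oneX)
  have KLa: "T4 \<subseteq> La4" by (auto simp: T4_def La4_def)
  have mLa: "A ** B \<in> La4" if "A \<in> La4" "B \<in> La4" for A B
    using that group4_standard(6) by (auto simp: group4_def)
  have Kdec: "A = tor (A$1$1) (A$2$2) ** xb (A$2$3 / A$2$2) \<and> tor (A$1$1) (A$2$2) \<in> T4" if "A \<in> Ka4" for A
  proof -
    have A: "A \<in> B4" "A \<in> La4" using that by (auto simp: Ka4_def)
    note d = B4_diag[OF A(1)]
    have "A$3$3 = 1 / A$2$2" "A$4$4 = 1 / A$1$1" using d by (auto simp: divide_simps mult.commute)
    then show ?thesis using d A B4_decomp(1)[OF A(1)]
      by (simp add: mat4_eq_iff tor_mult xb_def upp_def B4_def La4_def)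
  qed
  have K: "?K = Ka4"
  proof (intro equalityI subsetI)
    fix A assume "A \<in> Ka4" then show "A \<in> ?K" using Kdec[of A] by blast
  next
    fix A assume "A \<in> ?K"
    then obtain x s where A: "A = x ** xb s" "x \<in> T4" by blast
    have "x \<in> B4" using A by (auto simp: T4_def B4_def)
    then have "A \<in> B4" using A group4_standard(2) one_param_in by (auto simp: group4_def)
    moreover have "A \<in> La4" using A KLa mLa one_param_in by auto
    ultimately show "A \<in> Ka4" by (simp add: Ka4_def)
  qed
  then show "connectedin zariski Ka4" using cK by simp
  have "?X = La4"
  proof (intro equalityI subsetI)
    fix A assume A: "A \<in> La4"
    obtain s where s: "A$2$2 + s * A$3$2 \<noteq> 0"
    proof (cases "A$2$2 = 0")
      case True
      then have "A$3$2 \<noteq> 0" using A by (auto simp: La4_def Sp4_cols)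
      then show ?thesis using that[of 1] True by simp
    qed (use that[of 0] in simp)
    let ?A1 = "xb s ** A"
    have A1: "?A1 \<in> La4" using mLa A one_param_in by blast
    have e: "?A1$2$2 = A$2$2 + s * A$3$2" by (simp add: mult4 xb_def upp_def)
    let ?t = "?A1$3$2 / ?A1$2$2"
    let ?A2 = "yb (- ?t) ** ?A1"
    have A2: "?A2 \<in> La4" using mLa A1 one_param_in by blast
    have "?A2$3$2 = 0" using s e by (simp add: mult4 yb_def low_def)
    then have "?A2 \<in> Ka4" using A2 by (auto simp: Ka4_def La4_def B4_def)
    then have K2: "?A2 \<in> ?K" using K by blast
    have "yb ?t ** (yb (- ?t) ** ?A1) = ?A1"
      by (simp add: mat4_eq_iff mult4 yb_def low_def)
    moreover have "xb (-s) ** (xb s ** A) = A"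
      by (simp add: mat4_eq_iff mult4 xb_def upp_def)
    ultimately have "A = xb (-s) ** (yb ?t ** ?A2)" by simp
    then show "A \<in> ?X" using K2 by blast
  next
    fix A assume "A \<in> ?X"
    then obtain s t k where "A = xb s ** (yb t ** k)" "k \<in> ?K" by blast
    then show "A \<in> La4" using K mLa one_param_in by (auto simp: Ka4_def)
  qed
  then show "connectedin zariski La4" using cX by simp
qed

lemma connected_Lb4_Kb4: "connectedin zariski Lb4" "connectedin zariski Kb4"
proof -
  let ?K = "{x ** y | x y. x \<in> T4 \<and> y \<in> range xa}"
  let ?X = "{x ** y | x y. x \<in> range xa \<and> y \<in> {x ** y | x y. x \<in> range ya \<and> y \<in> ?K}}"
  have one: "mat 1 \<in> range xa" "mat 1 \<in> range ya" "mat 1 \<in> T4"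
    using one_param_at_0 group4_standard(5) by (auto simp: group4_def intro: range_eqI[of _ _ 0])
  have oneK: "mat 1 \<in> ?K" using one by (metis (mono_tags, lifting) matrix_mul_lid mem_Collect_eq)
  have oneX: "mat 1 \<in> {x ** y | x y. x \<in> range ya \<and> y \<in> ?K}"
    using oneK one by (metis (mono_tags, lifting) matrix_mul_lid mem_Collect_eq)
  have cK: "connectedin zariski ?K"
    by (intro connectedin_zariski_product connected_T4 connected_one_param one)
  have cX: "connectedin zariski ?X"
    by (intro connectedin_zariski_product connected_one_param cK oneK oneX)
  have KLb: "T4 \<subseteq> Lb4" by (auto simp: T4_def Lb4_def)
  have mLb: "A ** B \<in> Lb4" if "A \<in> Lb4" "B \<in> Lb4" for A B
    using that group4_standard(7) by (auto simp: group4_def)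
  have Kdec: "A = tor (A$1$1) (A$2$2) ** xa (A$1$2 / A$1$1) \<and> tor (A$1$1) (A$2$2) \<in> T4" if "A \<in> Kb4" for A
  proof -
    have A: "A \<in> B4" "A \<in> Lb4" using that by (auto simp: Kb4_def)
    note d = B4_diag[OF A(1)]
    have "A$3$3 = 1 / A$2$2" "A$4$4 = 1 / A$1$1" using d by (auto simp: divide_simps mult.commute)
    moreover have "A$1$2 * A$4$4 + A$2$2 * A$3$4 = 0" using A by (simp add: B4_def Lb4_def Sp4_cols)
    then have "A$3$4 = - (A$1$2 * A$4$4) / A$2$2" using d by (simp add: divide_simps add_eq_0_iff mult.commute)
    ultimately show ?thesis using d A B4_decomp(1)[OF A(1)]
      by (simp add: mat4_eq_iff tor_mult xa_def upp_def B4_def Lb4_def)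
  qed
  have K: "?K = Kb4"
  proof (intro equalityI subsetI)
    fix A assume "A \<in> Kb4" then show "A \<in> ?K" using Kdec[of A] by blast
  next
    fix A assume "A \<in> ?K"
    then obtain x s where A: "A = x ** xa s" "x \<in> T4" by blast
    have "x \<in> B4" using A by (auto simp: T4_def B4_def)
    then have "A \<in> B4" using A group4_standard(2) one_param_in by (auto simp: group4_def)
    moreover have "A \<in> Lb4" using A KLb mLb one_param_in by auto
    ultimately show "A \<in> Kb4" by (simp add: Kb4_def)
  qed
  then show "connectedin zariski Kb4" using cK by simp
  have "?X = Lb4"
  proof (intro equalityI subsetI)
    fix A assume A: "A \<in> Lb4"
    obtain s where s: "A$1$1 + s * A$2$1 \<noteq> 0"
    proof (cases "A$1$1 = 0")
      case True
      then have "A$2$1 \<noteq> 0" using A by (auto simp: Lb4_def Sp4_cols)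
      then show ?thesis using that[of 1] True by simp
    qed (use that[of 0] in simp)
    let ?A1 = "xa s ** A"
    have A1: "?A1 \<in> Lb4" using mLb A one_param_in by blast
    have e: "?A1$1$1 = A$1$1 + s * A$2$1" by (simp add: mult4 xa_def upp_def)
    let ?t = "?A1$2$1 / ?A1$1$1"
    let ?A2 = "ya (- ?t) ** ?A1"
    have A2: "?A2 \<in> Lb4" using mLb A1 one_param_in by blast
    have "?A2$2$1 = 0" using s e by (simp add: mult4 ya_def low_def)
    then have "?A2 \<in> Kb4" using A2 unfolding Kb4_def B4_eq Lb4_def by auto
    then have K2: "?A2 \<in> ?K" using K by blast
    have "ya ?t ** (ya (- ?t) ** ?A1) = ?A1"
      by (simp add: mat4_eq_iff mult4 ya_def low_def)
    moreover have "xa (-s) ** (xa s ** A) = A"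
      by (simp add: mat4_eq_iff mult4 xa_def upp_def)
    ultimately have "A = xa (-s) ** (ya ?t ** ?A2)" by simp
    then show "A \<in> ?X" using K2 by blast
  next
    fix A assume "A \<in> ?X"
    then obtain s t k where "A = xa s ** (ya t ** k)" "k \<in> ?K" by blast
    then show "A \<in> Lb4" using K mLb one_param_in by (auto simp: Kb4_def)
  qed
  then show "connectedin zariski Lb4" using cX by simp
qed

section \<open>Transport along the embedding\<close>

lemma group4_subgroup: "group4 H \<Longrightarrow> subgroup H GL"
  by (rule GL.subgroupI) (auto simp: group4_def inv_GL_adj subset_iff Sp4_invertible)

definition normal_unipotent :: "(complex^4^4) set \<Rightarrow> (complex^4^4) set \<Rightarrow> bool" where
  "normal_unipotent P N \<longleftrightarrow> group4 N \<and> N \<subseteq> P \<and> (\<forall>x\<in>P. \<forall>h\<in>N. x ** h ** adj x \<in> N) \<and> (\<forall>A\<in>N. unipotent A)"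

context sp4_rep
begin

definition rhoM :: "complex^'n^'n \<Rightarrow> complex^4^4" where
  "rhoM X = (\<chi> i j. rho i j X)"

lemma rhoM_Psi [simp]: "rhoM (Psi A) = A"
  by (simp add: rhoM_def rho_Psi vec_eq_iff)

lemma Psi_inj [simp]: "Psi A = Psi B \<longleftrightarrow> A = B"
  by (metis rhoM_Psi)

lemma Psi_image_mem [simp]: "Psi A \<in> Psi ` H \<longleftrightarrow> A \<in> H"
  by auto

lemma rhoM_image [simp]: "rhoM ` Psi ` H = H"
  by (simp add: image_image)

lemma rhoM_poly: "(\<lambda>X. rhoM X $ i $ j) \<in> poly_fun"
  by (simp add: rhoM_def rho_poly)

lemma Psi_adj: "A \<in> Sp4 \<Longrightarrow> Psi A ** Psi (adj A) = mat 1" "A \<in> Sp4 \<Longrightarrow> Psi (adj A) ** Psi A = mat 1"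
  by (simp_all add: Psi_mult[symmetric] adj_left adj_right Psi_one)

lemma inv_Psi: "A \<in> Sp4 \<Longrightarrow> inv\<^bsub>GL\<^esub> (Psi A) = Psi (adj A)"
  by (intro inv_GL_unique Psi_adj)

lemma Psi_invertible: "A \<in> Sp4 \<Longrightarrow> invertible (Psi A)"
  using Psi_adj by (auto simp: invertible_def)

lemma subgroup_Psi: "H \<subseteq> Sp4 \<Longrightarrow> subgroup (Psi ` H) GL \<longleftrightarrow> group4 H"
proof
  assume H: "H \<subseteq> Sp4" "subgroup (Psi ` H) GL"
  have "Psi (mat 1) \<in> Psi ` H" using subgroup.one_closed[OF H(2)] by (simp add: Psi_one)
  moreover have "Psi (A ** B) \<in> Psi ` H" if "A \<in> H" "B \<in> H" for A B
    using subgroup.m_closed[OF H(2), of "Psi A" "Psi B"] that by (simp add: Psi_mult)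
  moreover have "Psi (adj A) \<in> Psi ` H" if "A \<in> H" for A
    using subgroup.m_inv_closed[OF H(2), of "Psi A"] that H(1) by (auto simp: inv_Psi)
  ultimately show "group4 H" using H(1) by (auto simp: group4_def)
next
  assume "H \<subseteq> Sp4" "group4 H"
  then show "subgroup (Psi ` H) GL"
    by (intro GL.subgroupI)
      (auto simp: group4_def subset_iff Psi_invertible inv_Psi Psi_mult[symmetric])
qed

lemma closedin_vimage_Psi: "closedin zariski C \<Longrightarrow> closedin zariski {A. Psi A \<in> C}"
  using continuous_map_zariski_poly[OF Psi_poly] by (auto simp: continuous_map_closedin)

lemma closedin_vimage_rhoM: "closedin zariski C \<Longrightarrow> closedin zariski {A. rhoM A \<in> C}"
  using continuous_map_zariski_poly[OF rhoM_poly] by (auto simp: continuous_map_closedin)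

lemma closedin_Psi_image:
  assumes "closedin zariski H" shows "closedin zariski (Psi ` H)"
proof -
  have "closedin zariski {X. Psi (rhoM X) = X}"
  proof -
    have "{X. Psi (rhoM X) = X} = {X. \<forall>f\<in>range (\<lambda>(k, l) X. Psi (rhoM X) $ k $ l - X $ k $ l). f X = 0}"
      by (auto simp: vec_eq_iff)
    then show ?thesis
      by (rule closedin_zariskiI[rotated])
        (auto intro!: poly_fun_diff poly_fun.entry poly_fun_comp[OF Psi_poly rhoM_poly])
  qed
  moreover have "Psi ` H = {X. Psi (rhoM X) = X \<and> rhoM X \<in> H}" by force
  ultimately show ?thesis using closedin_zariski_conj closedin_vimage_rhoM[OF assms] by simp
qed

lemma closedin_GL_Psi:
  assumes "H \<subseteq> Sp4"
  shows "closedin (subtopology zariski (carrier GL)) (Psi ` H) \<longleftrightarrow> closedin zariski H"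
proof
  assume "closedin (subtopology zariski (carrier GL)) (Psi ` H)"
  then obtain C where C: "closedin zariski C" "Psi ` H = C \<inter> carrier GL"
    by (auto simp: closedin_subtopology)
  have "H = {A. A \<in> Sp4 \<and> Psi A \<in> C}"
    using assms C(2) Psi_invertible by (auto simp: subset_iff) (metis IntI Psi_image_mem GL_simps(1) mem_Collect_eq)
  then show "closedin zariski H"
    using closedin_zariski_conj[OF _ closedin_vimage_Psi[OF C(1)]] closedin_Sp4 by simp
next
  assume "closedin zariski H"
  moreover have "Psi ` H \<subseteq> carrier GL" using assms Psi_invertible by auto
  ultimately show "closedin (subtopology zariski (carrier GL)) (Psi ` H)"
    using closedin_Psi_image by (auto simp: closedin_subtopology)
qed

lemma connectedin_Psi: "connectedin zariski (Psi ` H) \<longleftrightarrow> connectedin zariski H"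
  using connectedin_zariski_image_poly[OF _ Psi_poly, of H]
    connectedin_zariski_image_poly[OF _ rhoM_poly, of "Psi ` H"] by auto

lemma linear_algebraic_Psi: "H \<subseteq> Sp4 \<Longrightarrow> linear_algebraic_group (Psi ` H) \<longleftrightarrow> group4 H \<and> closedin zariski H"
  unfolding linear_algebraic_group_def using subgroup_Psi closedin_GL_Psi by blast

lemma connected_algebraic_Psi:
  "H \<subseteq> Sp4 \<Longrightarrow> connected_algebraic_group (Psi ` H) \<longleftrightarrow> group4 H \<and> closedin zariski H \<and> connectedin zariski H"
  by (simp add: connected_algebraic_group_def linear_algebraic_Psi connectedin_Psi)

lemma solvable_Psi:
  assumes "group4 H"
  shows "solvable (sub_group (Psi ` H)) \<longleftrightarrow> solvable (sub_group H)"
proof -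
  have H: "subgroup H GL" "subgroup (Psi ` H) GL" "H \<subseteq> Sp4"
    using assms group4_subgroup subgroup_Psi by (auto simp: group4_def)
  interpret group_hom "sub_group H" "sub_group (Psi ` H)" Psi
    unfolding group_hom_def group_hom_axioms_def
    using subgroup.subgroup_is_group[OF H(1) group_GL] subgroup.subgroup_is_group[OF H(2) group_GL]
    by (auto simp: hom_def Psi_mult)
  show ?thesis
    using surj_hom_imp_solvable inj_hom_imp_solvable by (auto simp: inj_on_def)
qed

lemma unipotent_Psi: "unipotent (Psi A) \<longleftrightarrow> unipotent A"
proof -
  have Psi0: "Psi 0 = 0" using Psi_diff[of 0 0] by simp
  have "(((**) (Psi A - mat 1)) ^^ k) (mat 1) = Psi ((((**) (A - mat 1)) ^^ k) (mat 1))" for k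
    by (induction k) (simp_all add: Psi_one Psi_mult Psi_diff)
  then show ?thesis unfolding unipotent_def by (metis Psi0 Psi_inj)
qed

lemma normal_Psi:
  assumes "group4 P"
  shows "N \<lhd> sub_group (Psi ` P) \<longleftrightarrow>
    (\<exists>M. N = Psi ` M \<and> group4 M \<and> M \<subseteq> P \<and> (\<forall>x\<in>P. \<forall>h\<in>M. x ** h ** adj x \<in> M))"
proof -
  have P: "subgroup (Psi ` P) GL" "P \<subseteq> Sp4" using assms subgroup_Psi by (auto simp: group4_def)
  interpret S: group "sub_group (Psi ` P)" by (rule subgroup.subgroup_is_group[OF P(1) group_GL])
  have inv: "inv\<^bsub>sub_group (Psi ` P)\<^esub> (Psi x) = Psi (adj x)" if "x \<in> P" for x
    using GL.m_inv_consistent[OF P(1), of "Psi x"] that P(2) by (auto simp: inv_Psi)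
  have sub: "subgroup N (sub_group (Psi ` P)) \<longleftrightarrow> (\<exists>M. N = Psi ` M \<and> group4 M \<and> M \<subseteq> P)"
  proof
    assume N: "subgroup N (sub_group (Psi ` P))"
    from subgroup.subset[OF N] have "N \<subseteq> Psi ` P" by simp
    then obtain M where M: "M \<subseteq> P" "N = Psi ` M" by (metis subset_imageE)
    have "subgroup N GL" using GL.incl_subgroup[OF P(1) N] .
    then show "\<exists>M. N = Psi ` M \<and> group4 M \<and> M \<subseteq> P" using M P(2) subgroup_Psi by auto
  next
    assume "\<exists>M. N = Psi ` M \<and> group4 M \<and> M \<subseteq> P"
    then show "subgroup N (sub_group (Psi ` P))"
      using P subgroup_Psi GL.subgroup_incl[OF _ P(1)] by (metis group4_def image_mono)
  qed
  show ?thesis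
    unfolding S.normal_inv_iff sub
    by (auto simp: inv Psi_mult[symmetric]) 
qed

lemma unipotent_radical_Psi:
  assumes "group4 P"
  shows "unipotent_radical (Psi ` P) =
    Psi ` \<Union>{N. normal_unipotent P N \<and> closedin zariski N \<and> connectedin zariski N}"
proof -
  have "{U. connected_algebraic_group U \<and> U \<lhd> sub_group (Psi ` P) \<and> (\<forall>A\<in>U. unipotent A)} =
    (\<lambda>N. Psi ` N) ` {N. normal_unipotent P N \<and> closedin zariski N \<and> connectedin zariski N}" (is "?L = ?R")
  proof (intro equalityI subsetI)
    fix U assume "U \<in> ?L"
    then obtain M where M: "U = Psi ` M" "group4 M" "M \<subseteq> P" "\<forall>x\<in>P. \<forall>h\<in>M. x ** h ** adj x \<in> M"
      "connected_algebraic_group U" "\<forall>A\<in>U. unipotent A"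
      using normal_Psi[OF assms] by auto
    have "M \<subseteq> Sp4" using M(2) by (simp add: group4_def)
    then show "U \<in> ?R" using M by (auto simp: normal_unipotent_def connected_algebraic_Psi unipotent_Psi)
  next
    fix U assume "U \<in> ?R"
    then obtain M where M: "U = Psi ` M" "normal_unipotent P M" "closedin zariski M" "connectedin zariski M"
      by auto
    then have g: "group4 M" "M \<subseteq> Sp4" by (auto simp: normal_unipotent_def group4_def)
    have "U \<lhd> sub_group (Psi ` P)"
      unfolding normal_Psi[OF assms] using M by (intro exI[of _ M]) (auto simp: normal_unipotent_def)
    then show "U \<in> ?L" using M g by (auto simp: normal_unipotent_def connected_algebraic_Psi unipotent_Psi)
  qed
  then show ?thesis unfolding unipotent_radical_def by (simp add: image_Union)
qed

end

text \<open>Conjugates of the standard subgroups by \<open>g\<close> are the images of the standard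
  subgroups under another instance of the locale, so all statements about the latter apply to
  them.\<close>

lemma sp4_rep_conj:
  assumes "sp4_rep Psi rho" "g \<in> Sp4"
  shows "sp4_rep (\<lambda>A. Psi (g ** A ** adj g)) (\<lambda>i j X. (adj g ** (\<chi> k l. rho k l X) ** g) $ i $ j)"
proof -
  interpret sp4_rep Psi rho by fact
  show ?thesis
  proof
    fix A B :: "complex^4^4" and i j k l
    have "g ** (A ** B) ** adj g = g ** A ** adj g ** (g ** B ** adj g)"
      by (simp add: matrix_mul_assoc[symmetric] adj_cancel assms(2))
    then show "Psi (g ** (A ** B) ** adj g) = Psi (g ** A ** adj g) ** Psi (g ** B ** adj g)"
      unfolding Psi_mult[of "g ** A ** adj g", symmetric] by (rule arg_cong)
    show "Psi (g ** mat 1 ** adj g) = mat 1" using adj_right[OF assms(2)] by (simp add: Psi_one)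
    have "g ** (A - B) ** adj g = g ** A ** adj g - g ** B ** adj g"
      by (simp add: vec_eq_iff matrix_mult_entry right_diff_distrib left_diff_distrib sum_subtractf)
    then show "Psi (g ** (A - B) ** adj g) = Psi (g ** A ** adj g) - Psi (g ** B ** adj g)"
      unfolding Psi_diff[symmetric] by (rule arg_cong)
    show "(\<lambda>A. Psi (g ** A ** adj g) $ k $ l) \<in> poly_fun"
      by (rule poly_fun_comp[OF Psi_poly]) (intro poly_fun_matrix_mult poly_fun.const poly_fun.entry)
    show "(\<lambda>X. (adj g ** (\<chi> k l. rho k l X) ** g) $ i $ j) \<in> poly_fun"
      by (intro poly_fun_matrix_mult poly_fun.const poly_fun.entry) (simp add: rho_poly)
    have "(\<chi> k l. rho k l (Psi (g ** A ** adj g))) = g ** A ** adj g"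
      by (simp add: rho_Psi vec_eq_iff)
    moreover have "adj g ** (g ** A ** adj g) ** g = adj g ** g ** A ** (adj g ** g)"
      by (simp only: matrix_mul_assoc)
    ultimately show "(adj g ** (\<chi> k l. rho k l (Psi (g ** A ** adj g))) ** g) $ i $ j = A $ i $ j"
      using adj_left[OF assms(2)] by simp
  qed
qed

lemma conj_Sp4: "g \<in> Sp4 \<Longrightarrow> (\<lambda>A. g ** A ** adj g) ` Sp4 = Sp4"
proof (intro equalityI subsetI)
  fix A assume g: "g \<in> Sp4" and A: "A \<in> Sp4"
  have "g ** (adj g ** A ** g) ** adj g = (g ** adj g) ** A ** (g ** adj g)" by (simp only: matrix_mul_assoc)
  then have "A = g ** (adj g ** A ** g) ** adj g" using adj_right[OF g] by simp
  moreover have "adj g ** A ** g \<in> Sp4" using g A by (intro Sp4_mult Sp4_adj_closed)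
  ultimately show "A \<in> (\<lambda>A. g ** A ** adj g) ` Sp4" by blast
qed (auto intro!: Sp4_mult Sp4_adj_closed)

section \<open>Unipotent radicals\<close>

lemma unipotent_eigenvalue:
  assumes "unipotent A" "A *v v = c *s v" "v \<noteq> 0" shows "c = 1"
proof -
  obtain k where k: "(((**) (A - mat 1)) ^^ k) (mat 1) = 0" using assms(1) unfolding unipotent_def by blast
  have h: "(A - mat 1) *v v = (c - 1) *s v"
    using assms(2) by (simp add: matrix_vector_mult_diff_rdistrib vector_ssub_ldistrib vector_sub_rdistrib)
  then have "((((**) (A - mat 1)) ^^ k) (mat 1)) *v v = (c - 1) ^ k *s v" for k
  proof (induction k)
    case (Suc k)
    have "((((**) (A - mat 1)) ^^ Suc k) (mat 1)) *v v = (A - mat 1) *v ((c - 1) ^ k *s v)"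
      using Suc by (simp add: matrix_vector_mul_assoc[symmetric])
    also have "\<dots> = (c - 1) ^ k *s ((A - mat 1) *v v)" by (simp only: vector_scalar_commute)
    finally show ?case using h by (simp only: vector_smult_assoc power_Suc2)
  qed simp
  from this[of k] have "(c - 1) ^ k *s v = 0" unfolding k by simp
  then show ?thesis using assms(3) by (simp add: vector_mul_eq_0)
qed

lemma U4_unipotent: "A \<in> U4 \<Longrightarrow> unipotent A"
  unfolding unipotent_def
  by (rule exI[of _ 4]) (simp add: numeral_eq_Suc mat4_eq_iff mult4 mat_nth U4_def)

lemma quadratic_roots_one:
  fixes t D :: complex
  assumes "\<And>z. z * z - t * z + D = 0 \<Longrightarrow> z = 1" shows "t = 2 \<and> D = 1"
proof -
  define s where "s = csqrt (t * t - 4 * D)"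
  have s: "s * s = t * t - 4 * D" unfolding s_def by (metis power2_csqrt power2_eq_square)
  have "((t + s) / 2) * ((t + s) / 2) - t * ((t + s) / 2) + D = (s * s - t * t + 4 * D) / 4"
    by (simp add: field_simps)
  then have r1: "(t + s) / 2 = 1" using s by (intro assms) simp
  have "((t - s) / 2) * ((t - s) / 2) - t * ((t - s) / 2) + D = (s * s - t * t + 4 * D) / 4"
    by (simp add: field_simps)
  then have r2: "(t - s) / 2 = 1" using s by (intro assms) simp
  have "t + s = 2" "t - s = 2" using r1 r2 by simp_all
  then have "((t + s) + (t - s)) / 2 = 2" "((t + s) - (t - s)) / 2 = 0" by simp_all
  then have t: "t = 2" "s = 0" by simp_all
  then show ?thesis using s by simp
qed

lemma eigenvector_2x2:
  fixes a b c d z :: complex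
  assumes "z * z - (a + d) * z + (a * d - b * c) = 0"
  obtains x y where "x \<noteq> 0 \<or> y \<noteq> 0" "a * x + b * y = z * x" "c * x + d * y = z * y"
proof (cases "b = 0 \<and> z = a")
  case True
  show ?thesis
  proof (cases "c = 0 \<and> z = d")
    case True then show ?thesis using that[of 1 0] \<open>b = 0 \<and> z = a\<close> by simp
  next
    case False then show ?thesis using that[of "z - d" c] \<open>b = 0 \<and> z = a\<close> by (auto simp: algebra_simps)
  qed
next
  case False
  have "c * b + d * (z - a) = z * (z - a)" using assms by (simp add: algebra_simps)
  then show ?thesis using that[of b "z - a"] False by (auto simp: algebra_simps)
qed

definition vec4 :: "complex \<Rightarrow> complex \<Rightarrow> complex \<Rightarrow> complex \<Rightarrow> complex^4" where
  "vec4 a b c d = (\<chi> i. if i = 1 then a else if i = 2 then b else if i = 3 then c else d)"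

lemma vec4_nth [simp]: "vec4 a b c d $ 1 = a" "vec4 a b c d $ 2 = b" "vec4 a b c d $ 3 = c" "vec4 a b c d $ 4 = d"
  by (simp_all add: vec4_def)

lemma vec4_eq_iff: "v = w \<longleftrightarrow> v $ 1 = w $ 1 \<and> v $ 2 = w $ 2 \<and> v $ 3 = w $ 3 \<and> v $ 4 = w $ (4::4)" for v w :: "'a^4"
  by (auto simp: vec_eq_iff forall_4)

lemma mult_vec4: "((A :: complex^4^4) *v v) $ i = A $ i $ 1 * v $ 1 + A $ i $ 2 * v $ 2 + A $ i $ 3 * v $ 3 + A $ i $ 4 * v $ 4"
  by (simp add: matrix_vector_mult_def sum_4)

lemma unipotent_col1: fixes A :: "complex^4^4" shows "unipotent A \<Longrightarrow> A$2$1 = 0 \<Longrightarrow> A$3$1 = 0 \<Longrightarrow> A$4$1 = 0 \<Longrightarrow> A$1$1 = 1"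
  by (rule unipotent_eigenvalue[of A "vec4 1 0 0 0"]) (auto simp: vec4_eq_iff mult_vec4)

text \<open>The middle block acts on the quotient of the orthogonal hyperplane by the line. An
  eigenvector of the block lifts to one of \<open>A\<close>, so the eigenvalues of the block are 1
  too.\<close>

lemma unipotent_Pa4:
  assumes "unipotent A" "A \<in> Pa4"
  shows "A$1$1 = 1" "A$2$2 + A$3$3 = 2" "A$2$2 * A$3$3 - A$2$3 * A$3$2 = 1"
proof -
  show a1: "A$1$1 = 1" using assms unipotent_col1 by (auto simp: Pa4_def)
  have "A$2$2 + A$3$3 = 2 \<and> A$2$2 * A$3$3 - A$2$3 * A$3$2 = 1"
  proof (rule quadratic_roots_one)
    fix z assume "z * z - (A$2$2 + A$3$3) * z + (A$2$2 * A$3$3 - A$2$3 * A$3$2) = 0"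
    from eigenvector_2x2[OF this]
    obtain x y where xy: "x \<noteq> 0 \<or> y \<noteq> 0" "A$2$2 * x + A$2$3 * y = z * x" "A$3$2 * x + A$3$3 * y = z * y" .
    show "z = 1"
    proof (rule ccontr)
      assume "z \<noteq> 1"
      have "z = 1"
      proof (rule unipotent_eigenvalue[OF assms(1)])
        \<comment> \<open>The first coordinate solves the first row of the eigenvector equation;
          this needs division by z - 1, hence the proof by contradiction.\<close>
        let ?v = "vec4 ((A$1$2 * x + A$1$3 * y) / (z - 1)) x y 0"
        show "?v \<noteq> 0" using xy(1) by (auto simp: vec4_eq_iff)
        show "A *v ?v = z *s ?v"
          using xy(2,3) a1 \<open>z \<noteq> 1\<close> assms(2) by (simp add: vec4_eq_iff mult_vec4 Pa4_def field_simps)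
      qed
      then show False using \<open>z \<noteq> 1\<close> by simp
    qed
  qed
  then show "A$2$2 + A$3$3 = 2" "A$2$2 * A$3$3 - A$2$3 * A$3$2 = 1" by auto
qed

lemma unipotent_Pb4:
  assumes "unipotent A" "A \<in> Pb4"
  shows "A$1$1 + A$2$2 = 2" "A$1$1 * A$2$2 - A$1$2 * A$2$1 = 1"
proof -
  have "A$1$1 + A$2$2 = 2 \<and> A$1$1 * A$2$2 - A$1$2 * A$2$1 = 1"
  proof (rule quadratic_roots_one)
    fix z assume "z * z - (A$1$1 + A$2$2) * z + (A$1$1 * A$2$2 - A$1$2 * A$2$1) = 0"
    from eigenvector_2x2[OF this]
    obtain x y where xy: "x \<noteq> 0 \<or> y \<noteq> 0" "A$1$1 * x + A$1$2 * y = z * x" "A$2$1 * x + A$2$2 * y = z * y" .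
    show "z = 1"
    proof (rule unipotent_eigenvalue[OF assms(1)])
      show "vec4 x y 0 0 \<noteq> 0" using xy(1) by (auto simp: vec4_eq_iff)
      show "A *v vec4 x y 0 0 = z *s vec4 x y 0 0"
        using xy(2,3) assms(2) by (simp add: vec4_eq_iff mult_vec4 Pb4_def)
    qed
  qed
  then show "A$1$1 + A$2$2 = 2" "A$1$1 * A$2$2 - A$1$2 * A$2$1 = 1" by auto
qed

text \<open>The last two hypotheses are traces of m x m x^-1 for m = (a b; c d) and the elementary
  matrices x = (1 1; 0 1) and (1 0; 1 1). If m is unipotent these traces are 2 - c^2 and 2 - b^2, so
  a normal unipotent subgroup forces b = c = 0.\<close>

lemma conj_2x2_trivial:
  fixes a b c d :: complex
  assumes "a + d = 2" "a * d - b * c = 1"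
    "a * (a + c) + b * c + (c * (b + d - a - c) + d * (d - c)) = 2"
    "a * (a - b) + b * (a + c - b - d) + (c * b + d * (b + d)) = 2"
  shows "a = 1 \<and> b = 0 \<and> c = 0 \<and> d = 1"
proof -
  have "a * (a + c) + b * c + (c * (b + d - a - c) + d * (d - c)) = (a + d) * (a + d) - 2 * (a * d - b * c) - c * c"
    "a * (a - b) + b * (a + c - b - d) + (c * b + d * (b + d)) = (a + d) * (a + d) - 2 * (a * d - b * c) - b * b"
    by (simp_all add: algebra_simps)
  then have "c * c = 0" "b * b = 0" unfolding assms by simp_all
  then have z: "b = 0" "c = 0" by auto
  then have "a * d = 1" using assms(2) by simp
  moreover have d: "d = 2 - a" using assms(1) by (simp add: eq_diff_eq add.commute)
  ultimately have "(a - 1) * (a - 1) = 0" by (simp add: algebra_simps)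
  then show ?thesis using z d by auto
qed

text \<open>The products of an element of \<open>N\<close> with its conjugates by
  \<open>xb 1\<close> and \<open>yb 1\<close> are unipotent, which determines the middle block.
  Allowing any \<open>Q\<close> between \<open>La4\<close> and \<open>Pa4\<close> covers both the
  radical of the parabolic and the reductivity of its Levi subgroup.\<close>

lemma normal_unipotent_between_Pa4:
  assumes "normal_unipotent Q N" "La4 \<subseteq> Q" "Q \<subseteq> Pa4" shows "N \<subseteq> Ua4"
proof
  fix A assume A: "A \<in> N"
  note N = assms(1)[unfolded normal_unipotent_def group4_def]
  have AP: "A \<in> Pa4" "unipotent A" using A N assms(3) by auto
  note t = unipotent_Pa4[OF AP(2,1)]
  have g: "xb 1 \<in> Q" "yb 1 \<in> Q" using one_param_in assms(2) by auto
  have tr: "(A ** (g ** A ** adj g))$2$2 + (A ** (g ** A ** adj g))$3$3 = 2" if "g \<in> Q" for g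
  proof (rule unipotent_Pa4(2))
    have "A ** (g ** A ** adj g) \<in> N" using N A that by blast
    then show "unipotent (A ** (g ** A ** adj g))" "A ** (g ** A ** adj g) \<in> Pa4"
      using N assms(3) by blast+
  qed
  have z: "A$2$1 = 0" "A$3$1 = 0" "A$4$2 = 0" "A$4$3 = 0" "A$4$1 = 0" using AP(1) by (auto simp: Pa4_def)
  have "A$2$2 = 1 \<and> A$2$3 = 0 \<and> A$3$2 = 0 \<and> A$3$3 = 1"
  proof (rule conj_2x2_trivial[OF t(2,3)])
    show "A$2$2 * (A$2$2 + A$3$2) + A$2$3 * A$3$2 + (A$3$2 * (A$2$3 + A$3$3 - A$2$2 - A$3$2) + A$3$3 * (A$3$3 - A$3$2)) = 2"
      using tr[OF g(1)] by (simp add: mult4 xb_def upp_def z algebra_simps)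
    show "A$2$2 * (A$2$2 - A$2$3) + A$2$3 * (A$2$2 + A$3$2 - A$2$3 - A$3$3) + (A$3$2 * A$2$3 + A$3$3 * (A$2$3 + A$3$3)) = 2"
      using tr[OF g(2)] by (simp add: mult4 yb_def low_def z algebra_simps)
  qed
  moreover have "A$1$1 = 1" by (rule t(1))
  moreover have "A$4$4 = 1" using AP(1) t(1) by (auto simp: Pa4_def Sp4_cols)
  ultimately show "A \<in> Ua4" using AP(1) by (auto simp: Ua4_def Pa4_def)
qed

lemma La4_Pa4: "La4 \<subseteq> Pa4" and Lb4_Pb4: "Lb4 \<subseteq> Pb4"
  by (auto simp: subgroup4_defs)

lemma normal_unipotent_Pa4: "normal_unipotent Pa4 N \<Longrightarrow> N \<subseteq> Ua4"
  by (rule normal_unipotent_between_Pa4[OF _ La4_Pa4 order_refl])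

lemma normal_unipotent_between_Pb4:
  assumes "normal_unipotent Q N" "Lb4 \<subseteq> Q" "Q \<subseteq> Pb4" shows "N \<subseteq> Ub4"
proof
  fix A assume A: "A \<in> N"
  note N = assms(1)[unfolded normal_unipotent_def group4_def]
  have AP: "A \<in> Pb4" "unipotent A" using A N assms(3) by auto
  note t = unipotent_Pb4[OF AP(2,1)]
  have g: "xa 1 \<in> Q" "ya 1 \<in> Q" using one_param_in assms(2) by auto
  have tr: "(A ** (g ** A ** adj g))$1$1 + (A ** (g ** A ** adj g))$2$2 = 2" if "g \<in> Q" for g
  proof (rule unipotent_Pb4(1))
    have "A ** (g ** A ** adj g) \<in> N" using N A that by blast
    then show "unipotent (A ** (g ** A ** adj g))" "A ** (g ** A ** adj g) \<in> Pb4"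
      using N assms(3) by blast+
  qed
  have z: "A$3$1 = 0" "A$3$2 = 0" "A$4$2 = 0" "A$4$1 = 0" using AP(1) by (auto simp: Pb4_def)
  have m: "A$1$1 = 1 \<and> A$1$2 = 0 \<and> A$2$1 = 0 \<and> A$2$2 = 1"
  proof (rule conj_2x2_trivial[OF t(1,2)])
    show "A$1$1 * (A$1$1 + A$2$1) + A$1$2 * A$2$1 + (A$2$1 * (A$1$2 + A$2$2 - A$1$1 - A$2$1) + A$2$2 * (A$2$2 - A$2$1)) = 2"
      using tr[OF g(1)] by (simp add: mult4 xa_def upp_def z algebra_simps)
    show "A$1$1 * (A$1$1 - A$1$2) + A$1$2 * (A$1$1 + A$2$1 - A$1$2 - A$2$2) + (A$2$1 * A$1$2 + A$2$2 * (A$1$2 + A$2$2)) = 2"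
      using tr[OF g(2)] by (simp add: mult4 ya_def low_def z algebra_simps)
  qed
  moreover have "A$4$4 = 1 \<and> A$4$3 = 0 \<and> A$3$4 = 0 \<and> A$3$3 = 1"
    using AP(1) m z by (auto simp: Pb4_def Sp4_cols)
  ultimately show "A \<in> Ub4" using AP(1) by (auto simp: Ub4_def Pb4_def)
qed

lemma normal_unipotent_Pb4: "normal_unipotent Pb4 N \<Longrightarrow> N \<subseteq> Ub4"
  by (rule normal_unipotent_between_Pb4[OF _ Lb4_Pb4 order_refl])

lemma normal_unipotent_sub_B4:
  assumes "normal_unipotent Q N" "Q \<subseteq> B4" shows "N \<subseteq> U4"
proof
  fix A assume A: "A \<in> N"
  note N = assms(1)[unfolded normal_unipotent_def group4_def]
  have "A \<in> B4" using A N assms(2) by blast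
  then have AP: "A \<in> B4" "unipotent A" "A \<in> Pb4" "A \<in> Pa4" using A N by (auto simp: B4_def Pb4_def Pa4_def)
  have "A$1$1 = 1" "A$2$2 = 1" using unipotent_Pb4[OF AP(2,3)] unipotent_Pa4[OF AP(2,4)] by auto
  then show "A \<in> U4" using B4_diag[OF AP(1)] AP(1) by (simp add: U4_def B4_def)
qed

lemma normal_unipotent_B4: "normal_unipotent B4 N \<Longrightarrow> N \<subseteq> U4"
  by (rule normal_unipotent_sub_B4) auto

section \<open>The unipotent radical of the whole group\<close>

lemma Sp4_transitive:
  assumes "v \<noteq> 0" shows "\<exists>g\<in>Sp4. g *v vec4 1 0 0 0 = v"
proof -
  have main: "\<exists>g\<in>Sp4. g *v vec4 1 0 0 0 = v" if v: "v $ 1 \<noteq> 0" for v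
  proof -
    let ?a = "v$2 / v$1" and ?b = "v$3 / v$1" and ?c = "v$4 / v$1"
    let ?g = "low ?a 0 ?b (?c - ?a * ?b) ** tor (v$1) 1"
    have "?g \<in> Sp4" using tor_T4[of "v$1" 1] v by (intro Sp4_mult low_Sp4) (auto simp: T4_def)
    moreover have "?g *v vec4 1 0 0 0 = v"
      using v by (simp add: vec4_eq_iff mult_vec4 mult4 low_def tor_def)
    ultimately show ?thesis by blast
  qed
  have "\<exists>n\<in>Sp4. (n *v v) $ 1 \<noteq> 0"
  proof -
    let ?s = "mat4 0 1 0 0  1 0 0 0  0 0 0 1  0 0 1 0"
    have S: "?s \<in> Sp4" "J4 \<in> Sp4" by (simp_all add: Sp4_cols J4_def)
    have "?s ** J4 \<in> Sp4" using S Sp4_mult by blast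
    moreover have "v$1 \<noteq> 0 \<or> v$2 \<noteq> 0 \<or> v$3 \<noteq> 0 \<or> v$4 \<noteq> 0" using assms by (auto simp: vec4_eq_iff)
    moreover have "(mat 1 *v v)$1 = v$1" "(?s *v v)$1 = v$2" "(J4 *v v)$1 = v$4" "((?s ** J4) *v v)$1 = v$3"
      by (simp_all add: mult_vec4 J4_def mult4)
    ultimately show ?thesis using S Sp4_one by metis
  qed
  then obtain n where n: "n \<in> Sp4" "(n *v v) $ 1 \<noteq> 0" by blast
  from main[OF n(2)] obtain g where g: "g \<in> Sp4" "g *v vec4 1 0 0 0 = n *v v" by blast
  have "(adj n ** g) *v vec4 1 0 0 0 = adj n *v (n *v v)" using g(2) by (simp add: matrix_vector_mul_assoc[symmetric])
  also have "\<dots> = v" using adj_left[OF n(1)] by (simp add: matrix_vector_mul_assoc)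
  finally show ?thesis using Sp4_mult[OF Sp4_adj_closed[OF n(1)] g(1)] by blast
qed

lemma mult_e1: fixes A :: "complex^4^4" shows "(A *v vec4 1 0 0 0) $ i = A $ i $ 1"
  by (simp add: mult_vec4)

lemma conj_stabilises_e1:
  assumes "g \<in> Sp4" "g *v vec4 1 0 0 0 = v" "h \<in> Sp4" "h *v v = c *s v"
  shows "adj g ** h ** g \<in> Pa4"
proof -
  have "(adj g ** h ** g) *v vec4 1 0 0 0 = adj g *v (h *v (g *v vec4 1 0 0 0))"
    by (simp add: matrix_vector_mul_assoc matrix_mul_assoc)
  also have "\<dots> = c *s (adj g *v (g *v vec4 1 0 0 0))" using assms by (simp add: vector_scalar_commute)
  also have "\<dots> = c *s vec4 1 0 0 0" using adj_left[OF assms(1)] by (simp add: matrix_vector_mul_assoc)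
  finally have "(adj g ** h ** g) $ i $ 1 = c * vec4 1 0 0 0 $ i" for i
    by (metis mult_e1 vector_smult_component)
  moreover have "adj g ** h ** g \<in> Sp4" using assms by (intro Sp4_mult Sp4_adj_closed)
  ultimately show ?thesis by (simp add: Pa4_eq)
qed

text \<open>An element of \<open>N\<close> has an eigenvector and so is conjugate into
  \<open>Pa4\<close>, then into \<open>Ua4\<close>, then \<open>Ub4\<close>, by the results for
  parabolic subgroups. The two parameters left are moved by Weyl group representatives to root
  positions excluded by \<open>Ua4\<close> and \<open>Ub4\<close>.\<close>

lemma normal_unipotent_Sp4:
  assumes "normal_unipotent Sp4 N" shows "N \<subseteq> {mat 1}"
proof
  fix A assume A: "A \<in> N"
  note N = assms[unfolded normal_unipotent_def group4_def]
  have sub: "N \<inter> P \<subseteq> U" if "group4 P" "normal_unipotent P (N \<inter> P) \<Longrightarrow> N \<inter> P \<subseteq> U" for P U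
    using that N unfolding normal_unipotent_def group4_def by (auto simp: subset_iff)
  have Na: "N \<inter> Pa4 \<subseteq> Ua4" and Nb: "N \<inter> Pb4 \<subseteq> Ub4"
    using sub[OF _ normal_unipotent_Pa4] sub[OF _ normal_unipotent_Pb4] group4_standard by auto
  have "\<exists>w\<in>UNIV. w \<noteq> 0 \<and> (\<exists>c. A *v w = c *s w)"
    by (rule eigenvector_in_invariant_subspace) (auto simp: vec.subspace_UNIV UNIV_not_singleton)
  then obtain v c where v: "v \<noteq> 0" "A *v v = c *s v" by blast
  then obtain g where g: "g \<in> Sp4" "g *v vec4 1 0 0 0 = v" using Sp4_transitive by blast
  define A1 where "A1 = adj g ** A ** g"
  have AS: "A \<in> Sp4" using A N by blast
  have "adj g ** A ** adj (adj g) \<in> N" using N A Sp4_adj_closed[OF g(1)] by blast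
  then have A1N: "A1 \<in> N" by (simp add: A1_def adj_adj)
  have "A1 \<in> Pa4" unfolding A1_def by (rule conj_stabilises_e1[OF g AS v(2)])
  then have "A1 \<in> Ua4" using A1N Na by blast
  then have "A1 \<in> Pb4" "A1 \<in> U4" by (auto simp: Ua4_def Pb4_def U4_def)
  then have "A1 \<in> Ub4" using A1N Nb by blast
  define e f where "e = A1$2$4" and "f = A1$1$4"
  have A1e: "A1 = upp 0 0 e f"
    using U4_upp[OF \<open>A1 \<in> U4\<close>] \<open>A1 \<in> Ua4\<close> \<open>A1 \<in> Ub4\<close> by (simp add: Ua4_def Ub4_def e_def f_def)
  let ?s = "mat4 0 1 0 0  1 0 0 0  0 0 0 1  0 0 1 0"
  let ?r = "mat4 1 0 0 0  0 0 1 0  0 (-1) 0 0  0 0 0 1"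
  have S: "?s \<in> Sp4" "?r \<in> Sp4" by (simp_all add: Sp4_cols)
  have c1: "?s ** A1 ** adj ?s = upp 0 f e 0"
    by (simp add: A1e mat4_eq_iff mult4 upp_def)
  have "?s ** A1 ** adj ?s \<in> N" using N A1N S by blast
  then have "upp 0 f e 0 \<in> Ua4" using Na c1 by (auto simp: Pa4_def upp_def Sp4_cols)
  then have f0: "f = 0" by (simp add: Ua4_def upp_def)
  have c2: "?r ** A1 ** adj ?r = upp e 0 0 f" if "f = 0"
    using that by (simp add: A1e mat4_eq_iff mult4 upp_def)
  have "?r ** A1 ** adj ?r \<in> N" using N A1N S by blast
  then have "upp e 0 0 f \<in> Ub4" using Nb c2[OF f0] by (auto simp: Pb4_def upp_def Sp4_cols)
  then have "e = 0" by (simp add: Ub4_def upp_def)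
  then have "A1 = mat 1" using f0 A1e by (simp add: upp_def mat4_eq_iff mat_nth)
  then have "g ** (adj g ** A ** g) ** adj g = mat 1" using adj_right[OF g(1)] by (simp add: A1_def)
  moreover have "g ** (adj g ** A ** g) ** adj g = (g ** adj g) ** A ** (g ** adj g)" by (simp only: matrix_mul_assoc)
  ultimately show "A \<in> {mat 1}" using adj_right[OF g(1)] by simp
qed

lemma normal_unipotent_standard:
  "normal_unipotent B4 U4" "normal_unipotent Pa4 Ua4" "normal_unipotent Pb4 Ub4" "normal_unipotent Sp4 {mat 1}"
proof -
  have u: "unipotent A" if "A \<in> U4 \<or> A \<in> Ua4 \<or> A \<in> Ub4" for A
    using that by (intro U4_unipotent) (auto simp: U4_def Ua4_def Ub4_def)
  have one: "mat 1 \<in> U4" using group4_standard(8) by (simp add: group4_def)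
  have sp: "x ** h ** adj x \<in> Sp4" if "x \<in> Sp4" "h \<in> Sp4" for x h
    using that by (intro Sp4_mult Sp4_adj_closed)
  show "normal_unipotent Sp4 {mat 1}"
    using u one by (auto simp: normal_unipotent_def group4_def Sp4_one adj_one adj_right)
  have "x ** h ** adj x \<in> U4" if "x \<in> B4" "h \<in> U4" for x h
  proof -
    have "x ** h ** adj x \<in> Sp4" using that sp by (auto simp: B4_def U4_def)
    then show ?thesis using that B4_diag[OF that(1)] by (auto simp: B4_def U4_def mult4 mult.commute)
  qed
  then show "normal_unipotent B4 U4"
    unfolding normal_unipotent_def using group4_standard u by (auto simp: U4_def B4_def)
  have "x ** h ** adj x \<in> Ua4" if x: "x \<in> Pa4" and h: "h \<in> Ua4" for x h
  proof -
    have "x ** h ** adj x \<in> Sp4" using that sp by (auto simp: Pa4_def Ua4_def)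
    moreover have "x$1$1 * x$4$4 = 1" "x$2$2 * x$3$3 - x$3$2 * x$2$3 = 1" using x by (auto simp: Pa4_def Sp4_cols)
    ultimately show ?thesis using that
      by (auto simp: Pa4_def Ua4_def mult4 algebra_simps)
  qed
  then show "normal_unipotent Pa4 Ua4"
    unfolding normal_unipotent_def using group4_standard u by (auto simp: Ua4_def Pa4_def)
  have "x ** h ** adj x \<in> Ub4" if x: "x \<in> Pb4" and h: "h \<in> Ub4" for x h
  proof -
    have "x ** h ** adj x \<in> Sp4" using that sp by (auto simp: Pb4_def Ub4_def)
    moreover have xS: "x \<in> Sp4" and z: "x$3$1 = 0" "x$4$1 = 0" "x$3$2 = 0" "x$4$2 = 0" using x by (auto simp: Pb4_def)
    moreover note Sp4_cols[THEN iffD1, OF xS] Sp4_rows[OF xS]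
    ultimately show ?thesis using h
      by (auto simp: Ub4_def mult4 algebra_simps)
  qed
  then show "normal_unipotent Pb4 Ub4"
    unfolding normal_unipotent_def using group4_standard u by (auto simp: Ub4_def Pb4_def)
qed

lemma (in sp4_rep) unipotent_radical_standard:
  "unipotent_radical (Psi ` B4) = Psi ` U4" "unipotent_radical (Psi ` Pa4) = Psi ` Ua4"
  "unipotent_radical (Psi ` Pb4) = Psi ` Ub4" "unipotent_radical (Psi ` Sp4) = {mat 1}"
proof -
  have *: "unipotent_radical (Psi ` P) = Psi ` U" if "group4 P" "normal_unipotent P U"
    "\<And>N. normal_unipotent P N \<Longrightarrow> N \<subseteq> U" "closedin zariski U" "connectedin zariski U" for P U
    unfolding unipotent_radical_Psi[OF that(1)] using that by (intro arg_cong[of _ _ "image Psi"]) blast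
  have "closedin zariski {mat 1 :: complex^4^4}"
  proof -
    have "{mat 1 :: complex^4^4} = {A. \<forall>f\<in>range (\<lambda>(i, j) A. A $ i $ j - mat 1 $ i $ j). f A = 0}"
      by (auto simp: vec_eq_iff)
    then show ?thesis
      by (rule closedin_zariskiI[rotated]) (auto intro!: poly_fun_diff poly_fun.entry poly_fun.const)
  qed
  then have "unipotent_radical (Psi ` Sp4) = Psi ` {mat 1}"
    by (intro * normal_unipotent_Sp4 normal_unipotent_standard group4_standard) (simp_all add: connectedin_sing)
  then show "unipotent_radical (Psi ` Sp4) = {mat 1}" by (simp add: Psi_one)
  show "unipotent_radical (Psi ` B4) = Psi ` U4" "unipotent_radical (Psi ` Pa4) = Psi ` Ua4"
    "unipotent_radical (Psi ` Pb4) = Psi ` Ub4"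
    by (intro * normal_unipotent_B4 normal_unipotent_Pa4 normal_unipotent_Pb4 normal_unipotent_standard
      group4_standard closedin_standard connected_U4 connected_Ua4 connected_Ub4; assumption)+
qed

section \<open>Borel subgroups\<close>

lemma solvable_sub_group_iff:
  assumes "subgroup H GL"
  shows "solvable (sub_group H) \<longleftrightarrow> (\<exists>k. (derived GL ^^ k) H \<subseteq> {mat 1})"
proof -
  interpret S: group "sub_group H" by (rule subgroup.subgroup_is_group[OF assms group_GL])
  have "mat 1 \<in> (derived GL ^^ k) H" for k
    using subgroup.one_closed[OF GL.exp_of_derived_is_subgroup[OF assms]] by simp
  then have "(derived GL ^^ k) H \<subseteq> {mat 1} \<longleftrightarrow> (derived GL ^^ k) H = {mat 1}" for k by blast
  then show ?thesis unfolding S.solvable_iff_trivial_derived_seq by (simp add: derived_sub_group[OF assms])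
qed

lemma solvable_sub_group_mono:
  assumes "subgroup H GL" "subgroup K GL" "K \<subseteq> H" "solvable (sub_group H)"
  shows "solvable (sub_group K)"
  using assms(4) GL.mono_exp_of_derived[OF assms(3)] unfolding solvable_sub_group_iff[OF assms(1)] solvable_sub_group_iff[OF assms(2)]
  by (meson order_trans)

lemma derived_subset:
  assumes "group4 H" "group4 K" "\<And>a b. a \<in> H \<Longrightarrow> b \<in> H \<Longrightarrow> a ** b ** adj a ** adj b \<in> K"
  shows "derived GL H \<subseteq> K"
proof -
  have "derived_set GL H \<subseteq> K"
    using assms(1,3) by (auto simp: group4_def inv_GL_adj subset_iff)
  then show ?thesis unfolding derived_def
    by (rule GL.generate_subgroup_incl) (rule group4_subgroup[OF assms(2)])
qed

text \<open>Commutators kill first the torus part, then the two simple root coordinates of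
  \<open>U4\<close>; what remains, \<open>V4\<close>, is commutative. The derived length is thus at
  most three.\<close>

lemma solvable_B4: "solvable (sub_group B4)"
proof -
  have Sp: "a ** b ** adj a ** adj b \<in> Sp4" if "a \<in> Sp4" "b \<in> Sp4" for a b
    using that by (intro Sp4_mult Sp4_adj_closed)
  have 1: "derived GL B4 \<subseteq> U4"
  proof (rule derived_subset[OF group4_standard(2,8)])
    fix a b assume ab: "a \<in> B4" "b \<in> B4"
    have d: "a$4$4 = 1 / a$1$1" "a$3$3 = 1 / a$2$2" "b$4$4 = 1 / b$1$1" "b$3$3 = 1 / b$2$2"
      using B4_diag[OF ab(1)] B4_diag[OF ab(2)] by (auto simp: divide_simps mult.commute)
    have "a ** b ** adj a ** adj b \<in> Sp4" using ab by (intro Sp) (auto simp: B4_def)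
    then show "a ** b ** adj a ** adj b \<in> U4"
      using d B4_diag[OF ab(1)] B4_diag[OF ab(2)] ab by (simp add: U4_def B4_def mult4)
  qed
  have 2: "derived GL U4 \<subseteq> V4"
  proof (rule derived_subset[OF group4_standard(8,11)])
    fix a b assume ab: "a \<in> U4" "b \<in> U4"
    have s: "a$3$4 = - a$1$2" "b$3$4 = - b$1$2"
      using U4_upp[OF ab(1)] U4_upp[OF ab(2)] by (metis upp_def mat4_nth(2,12))+
    have "a ** b ** adj a ** adj b \<in> Sp4" using ab by (intro Sp) (auto simp: U4_def)
    then show "a ** b ** adj a ** adj b \<in> V4"
      using ab s by (simp add: U4_def V4_def mult4)
  qed
  have 3: "derived GL V4 \<subseteq> {mat 1}"
  proof (rule derived_subset[OF group4_standard(11)])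
    show "group4 {mat 1}" by (auto simp: group4_def Sp4_one adj_one)
    fix a b assume ab: "a \<in> V4" "b \<in> V4"
    then have "a \<in> U4" "b \<in> U4" by (auto simp: U4_def V4_def)
    moreover have "a$1$2 = 0" "a$2$3 = 0" "b$1$2 = 0" "b$2$3 = 0" using ab by (auto simp: V4_def)
    ultimately obtain e f e' f' where "a = upp 0 0 e f" "b = upp 0 0 e' f'" by (metis U4_upp)
    then show "a ** b ** adj a ** adj b \<in> {mat 1}"
      by (simp add: upp_def mat4_eq_iff mult4 mat_nth)
  qed
  have "(derived GL ^^ 3) B4 = derived GL (derived GL (derived GL B4))" by (simp add: numeral_3_eq_3)
  also have "\<dots> \<subseteq> derived GL (derived GL U4)" by (intro GL.mono_derived 1)
  also have "\<dots> \<subseteq> derived GL V4" by (intro GL.mono_derived 2)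
  also note 3
  finally show ?thesis using solvable_sub_group_iff[OF group4_subgroup[OF group4_standard(2)]] by blast
qed

text \<open>The map need only be multiplicative on \<open>H\<close>. This is what taking a diagonal
  block satisfies, and it gives common eigenvectors in the subquotients of a flag.\<close>

lemma lie_kolchin_image:
  fixes \<phi> :: "complex^4^4 \<Rightarrow> complex^'m^'m"
  assumes H: "group4 H" "connectedin zariski H" "solvable (sub_group H)"
    and \<phi>: "\<And>i j. (\<lambda>A. \<phi> A $ i $ j) \<in> poly_fun" "\<And>A B. A \<in> H \<Longrightarrow> B \<in> H \<Longrightarrow> \<phi> (A ** B) = \<phi> A ** \<phi> B"
      "\<phi> (mat 1) = mat 1"
  shows "\<exists>v. v \<noteq> 0 \<and> (\<forall>h\<in>H. \<exists>c. \<phi> h *v v = c *s v)"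
proof -
  have one: "mat 1 \<in> H" and adj: "\<And>A. A \<in> H \<Longrightarrow> adj A \<in> H" and HS: "H \<subseteq> Sp4"
    using H(1) by (auto simp: group4_def)
  have inv: "\<phi> A ** \<phi> (adj A) = mat 1" "\<phi> (adj A) ** \<phi> A = mat 1" if "A \<in> H" for A
    using \<phi>(2)[of A "adj A"] \<phi>(2)[of "adj A" A] that adj adj_left adj_right HS \<phi>(3) by (auto simp: subset_iff)
  have S: "subgroup (\<phi> ` H) GL"
  proof (rule GL.subgroupI)
    show "\<phi> ` H \<subseteq> carrier GL" using inv by (auto simp: invertible_def)
    show "\<phi> ` H \<noteq> {}" using one by blast
    show "inv\<^bsub>GL\<^esub> a \<in> \<phi> ` H" if "a \<in> \<phi> ` H" for a
      using that inv_GL_unique[OF inv(1)] adj by auto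
    show "a \<otimes>\<^bsub>GL\<^esub> b \<in> \<phi> ` H" if "a \<in> \<phi> ` H" "b \<in> \<phi> ` H" for a b
    proof -
      from that obtain x y where "x \<in> H" "y \<in> H" "a = \<phi> x" "b = \<phi> y" by blast
      then show ?thesis using \<phi>(2)[of x y] H(1) by (auto simp: group4_def intro!: image_eqI[of _ _ "x ** y"])
    qed
  qed
  interpret group_hom "sub_group H" "sub_group (\<phi> ` H)" \<phi>
    unfolding group_hom_def group_hom_axioms_def
    using subgroup.subgroup_is_group[OF group4_subgroup[OF H(1)] group_GL] subgroup.subgroup_is_group[OF S group_GL] \<phi>(2)
    by (auto simp: hom_def)
  have "solvable (sub_group (\<phi> ` H))" by (rule surj_hom_imp_solvable[OF _ H(3)]) simp
  from lie_kolchin[OF S connectedin_zariski_image_poly[OF H(2) \<phi>(1)] this] show ?thesis by blast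
qed

text \<open>For \<open>A\<close> in \<open>Pa4\<close>, the action on the quotient of the orthogonal
  hyperplane by the fixed line; \<open>top_block\<close> is, for \<open>A\<close> in
  \<open>Pb4\<close>, the action on the fixed plane.\<close>

definition middle_block :: "complex^4^4 \<Rightarrow> complex^2^2" where
  "middle_block A = (\<chi> i j. A $ (if i = 1 then 2 else 3) $ (if j = 1 then 2 else 3))"

definition top_block :: "complex^4^4 \<Rightarrow> complex^2^2" where
  "top_block A = (\<chi> i j. A $ (if i = 1 then 1 else 2) $ (if j = 1 then 1 else 2))"

lemma block_mult:
  "A \<in> Pa4 \<Longrightarrow> B \<in> Pa4 \<Longrightarrow> middle_block (A ** B) = middle_block A ** middle_block B"
  "A \<in> Pb4 \<Longrightarrow> B \<in> Pb4 \<Longrightarrow> top_block (A ** B) = top_block A ** top_block B"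
  by (simp_all add: vec_eq_iff forall_2 middle_block_def top_block_def matrix_mult_entry[of "_ :: complex^2^2"] sum_2 mult4 Pa4_def Pb4_def)

lemma block_one: "middle_block (mat 1) = mat 1" "top_block (mat 1) = mat 1"
  by (simp_all add: vec_eq_iff forall_2 middle_block_def top_block_def mat_nth)

lemma block_mult_vec:
  "(middle_block A *v v) $ 1 = A$2$2 * v$1 + A$2$3 * v$2" "(middle_block A *v v) $ 2 = A$3$2 * v$1 + A$3$3 * v$2"
  "(top_block A *v v) $ 1 = A$1$1 * v$1 + A$1$2 * v$2" "(top_block A *v v) $ 2 = A$2$1 * v$1 + A$2$2 * v$2"
  by (simp_all add: matrix_vector_mult_def sum_2 middle_block_def top_block_def)

lemma conj_mult: "g \<in> Sp4 \<Longrightarrow> adj g ** (A ** B) ** g = adj g ** A ** g ** (adj g ** B ** g)"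
  by (simp add: matrix_mul_assoc[symmetric] adj_cancel)

text \<open>A common eigenvector spans a line that is moved to the standard one. A common
  eigenvector in the hyperplane modulo this line completes an isotropic flag, because a line in a
  symplectic plane is isotropic.\<close>

lemma conj_into_B4:
  assumes H: "group4 H" "connectedin zariski H" "solvable (sub_group H)"
  shows "\<exists>g\<in>Sp4. \<forall>h\<in>H. adj g ** h ** g \<in> B4"
proof -
  have HS: "H \<subseteq> Sp4" using H(1) by (simp add: group4_def)
  obtain v where v: "v \<noteq> 0" "\<And>h. h \<in> H \<Longrightarrow> \<exists>c. h *v v = c *s v"
    using lie_kolchin_image[OF H, of "\<lambda>A. A"] poly_fun.entry by blast
  obtain g1 where g1: "g1 \<in> Sp4" "g1 *v vec4 1 0 0 0 = v" using Sp4_transitive[OF v(1)] by blast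
  have P: "adj g1 ** h ** g1 \<in> Pa4" if "h \<in> H" for h
    using v(2)[OF that] conj_stabilises_e1[OF g1] HS that by blast
  have "\<exists>w. w \<noteq> 0 \<and> (\<forall>h\<in>H. \<exists>c. middle_block (adj g1 ** h ** g1) *v w = c *s w)"
  proof (rule lie_kolchin_image[OF H])
    show "(\<lambda>A. middle_block (adj g1 ** A ** g1) $ i $ j) \<in> poly_fun" for i j
      unfolding middle_block_def
      by (simp, intro conjI impI poly_fun_matrix_mult poly_fun.const poly_fun.entry)
    show "middle_block (adj g1 ** (A ** B) ** g1) = middle_block (adj g1 ** A ** g1) ** middle_block (adj g1 ** B ** g1)"
      if "A \<in> H" "B \<in> H" for A B
      using block_mult(1)[OF P[OF that(1)] P[OF that(2)]] conj_mult[OF g1(1)] by simp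
    show "middle_block (adj g1 ** mat 1 ** g1) = mat 1" by (simp add: adj_left[OF g1(1)] block_one)
  qed
  then obtain w where w: "w \<noteq> 0" "\<And>h. h \<in> H \<Longrightarrow> \<exists>c. middle_block (adj g1 ** h ** g1) *v w = c *s w" by blast
  define x y where "x = w$1" and "y = w$2"
  have xy: "x \<noteq> 0 \<or> y \<noteq> 0" using w(1) by (auto simp: vec_eq_iff forall_2 x_def y_def)
  \<comment> \<open>The eigenvector (x, y) is completed to a two by two matrix of determinant 1, so
    that \<open>g2\<close> is symplectic and fixes the first basis vector.\<close>
  obtain p q where pq: "x * q - y * p = 1"
  proof (cases "x = 0")
    case True then show ?thesis using xy that[where p = "-1 / y" and q = 0] by simp
  next
    case False then show ?thesis using that[where p = 0 and q = "1 / x"] by simp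
  qed
  define g2 where "g2 = mat4 1 0 0 0  0 x p 0  0 y q 0  0 0 0 1"
  have g2: "g2 \<in> Pa4" using pq by (simp add: Pa4_def Sp4_cols g2_def algebra_simps)
  then have g2S: "g2 \<in> Sp4" by (simp add: Pa4_def)
  have PM: "A ** B \<in> Pa4" "adj A \<in> Pa4" if "A \<in> Pa4" "B \<in> Pa4" for A B
    using that group4_standard(3) by (auto simp: group4_def)
  have "adj (g1 ** g2) ** h ** (g1 ** g2) \<in> B4" if h: "h \<in> H" for h
  proof -
    let ?h = "adj g1 ** h ** g1"
    obtain c where "middle_block ?h *v w = c *s w" using w(2)[OF h] by blast
    then have c: "?h$2$2 * x + ?h$2$3 * y = c * x" "?h$3$2 * x + ?h$3$3 * y = c * y"
      by (metis block_mult_vec(1,2) vector_smult_component x_def y_def)+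
    have h0: "?h$2$1 = 0" "?h$3$1 = 0" "?h$4$1 = 0" "?h$4$2 = 0" "?h$4$3 = 0" using P[OF h] by (auto simp: Pa4_def)
    have "(adj g2 ** (?h ** g2)) $ 3 $ 2 = - y * (?h$2$2 * x + ?h$2$3 * y) + x * (?h$3$2 * x + ?h$3$3 * y)"
      unfolding mult4[of "adj g2" "?h ** g2"] mult4[of ?h g2] by (simp add: g2_def h0)
    also have "\<dots> = 0" unfolding c by simp
    finally have z: "(adj g2 ** ?h ** g2) $ 3 $ 2 = 0" by (simp add: matrix_mul_assoc)
    have "adj g2 ** ?h ** g2 \<in> Pa4" by (rule PM(1)[OF PM(1)[OF PM(2)[OF g2 g2] P[OF h]] g2])
    with z have "adj g2 ** ?h ** g2 \<in> B4" unfolding Pa4_def B4_def by blast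
    then show ?thesis by (simp only: adj_mult matrix_mul_assoc)
  qed
  then show ?thesis using Sp4_mult[OF g1(1) g2S] by blast
qed

lemma conj_inverse: "g \<in> Sp4 \<Longrightarrow> g ** (adj g ** h ** g) ** adj g = h"
  by (simp add: matrix_mul_assoc[symmetric] adj_cancel) (simp add: matrix_mul_assoc adj_right)

context sp4_rep
begin

text \<open>Lie--Kolchin puts \<open>B\<close> inside a conjugate of \<open>B4\<close>, which is
  itself connected, closed and solvable; maximality of \<open>B\<close> gives equality.\<close>

lemma borel_conj:
  assumes "borel_subgroup (Psi ` Sp4) B"
  shows "\<exists>g\<in>Sp4. B = (\<lambda>A. Psi (g ** A ** adj g)) ` B4"
proof -
  note B = assms[unfolded borel_subgroup_def]
  obtain B0 where B0: "B0 \<subseteq> Sp4" "B = Psi ` B0" using B by (meson subset_imageE)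
  have "group4 B0" "connectedin zariski B0" "solvable (sub_group B0)"
    using B B0 connected_algebraic_Psi solvable_Psi by auto
  then obtain g where g: "g \<in> Sp4" "\<forall>h\<in>B0. adj g ** h ** g \<in> B4" using conj_into_B4 by blast
  let ?Q = "\<lambda>A. Psi (g ** A ** adj g)"
  interpret Q: sp4_rep ?Q "\<lambda>i j X. (adj g ** (\<chi> k l. rho k l X) ** g) $ i $ j"
    by (rule sp4_rep_conj[OF sp4_rep_axioms g(1)])
  have B4S: "B4 \<subseteq> Sp4" by (auto simp: B4_def)
  have "B \<subseteq> ?Q ` B4"
  proof
    fix X assume "X \<in> B"
    then obtain h where h: "h \<in> B0" "X = Psi h" using B0 by blast
    then show "X \<in> ?Q ` B4" using g by (intro image_eqI[of _ _ "adj g ** h ** g"]) (auto simp: conj_inverse)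
  qed
  moreover have "?Q ` B4 \<subseteq> Psi ` Sp4" using B4S g(1) by (auto intro!: Sp4_mult Sp4_adj_closed)
  moreover have "connected_algebraic_group (?Q ` B4)"
    using Q.connected_algebraic_Psi[OF B4S] group4_standard closedin_standard connected_B4 by simp
  moreover have "solvable (sub_group (?Q ` B4))"
    using Q.solvable_Psi[OF group4_standard(2)] solvable_B4 by simp
  ultimately have "?Q ` B4 = B" using B by blast
  then show ?thesis using g(1) by blast
qed

section \<open>Maximal tori\<close>

lemma coordinate_fun_const: "coordinate_fun H (\<lambda>_. c)"
  unfolding coordinate_fun_def by (rule bexI[of _ "\<lambda>_. c"], rule exI[of _ 0]) (auto intro: poly_fun.const)

lemma coordinate_fun_poly: "p \<in> poly_fun \<Longrightarrow> (\<And>A. A \<in> H \<Longrightarrow> f A = p A) \<Longrightarrow> coordinate_fun H f"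
  unfolding coordinate_fun_def by (rule bexI[of _ p], rule exI[of _ 0]) auto

end

lemma poly_fun_det': "(\<lambda>A. det A) \<in> poly_fun"
  by (rule poly_fun_det) (rule poly_fun.entry)

lemma coordinate_fun_add:
  assumes "coordinate_fun H f" "coordinate_fun H g" "H \<subseteq> carrier GL"
  shows "coordinate_fun H (\<lambda>A. f A + g A)"
proof -
  obtain p k p' k' where h: "p \<in> poly_fun" "\<And>A. A \<in> H \<Longrightarrow> f A = p A / det A ^ k"
    "p' \<in> poly_fun" "\<And>A. A \<in> H \<Longrightarrow> g A = p' A / det A ^ k'"
    using assms unfolding coordinate_fun_def by blast
  have "f A + g A = (p A * det A ^ k' + p' A * det A ^ k) / det A ^ (k + k')" if "A \<in> H" for A
  proof -
    have "det A \<noteq> 0" using that assms(3) by (auto simp: invertible_det_nz)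
    then show ?thesis using that by (simp add: h(2,4) add_frac_eq power_add)
  qed
  moreover have "(\<lambda>A. p A * det A ^ k' + p' A * det A ^ k) \<in> poly_fun"
    by (intro poly_fun.add poly_fun.mult poly_fun_power poly_fun_det' h)
  ultimately show ?thesis unfolding coordinate_fun_def by (intro bexI exI ballI)
qed

lemma coordinate_fun_mult:
  assumes "coordinate_fun H f" "coordinate_fun H g"
  shows "coordinate_fun H (\<lambda>A. f A * g A)"
proof -
  obtain p k p' k' where h: "p \<in> poly_fun" "\<And>A. A \<in> H \<Longrightarrow> f A = p A / det A ^ k"
    "p' \<in> poly_fun" "\<And>A. A \<in> H \<Longrightarrow> g A = p' A / det A ^ k'"
    using assms unfolding coordinate_fun_def by blast
  have "f A * g A = (p A * p' A) / det A ^ (k + k')" if "A \<in> H" for A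
    using that by (simp add: h(2,4) power_add)
  moreover have "(\<lambda>A. p A * p' A) \<in> poly_fun" by (intro poly_fun.mult h)
  ultimately show ?thesis unfolding coordinate_fun_def by (intro bexI exI ballI)
qed

section \<open>Diagonal tori\<close>

lemma diagonal_torus_det:
  assumes "D \<in> diagonal_torus S" shows "det D = (\<Prod>i\<in>S. D $ i $ i)" "\<And>i. D $ i $ i \<noteq> 0"
proof -
  have "det D = (\<Prod>i\<in>UNIV. D $ i $ i)"
    using assms by (intro det_diagonal) (auto simp: diagonal_torus_def)
  also have "\<dots> = (\<Prod>i\<in>S. D $ i $ i)"
    using assms by (intro prod.mono_neutral_right) (auto simp: diagonal_torus_def)
  finally show d: "det D = (\<Prod>i\<in>S. D $ i $ i)" .
  have "det D \<noteq> 0" using assms by (simp add: diagonal_torus_def invertible_det_nz)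
  then show "D $ i $ i \<noteq> 0" for i
    using d assms by (cases "i \<in> S") (auto simp: diagonal_torus_def)
qed

lemma diagonal_torusI:
  assumes "\<And>i j. i \<noteq> j \<Longrightarrow> A $ i $ j = 0" "\<And>i. i \<notin> S \<Longrightarrow> A $ i $ i = 1" "\<And>i. A $ i $ i \<noteq> 0"
  shows "A \<in> diagonal_torus S"
proof -
  have "det A = (\<Prod>i\<in>UNIV. A $ i $ i)" using assms(1) by (intro det_diagonal) auto
  then have "det A \<noteq> 0" using assms(3) by simp
  then show ?thesis using assms(1,2) by (auto simp: diagonal_torus_def invertible_det_nz)
qed

lemma diagonal_torus_mult_nth:
  assumes "A \<in> diagonal_torus S"
  shows "(A ** B) $ i $ j = A $ i $ i * B $ i $ j"
proof -
  have "(A ** B) $ i $ j = (\<Sum>k\<in>{i}. A $ i $ k * B $ k $ j)"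
    unfolding matrix_mult_entry using assms by (intro sum.mono_neutral_right) (auto simp: diagonal_torus_def)
  then show ?thesis by simp
qed

lemma diagonal_torus_mult:
  assumes "A \<in> diagonal_torus S" "B \<in> diagonal_torus S" shows "A ** B \<in> diagonal_torus S"
  using assms diagonal_torus_det(2)[OF assms(1)] diagonal_torus_det(2)[OF assms(2)]
  by (intro diagonal_torusI) (auto simp: diagonal_torus_mult_nth[OF assms(1)] diagonal_torus_def)

lemma diagonal_torus_subgroup: "subgroup (diagonal_torus S) GL"
proof (rule GL.subgroupI)
  show "diagonal_torus S \<subseteq> carrier GL" by (auto simp: diagonal_torus_def)
  have "mat 1 \<in> diagonal_torus S" by (rule diagonal_torusI) (auto simp: mat_nth)
  then show "diagonal_torus S \<noteq> {}" by blast
  show "a \<otimes>\<^bsub>GL\<^esub> b \<in> diagonal_torus S" if "a \<in> diagonal_torus S" "b \<in> diagonal_torus S" for a b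
    using diagonal_torus_mult[OF that] by simp
  show "inv\<^bsub>GL\<^esub> a \<in> diagonal_torus S" if a: "a \<in> diagonal_torus S" for a
  proof -
    let ?b = "\<chi> i j. if i = j then 1 / a $ i $ i else 0"
    have "a ** ?b = mat 1"
      using diagonal_torus_det(2)[OF a] by (simp add: vec_eq_iff diagonal_torus_mult_nth[OF a] mat_nth)
    then have "inv\<^bsub>GL\<^esub> a = ?b" by (rule inv_GL_unique)
    moreover have "?b \<in> diagonal_torus S"
      using a diagonal_torus_det(2)[OF a] by (intro diagonal_torusI) (auto simp: diagonal_torus_def)
    ultimately show ?thesis by simp
  qed
qed

lemma tor_tor: "tor a b ** tor c d = tor (a * c) (b * d)"
  by (simp add: mat4_eq_iff mult4 tor_def)

context sp4_rep
begin

text \<open>The model of a torus consists of diagonal matrices of the same size as the ambient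
  group, so the two parameters are put at two distinct indices \<open>p\<close> and
  \<open>q\<close>.\<close>

lemma torus_T4:
  fixes p q :: 'n
  assumes pq: "p \<noteq> q" shows "torus (Psi ` T4)"
proof -
  let ?D = "diagonal_torus {p, q}"
  define \<phi> where "\<phi> D = Psi (tor (D $ p $ p) (D $ q $ q))" for D :: "complex^'n^'n"
  have TS: "T4 \<subseteq> Sp4" by (auto simp: T4_def)
  have lin: "linear_algebraic_group (Psi ` T4)"
    using linear_algebraic_Psi[OF TS] group4_standard closedin_standard by simp
  have nz: "D $ p $ p \<noteq> 0" "D $ q $ q \<noteq> 0" "det D = D $ p $ p * D $ q $ q" if "D \<in> ?D" for D
    using diagonal_torus_det[OF that] pq by auto
  have hom: "\<phi> \<in> hom (sub_group ?D) (sub_group (Psi ` T4))"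
  proof (rule homI)
    fix x assume "x \<in> carrier (sub_group ?D)"
    then show "\<phi> x \<in> carrier (sub_group (Psi ` T4))" using nz by (auto simp: \<phi>_def intro: tor_T4)
  next
    fix x y assume "x \<in> carrier (sub_group ?D)" "y \<in> carrier (sub_group ?D)"
    then show "\<phi> (x \<otimes>\<^bsub>sub_group ?D\<^esub> y) = \<phi> x \<otimes>\<^bsub>sub_group (Psi ` T4)\<^esub> \<phi> y"
      by (simp add: \<phi>_def Psi_mult[symmetric] tor_tor diagonal_torus_mult_nth)
  qed
  define \<psi> where "\<psi> X = (\<chi> i j. if i = j then (if i = p then rho 1 1 X else if i = q then rho 2 2 X else 1) else 0)"
    for X :: "complex^'n^'n"
  have psi_phi: "\<psi> (\<phi> D) = D" if "D \<in> ?D" for D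
    using that by (auto simp: vec_eq_iff \<psi>_def \<phi>_def rho_Psi tor_def diagonal_torus_def)
  have surj: "\<exists>D\<in>?D. \<phi> D = Psi t" if t: "t \<in> T4" for t
  proof -
    note tt = T4_tor[OF t]
    let ?d = "\<chi> i j. if i = j then (if i = p then t$1$1 else if i = q then t$2$2 else 1) else 0"
    have "?d \<in> ?D" using tt by (intro diagonal_torusI) auto
    moreover have "\<phi> ?d = Psi t" using tt pq by (simp add: \<phi>_def)
    ultimately show ?thesis by blast
  qed
  have bij: "bij_betw \<phi> ?D (Psi ` T4)"
    unfolding bij_betw_def
  proof
    show "inj_on \<phi> ?D" using psi_phi by (metis inj_onI)
    have "\<phi> ` ?D \<subseteq> Psi ` T4" using hom by (auto simp: hom_def)
    moreover have "Psi t \<in> \<phi> ` ?D" if "t \<in> T4" for t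
      using surj[OF that] by (metis image_eqI)
    ultimately show "\<phi> ` ?D = Psi ` T4" by blast
  qed
  have inv: "inv_into ?D \<phi> X = \<psi> X" if "X \<in> Psi ` T4" for X
  proof -
    from that obtain t where t: "t \<in> T4" "X = Psi t" by blast
    then obtain D where D: "D \<in> ?D" "\<phi> D = X" using surj[OF t(1)] by blast
    have "inj_on \<phi> ?D" using bij by (rule bij_betw_imp_inj_on)
    then have "inv_into ?D \<phi> (\<phi> D) = D" using D(1) by (rule inv_into_f_f)
    then show ?thesis using psi_phi[OF D(1)] D(2) by simp
  qed
  have GD: "group (sub_group ?D)" by (rule subgroup.subgroup_is_group[OF diagonal_torus_subgroup group_GL])
  have hom2: "inv_into ?D \<phi> \<in> hom (sub_group (Psi ` T4)) (sub_group ?D)"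
    using group.iso_set_sym[OF GD, of \<phi> "sub_group (Psi ` T4)"] hom bij by (simp add: iso_def)
  have coord: "coordinate_fun ?D (\<lambda>A. \<phi> A $ k $ l)" for k l
    unfolding \<phi>_def
  proof (rule poly_fun_compose[where Q = "coordinate_fun ?D", OF Psi_poly])
    have sub: "?D \<subseteq> carrier GL" using subgroup.subset[OF diagonal_torus_subgroup] .
    show "coordinate_fun ?D (\<lambda>A. f A + g A)" if "coordinate_fun ?D f" "coordinate_fun ?D g" for f g
      by (rule coordinate_fun_add[OF that sub])
    have a: "coordinate_fun ?D (\<lambda>D. D $ i $ j)" for i j
      by (rule coordinate_fun_poly[OF poly_fun.entry]) simp
    \<comment> \<open>The determinant is the product of the two parameters, so the inverse of one is
      the other divided by \<open>det\<close>.\<close>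
    have b: "coordinate_fun ?D (\<lambda>D. 1 / D $ p $ p)"
      unfolding coordinate_fun_def
      by (rule bexI[of _ "\<lambda>D. D $ q $ q"], rule exI[of _ 1]) (auto simp: nz poly_fun.entry)
    have c: "coordinate_fun ?D (\<lambda>D. 1 / D $ q $ q)"
      unfolding coordinate_fun_def
      by (rule bexI[of _ "\<lambda>D. D $ p $ p"], rule exI[of _ 1]) (auto simp: nz poly_fun.entry)
    show "coordinate_fun ?D (\<lambda>D. tor (D $ p $ p) (D $ q $ q) $ i $ j)" for i j :: 4
      using a b c coordinate_fun_const[of ?D 0] exhaust_4[of i] exhaust_4[of j]
      by (auto simp: tor_def)
  qed (auto intro: coordinate_fun_const coordinate_fun_mult)
  have coord2: "coordinate_fun (Psi ` T4) (\<lambda>A. inv_into ?D \<phi> A $ i $ j)" for i j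
  proof (rule coordinate_fun_poly)
    show "(\<lambda>X. \<psi> X $ i $ j) \<in> poly_fun"
      unfolding \<psi>_def by (cases "i = j"; cases "i = p"; cases "i = q") (simp_all add: rho_poly poly_fun.const)
    show "inv_into ?D \<phi> A $ i $ j = \<psi> A $ i $ j" if "A \<in> Psi ` T4" for A using inv[OF that] by simp
  qed
  have "algebraic_iso ?D (Psi ` T4) \<phi>"
    unfolding algebraic_iso_def algebraic_hom_def using hom hom2 bij coord coord2 by blast
  then show ?thesis unfolding torus_def using lin by blast
qed

end

text \<open>The numeral \<open>4\<close> of type \<open>4\<close> is the element \<open>0\<close>, so triangularity refers to a position function
  instead of the order of the index type.\<close>

definition pos4 :: "4 \<Rightarrow> nat" where
  "pos4 i = (if i = 1 then 1 else if i = 2 then 2 else if i = 3 then 3 else 4)"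

lemma omega_mult: "t \<in> Sp4 \<Longrightarrow> omega (t ** M) i j = omega M i j"
proof -
  have *: "omega A i j = (transpose A ** J4 ** A) $ i $ j" for A
    by (simp add: mult4 J4_def omega_def)
  assume "t \<in> Sp4"
  then have "transpose t ** J4 ** t = J4" by (simp add: Sp4_def)
  moreover have "transpose (t ** M) ** J4 ** (t ** M) = transpose M ** (transpose t ** J4 ** t) ** M"
    by (simp only: matrix_transpose_mul matrix_mul_assoc)
  ultimately have "transpose (t ** M) ** J4 ** (t ** M) = transpose M ** J4 ** M" by simp
  then show ?thesis by (simp add: *)
qed

lemma omega_diagonal:
  assumes "\<And>a j. D $ a $ j = (if a = j then d j else 0)"
  shows "omega (M ** D) i j = d i * d j * omega M i j"
proof -
  have "(M ** D) $ a $ j = M $ a $ j * d j" for a j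
    using exhaust_4[of j] by (auto simp: mult4 assms)
  then show ?thesis by (simp add: omega_def algebra_simps)
qed

text \<open>A family of upper triangular symplectic matrices with a common unitriangular eigenbasis has a
  symplectic one: only the last vector has to be corrected.\<close>

lemma symplectic_eigenbasis:
  assumes TB: "\<And>t. t \<in> T0 \<Longrightarrow> t \<in> B4"
    and w: "\<And>k. w k $ k = 1" "\<And>k a. pos4 k < pos4 a \<Longrightarrow> w k $ a = 0"
    and ev: "\<And>t k. t \<in> T0 \<Longrightarrow> t *v w k = (t $ k $ k) *s w k"
  shows "\<exists>b\<in>B4. \<forall>t\<in>T0. adj b ** t ** b \<in> T4"
proof -
  define M where "M = mat4 (w 1 $ 1) (w 2 $ 1) (w 3 $ 1) (w 4 $ 1) (w 1 $ 2) (w 2 $ 2) (w 3 $ 2) (w 4 $ 2)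
    (w 1 $ 3) (w 2 $ 3) (w 3 $ 3) (w 4 $ 3) (w 1 $ 4) (w 2 $ 4) (w 3 $ 4) (w 4 $ 4)"
  have Mk: "M $ a $ k = w k $ a" for a k
    using exhaust_4[of a] exhaust_4[of k] by (auto simp: M_def)
  have M0: "M$1$1 = 1" "M$2$2 = 1" "M$3$3 = 1" "M$4$4 = 1" "M$2$1 = 0" "M$3$1 = 0" "M$4$1 = 0" "M$3$2 = 0" "M$4$2 = 0" "M$4$3 = 0"
    using w by (simp_all add: Mk pos4_def)
  define \<alpha> \<beta> where "\<alpha> = omega M 2 4" and "\<beta> = omega M 3 4"
  \<comment> \<open>Right multiplication by \<open>E\<close> adds \<beta> times column 2 and
    subtracts \<alpha> times column 3 from the last column, which makes it orthogonal to these two.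
    The other pairings of the columns are right by triangularity.\<close>
  define E where "E = mat4 1 0 0 0  0 1 0 \<beta>  0 0 1 (- \<alpha>)  0 0 0 1"
  define b where "b = M ** E"
  have bB: "b \<in> B4"
  proof -
    have "b$1$1 = 1" "b$2$2 = 1" "b$3$3 = 1" "b$4$4 = 1" "b$2$1 = 0" "b$3$1 = 0" "b$4$1 = 0" "b$3$2 = 0" "b$4$2 = 0" "b$4$3 = 0"
      "b$1$4 = M$1$4 + \<beta> * M$1$2 - \<alpha> * M$1$3" "b$2$4 = M$2$4 + \<beta> - \<alpha> * M$2$3" "b$3$4 = M$3$4 - \<alpha>"
      "b$1$2 = M$1$2" "b$1$3 = M$1$3" "b$2$3 = M$2$3"
      by (simp_all add: b_def mult4 E_def M0)
    moreover have "\<alpha> = M$1$2 + M$3$4" "\<beta> = M$1$3 + M$2$3 * M$3$4 - M$2$4"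
      by (simp_all add: \<alpha>_def \<beta>_def omega_def M0)
    ultimately show ?thesis by (simp add: B4_def Sp4_cols algebra_simps)
  qed
  have "adj b ** t ** b \<in> T4" if t: "t \<in> T0" for t
  proof -
    define D where "D = mat4 (t$1$1) 0 0 0  0 (t$2$2) 0 0  0 0 (t$3$3) 0  0 0 0 (t$4$4)"
    have tB: "t \<in> B4" and tS: "t \<in> Sp4" using TB[OF t] by (auto simp: B4_def)
    have Dk: "D $ a $ j = (if a = j then t $ j $ j else 0)" for a j
      using exhaust_4[of a] exhaust_4[of j] by (auto simp: D_def)
    have tM: "t ** M = M ** D"
    proof -
      have "(t ** M) $ a $ k = (M ** D) $ a $ k" for a k
      proof -
        have "(t ** M) $ a $ k = (t *v w k) $ a" by (simp add: mult4 mult_vec4 Mk)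
        also have "\<dots> = t $ k $ k * w k $ a" by (simp add: ev[OF t])
        also have "\<dots> = (M ** D) $ a $ k"
          using exhaust_4[of k] by (auto simp: mult4 Dk Mk)
        finally show ?thesis .
      qed
      then show ?thesis by (simp add: vec_eq_iff)
    qed
    \<comment> \<open>Invariance of the form: if columns i and j pair nontrivially, their weights
      are inverse to each other. So if \<alpha> is nonzero, columns 3 and 4 have equal weights, and
      likewise columns 2 and 4 for \<beta>; the correction stays within weight spaces.\<close>
    have om: "omega M i j = t $ i $ i * t $ j $ j * omega M i j" for i j
      using omega_mult[OF tS, of M i j] omega_diagonal[of D "\<lambda>j. t $ j $ j" M i j] Dk tM by simp
    note d = B4_diag[OF tB]
    have a: "\<alpha> * t$3$3 = \<alpha> * t$4$4"
    proof (cases "\<alpha> = 0")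
      case False
      then have "t$2$2 * t$4$4 = 1" using om[of 2 4] by (simp add: \<alpha>_def)
      then have "t$2$2 * t$4$4 = t$2$2 * t$3$3" using d by simp
      then have "t$4$4 = t$3$3" using d mult_left_cancel by blast
      then show ?thesis by simp
    qed simp
    have b': "\<beta> * t$2$2 = \<beta> * t$4$4"
    proof (cases "\<beta> = 0")
      case False
      then have "t$3$3 * t$4$4 = 1" using om[of 3 4] by (simp add: \<beta>_def)
      then have "t$3$3 * t$4$4 = t$3$3 * t$2$2" using d by (simp add: mult.commute)
      then have "t$4$4 = t$2$2" using d mult_left_cancel by blast
      then show ?thesis by simp
    qed simp
    have "D ** E = E ** D"
      using a b' by (simp add: mat4_eq_iff mult4 D_def E_def mult.commute)
    then have "t ** b = b ** D" unfolding b_def using tM by (metis matrix_mul_assoc)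
    then have "adj b ** t ** b = adj b ** b ** D" by (simp add: matrix_mul_assoc[symmetric])
    also have "\<dots> = D" using bB by (simp add: B4_def adj_left)
    finally have e: "adj b ** t ** b = D" .
    have "adj b ** t ** b \<in> Sp4" using bB tS by (intro Sp4_mult Sp4_adj_closed) (auto simp: B4_def)
    then show ?thesis unfolding e by (simp add: T4_def D_def)
  qed
  then show ?thesis using bB by blast
qed

lemma B4_mult_diag: "A \<in> B4 \<Longrightarrow> B \<in> B4 \<Longrightarrow> (A ** B) $ k $ k = A $ k $ k * B $ k $ k"
  using exhaust_4[of k] by (auto simp: mult4 B4_def)

lemma B4_diag_nz: "A \<in> B4 \<Longrightarrow> A $ k $ k \<noteq> 0"
  using exhaust_4[of k] B4_diag[of A] by auto

lemma B4_pos: "A \<in> B4 \<Longrightarrow> pos4 k < pos4 a \<Longrightarrow> A $ a $ k = 0"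
  using exhaust_4[of k] exhaust_4[of a] by (auto simp: B4_def pos4_def)

lemma matrix_vector_sum: "A *v (\<Sum>x\<in>I. f x) = (\<Sum>x\<in>I. A *v f x)" for A :: "complex^'n^'m"
  by (induction I rule: infinite_finite_induct) (auto simp: matrix_vector_right_distrib)

lemma finite_matrices: "finite R \<Longrightarrow> finite {D :: 'a^'n^'m. \<forall>i j. D $ i $ j \<in> R}"
proof -
  assume R: "finite R"
  have "finite (UNIV \<rightarrow>\<^sub>E R :: ('m \<times> 'n \<Rightarrow> 'a) set)" using R by (intro finite_PiE) auto
  moreover have "{D :: 'a^'n^'m. \<forall>i j. D $ i $ j \<in> R} \<subseteq> (\<lambda>f. \<chi> i j. f (i, j)) ` (UNIV \<rightarrow>\<^sub>E R)"
  proof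
    fix D :: "'a^'n^'m" assume "D \<in> {D. \<forall>i j. D $ i $ j \<in> R}"
    then show "D \<in> (\<lambda>f. \<chi> i j. f (i, j)) ` (UNIV \<rightarrow>\<^sub>E R)"
      by (intro image_eqI[of _ _ "\<lambda>(i, j). D $ i $ j"]) (auto simp: vec_eq_iff)
  qed
  ultimately show ?thesis using finite_surj by blast
qed

text \<open>An algebraic torus in \<open>B4\<close> is conjugate into \<open>T4\<close>: averaging over the \<open>N\<close>-torsion subgroup gives
  common eigenvectors of the \<open>N\<close>-torsion, and for \<open>N\<close> larger than the degrees of the one-parameter
  subgroups these are eigenvectors of the whole torus.\<close>

lemma (in sp4_rep) torus_conj:
  assumes T0: "T0 \<subseteq> B4" and tor: "torus (Psi ` T0)"
  shows "\<exists>b\<in>B4. \<forall>t\<in>T0. adj b ** t ** b \<in> T4"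
proof -
  obtain S :: "'n set" and \<phi> where iso: "algebraic_iso (diagonal_torus S) (Psi ` T0) \<phi>"
    using tor unfolding torus_def by blast
  define D where "D = diagonal_torus S"
  define \<tau> where "\<tau> d = rhoM (\<phi> d)" for d
  note iso' = iso[unfolded algebraic_iso_def algebraic_hom_def, folded D_def]
  have hom: "\<phi> \<in> hom (sub_group D) (sub_group (Psi ` T0))" and bij: "\<phi> ` D = Psi ` T0"
    and co: "\<And>i j. coordinate_fun D (\<lambda>A. \<phi> A $ i $ j)"
    using iso' by (auto simp: bij_betw_def)
  have DGL: "D \<subseteq> carrier GL" unfolding D_def by (rule subgroup.subset[OF diagonal_torus_subgroup])
  have \<tau>T: "\<tau> d \<in> T0" if "d \<in> D" for d
  proof -
    have "\<phi> d \<in> Psi ` T0" using that bij by blast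
    then show ?thesis by (auto simp: \<tau>_def)
  qed
  have \<tau>B: "\<tau> d \<in> B4" if "d \<in> D" for d using \<tau>T[OF that] T0 by blast
  have \<tau>surj: "\<exists>d\<in>D. \<tau> d = t" if "t \<in> T0" for t
  proof -
    have "Psi t \<in> \<phi> ` D" using that bij by blast
    then show ?thesis by (auto simp: \<tau>_def) (metis rhoM_Psi)
  qed
  have \<tau>m: "\<tau> (x ** y) = \<tau> x ** \<tau> y" if "x \<in> D" "y \<in> D" for x y
  proof -
    have "\<phi> (x ** y) = \<phi> x ** \<phi> y" using hom that by (simp add: hom_def)
    moreover have "\<phi> x \<in> Psi ` T0" "\<phi> y \<in> Psi ` T0" using that bij by blast+
    then obtain s t where "\<phi> x = Psi s" "\<phi> y = Psi t" by blast
    ultimately show ?thesis by (simp add: \<tau>_def Psi_mult[symmetric])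
  qed
  have \<tau>co: "coordinate_fun D (\<lambda>d. \<tau> d $ a $ b)" for a b
    unfolding \<tau>_def
  proof (simp add: rhoM_def, rule poly_fun_compose[where Q = "coordinate_fun D", OF rho_poly])
    show "coordinate_fun D (\<lambda>A. f A + g A)" if "coordinate_fun D f" "coordinate_fun D g" for f g
      by (rule coordinate_fun_add[OF that DGL])
  qed (auto intro: coordinate_fun_const coordinate_fun_mult co)
  have D_mult: "x ** y \<in> D" if "x \<in> D" "y \<in> D" for x y
    using that diagonal_torus_mult unfolding D_def by blast
  have D_one: "mat 1 \<in> D" unfolding D_def using subgroup.one_closed[OF diagonal_torus_subgroup] by simp
  \<comment> \<open>The one-parameter subgroup in the coordinate i. Its determinant is z, so entries
    of \<open>\<tau> (E i z)\<close> are Laurent polynomials in z.\<close>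
  define E :: "'n \<Rightarrow> complex \<Rightarrow> complex^'n^'n" where
    "E i z = (\<chi> a b. if a = b then (if a = i then z else 1) else 0)" for i z
  have E_D: "E i z \<in> D" if "i \<in> S" "z \<noteq> 0" for i z
    unfolding D_def using that by (intro diagonal_torusI) (auto simp: E_def)
  have E_det: "det (E i z) = z" for i z
  proof -
    have "det (E i z) = (\<Prod>a\<in>UNIV. E i z $ a $ a)" by (rule det_diagonal) (simp add: E_def)
    also have "\<dots> = z" by (simp add: E_def)
    finally show ?thesis .
  qed
  have "\<forall>i a b. \<exists>P k. i \<in> S \<longrightarrow> (\<forall>z. z \<noteq> 0 \<longrightarrow> \<tau> (E i z) $ a $ b = poly P z / z ^ k)"
  proof (intro allI)
    fix i a b
    obtain p k where p: "p \<in> poly_fun" "\<And>A. A \<in> D \<Longrightarrow> \<tau> A $ a $ b = p A / det A ^ k"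
      using \<tau>co[of a b] unfolding coordinate_fun_def by blast
    have "\<exists>P. \<forall>s. E i s $ x $ y = poly P s" for x y
    proof (cases "x = y \<and> x = i")
      case True then show ?thesis by (intro exI[of _ "[:0, 1:]"]) (clarsimp simp: E_def)
    next
      case False then show ?thesis by (intro exI[of _ "[:if x = y then 1 else 0:]"]) (auto simp: E_def)
    qed
    from univariate_poly_fun[OF p(1) this] obtain P where "\<And>s. p (E i s) = poly P s" by blast
    then show "\<exists>P k. i \<in> S \<longrightarrow> (\<forall>z. z \<noteq> 0 \<longrightarrow> \<tau> (E i z) $ a $ b = poly P z / z ^ k)"
      using p(2)[OF E_D] by (intro exI[of _ P] exI[of _ k]) (simp add: E_det)
  qed
  then obtain P kf where P: "\<And>i a b z. i \<in> S \<Longrightarrow> z \<noteq> 0 \<Longrightarrow> \<tau> (E i z) $ a $ b = poly (P i a b) z / z ^ kf i a b"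
    by metis
  \<comment> \<open>A common bound for all pole orders at 0; after multiplication by z^K all these
    entries are polynomials.\<close>
  define K where "K = (\<Sum>i\<in>UNIV. \<Sum>a\<in>UNIV. \<Sum>b\<in>UNIV. kf i a b)"
  have sum3: "f i a b \<le> (\<Sum>i\<in>UNIV. \<Sum>a\<in>UNIV. \<Sum>b\<in>UNIV. f i a b)" for f :: "'n \<Rightarrow> 4 \<Rightarrow> 4 \<Rightarrow> nat" and i a b
  proof -
    have "f i a b \<le> (\<Sum>b\<in>UNIV. f i a b)" by (rule member_le_sum) auto
    also have "\<dots> \<le> (\<Sum>a\<in>UNIV. \<Sum>b\<in>UNIV. f i a b)" by (rule member_le_sum) auto
    also have "\<dots> \<le> (\<Sum>i\<in>UNIV. \<Sum>a\<in>UNIV. \<Sum>b\<in>UNIV. f i a b)" by (rule member_le_sum) auto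
    finally show ?thesis .
  qed
  define Q where "Q i a b = P i a b * monom 1 (K - kf i a b)" for i a b
  have Q: "\<tau> (E i z) $ a $ b * z ^ K = poly (Q i a b) z" if "i \<in> S" "z \<noteq> 0" for i a b z
  proof -
    have "kf i a b \<le> K" unfolding K_def by (rule sum3)
    then have "z ^ K = z ^ kf i a b * z ^ (K - kf i a b)" by (simp add: power_add[symmetric])
    then show ?thesis using P[OF that] that(2) by (simp add: Q_def poly_monom)
  qed
  \<comment> \<open>Larger than all degrees, so that a combination of the polynomials
    \<open>Q\<close> that vanishes at all N-th roots of unity is zero.\<close>
  define N where "N = Suc (\<Sum>i\<in>UNIV. \<Sum>a\<in>UNIV. \<Sum>b\<in>UNIV. degree (Q i a b))"
  have N: "degree (Q i a b) < N" for i a b unfolding N_def using sum3[of "\<lambda>i a b. degree (Q i a b)"] by (simp add: le_imp_less_Suc)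
  have N0: "N > 0" by (simp add: N_def)
  define F where "F = {d \<in> D. \<forall>i. d $ i $ i ^ N = 1}"
  have FD: "F \<subseteq> D" by (auto simp: F_def)
  have finF: "finite F"
  proof (rule finite_subset[OF _ finite_matrices])
    show "F \<subseteq> {d. \<forall>i j. d $ i $ j \<in> insert 0 {z. z ^ N = 1}}"
    proof (intro subsetI CollectI allI)
      fix d i j assume "d \<in> F"
      then show "d $ i $ j \<in> insert 0 {z. z ^ N = 1}"
        by (cases "i = j") (auto simp: F_def D_def diagonal_torus_def)
    qed
    show "finite (insert 0 {z :: complex. z ^ N = 1})" using finite_roots_unity[of N, where 'a = complex] N0 by simp
  qed
  have F_one: "mat 1 \<in> F" using D_one by (simp add: F_def mat_nth)
  have F_mult: "x ** y \<in> F" if "x \<in> F" "y \<in> F" for x y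
    using that D_mult[of x y] diagonal_torus_mult_nth[of x S y] unfolding F_def D_def by (simp add: power_mult_distrib)
  have F_reindex: "sum f ((**) y ` F) = (\<Sum>d\<in>F. f (y ** d))" "(**) y ` F = F" if y: "y \<in> F" for y and f :: "_ \<Rightarrow> complex^4"
  proof -
    have "invertible y" using y FD DGL by auto
    have inj: "inj_on ((**) y) F"
    proof (rule inj_onI)
      fix a b assume "y ** a = y ** b"
      then have "inv\<^bsub>GL\<^esub> y ** y ** a = inv\<^bsub>GL\<^esub> y ** y ** b" by (simp only: matrix_mul_assoc[symmetric])
      then show "a = b" using inv_GL(2)[OF \<open>invertible y\<close>] by simp
    qed
    show "sum f ((**) y ` F) = (\<Sum>d\<in>F. f (y ** d))" by (simp add: sum.reindex[OF inj])
    show "(**) y ` F = F" by (rule endo_inj_surj[OF finF _ inj]) (auto intro: F_mult y)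
  qed
  \<comment> \<open>The average, up to the factor \<open>card F\<close>, of the k-th basis vector
    twisted by the inverse of the k-th diagonal character. This character is multiplicative on
    triangular matrices, so \<open>v k\<close> is an eigenvector for \<open>F\<close>; triangularity
    also keeps its k-th coordinate nonzero.\<close>
  define v where "v k = (\<Sum>d\<in>F. inverse (\<tau> d $ k $ k) *s (\<tau> d *v axis k 1))" for k
  have nth: "(A *v axis k 1) $ a = A $ a $ k" for A :: "complex^4^4" and k a
    by (simp add: matrix_vector_mult_def axis_def if_distrib cong: if_cong)
  have vk: "v k $ k = of_nat (card F)" for k
  proof -
    have "v k $ k = (\<Sum>d\<in>F. inverse (\<tau> d $ k $ k) * \<tau> d $ k $ k)" by (simp add: v_def nth)
    also have "\<dots> = (\<Sum>d\<in>F. 1)" using B4_diag_nz[OF \<tau>B] FD by (intro sum.cong) auto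
    finally show ?thesis by simp
  qed
  have va: "v k $ a = 0" if "pos4 k < pos4 a" for k a
    unfolding v_def using B4_pos[OF \<tau>B that] FD by (simp add: nth) (intro sum.neutral, auto)
  have evF: "\<tau> y *v v k = \<tau> y $ k $ k *s v k" if y: "y \<in> F" for y k
  proof -
    let ?g = "\<lambda>d. inverse (\<tau> d $ k $ k) *s (\<tau> d *v axis k 1)"
    have "\<tau> y *v v k = (\<Sum>d\<in>F. \<tau> y $ k $ k *s ?g (y ** d))"
      unfolding v_def matrix_vector_sum
    proof (rule sum.cong[OF refl])
      fix d assume d: "d \<in> F"
      have yd: "y \<in> D" "d \<in> D" using y d FD by auto
      note B = \<tau>B[OF yd(1)] \<tau>B[OF yd(2)] \<tau>m[OF yd]
      show "\<tau> y *v ?g d = \<tau> y $ k $ k *s ?g (y ** d)"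
        using B4_diag_nz[OF B(1), of k] B4_diag_nz[OF B(2), of k]
        by (simp add: B(3) B4_mult_diag[OF B(1,2)] vector_scalar_commute vector_smult_assoc matrix_vector_mul_assoc)
    qed
    also have "\<dots> = (\<Sum>d\<in>(**) y ` F. \<tau> y $ k $ k *s ?g d)" by (rule F_reindex(1)[OF y, symmetric])
    also have "\<dots> = \<tau> y $ k $ k *s v k"
      unfolding F_reindex(2)[OF y] v_def by (simp add: vec_eq_iff sum_distrib_left mult.assoc)
    finally show ?thesis .
  qed
  have evE: "\<tau> (E i z) *v v k = \<tau> (E i z) $ k $ k *s v k" if i: "i \<in> S" and z: "z \<noteq> 0" for i z k
  proof -
    have "(\<tau> (E i z) *v v k) $ a = (\<tau> (E i z) $ k $ k *s v k) $ a" for a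
    proof -
      \<comment> \<open>Up to the factor z^K this is one coordinate of the failure of the
        eigenvector equation at \<open>E i z\<close>. It vanishes at the N-th roots of unity,
        because there \<open>E i z\<close> lies in \<open>F\<close>.\<close>
      define R where "R = (\<Sum>b\<in>UNIV. smult (v k $ b) (Q i a b)) - smult (v k $ a) (Q i k k)"
      have R: "poly R z = ((\<tau> (E i z) *v v k) $ a - (\<tau> (E i z) $ k $ k *s v k) $ a) * z ^ K" if "z \<noteq> 0" for z
        unfolding R_def using Q[OF i that, symmetric]
        by (simp add: poly_sum matrix_vector_mult_def sum_distrib_right sum_distrib_left left_diff_distrib
            right_diff_distrib mult_ac)
      have "R = 0"
      proof (rule ccontr)
        assume "R \<noteq> 0"
        have "{z. z ^ N = 1} \<subseteq> {z. poly R z = 0}"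
        proof
          fix \<zeta> :: complex assume "\<zeta> \<in> {z. z ^ N = 1}"
          then have \<zeta>: "\<zeta> ^ N = 1" "\<zeta> \<noteq> 0" using N0 by (auto simp: power_0_left)
          have "E i \<zeta> \<in> F" using E_D[OF i \<zeta>(2)] \<zeta>(1) by (simp add: F_def E_def)
          then show "\<zeta> \<in> {z. poly R z = 0}" using evF R[OF \<zeta>(2)] by simp
        qed
        then have "card {z :: complex. z ^ N = 1} \<le> card {z. poly R z = 0}"
          using \<open>R \<noteq> 0\<close> by (intro card_mono poly_roots_finite)
        also have "\<dots> \<le> degree R" by (rule card_poly_roots_bound[OF \<open>R \<noteq> 0\<close>])
        also have "\<dots> < N"
          unfolding R_def
        proof (rule degree_diff_less)
          have "degree (\<Sum>b\<in>UNIV. smult (v k $ b) (Q i a b)) \<le> N - 1"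
            using N by (intro degree_sum_le) (auto intro: order_trans[OF degree_smult_le] simp: less_Suc_eq_le N_def)
          then show "degree (\<Sum>b\<in>UNIV. smult (v k $ b) (Q i a b)) < N" using N0 by linarith
          show "degree (smult (v k $ a) (Q i k k)) < N" using N degree_smult_le le_less_trans by blast
        qed
        finally show False using card_roots_unity_eq[of N] N0 by simp
      qed
      then show ?thesis using R[OF z] z by simp
    qed
    then show ?thesis by (simp add: vec_eq_iff)
  qed
  \<comment> \<open>The coordinates outside \<open>X\<close> are set to 1, so that d is reached from
    the identity by one-parameter factors, in an induction over \<open>X\<close>.\<close>
  define rs where "rs X d = (\<chi> a b. if a = b then (if a \<in> X then d $ a $ a else 1) else 0)"
    for X and d :: "complex^'n^'n"
  have rsD: "rs X d \<in> D" if "d \<in> D" for X d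
    unfolding D_def using that diagonal_torus_det(2)[of d S]
    by (intro diagonal_torusI) (auto simp: rs_def D_def diagonal_torus_def)
  have evrs: "\<tau> (rs X d) *v v k = \<tau> (rs X d) $ k $ k *s v k" if d: "d \<in> D" and "X \<subseteq> S" for X d k
  proof -
    have "finite X" by simp
    then show ?thesis using \<open>X \<subseteq> S\<close>
    proof (induction X)
      case empty
      have "rs {} d = mat 1" by (simp add: rs_def vec_eq_iff mat_nth)
      then show ?case using evF[OF F_one] by simp
    next
      case (insert i X)
      have i: "i \<in> S" "d $ i $ i \<noteq> 0" using insert.prems diagonal_torus_det(2)[of d S] d by (auto simp: D_def)
      note Ei = E_D[OF i]
      have e: "rs (insert i X) d = E i (d $ i $ i) ** rs X d"
        using insert.hyps by (simp add: vec_eq_iff diagonal_torus_mult_nth[OF Ei[unfolded D_def]]) (auto simp: E_def rs_def)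
      have m: "\<tau> (rs (insert i X) d) = \<tau> (E i (d $ i $ i)) ** \<tau> (rs X d)"
        unfolding e by (rule \<tau>m[OF Ei rsD[OF d]])
      have "\<tau> (rs X d) *v v k = \<tau> (rs X d) $ k $ k *s v k" using insert by blast
      then show ?case unfolding m B4_mult_diag[OF \<tau>B[OF Ei] \<tau>B[OF rsD[OF d]]]
        by (simp add: matrix_vector_mul_assoc[symmetric] vector_scalar_commute evE[OF i] vector_smult_assoc mult.commute)
    qed
  qed
  have cF: "card F \<noteq> 0" using F_one finF by auto
  show ?thesis
  proof (rule symplectic_eigenbasis[where w = "\<lambda>k. inverse (of_nat (card F)) *s v k"])
    show "t \<in> B4" if "t \<in> T0" for t using that T0 by blast
    show "(inverse (of_nat (card F)) *s v k) $ k = 1" for k using cF by (simp add: vk)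
    show "(inverse (of_nat (card F)) *s v k) $ a = 0" if "pos4 k < pos4 a" for k a by (simp add: va[OF that])
    show "t *v (inverse (of_nat (card F)) *s v k) = t $ k $ k *s (inverse (of_nat (card F)) *s v k)" if t: "t \<in> T0" for t k
    proof -
      obtain d where d: "d \<in> D" "\<tau> d = t" using \<tau>surj[OF t] by blast
      have "rs S d = d" using d(1) by (auto simp: rs_def D_def diagonal_torus_def vec_eq_iff)
      then have "t *v v k = t $ k $ k *s v k" using evrs[OF d(1) order_refl, of k] d(2) by simp
      then show ?thesis by (simp add: vector_scalar_commute vector_smult_assoc mult.commute)
    qed
  qed
qed

text \<open>The preceding result puts \<open>T\<close> inside a conjugate of the standard torus.
  That conjugate is itself a torus, so maximality gives equality. The conjugating element lies in
  \<open>B4\<close> and so does not disturb the Borel subgroup.\<close>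

lemma (in sp4_rep) maximal_torus_conj:
  fixes p q :: 'n
  assumes T: "maximal_torus (Psi ` Sp4) T" "T \<subseteq> Psi ` B4" and pq: "p \<noteq> q"
  shows "\<exists>b\<in>B4. T = (\<lambda>A. Psi (b ** A ** adj b)) ` T4"
proof -
  obtain T0 where T0: "T0 \<subseteq> B4" "T = Psi ` T0" using T(2) by (meson subset_imageE)
  obtain b where b: "b \<in> B4" "\<forall>t\<in>T0. adj b ** t ** b \<in> T4"
    using torus_conj[OF T0(1)] T(1) T0(2) unfolding maximal_torus_def by blast
  have bS: "b \<in> Sp4" using b(1) by (simp add: B4_def)
  let ?Q = "\<lambda>A. Psi (b ** A ** adj b)"
  interpret Q: sp4_rep ?Q "\<lambda>i j X. (adj b ** (\<chi> k l. rho k l X) ** b) $ i $ j"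
    by (rule sp4_rep_conj[OF sp4_rep_axioms bS])
  have "T \<subseteq> ?Q ` T4"
  proof
    fix X assume "X \<in> T"
    then obtain h where h: "h \<in> T0" "X = Psi h" using T0 by blast
    then show "X \<in> ?Q ` T4" using b by (intro image_eqI[of _ _ "adj b ** h ** b"]) (auto simp: conj_inverse bS)
  qed
  moreover have "?Q ` T4 \<subseteq> Psi ` Sp4" using bS by (auto simp: T4_def intro!: Sp4_mult Sp4_adj_closed)
  moreover have "torus (?Q ` T4)" by (rule Q.torus_T4[OF pq])
  ultimately have "?Q ` T4 = T" using T(1) unfolding maximal_torus_def by blast
  then show ?thesis using b(1) by blast
qed

section \<open>Polynomial functions in four variables\<close>

inductive_set PF :: "(complex^4 \<Rightarrow> complex) set" where
  const: "(\<lambda>_. c) \<in> PF"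
| coord: "(\<lambda>x. x $ i) \<in> PF"
| add: "f \<in> PF \<Longrightarrow> g \<in> PF \<Longrightarrow> (\<lambda>x. f x + g x) \<in> PF"
| mult: "f \<in> PF \<Longrightarrow> g \<in> PF \<Longrightarrow> (\<lambda>x. f x * g x) \<in> PF"

lemma PF_cmult: "f \<in> PF \<Longrightarrow> (\<lambda>x. c * f x) \<in> PF"
  by (rule PF.mult[OF PF.const])

lemma PF_uminus: "f \<in> PF \<Longrightarrow> (\<lambda>x. - f x) \<in> PF"
  using PF_cmult[of f "-1"] by simp

lemma PF_diff: "f \<in> PF \<Longrightarrow> g \<in> PF \<Longrightarrow> (\<lambda>x. f x - g x) \<in> PF"
  using PF.add[OF _ PF_uminus, of f g] by simp

lemma PF_comp:
  assumes "f \<in> PF" "\<And>i. (\<lambda>x. \<kappa> x $ i) \<in> PF" shows "(\<lambda>x. f (\<kappa> x)) \<in> PF"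
  using assms(1) by induction (auto intro: PF.intros assms(2))

lemma PF_poly_fun:
  assumes "p \<in> poly_fun" "\<And>i j. (\<lambda>x. \<phi> x $ i $ j) \<in> PF" shows "(\<lambda>x. p (\<phi> x)) \<in> PF"
  by (rule poly_fun_compose[OF assms(1), where Q = "\<lambda>f. f \<in> PF"]) (auto intro: PF.intros assms(2))

lemma PF_matrix_mult:
  fixes f g :: "complex^4 \<Rightarrow> complex^4^4"
  assumes "\<And>i j. (\<lambda>x. f x $ i $ j) \<in> PF" "\<And>i j. (\<lambda>x. g x $ i $ j) \<in> PF"
  shows "(\<lambda>x. (f x ** g x) $ i $ j) \<in> PF"
  unfolding mult4 by (intro PF.add PF.mult assms)

text \<open>Two points of four-space are joined by a line, on which polynomial conditions become
  univariate; this yields irreducibility.\<close>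

lemma PF_line:
  assumes "f \<in> PF" shows "\<exists>P. \<forall>s. f (x + s *s (y - x)) = poly P s"
  using assms
proof induction
  case (const c)
  show ?case by (rule exI[of _ "[:c:]"]) simp
next
  case (coord i)
  show ?case by (rule exI[of _ "[:x $ i, y $ i - x $ i:]"]) (simp add: algebra_simps)
next
  case (add f g)
  then show ?case by (metis poly_add)
next
  case (mult f g)
  then show ?case by (metis poly_mult)
qed

text \<open>Polynomials in four variables are nested univariate ones, so that greatest common
  divisors exist by iterating the result on univariate polynomials over a factorial ring. The
  outermost variable is the first coordinate.\<close>

definition eval4 :: "complex poly poly poly poly \<Rightarrow> complex^4 \<Rightarrow> complex" where
  "eval4 p x = poly (poly (poly (poly p [:[:[:x $ 1:]:]:]) [:[:x $ 2:]:]) [:x $ 3:]) (x $ 4)"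

lemma eval4_simps [simp]:
  "eval4 (p + q) x = eval4 p x + eval4 q x" "eval4 (p * q) x = eval4 p x * eval4 q x"
  "eval4 (p - q) x = eval4 p x - eval4 q x" "eval4 0 x = 0" "eval4 1 x = 1" "eval4 (p ^ k) x = eval4 p x ^ k"
  by (simp_all add: eval4_def)

lemma eval4_sum: "eval4 (sum f I) x = (\<Sum>i\<in>I. eval4 (f i) x)"
  by (induction I rule: infinite_finite_induct) auto

lemma eval4_prod: "eval4 (prod f I) x = (\<Prod>i\<in>I. eval4 (f i) x)"
  by (induction I rule: infinite_finite_induct) auto

lemma eval4_PF: "(\<lambda>x. eval4 p x) \<in> PF"
proof -
  have 1: "(\<lambda>x. poly p (x $ 4)) \<in> PF" for p :: "complex poly"
    by (induction p) (auto intro!: PF.intros)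
  have 2: "(\<lambda>x. poly (poly p [:x $ 3:]) (x $ 4)) \<in> PF" for p :: "complex poly poly"
    by (induction p) (auto intro!: PF.intros 1)
  have 3: "(\<lambda>x. poly (poly (poly p [:[:x $ 2:]:]) [:x $ 3:]) (x $ 4)) \<in> PF" for p :: "complex poly poly poly"
    by (induction p) (auto intro!: PF.intros 2)
  show ?thesis unfolding eval4_def
    by (induction p) (auto intro!: PF.intros 3)
qed

lemma PF_eval4: "f \<in> PF \<Longrightarrow> \<exists>p. f = eval4 p"
proof (induction rule: PF.induct)
  case (const c)
  show ?case by (rule exI[of _ "[:[:[:[:c:]:]:]:]"]) (simp add: fun_eq_iff eval4_def)
next
  case (coord i)
  have "(\<lambda>x. x $ 1) = eval4 [:0, 1:]" "(\<lambda>x. x $ 2) = eval4 [:[:0, 1:]:]"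
    "(\<lambda>x. x $ 3) = eval4 [:[:[:0, 1:]:]:]" "(\<lambda>x. x $ 4) = eval4 [:[:[:[:0, 1:]:]:]:]"
    by (simp_all add: fun_eq_iff eval4_def)
  then show ?case using exhaust_4[of i] by blast
next
  case (add f g)
  then obtain p q where "f = eval4 p" "g = eval4 q" by blast
  then show ?case by (intro exI[of _ "p + q"]) (simp add: fun_eq_iff)
next
  case (mult f g)
  then obtain p q where "f = eval4 p" "g = eval4 q" by blast
  then show ?case by (intro exI[of _ "p * q"]) (simp add: fun_eq_iff)
qed

lemma poly_nonzero_value:
  fixes p :: "'a::idom poly" and f :: "complex \<Rightarrow> 'a"
  assumes "p \<noteq> 0" "inj f" shows "\<exists>c. poly p (f c) \<noteq> 0"
proof (rule ccontr)
  assume "\<not> ?thesis"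
  then have "range f \<subseteq> {x. poly p x = 0}" by auto
  then have "finite (range f)" using poly_roots_finite[OF assms(1)] finite_subset by blast
  then show False using finite_imageD[OF _ assms(2)] infinite_UNIV_char_0 by blast
qed

lemma eval4_nonzero: "p \<noteq> 0 \<Longrightarrow> \<exists>x. eval4 p x \<noteq> 0"
proof -
  assume "p \<noteq> 0"
  from poly_nonzero_value[OF this, of "\<lambda>c. [:[:[:c:]:]:]"]
  obtain a where "poly p [:[:[:a:]:]:] \<noteq> 0" by (auto simp: inj_def)
  from poly_nonzero_value[OF this, of "\<lambda>c. [:[:c:]:]"]
  obtain b where "poly (poly p [:[:[:a:]:]:]) [:[:b:]:] \<noteq> 0" by (auto simp: inj_def)
  from poly_nonzero_value[OF this, of "\<lambda>c. [:c:]"]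
  obtain c where "poly (poly (poly p [:[:[:a:]:]:]) [:[:b:]:]) [:c:] \<noteq> 0" by (auto simp: inj_def)
  from poly_nonzero_value[OF this, of "\<lambda>c. c"]
  obtain d where "poly (poly (poly (poly p [:[:[:a:]:]:]) [:[:b:]:]) [:c:]) d \<noteq> 0" by auto
  then show ?thesis by (intro exI[of _ "vec4 a b c d"]) (simp add: eval4_def)
qed

lemma eval4_eqI: "(\<And>x. eval4 p x = eval4 q x) \<Longrightarrow> p = q"
  using eval4_nonzero[of "p - q"] by auto

lemma eval4_eq_on_open:
  assumes "r \<noteq> 0" "\<And>x. eval4 r x \<noteq> 0 \<Longrightarrow> eval4 p x = eval4 q x" shows "p = q"
proof -
  have "(p - q) * r = 0" by (rule eval4_eqI) (use assms(2) in auto)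
  then show ?thesis using assms(1) by simp
qed

lemma PF_nonzero_mult:
  assumes "f \<in> PF" "g \<in> PF" "f x \<noteq> 0" "g y \<noteq> 0" shows "\<exists>z. f z \<noteq> 0 \<and> g z \<noteq> 0"
proof -
  obtain p q where "f = eval4 p" "g = eval4 q" using PF_eval4 assms(1,2) by metis
  moreover have "p * q \<noteq> 0" using assms(3,4) calculation by auto
  ultimately show ?thesis using eval4_nonzero[of "p * q"] by auto
qed

text \<open>Polynomial rings over a field are factorial, hence integrally closed: a rational function that is
  integral over the local rings at the points of \<open>V\<close> has a reduced denominator without zeros on \<open>V\<close>.\<close>

lemma integral_rational_function:
  fixes h :: "complex^4 \<Rightarrow> complex" and n :: nat
  assumes D: "D \<noteq> {}" "\<And>x. x \<in> D \<Longrightarrow> \<exists>r\<in>PF. r x \<noteq> 0 \<and> (\<forall>y. r y \<noteq> 0 \<longrightarrow> y \<in> D)"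
    and h: "\<And>x. x \<in> D \<Longrightarrow> \<exists>p\<in>PF. \<exists>q\<in>PF. q x \<noteq> 0 \<and> (\<forall>y\<in>D. q y \<noteq> 0 \<longrightarrow> h y = p y / q y)"
    and V: "\<And>x. x \<in> V \<Longrightarrow> \<exists>r\<in>PF. r x \<noteq> 0 \<and> (\<forall>y. r y \<noteq> 0 \<longrightarrow> y \<in> V)"
    and a: "\<And>i x. i < n \<Longrightarrow> x \<in> V \<Longrightarrow> \<exists>p\<in>PF. \<exists>q\<in>PF. q x \<noteq> 0 \<and> (\<forall>y\<in>V. q y \<noteq> 0 \<longrightarrow> a i y = p y / q y)"
    and eq: "\<And>y. y \<in> D \<Longrightarrow> y \<in> V \<Longrightarrow> h y ^ n + (\<Sum>i<n. a i y * h y ^ i) = 0"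
  shows "\<exists>p\<in>PF. \<exists>q\<in>PF. (\<forall>x\<in>V. q x \<noteq> 0) \<and> (\<forall>x\<in>D. h x * q x = p x) \<and> (\<exists>x. q x \<noteq> 0)"
proof -
  have Dp: "\<exists>r. eval4 r x \<noteq> 0 \<and> (\<forall>y. eval4 r y \<noteq> 0 \<longrightarrow> y \<in> D)" if "x \<in> D" for x
    using D(2)[OF that] PF_eval4 by metis
  have hp: "\<exists>p q. eval4 q x \<noteq> 0 \<and> (\<forall>y\<in>D. eval4 q y \<noteq> 0 \<longrightarrow> h y = eval4 p y / eval4 q y)" if "x \<in> D" for x
    using h[OF that] PF_eval4 by metis
  obtain x0 where x0: "x0 \<in> D" using D(1) by blast
  obtain p0 q0 where pq0: "eval4 q0 x0 \<noteq> 0" "\<And>y. y \<in> D \<Longrightarrow> eval4 q0 y \<noteq> 0 \<Longrightarrow> h y = eval4 p0 y / eval4 q0 y"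
    using hp[OF x0] by blast
  have q00: "q0 \<noteq> 0" using pq0(1) by auto
  then obtain P Q g where PQ: "p0 = P * g" "q0 = Q * g" "coprime P Q" "g \<noteq> 0"
    using gcd_coprime_exists[of p0 q0] by (metis gcd_eq_0_iff)
  have Q0: "Q \<noteq> 0" using q00 PQ by auto
  \<comment> \<open>Local fractions for \<open>h\<close> agree with P / Q on a nonempty open set,
    hence identically. So the reduced fraction found near one point is valid on all of
    \<open>D\<close>.\<close>
  have hQ: "h x * eval4 Q x = eval4 P x" if x: "x \<in> D" for x
  proof -
    obtain p q where pq: "eval4 q x \<noteq> 0" "\<And>y. y \<in> D \<Longrightarrow> eval4 q y \<noteq> 0 \<Longrightarrow> h y = eval4 p y / eval4 q y"
      using hp[OF x] by blast
    obtain r where r: "eval4 r x \<noteq> 0" "\<And>y. eval4 r y \<noteq> 0 \<Longrightarrow> y \<in> D" using Dp[OF x] by blast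
    have "p * q0 = p0 * q"
    proof (rule eval4_eq_on_open[of "r * q * q0"])
      show "r * q * q0 \<noteq> 0" using r(1) pq(1) q00 by auto
      fix y assume "eval4 (r * q * q0) y \<noteq> 0"
      then have y: "y \<in> D" "eval4 q y \<noteq> 0" "eval4 q0 y \<noteq> 0" using r(2) by auto
      have "eval4 p y / eval4 q y = eval4 p0 y / eval4 q0 y" using pq(2)[OF y(1,2)] pq0(2)[OF y(1,3)] by simp
      then show "eval4 (p * q0) y = eval4 (p0 * q) y" using y by (simp add: frac_eq_eq)
    qed
    then have "(p * Q) * g = (P * q) * g" using PQ by (simp add: mult_ac)
    then have "p * Q = P * q" using PQ(4) by simp
    then have "eval4 p x * eval4 Q x = eval4 P x * eval4 q x" by (metis eval4_simps(2))
    moreover have "eval4 p x = h x * eval4 q x" using pq(2)[OF x pq(1)] pq(1) by simp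
    ultimately have "eval4 q x * (h x * eval4 Q x) = eval4 q x * eval4 P x" by (simp add: mult_ac)
    then show ?thesis using pq(1) by simp
  qed
  have "eval4 Q x \<noteq> 0" if x: "x \<in> V" for x
  proof -
    have "\<forall>i. \<exists>b c. i < n \<longrightarrow> eval4 c x \<noteq> 0 \<and> (\<forall>y\<in>V. eval4 c y \<noteq> 0 \<longrightarrow> a i y = eval4 b y / eval4 c y)"
      using a[OF _ x] PF_eval4 by metis
    then obtain b c where bc: "\<And>i. i < n \<Longrightarrow> eval4 (c i) x \<noteq> 0"
      "\<And>i y. i < n \<Longrightarrow> y \<in> V \<Longrightarrow> eval4 (c i) y \<noteq> 0 \<Longrightarrow> a i y = eval4 (b i) y / eval4 (c i) y" by metis
    \<comment> \<open>A common denominator of the coefficients of the integral equation that does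
      not vanish at x.\<close>
    define C where "C = (\<Prod>i<n. c i)"
    have Cx: "eval4 C x \<noteq> 0" using bc(1) by (simp add: C_def eval4_prod)
    obtain r where r: "eval4 r x \<noteq> 0" "\<And>y. eval4 r y \<noteq> 0 \<Longrightarrow> y \<in> V" using V[OF x] PF_eval4 by metis
    obtain s where s: "eval4 s x0 \<noteq> 0" "\<And>y. eval4 s y \<noteq> 0 \<Longrightarrow> y \<in> D" using Dp[OF x0] by blast
    \<comment> \<open>After multiplication by C Q^n each term with i < n keeps a factor Q;
      \<open>S\<close> collects the terms with this factor removed. So Q divides C P^n, hence C, and
      cannot vanish at x.\<close>
    define S where "S = (\<Sum>i<n. b i * (\<Prod>j\<in>{..<n} - {i}. c j) * P ^ i * Q ^ (n - i - 1))"
    have "C * P ^ n + Q * S = 0"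
    proof (rule eval4_eq_on_open[of "C * r * s * Q"])
      show "C * r * s * Q \<noteq> 0" using Cx r(1) s(1) Q0 by auto
      fix y assume "eval4 (C * r * s * Q) y \<noteq> 0"
      then have y: "y \<in> V" "y \<in> D" "eval4 C y \<noteq> 0" "eval4 Q y \<noteq> 0" using r(2) s(2) by auto
      have cy: "eval4 (c i) y \<noteq> 0" if "i < n" for i using y(3) that by (auto simp: C_def eval4_prod)
      have t: "eval4 Q y * eval4 (b i * (\<Prod>j\<in>{..<n} - {i}. c j) * P ^ i * Q ^ (n - i - 1)) y =
          eval4 C y * eval4 Q y ^ n * (a i y * h y ^ i)" if i: "i < n" for i
      proof -
        have "eval4 C y = eval4 (c i) y * eval4 (\<Prod>j\<in>{..<n} - {i}. c j) y"
          unfolding C_def eval4_prod using i by (subst prod.remove[of _ i]) auto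
        moreover have "eval4 Q y ^ n = eval4 Q y ^ i * (eval4 Q y * eval4 Q y ^ (n - i - 1))"
        proof -
          have n: "i + Suc (n - i - 1) = n" using i by simp
          have "eval4 Q y ^ (i + Suc (n - i - 1)) = eval4 Q y ^ i * (eval4 Q y * eval4 Q y ^ (n - i - 1))"
            by (simp only: power_add power_Suc)
          then show ?thesis by (simp only: n)
        qed
        moreover have "eval4 (b i) y = a i y * eval4 (c i) y" using bc(2)[OF i y(1) cy[OF i]] cy[OF i] by simp
        moreover have "eval4 P y ^ i = h y ^ i * eval4 Q y ^ i"
          by (simp only: hQ[OF y(2), symmetric] power_mult_distrib)
        ultimately show ?thesis by (simp add: mult_ac)
      qed
      have "eval4 (C * P ^ n + Q * S) y = eval4 C y * eval4 P y ^ n + (\<Sum>i<n. eval4 C y * eval4 Q y ^ n * (a i y * h y ^ i))"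
        using t by (simp add: S_def eval4_sum sum_distrib_left)
      also have "eval4 P y ^ n = eval4 Q y ^ n * h y ^ n" by (simp only: hQ[OF y(2), symmetric] power_mult_distrib mult.commute)
      also have "eval4 C y * (eval4 Q y ^ n * h y ^ n) + (\<Sum>i<n. eval4 C y * eval4 Q y ^ n * (a i y * h y ^ i)) =
        eval4 C y * eval4 Q y ^ n * (h y ^ n + (\<Sum>i<n. a i y * h y ^ i))"
        by (simp add: sum_distrib_left distrib_left mult_ac)
      finally show "eval4 (C * P ^ n + Q * S) y = eval4 0 y" using eq[OF y(2,1)] by simp
    qed
    then have "C * P ^ n = Q * (- S)" by (simp add: add_eq_0_iff2)
    then have "Q dvd C * P ^ n" by simp
    moreover have "coprime Q (P ^ n)" using PQ(3) by (simp add: coprime_commute)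
    ultimately have "Q dvd C" by (simp add: coprime_dvd_mult_left_iff)
    then obtain k where "C = Q * k" by blast
    then show ?thesis using Cx by auto
  qed
  then show ?thesis using hQ eval4_PF eval4_nonzero[OF Q0]
    by (intro bexI[of _ "eval4 P"] bexI[of _ "eval4 Q"]) auto
qed

section \<open>The big cell\<close>

text \<open>The Pluecker coordinates of the plane spanned by the first two columns.\<close>

definition mn :: "complex^4^4 \<Rightarrow> 4 \<Rightarrow> 4 \<Rightarrow> complex" where
  "mn A i j = A $ i $ 1 * A $ j $ 2 - A $ j $ 1 * A $ i $ 2"

definition low4 :: "complex^4 \<Rightarrow> complex^4^4" where
  "low4 y = low (y $ 1) (y $ 2) (y $ 3) (y $ 4)"

definition upp4 :: "complex^4 \<Rightarrow> complex^4^4" where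
  "upp4 y = upp (y $ 1) (y $ 2) (y $ 3) (y $ 4)"

text \<open>Ratios of functions that right multiplication by \<open>B4\<close> changes only by a
  common factor; hence functions of the flag. They are the coordinates of the lower unipotent factor
  on the big cell.\<close>

definition psi4 :: "complex^4^4 \<Rightarrow> complex^4" where
  "psi4 A = vec4 (A$2$1 / A$1$1) (mn A 1 3 / mn A 1 2) (mn A 1 4 / mn A 1 2) (- mn A 2 4 / mn A 1 2)"

definition bigcell :: "(complex^4^4) set" where
  "bigcell = {A. A$1$1 \<noteq> 0 \<and> mn A 1 2 \<noteq> 0}"

text \<open>This is the isotropy of the plane spanned by the first two columns.\<close>

lemma mn_14_23: "A \<in> Sp4 \<Longrightarrow> mn A 1 4 = - mn A 2 3"
  by (simp add: Sp4_cols mn_def) (simp add: algebra_simps add_eq_0_iff2 eq_neg_iff_add_eq_0)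

lemma PF_low4: "(\<lambda>x. low4 x $ i $ j) \<in> PF" and PF_upp4: "(\<lambda>x. upp4 x $ i $ j) \<in> PF"
  using exhaust_4[of i] exhaust_4[of j]
  by (auto simp: low4_def low_def upp4_def upp_def intro!: PF.intros PF_uminus)

lemma low4_Sp4: "low4 y \<in> Sp4" and upp4_U4: "upp4 y \<in> U4"
  by (simp_all add: low4_def low_Sp4 upp4_def upp_U4)

lemma bigcell_decomp:
  assumes A: "A \<in> Sp4" "A \<in> bigcell"
  shows "adj (low4 (psi4 A)) ** A \<in> B4" "A = low4 (psi4 A) ** (adj (low4 (psi4 A)) ** A)"
proof -
  let ?L = "low4 (psi4 A)"
  have nz: "A$1$1 \<noteq> 0" "mn A 1 2 \<noteq> 0" using A(2) by (auto simp: bigcell_def)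
  note m = mn_14_23[OF A(1)]
  have S: "adj ?L ** A \<in> Sp4" using A(1) low4_Sp4 by (intro Sp4_mult Sp4_adj_closed)
  have r2: "- (A$2$1 / A$1$1) * A$1$1 + A$2$1 = 0" using nz by simp
  \<comment> \<open>After the isotropy relation is inserted, this expands a three by three
    determinant of rows 1, 2, 3 with a repeated column; the next fact does the same with rows 1, 2,
    4.\<close>
  have p3: "- (mn A 1 4 / mn A 1 2) * A$1$k - (mn A 1 3 / mn A 1 2) * A$2$k + A$3$k = 0" if "k = 1 \<or> k = 2" for k
  proof -
    have "- (mn A 1 4 / mn A 1 2) * A$1$k - (mn A 1 3 / mn A 1 2) * A$2$k + A$3$k =
      (- mn A 1 4 * A$1$k - mn A 1 3 * A$2$k + mn A 1 2 * A$3$k) / mn A 1 2"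
      using nz by (simp add: field_simps)
    also have "- mn A 1 4 * A$1$k - mn A 1 3 * A$2$k + mn A 1 2 * A$3$k = 0"
      unfolding m using that by (auto simp: mn_def algebra_simps)
    finally show ?thesis by simp
  qed
  have p4: "- (- mn A 2 4 / mn A 1 2) * A$1$1 - (mn A 1 4 / mn A 1 2) * A$2$1 + A$4$1 = 0"
  proof -
    have "- (- mn A 2 4 / mn A 1 2) * A$1$1 - (mn A 1 4 / mn A 1 2) * A$2$1 + A$4$1 =
      (mn A 2 4 * A$1$1 - mn A 1 4 * A$2$1 + mn A 1 2 * A$4$1) / mn A 1 2"
      using nz by (simp add: field_simps)
    also have "mn A 2 4 * A$1$1 - mn A 1 4 * A$2$1 + mn A 1 2 * A$4$1 = 0"
      by (simp add: mn_def algebra_simps)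
    finally show ?thesis by simp
  qed
  have e2: "(adj ?L ** A) $ 2 $ 1 = 0" using r2 by (simp add: mult4 low4_def low_def psi4_def)
  have e3: "(adj ?L ** A) $ 3 $ 1 = 0" "(adj ?L ** A) $ 3 $ 2 = 0"
    using p3[of 1] p3[of 2] by (simp_all add: mult4 low4_def low_def psi4_def)
  have "(adj ?L ** A) $ 4 $ 1 = (- (- mn A 2 4 / mn A 1 2) * A$1$1 - (mn A 1 4 / mn A 1 2) * A$2$1 + A$4$1)
     + (A$2$1 / A$1$1) * (- (mn A 1 4 / mn A 1 2) * A$1$1 - (mn A 1 3 / mn A 1 2) * A$2$1 + A$3$1)"
    by (simp add: mult4 low4_def low_def psi4_def algebra_simps)
  then have e4: "(adj ?L ** A) $ 4 $ 1 = 0" using p4 p3[of 1] by simp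
  show "adj ?L ** A \<in> B4" using S e2 e3 e4 by (simp add: B4_eq)
  show "A = ?L ** (adj ?L ** A)" by (simp add: adj_cancel low4_Sp4)
qed

lemma B4_right_mult:
  assumes "b \<in> B4"
  shows "(A ** b) $ i $ 1 = A $ i $ 1 * b $ 1 $ 1" "mn (A ** b) i j = mn A i j * (b $ 1 $ 1 * b $ 2 $ 2)"
  using assms by (auto simp: mult4 mn_def B4_def algebra_simps)

lemma psi4_right: "b \<in> B4 \<Longrightarrow> psi4 (A ** b) = psi4 A"
  using B4_diag[of b] by (simp add: psi4_def B4_right_mult)

lemma bigcell_right: "b \<in> B4 \<Longrightarrow> A ** b \<in> bigcell \<longleftrightarrow> A \<in> bigcell"
  using B4_diag[of b] by (simp add: bigcell_def B4_right_mult)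

lemma psi4_low4: "psi4 (low4 y) = y" and low4_bigcell: "low4 y \<in> bigcell"
  by (simp_all add: psi4_def low4_def low_def mn_def vec4_eq_iff bigcell_def)

text \<open>Along the orbit of the upper unipotent group the two functions defining the big cell are
  polynomials in four parameters, neither of them identically zero; so they are nonzero together
  somewhere.\<close>

lemma translate_bigcell:
  assumes A: "A \<in> Sp4" shows "\<exists>u\<in>U4. u ** A \<in> bigcell"
proof -
  note c = A[unfolded Sp4_cols]
  let ?f = "\<lambda>y. (upp4 y ** A) $ 1 $ 1" and ?g = "\<lambda>y. mn (upp4 y ** A) 1 2"
  have pf: "(\<lambda>y. (upp4 y ** A) $ i $ j) \<in> PF" for i j by (intro PF_matrix_mult PF_upp4 PF.const)
  have f: "?f \<in> PF" by (rule pf)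
  have g: "?g \<in> PF" unfolding mn_def by (intro PF_diff PF.mult pf)
  have fe: "?f y = A$1$1 + y$1 * A$2$1 + (y$3 + y$1 * y$2) * A$3$1 + (y$4 + y$1 * y$3) * A$4$1" for y
    by (simp add: mult4 upp4_def upp_def)
  have ge: "?g y = mn A 1 2 + y$2 * mn A 1 3 + y$3 * mn A 1 4 - y$3 * mn A 2 3 - y$4 * mn A 2 4
    + (y$3 * y$3 - y$4 * y$2) * mn A 3 4" for y
    by (simp add: mult4 upp4_def upp_def mn_def algebra_simps)
  have "\<exists>y. ?f y \<noteq> 0"
  proof (rule ccontr)
    assume "\<not> ?thesis"
    then have z: "?f y = 0" for y by blast
    have "A$1$1 = 0" "A$2$1 = 0" "A$3$1 = 0" "A$4$1 = 0"
      using z[of "vec4 0 0 0 0"] z[of "vec4 1 0 0 0"] z[of "vec4 0 0 1 0"] z[of "vec4 0 0 0 1"]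
      unfolding fe by simp_all
    then show False using c by simp
  qed
  then obtain y1 where y1: "?f y1 \<noteq> 0" by blast
  have "\<exists>y. ?g y \<noteq> 0"
  proof (rule ccontr)
    assume "\<not> ?thesis"
    then have z: "?g y = 0" for y by blast
    have m12: "mn A 1 2 = 0" and m13: "mn A 1 3 = 0" and m24: "mn A 2 4 = 0"
      using z[of "vec4 0 0 0 0"] z[of "vec4 0 1 0 0"] z[of "vec4 0 0 0 1"] unfolding ge by simp_all
    \<comment> \<open>The parameter values 1 and -1 separate the linear term from the quadratic
      one.\<close>
    have "2 * mn A 1 4 + mn A 3 4 = 0" "mn A 3 4 - 2 * mn A 1 4 = 0"
      using z[of "vec4 0 0 1 0"] z[of "vec4 0 0 (-1) 0"] m12 mn_14_23[OF A] unfolding ge by simp_all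
    then have "mn A 3 4 = ((2 * mn A 1 4 + mn A 3 4) + (mn A 3 4 - 2 * mn A 1 4)) / 2"
      "mn A 1 4 = ((2 * mn A 1 4 + mn A 3 4) - (mn A 3 4 - 2 * mn A 1 4)) / 4" by simp_all
    then have m34: "mn A 3 4 = 0" and m14: "mn A 1 4 = 0"
      using \<open>2 * mn A 1 4 + mn A 3 4 = 0\<close> \<open>mn A 3 4 - 2 * mn A 1 4 = 0\<close> by simp_all
    then have m23: "mn A 2 3 = 0" using mn_14_23[OF A] by simp
    have prod: "A $ i $ 1 * A $ j $ 2 = A $ j $ 1 * A $ i $ 2" for i j
      using m12 m13 m14 m23 m24 m34 exhaust_4[of i] exhaust_4[of j] by (auto simp: mn_def)
    have "A $ i $ 2 = 0" for i
    proof -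
      \<comment> \<open>The bracket is the form on columns 1 and 4, which is 1. If all minors
        vanish, column 2 may be exchanged with column 1, and the bracket becomes the form on columns
        2 and 4, which is 0.\<close>
      have "A $ i $ 2 = A $ i $ 2 * (A$1$1 * A$4$4 + A$2$1 * A$3$4 - A$3$1 * A$2$4 - A$4$1 * A$1$4)"
        using c by simp
      also have "\<dots> = A$1$1 * A$i$2 * A$4$4 + A$2$1 * A$i$2 * A$3$4 - A$3$1 * A$i$2 * A$2$4 - A$4$1 * A$i$2 * A$1$4"
        by (simp add: algebra_simps)
      also have "\<dots> = A$i$1 * A$1$2 * A$4$4 + A$i$1 * A$2$2 * A$3$4 - A$i$1 * A$3$2 * A$2$4 - A$i$1 * A$4$2 * A$1$4"
        unfolding prod[of _ i] by (simp add: prod[of i])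
      also have "\<dots> = A$i$1 * (A$1$2 * A$4$4 + A$2$2 * A$3$4 - A$3$2 * A$2$4 - A$4$2 * A$1$4)"
        by (simp add: algebra_simps)
      also have "\<dots> = 0" using c by simp
      finally show ?thesis .
    qed
    then show False using c by simp
  qed
  then obtain y2 where y2: "?g y2 \<noteq> 0" by blast
  from PF_nonzero_mult[OF f g y1 y2] obtain y where "?f y \<noteq> 0" "?g y \<noteq> 0" by blast
  then show ?thesis using upp4_U4 by (intro bexI[of _ "upp4 y"]) (auto simp: bigcell_def)
qed

lemma PF_psi4_rational:
  assumes "f \<in> PF" shows "\<exists>p\<in>poly_fun. \<exists>q\<in>poly_fun. \<forall>A\<in>bigcell. q A \<noteq> 0 \<and> f (psi4 A) = p A / q A"
  using assms
proof induction
  case (const c)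
  show ?case by (rule bexI[of _ "\<lambda>_. c"], rule bexI[of _ "\<lambda>_. 1"]) (auto intro: poly_fun.const)
next
  case (coord i)
  have mn: "(\<lambda>A. mn A i j) \<in> poly_fun" for i j
    unfolding mn_def by (intro poly_fun_diff poly_fun.mult poly_fun.entry)
  have r: "\<exists>p\<in>poly_fun. \<exists>q\<in>poly_fun. \<forall>A\<in>bigcell. q A \<noteq> 0 \<and> f A = p A / q A"
    if "p \<in> poly_fun" "q \<in> poly_fun" "\<And>A. A \<in> bigcell \<Longrightarrow> q A \<noteq> 0 \<and> f A = p A / q A" for f p q
    using that by (intro bexI[of _ p] bexI[of _ q]) auto
  have "\<exists>p\<in>poly_fun. \<exists>q\<in>poly_fun. \<forall>A\<in>bigcell. q A \<noteq> 0 \<and> psi4 A $ 1 = p A / q A"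
    by (rule r[OF poly_fun.entry poly_fun.entry]) (auto simp: psi4_def bigcell_def)
  moreover have "\<exists>p\<in>poly_fun. \<exists>q\<in>poly_fun. \<forall>A\<in>bigcell. q A \<noteq> 0 \<and> psi4 A $ 2 = p A / q A"
    by (rule r[OF mn mn]) (auto simp: psi4_def bigcell_def)
  moreover have "\<exists>p\<in>poly_fun. \<exists>q\<in>poly_fun. \<forall>A\<in>bigcell. q A \<noteq> 0 \<and> psi4 A $ 3 = p A / q A"
    by (rule r[OF mn mn]) (auto simp: psi4_def bigcell_def)
  moreover have "\<exists>p\<in>poly_fun. \<exists>q\<in>poly_fun. \<forall>A\<in>bigcell. q A \<noteq> 0 \<and> psi4 A $ 4 = p A / q A"
    by (rule r[OF poly_fun_uminus[OF mn] mn]) (auto simp: psi4_def bigcell_def)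
  ultimately show ?case using exhaust_4[of i] by blast
next
  case (add f g)
  then obtain p q p' q' where h: "p \<in> poly_fun" "q \<in> poly_fun" "p' \<in> poly_fun" "q' \<in> poly_fun"
    "\<forall>A\<in>bigcell. q A \<noteq> 0 \<and> f (psi4 A) = p A / q A" "\<forall>A\<in>bigcell. q' A \<noteq> 0 \<and> g (psi4 A) = p' A / q' A" by blast
  show ?case
    by (rule bexI[of _ "\<lambda>A. p A * q' A + p' A * q A"], rule bexI[of _ "\<lambda>A. q A * q' A"])
      (use h in \<open>auto intro!: poly_fun.intros simp: add_frac_eq\<close>)
next
  case (mult f g)
  then obtain p q p' q' where h: "p \<in> poly_fun" "q \<in> poly_fun" "p' \<in> poly_fun" "q' \<in> poly_fun"
    "\<forall>A\<in>bigcell. q A \<noteq> 0 \<and> f (psi4 A) = p A / q A" "\<forall>A\<in>bigcell. q' A \<noteq> 0 \<and> g (psi4 A) = p' A / q' A" by blast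
  show ?case
    by (rule bexI[of _ "\<lambda>A. p A * p' A"], rule bexI[of _ "\<lambda>A. q A * q' A"])
      (use h in \<open>auto intro!: poly_fun.intros\<close>)
qed

section \<open>The flag variety\<close>

context sp4_rep
begin

definition cs :: "complex^4^4 \<Rightarrow> (complex^'n^'n) set" where
  "cs A = Psi A <#\<^bsub>GL\<^esub> (Psi ` B4)"

abbreviation flags :: "(complex^'n^'n) set topology" where
  "flags \<equiv> coset_space (Psi ` Sp4) (Psi ` B4)"

text \<open>Sets of flags are handled through their preimages among four by four matrices, where
  closed and open sets are described by polynomials.\<close>

definition pre :: "(complex^'n^'n) set set \<Rightarrow> (complex^4^4) set" where
  "pre U = {A \<in> Sp4. cs A \<in> U}"

lemma cs_eq: "cs A = (\<lambda>b. Psi (A ** b)) ` B4"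
  by (auto simp: cs_def l_coset_def Psi_mult)

lemma B4_Sp4: "b \<in> B4 \<Longrightarrow> b \<in> Sp4"
  by (simp add: B4_def)

lemma B4_one: "mat 1 \<in> B4" and B4_mult: "a \<in> B4 \<Longrightarrow> b \<in> B4 \<Longrightarrow> a ** b \<in> B4" and B4_adj: "a \<in> B4 \<Longrightarrow> adj a \<in> B4"
  using group4_standard(2) by (auto simp: group4_def)

lemma cs_right: "b \<in> B4 \<Longrightarrow> cs (A ** b) = cs A"
proof -
  assume b: "b \<in> B4"
  have "Psi (A ** c) \<in> cs (A ** b)" if "c \<in> B4" for c
  proof -
    have "A ** c = A ** b ** (adj b ** c)"
      by (simp add: matrix_mul_assoc[symmetric] adj_cancel B4_Sp4[OF b])
    then show ?thesis unfolding cs_eq using b that B4_mult B4_adj by (intro image_eqI[of _ _ "adj b ** c"]) auto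
  qed
  moreover have "Psi (A ** b ** c) \<in> cs A" if "c \<in> B4" for c
    unfolding cs_eq using b that B4_mult by (intro image_eqI[of _ _ "b ** c"]) (auto simp: matrix_mul_assoc)
  ultimately show ?thesis by (auto simp: cs_eq[of "A ** b"] cs_eq[of A])
qed

lemma cs_eqD: "cs A = cs A' \<Longrightarrow> \<exists>b\<in>B4. A' = A ** b"
proof -
  assume "cs A = cs A'"
  moreover have "Psi A' \<in> cs A'" unfolding cs_eq using B4_one by (auto intro!: image_eqI[of _ _ "mat 1"])
  ultimately have "Psi A' \<in> cs A" by simp
  then show ?thesis unfolding cs_eq by auto
qed

lemma cs_act: "Psi h <#\<^bsub>GL\<^esub> cs A = cs (h ** A)"
  by (auto simp: cs_eq l_coset_def Psi_mult matrix_mul_assoc)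

lemma lcosets_eq: "lcosets\<^bsub>sub_group (Psi ` Sp4)\<^esub> (Psi ` B4) = cs ` Sp4"
  by (auto simp: LCOSETS_def cs_def l_coset_def)

lemma coset_preimage_eq: "coset_preimage (Psi ` Sp4) (Psi ` B4) U = Psi ` pre U"
  by (auto simp: coset_preimage_def pre_def cs_def)

lemma openin_Psi_image:
  assumes "X \<subseteq> Sp4"
  shows "openin (subtopology zariski (Psi ` Sp4)) (Psi ` X) \<longleftrightarrow> (\<exists>W. openin zariski W \<and> X = W \<inter> Sp4)"
proof
  assume "openin (subtopology zariski (Psi ` Sp4)) (Psi ` X)"
  then obtain W where W: "openin zariski W" "Psi ` X = W \<inter> Psi ` Sp4" by (auto simp: openin_subtopology)
  have "openin zariski {A. Psi A \<in> W}"
    using continuous_map_zariski_poly[OF Psi_poly] W(1) by (auto simp: continuous_map)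
  moreover have "X = {A. Psi A \<in> W} \<inter> Sp4"
    using W(2) assms by (auto simp: subset_iff) (metis IntI Psi_image_mem)
  ultimately show "\<exists>W. openin zariski W \<and> X = W \<inter> Sp4" by blast
next
  assume "\<exists>W. openin zariski W \<and> X = W \<inter> Sp4"
  then obtain W where W: "openin zariski W" "X = W \<inter> Sp4" by blast
  have "openin zariski {M. rhoM M \<in> W}"
    using continuous_map_zariski_poly[OF rhoM_poly] W(1) by (auto simp: continuous_map)
  moreover have "Psi ` X = {M. rhoM M \<in> W} \<inter> Psi ` Sp4" using W(2) by auto
  ultimately show "openin (subtopology zariski (Psi ` Sp4)) (Psi ` X)" by (auto simp: openin_subtopology)
qed

lemma openin_flags: "openin flags U \<longleftrightarrow> U \<subseteq> cs ` Sp4 \<and> (\<exists>W. openin zariski W \<and> pre U = W \<inter> Sp4)"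
  unfolding openin_coset_space lcosets_eq coset_preimage_eq
  by (subst openin_Psi_image) (auto simp: pre_def)

lemma topspace_flags: "topspace flags = cs ` Sp4"
proof -
  have "pre (cs ` Sp4) = UNIV \<inter> Sp4" by (auto simp: pre_def)
  then have "openin flags (cs ` Sp4)"
    unfolding openin_flags using openin_topspace[of zariski] by auto
  moreover have "U \<subseteq> cs ` Sp4" if "openin flags U" for U using that openin_flags by blast
  ultimately show ?thesis unfolding topspace_def by blast
qed

lemma closedin_flags: "closedin flags C \<longleftrightarrow> C \<subseteq> cs ` Sp4 \<and> closedin zariski (pre C)"
proof -
  have e: "pre (cs ` Sp4 - C) = Sp4 - pre C" by (auto simp: pre_def)
  have "(\<exists>W. openin zariski W \<and> Sp4 - pre C = W \<inter> Sp4) \<longleftrightarrow> closedin zariski (pre C)"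
  proof
    assume "\<exists>W. openin zariski W \<and> Sp4 - pre C = W \<inter> Sp4"
    then obtain W where W: "openin zariski W" "Sp4 - pre C = W \<inter> Sp4" by blast
    have "closedin zariski (- W)" using W(1) by (simp add: closedin_def Compl_eq_Diff_UNIV Diff_Diff_Int)
    moreover have "pre C = - W \<inter> Sp4" using W(2) by (auto simp: pre_def)
    ultimately show "closedin zariski (pre C)" using closedin_Sp4 by auto
  next
    assume "closedin zariski (pre C)"
    then have "openin zariski (- pre C)" by (simp add: closedin_def Compl_eq_Diff_UNIV)
    moreover have "Sp4 - pre C = - pre C \<inter> Sp4" by auto
    ultimately show "\<exists>W. openin zariski W \<and> Sp4 - pre C = W \<inter> Sp4" by blast
  qed
  then show ?thesis by (auto simp: closedin_def topspace_flags openin_flags e)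
qed

lemma pre_cs_image:
  assumes "Z \<subseteq> Sp4" "\<And>A b. A \<in> Z \<Longrightarrow> b \<in> B4 \<Longrightarrow> A ** b \<in> Z"
  shows "pre (cs ` Z) = Z"
proof -
  have "A \<in> Z" if "cs A = cs A'" "A' \<in> Z" for A A'
    using cs_eqD[of A' A] that assms(2) by metis
  then show ?thesis using assms(1) by (auto simp: pre_def)
qed

subsection \<open>Local description of regular functions\<close>

lemma poly_fun_Psi: "p \<in> poly_fun \<Longrightarrow> (\<lambda>A. p (Psi A)) \<in> poly_fun"
  by (rule poly_fun_comp[OF _ Psi_poly])

lemma poly_fun_rhoM: "p \<in> poly_fun \<Longrightarrow> (\<lambda>X. p (rhoM X)) \<in> poly_fun"
  by (rule poly_fun_comp[OF _ rhoM_poly])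

lemma openin_flags_local:
  assumes "openin flags V" "A \<in> pre V"
  shows "\<exists>r\<in>poly_fun. r A \<noteq> 0 \<and> (\<forall>A'\<in>Sp4. r A' \<noteq> 0 \<longrightarrow> A' \<in> pre V)"
proof -
  obtain W where W: "openin zariski W" "pre V = W \<inter> Sp4" using assms(1) openin_flags by blast
  then obtain f where "f \<in> poly_fun" "f A \<noteq> 0" "\<And>y. f y \<noteq> 0 \<Longrightarrow> y \<in> W"
    using openin_zariski_basic[OF W(1)] assms(2) by blast
  then show ?thesis using W(2) by (intro bexI[of _ f]) auto
qed

lemma openin_sub_local:
  assumes "openin (subtopology flags Y) U" "A \<in> pre U"
  shows "\<exists>r\<in>poly_fun. r A \<noteq> 0 \<and> (\<forall>A'\<in>pre Y. r A' \<noteq> 0 \<longrightarrow> A' \<in> pre U)"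
proof -
  obtain V where V: "openin flags V" "U = V \<inter> Y" using assms(1) by (auto simp: openin_subtopology)
  then have "A \<in> pre V" using assms(2) by (auto simp: pre_def)
  from openin_flags_local[OF V(1) this] show ?thesis using V(2) by (auto simp: pre_def)
qed

text \<open>The neighbourhood on which the fraction represents \<open>h\<close> is absorbed into the
  fraction: numerator and denominator are multiplied by a function vanishing outside it, so the
  condition on the denominator alone defines the domain.\<close>

lemma regular_flags_local:
  assumes "regular_on_cosets (Psi ` Sp4) (Psi ` B4) V h" "A \<in> pre V"
  shows "\<exists>p\<in>poly_fun. \<exists>q\<in>poly_fun. q A \<noteq> 0 \<and> (\<forall>A'\<in>pre V. q A' \<noteq> 0 \<longrightarrow> h (cs A') = p A' / q A')"
proof -
  have "Psi A \<in> Psi ` pre V" using assms(2) by blast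
  then obtain W p q where W: "openin zariski W" "Psi A \<in> W" "p \<in> poly_fun" "q \<in> poly_fun"
    "\<And>y. y \<in> W \<inter> Psi ` pre V \<Longrightarrow> q y \<noteq> 0 \<and> h (y <#\<^bsub>GL\<^esub> (Psi ` B4)) = p y / q y"
    using assms(1) unfolding regular_on_cosets_def coset_preimage_eq regular_on_def by metis
  obtain f where f: "f \<in> poly_fun" "f (Psi A) \<noteq> 0" "\<And>y. f y \<noteq> 0 \<Longrightarrow> y \<in> W"
    using openin_zariski_basic[OF W(1,2)] by blast
  have "q (Psi A') \<noteq> 0 \<and> h (cs A') = p (Psi A') / q (Psi A')" if "A' \<in> pre V" "f (Psi A') \<noteq> 0" for A'
    using W(5)[of "Psi A'"] f(3) that by (auto simp: cs_def)
  then show ?thesis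
    using W(3,4) f(1,2) assms(2)
    by (intro bexI[of _ "\<lambda>A. p (Psi A) * f (Psi A)"] bexI[of _ "\<lambda>A. q (Psi A) * f (Psi A)"])
      (auto intro!: poly_fun.mult poly_fun_Psi)
qed

lemma regular_subvariety_local:
  assumes "regular_on_subvariety (Psi ` Sp4) (Psi ` B4) Y U f" "A \<in> pre U"
  shows "\<exists>p\<in>poly_fun. \<exists>q\<in>poly_fun. q A \<noteq> 0 \<and> (\<forall>A'\<in>pre U. q A' \<noteq> 0 \<longrightarrow> f (cs A') = p A' / q A')"
proof -
  have "cs A \<in> U" using assms(2) by (simp add: pre_def)
  then obtain V h where V: "openin flags V" "cs A \<in> V" "regular_on_cosets (Psi ` Sp4) (Psi ` B4) V h"
    "\<And>z. z \<in> V \<inter> U \<Longrightarrow> f z = h z"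
    using assms(1) unfolding regular_on_subvariety_def by metis
  have AV: "A \<in> pre V" using V(2) assms(2) by (simp add: pre_def)
  obtain p q where pq: "p \<in> poly_fun" "q \<in> poly_fun" "q A \<noteq> 0" "\<And>A'. A' \<in> pre V \<Longrightarrow> q A' \<noteq> 0 \<Longrightarrow> h (cs A') = p A' / q A'"
    using regular_flags_local[OF V(3) AV] by blast
  obtain r where r: "r \<in> poly_fun" "r A \<noteq> 0" "\<And>A'. A' \<in> Sp4 \<Longrightarrow> r A' \<noteq> 0 \<Longrightarrow> A' \<in> pre V"
    using openin_flags_local[OF V(1) AV] by blast
  have "f (cs A') = p A' / q A'" if "A' \<in> pre U" "q A' \<noteq> 0" "r A' \<noteq> 0" for A'
  proof -
    have "A' \<in> pre V" using r(3) that by (auto simp: pre_def)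
    then show ?thesis using pq(4) that V(4)[of "cs A'"] by (auto simp: pre_def)
  qed
  then show ?thesis using pq r
    by (intro bexI[of _ "\<lambda>A. p A * r A"] bexI[of _ "\<lambda>A. q A * r A"]) (auto intro!: poly_fun.mult)
qed

lemma regular_flagsI:
  assumes "p \<in> poly_fun" "q \<in> poly_fun" "\<And>A. A \<in> pre V \<Longrightarrow> q A \<noteq> 0 \<and> h (cs A) = p A / q A"
  shows "regular_on_cosets (Psi ` Sp4) (Psi ` B4) V h"
  unfolding regular_on_cosets_def coset_preimage_eq regular_on_def
proof
  fix x assume "x \<in> Psi ` pre V"
  have "q (rhoM y) \<noteq> 0 \<and> h (y <#\<^bsub>GL\<^esub> (Psi ` B4)) = p (rhoM y) / q (rhoM y)" if "y \<in> Psi ` pre V" for y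
    using that assms(3) by (auto simp: cs_def)
  then show "\<exists>V'. \<exists>p\<in>poly_fun. \<exists>q\<in>poly_fun. openin zariski V' \<and> x \<in> V' \<and>
      (\<forall>y\<in>V' \<inter> Psi ` pre V. q y \<noteq> 0 \<and> h (y <#\<^bsub>GL\<^esub> (Psi ` B4)) = p y / q y)"
    using poly_fun_rhoM[OF assms(1)] poly_fun_rhoM[OF assms(2)] openin_topspace[of zariski]
    by (intro exI[of _ UNIV] bexI[of _ "\<lambda>X. p (rhoM X)"] bexI[of _ "\<lambda>X. q (rhoM X)"]) auto
qed

end

section \<open>Charts of Schubert varieties\<close>

text \<open>A chart of a \<open>B4\<close>-stable closed set \<open>Z\<close> is a polynomial map \<open>\<kappa>\<close> of four-space onto the intersection of
  \<open>Z\<close> with the opposite big cell. The intersection need not be smooth: \<open>descends\<close> says that \<open>\<kappa>\<close> is a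
  quotient map as far as fractions are concerned.\<close>

definition descends :: "(complex^4 \<Rightarrow> complex^4) \<Rightarrow> bool" where
  "descends \<kappa> \<longleftrightarrow> (\<forall>p\<in>PF. \<forall>q\<in>PF. \<forall>r\<in>PF. (\<exists>x. r x \<noteq> 0) \<longrightarrow>
     (\<forall>x x'. \<kappa> x = \<kappa> x' \<longrightarrow> r x \<noteq> 0 \<longrightarrow> p x * q x' = p x' * q x) \<longrightarrow>
     (\<exists>p'\<in>PF. \<exists>q'\<in>PF. (\<forall>x. (\<forall>x'. \<kappa> x' = \<kappa> x \<longrightarrow> q x' \<noteq> 0) \<longrightarrow> q' (\<kappa> x) \<noteq> 0) \<and>
        (\<forall>x c. (\<forall>x'. \<kappa> x' = \<kappa> x \<longrightarrow> c * q x' = p x') \<longrightarrow> c * q' (\<kappa> x) = p' (\<kappa> x))))"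

definition schubert_chart :: "(complex^4^4) set \<Rightarrow> (complex^4 \<Rightarrow> complex^4) \<Rightarrow> bool" where
  "schubert_chart Z \<kappa> \<longleftrightarrow> Z \<subseteq> Sp4 \<and> closedin zariski Z \<and> (\<forall>A\<in>Z. \<forall>b\<in>B4. A ** b \<in> Z \<and> b ** A \<in> Z) \<and>
     (\<forall>i. (\<lambda>x. \<kappa> x $ i) \<in> PF) \<and> (\<forall>x. low4 (\<kappa> x) \<in> Z) \<and> (\<forall>y. low4 y \<in> Z \<longrightarrow> (\<exists>x. \<kappa> x = y)) \<and> descends \<kappa>"

lemma bigcell_low4:
  assumes "A \<in> Sp4" "A \<in> bigcell" shows "\<exists>b\<in>B4. A ** b = low4 (psi4 A)"
proof -
  let ?L = "low4 (psi4 A)" and ?b = "adj (low4 (psi4 A)) ** A"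
  have b: "?b \<in> B4" by (rule bigcell_decomp(1)[OF assms])
  then have bS: "?b \<in> Sp4" "adj ?b \<in> B4" using group4_standard(2) by (auto simp: B4_def group4_def)
  have "A ** adj ?b = ?L ** ?b ** adj ?b" using bigcell_decomp(2)[OF assms] by (rule arg_cong)
  also have "\<dots> = ?L ** (?b ** adj ?b)" by (rule matrix_mul_assoc[symmetric])
  also have "\<dots> = ?L" unfolding adj_right[OF bS(1)] by (rule matrix_mul_rid)
  finally show ?thesis using bS(2) by blast
qed

text \<open>Some upper unipotent element moves \<open>A\<close> into the big cell without leaving
  \<open>Z\<close>, so the translates of the one chart reach every flag in \<open>Z\<close>.\<close>

lemma schubert_chart_cover:
  assumes "schubert_chart Z \<kappa>" "A \<in> Z"
  shows "\<exists>y x. \<exists>b\<in>B4. A = upp4 y ** low4 (\<kappa> x) ** b"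
proof -
  note Z = assms(1)[unfolded schubert_chart_def]
  have A: "A \<in> Sp4" using Z assms(2) by blast
  obtain u where u: "u \<in> U4" "u ** A \<in> bigcell" using translate_bigcell[OF A] by blast
  have uS: "u \<in> Sp4" and uB: "u \<in> B4" using u(1) by (auto simp: U4_def B4_def)
  let ?A = "u ** A"
  have AZ: "?A \<in> Z" using Z assms(2) uB by blast
  then have AS: "?A \<in> Sp4" using Z by blast
  note d = bigcell_decomp[OF AS u(2)]
  let ?b = "adj (low4 (psi4 ?A)) ** ?A"
  obtain c where c: "c \<in> B4" "?A ** c = low4 (psi4 ?A)" using bigcell_low4[OF AS u(2)] by blast
  have "?A ** c \<in> Z" using Z AZ c(1) by blast
  then obtain x where x: "\<kappa> x = psi4 ?A" using Z c(2) by auto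
  have "adj u \<in> U4" using u(1) group4_standard(8) by (simp add: group4_def)
  then obtain y where y: "adj u = upp4 y" using U4_upp by (metis upp4_def vec4_nth)
  have "A = adj u ** ?A" by (simp add: adj_cancel uS)
  also have "\<dots> = adj u ** (low4 (psi4 ?A) ** ?b)" using d(2) by simp
  finally have "A = upp4 y ** low4 (\<kappa> x) ** ?b" by (simp add: y x matrix_mul_assoc)
  then show ?thesis using d(1) by blast
qed

context sp4_rep
begin

lemma schubert_chart_pre: "schubert_chart Z \<kappa> \<Longrightarrow> pre (cs ` Z) = Z"
  by (intro pre_cs_image) (auto simp: schubert_chart_def)

lemma schubert_chart_closed: "schubert_chart Z \<kappa> \<Longrightarrow> closedin flags (cs ` Z)"
  unfolding closedin_flags by (subst schubert_chart_pre) (auto simp: schubert_chart_def)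

text \<open>Points of \<open>Z\<close> outside C and outside D are joined by a line in the space of
  the parameters of cover and chart. Equations for C and D restrict to nonzero univariate
  polynomials on it, so some point of the line avoids both.\<close>

lemma schubert_chart_irreducible:
  assumes Z: "schubert_chart Z \<kappa>" and C: "closedin flags C" "closedin flags D" "cs ` Z \<subseteq> C \<union> D"
  shows "cs ` Z \<subseteq> C \<or> cs ` Z \<subseteq> D"
proof (rule ccontr)
  assume "\<not> ?thesis"
  then obtain A1 A2 where A: "A1 \<in> Z" "cs A1 \<notin> C" "A2 \<in> Z" "cs A2 \<notin> D" by blast
  note Z' = Z[unfolded schubert_chart_def]
  define m where "m y x = upp4 y ** low4 (\<kappa> x)" for y x
  have mZ: "m y x \<in> Z" for y x
  proof -
    have "upp4 y \<in> B4" using upp4_U4[of y] by (auto simp: U4_def B4_def)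
    then show ?thesis unfolding m_def using Z' by blast
  qed
  have mS: "m y x \<in> Sp4" for y x using mZ Z' by blast
  obtain y1 x1 b1 where 1: "b1 \<in> B4" "A1 = m y1 x1 ** b1" using schubert_chart_cover[OF Z A(1)] unfolding m_def by blast
  obtain y2 x2 b2 where 2: "b2 \<in> B4" "A2 = m y2 x2 ** b2" using schubert_chart_cover[OF Z A(3)] unfolding m_def by blast
  have n1: "m y1 x1 \<notin> pre C" and n2: "m y2 x2 \<notin> pre D"
    using A(2,4) cs_right[OF 1(1)] cs_right[OF 2(1)] 1(2) 2(2) by (auto simp: pre_def)
  obtain F where F: "F \<subseteq> poly_fun" "pre C = {A. \<forall>f\<in>F. f A = 0}" using C(1) unfolding closedin_flags closedin_zariski by blast
  obtain G where G: "G \<subseteq> poly_fun" "pre D = {A. \<forall>f\<in>G. f A = 0}" using C(2) unfolding closedin_flags closedin_zariski by blast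
  obtain f where f: "f \<in> poly_fun" "f (m y1 x1) \<noteq> 0" "\<And>A. A \<in> pre C \<Longrightarrow> f A = 0" using n1 F by auto
  obtain g where g: "g \<in> poly_fun" "g (m y2 x2) \<noteq> 0" "\<And>A. A \<in> pre D \<Longrightarrow> g A = 0" using n2 G by auto
  let ?y = "\<lambda>s. y1 + s *s (y2 - y1)" and ?x = "\<lambda>s. x1 + s *s (x2 - x1)"
  have ent: "\<exists>P. \<forall>s. m (?y s) (?x s) $ i $ j = poly P s" for i j
  proof -
    have U: "\<exists>P. \<forall>s. upp4 (?y s) $ i $ k = poly P s" for k by (rule PF_line[OF PF_upp4])
    have L: "\<exists>P. \<forall>s. low4 (\<kappa> (?x s)) $ k $ j = poly P s" for k
      by (rule PF_line[OF PF_comp[OF PF_low4]]) (use Z' in blast)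
    obtain PU where PU: "\<And>k s. upp4 (?y s) $ i $ k = poly (PU k) s" using U by metis
    obtain PL where PL: "\<And>k s. low4 (\<kappa> (?x s)) $ k $ j = poly (PL k) s" using L by metis
    show ?thesis
      by (rule exI[of _ "\<Sum>k\<in>UNIV. PU k * PL k"]) (simp only: m_def matrix_mult_entry PU PL poly_sum poly_mult simp_thms)
  qed
  obtain P where P: "\<And>s. f (m (?y s) (?x s)) = poly P s" using univariate_poly_fun[OF f(1) ent] by blast
  obtain Q where Q: "\<And>s. g (m (?y s) (?x s)) = poly Q s" using univariate_poly_fun[OF g(1) ent] by blast
  have "P \<noteq> 0" using P[of 0] f(2) by auto
  moreover have "Q \<noteq> 0" using Q[of 1] g(2) by auto
  ultimately have "P * Q \<noteq> 0" by simp
  then obtain s where "poly (P * Q) s \<noteq> 0" using poly_all_0_iff_0 by blast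
  then have "f (m (?y s) (?x s)) \<noteq> 0" "g (m (?y s) (?x s)) \<noteq> 0" using P Q by auto
  then have "m (?y s) (?x s) \<notin> pre C" "m (?y s) (?x s) \<notin> pre D" using f(3) g(3) by blast+
  then show False using C(3) mZ mS by (auto simp: pre_def)
qed

lemma irreducible_chart:
  assumes Z: "schubert_chart Z \<kappa>" shows "irreducible_subvariety (Psi ` Sp4) (Psi ` B4) (cs ` Z)"
proof -
  have "low4 (\<kappa> 0) \<in> Z" using Z by (auto simp: schubert_chart_def)
  then show ?thesis
    unfolding irreducible_subvariety_def
    using schubert_chart_closed[OF Z] schubert_chart_irreducible[OF Z] by blast
qed

text \<open>The chart is translated so that it contains y, and the integral function is pulled back
  to four-space, where it becomes a fraction without poles over \<open>V\<close>. The condition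
  \<open>descends\<close> turns it into a fraction in the cell coordinates, and \<open>psi4\<close>
  makes that a regular function near y.\<close>

lemma normal_chart:
  assumes Z: "schubert_chart Z \<kappa>"
  shows "normal_subvariety (Psi ` Sp4) (Psi ` B4) (cs ` Z)"
  unfolding normal_subvariety_def
proof (intro conjI irreducible_chart[OF Z] ballI allI impI, elim conjE exE)
  fix y U f V a and n :: nat
  assume y: "y \<in> cs ` Z" and U: "U \<noteq> {}" "regular_on_subvariety (Psi ` Sp4) (Psi ` B4) (cs ` Z) U f"
    and V: "y \<in> V" "\<forall>i<n. regular_on_subvariety (Psi ` Sp4) (Psi ` B4) (cs ` Z) V (a i)"
      "openin (subtopology flags (cs ` Z)) V"
    and eq: "\<forall>z\<in>U \<inter> V. f z ^ n + (\<Sum>i<n. a i z * f z ^ i) = 0"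
  note Z' = Z[unfolded schubert_chart_def]
  have preZ: "pre (cs ` Z) = Z" by (rule schubert_chart_pre[OF Z])
  have Uo: "openin (subtopology flags (cs ` Z)) U" using U(2) by (simp add: regular_on_subvariety_def)
  have UZ: "U \<subseteq> cs ` Z" and VZ: "V \<subseteq> cs ` Z" using openin_subset[OF Uo] openin_subset[OF V(3)] by auto
  obtain A0 where A0: "A0 \<in> Z" "y = cs A0" using y by blast
  obtain t x0 b0 where t: "b0 \<in> B4" "A0 = upp4 t ** low4 (\<kappa> x0) ** b0" using schubert_chart_cover[OF Z A0(1)] by blast
  define u where "u = upp4 t"
  define m where "m x = u ** low4 (\<kappa> x)" for x
  have uB: "u \<in> B4" using upp4_U4[of t] by (auto simp: U4_def B4_def u_def)
  then have uS: "u \<in> Sp4" "adj u \<in> Sp4" by (auto simp: B4_def Sp4_adj_closed)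
  have mZ: "m x \<in> Z" for x unfolding m_def using Z' uB by blast
  have mS: "m x \<in> Sp4" for x using mZ Z' by blast
  have ym: "y = cs (m x0)" using A0(2) t cs_right by (simp add: m_def u_def)
  have mPF: "(\<lambda>x. m x $ i $ j) \<in> PF" for i j
    unfolding m_def by (intro PF_matrix_mult PF.const PF_comp[OF PF_low4]) (use Z' in blast)
  have mpoly: "(\<lambda>x. p (m x)) \<in> PF" if "p \<in> poly_fun" for p by (rule PF_poly_fun[OF that mPF])
  define Dm where "Dm = {x. cs (m x) \<in> U}"
  define Vm where "Vm = {x. cs (m x) \<in> V}"
  have preI: "m x \<in> pre S \<longleftrightarrow> cs (m x) \<in> S" for x S using mS by (simp add: pre_def)
  have open_pull: "\<exists>r\<in>PF. r x \<noteq> 0 \<and> (\<forall>x'. r x' \<noteq> 0 \<longrightarrow> cs (m x') \<in> S)"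
    if S: "openin (subtopology flags (cs ` Z)) S" and x: "cs (m x) \<in> S" for S x
  proof -
    have "m x \<in> pre S" using x preI by blast
    from openin_sub_local[OF S this] obtain r where r: "r \<in> poly_fun" "r (m x) \<noteq> 0"
      "\<And>A. A \<in> Z \<Longrightarrow> r A \<noteq> 0 \<Longrightarrow> A \<in> pre S" unfolding preZ by blast
    show ?thesis
      by (rule bexI[OF _ mpoly[OF r(1)]]) (use r mZ preI in blast)
  qed
  have fun_pull: "\<exists>p\<in>PF. \<exists>q\<in>PF. q x \<noteq> 0 \<and> (\<forall>x'. cs (m x') \<in> S \<longrightarrow> q x' \<noteq> 0 \<longrightarrow> g (cs (m x')) = p x' / q x')"
    if S: "regular_on_subvariety (Psi ` Sp4) (Psi ` B4) (cs ` Z) S g" and x: "cs (m x) \<in> S" for S g x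
  proof -
    have "m x \<in> pre S" using x preI by blast
    from regular_subvariety_local[OF S this] obtain p q where pq: "p \<in> poly_fun" "q \<in> poly_fun" "q (m x) \<noteq> 0"
      "\<And>A. A \<in> pre S \<Longrightarrow> q A \<noteq> 0 \<Longrightarrow> g (cs A) = p A / q A" by blast
    show ?thesis
      by (rule bexI[OF _ mpoly[OF pq(1)]], rule bexI[OF _ mpoly[OF pq(2)]]) (use pq preI in blast)
  qed
  \<comment> \<open>\<open>U\<close> might a priori miss the translated cell. But both are nonempty
    open subsets of an irreducible space: otherwise the complements \<open>?C\<close> and
    \<open>?N\<close> would cover it.\<close>
  have "Dm \<noteq> {}"
  proof
    assume "Dm = {}"
    then have no: "cs (m x) \<notin> U" for x by (auto simp: Dm_def)
    obtain A1 where A1: "A1 \<in> Z" "cs A1 \<in> U" using U(1) UZ by blast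
    obtain S where S: "openin flags S" "U = S \<inter> cs ` Z" using Uo by (auto simp: openin_subtopology)
    let ?C = "cs ` Sp4 - S"
    have "closedin flags ?C" using S(1) by (metis closedin_diff closedin_topspace topspace_flags)
    define bc where "bc = {A \<in> Sp4. adj u ** A \<in> bigcell}"
    have bcr: "A ** b \<in> bc \<longleftrightarrow> A \<in> bc" if "A \<in> Sp4" "b \<in> B4" for A b
      using that Sp4_mult[OF that(1) B4_Sp4[OF that(2)]]
      by (simp add: bc_def matrix_mul_assoc bigcell_right)
    let ?N = "cs ` (Sp4 - bc)"
    have "pre ?N = Sp4 - bc"
      by (rule pre_cs_image) (auto simp: bcr Sp4_mult B4_Sp4)
    moreover have "Sp4 - bc = {A. A \<in> Sp4 \<and> (adj u ** A) $ 1 $ 1 * mn (adj u ** A) 1 2 = 0}"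
      by (auto simp: bc_def bigcell_def)
    moreover have "closedin zariski {A. A \<in> Sp4 \<and> (adj u ** A) $ 1 $ 1 * mn (adj u ** A) 1 2 = 0}"
      unfolding mn_def
      by (intro closedin_zariski_conj closedin_zariski_zero poly_fun.mult poly_fun_diff poly_fun_matrix_mult poly_fun.const poly_fun.entry)
        (use closedin_Sp4 in simp)
    ultimately have "closedin flags ?N" unfolding closedin_flags by auto
    moreover have "cs ` Z \<subseteq> ?C \<union> ?N"
    proof (rule ccontr)
      assume "\<not> ?thesis"
      then obtain A where A: "A \<in> Z" "cs A \<in> S" "cs A \<notin> ?N" using Z' by blast
      then have AS: "A \<in> Sp4" "adj u ** A \<in> bigcell" using Z' by (auto simp: bc_def)
      have AZ: "adj u ** A \<in> Z" using Z' A(1) B4_adj[OF uB] by blast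
      have AS': "adj u ** A \<in> Sp4" using AZ Z' by blast
      obtain b where b: "b \<in> B4" "adj u ** A ** b = low4 (psi4 (adj u ** A))" using bigcell_low4[OF AS' AS(2)] by blast
      have "adj u ** A ** b \<in> Z" using Z' AZ b(1) by blast
      then obtain x where x: "\<kappa> x = psi4 (adj u ** A)" using Z' b(2) by auto
      have "m x = A ** b" unfolding m_def x b(2)[symmetric] by (simp add: matrix_mul_assoc[symmetric] adj_cancel uS)
      then have "cs (m x) = cs A" using cs_right[OF b(1)] by simp
      then show False using no[of x] A S by auto
    qed
    ultimately have "cs ` Z \<subseteq> ?C \<or> cs ` Z \<subseteq> ?N"
      using schubert_chart_irreducible[OF Z \<open>closedin flags ?C\<close>] by blast
    moreover have "\<not> cs ` Z \<subseteq> ?C" using A1 S by blast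
    moreover have "\<not> cs ` Z \<subseteq> ?N"
    proof
      assume "cs ` Z \<subseteq> ?N"
      then have "m x0 \<in> pre ?N" using mZ mS by (auto simp: pre_def)
      then have "m x0 \<notin> bc" using \<open>pre ?N = Sp4 - bc\<close> by blast
      then show False using mS low4_bigcell by (simp add: bc_def m_def adj_cancel uS)
    qed
    ultimately show False by blast
  qed
  have "\<exists>p\<in>PF. \<exists>q\<in>PF. (\<forall>x\<in>Vm. q x \<noteq> 0) \<and> (\<forall>x\<in>Dm. f (cs (m x)) * q x = p x) \<and> (\<exists>x. q x \<noteq> 0)"
  proof (rule integral_rational_function[where a = "\<lambda>i x. a i (cs (m x))" and n = n])
    show "Dm \<noteq> {}" by fact
    show "\<exists>r\<in>PF. r x \<noteq> 0 \<and> (\<forall>y. r y \<noteq> 0 \<longrightarrow> y \<in> Dm)" if "x \<in> Dm" for x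
      using open_pull[OF Uo, of x] that by (simp add: Dm_def)
    show "\<exists>r\<in>PF. r x \<noteq> 0 \<and> (\<forall>y. r y \<noteq> 0 \<longrightarrow> y \<in> Vm)" if "x \<in> Vm" for x
      using open_pull[OF V(3), of x] that by (simp add: Vm_def)
    show "\<exists>p\<in>PF. \<exists>q\<in>PF. q x \<noteq> 0 \<and> (\<forall>y\<in>Dm. q y \<noteq> 0 \<longrightarrow> f (cs (m y)) = p y / q y)" if "x \<in> Dm" for x
      using fun_pull[OF U(2), of x] that by (simp add: Dm_def)
    show "\<exists>p\<in>PF. \<exists>q\<in>PF. q x \<noteq> 0 \<and> (\<forall>y\<in>Vm. q y \<noteq> 0 \<longrightarrow> a i (cs (m y)) = p y / q y)" if "i < n" "x \<in> Vm" for i x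
      using fun_pull[OF V(2)[rule_format, OF that(1)], of x] that by (simp add: Vm_def)
    show "f (cs (m y)) ^ n + (\<Sum>i<n. a i (cs (m y)) * f (cs (m y)) ^ i) = 0" if "y \<in> Dm" "y \<in> Vm" for y
      using eq that by (simp add: Dm_def Vm_def)
  qed
  then obtain p q where pq: "p \<in> PF" "q \<in> PF" "\<And>x. x \<in> Vm \<Longrightarrow> q x \<noteq> 0"
    "\<And>x. x \<in> Dm \<Longrightarrow> f (cs (m x)) * q x = p x" by blast
  obtain x1 where x1: "x1 \<in> Dm" using \<open>Dm \<noteq> {}\<close> by blast
  obtain r where r: "r \<in> PF" "r x1 \<noteq> 0" "\<And>x. r x \<noteq> 0 \<Longrightarrow> x \<in> Dm"
    using open_pull[OF Uo, of x1] x1 by (auto simp: Dm_def)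
  \<comment> \<open>Points with the same image under \<open>\<kappa>\<close> give the same flag and
    hence the same value of f; this is the compatibility that \<open>descends\<close>
    requires.\<close>
  have "p x * q x' = p x' * q x" if k: "\<kappa> x = \<kappa> x'" and "r x \<noteq> 0" for x x'
  proof -
    have "x \<in> Dm" using r(3) that by blast
    moreover have "m x = m x'" using k by (simp add: m_def)
    ultimately have "f (cs (m x)) * q x = p x" "f (cs (m x)) * q x' = p x'"
      using pq(4)[of x] pq(4)[of x'] by (auto simp: Dm_def)
    then have "p x * q x' = f (cs (m x)) * q x * q x'" "p x' * q x = f (cs (m x)) * q x' * q x" by simp_all
    then show ?thesis by (simp only: mult_ac)
  qed
  then have c: "\<forall>x x'. \<kappa> x = \<kappa> x' \<longrightarrow> r x \<noteq> 0 \<longrightarrow> p x * q x' = p x' * q x" by blast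
  have "descends \<kappa>" using Z' by blast
  from this[unfolded descends_def, THEN bspec, OF pq(1), THEN bspec, OF pq(2), THEN bspec, OF r(1)]
  have "\<exists>p'\<in>PF. \<exists>q'\<in>PF. (\<forall>x. (\<forall>x'. \<kappa> x' = \<kappa> x \<longrightarrow> q x' \<noteq> 0) \<longrightarrow> q' (\<kappa> x) \<noteq> 0) \<and>
        (\<forall>x c. (\<forall>x'. \<kappa> x' = \<kappa> x \<longrightarrow> c * q x' = p x') \<longrightarrow> c * q' (\<kappa> x) = p' (\<kappa> x))"
    using c r(2) by blast
  then obtain p' q' where pq': "p' \<in> PF" "q' \<in> PF" "\<And>x. (\<And>x'. \<kappa> x' = \<kappa> x \<Longrightarrow> q x' \<noteq> 0) \<Longrightarrow> q' (\<kappa> x) \<noteq> 0"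
    "\<And>x c. (\<And>x'. \<kappa> x' = \<kappa> x \<Longrightarrow> c * q x' = p x') \<Longrightarrow> c * q' (\<kappa> x) = p' (\<kappa> x)" by blast
  obtain n1 d1 where nd1: "n1 \<in> poly_fun" "d1 \<in> poly_fun" "\<And>A. A \<in> bigcell \<Longrightarrow> d1 A \<noteq> 0 \<and> p' (psi4 A) = n1 A / d1 A"
    using PF_psi4_rational[OF pq'(1)] by blast
  obtain n2 d2 where nd2: "n2 \<in> poly_fun" "d2 \<in> poly_fun" "\<And>A. A \<in> bigcell \<Longrightarrow> d2 A \<noteq> 0 \<and> q' (psi4 A) = n2 A / d2 A"
    using PF_psi4_rational[OF pq'(2)] by blast
  define O' where "O' = {A \<in> Sp4. adj u ** A \<in> bigcell \<and> q' (psi4 (adj u ** A)) \<noteq> 0}"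
  \<comment> \<open>The value at a coset is computed from a chosen representative. It does not
    depend on the choice because \<open>psi4\<close> is invariant under \<open>B4\<close> on the
    right.\<close>
  define g where "g c = (let A = (SOME A. A \<in> Sp4 \<and> cs A = c) in p' (psi4 (adj u ** A)) / q' (psi4 (adj u ** A)))" for c
  have g: "g (cs A) = p' (psi4 (adj u ** A)) / q' (psi4 (adj u ** A))" if A: "A \<in> Sp4" for A
  proof -
    define A1 where "A1 = (SOME A'. A' \<in> Sp4 \<and> cs A' = cs A)"
    have "A1 \<in> Sp4 \<and> cs A1 = cs A" unfolding A1_def by (rule someI[of _ A]) (use A in simp)
    then obtain b where b: "b \<in> B4" "A = A1 ** b" using cs_eqD by blast
    have "psi4 (adj u ** A) = psi4 (adj u ** A1 ** b)" unfolding b(2) by (simp only: matrix_mul_assoc)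
    also have "\<dots> = psi4 (adj u ** A1)" by (rule psi4_right[OF b(1)])
    finally show ?thesis by (simp add: g_def Let_def A1_def)
  qed
  have tr: "(\<lambda>A. p (adj u ** A)) \<in> poly_fun" if "p \<in> poly_fun" for p
    by (rule poly_fun_comp[OF that]) (intro poly_fun_matrix_mult poly_fun.const poly_fun.entry)
  have O'r: "A ** b \<in> O' \<longleftrightarrow> A \<in> O'" if "A \<in> Sp4" "b \<in> B4" for A b
    using that Sp4_mult[OF that(1) B4_Sp4[OF that(2)]]
    by (simp add: O'_def matrix_mul_assoc bigcell_right psi4_right)
  have preO: "pre (cs ` O') = O'" 
  proof (rule pre_cs_image)
    show sub: "O' \<subseteq> Sp4" by (auto simp: O'_def)
    show "A ** b \<in> O'" if "A \<in> O'" "b \<in> B4" for A b using O'r[of A b] that sub by blast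
  qed
  have openO: "openin flags (cs ` O')"
    unfolding openin_flags preO
  proof
    show "cs ` O' \<subseteq> cs ` Sp4" by (auto simp: O'_def)
    let ?r = "\<lambda>A. (adj u ** A) $ 1 $ 1 * mn (adj u ** A) 1 2 * n2 (adj u ** A)"
    have "O' = {A. ?r A \<noteq> 0} \<inter> Sp4"
    proof -
      have "q' (psi4 A) \<noteq> 0 \<longleftrightarrow> n2 A \<noteq> 0" if "A \<in> bigcell" for A using nd2(3)[OF that] by auto
      then show ?thesis by (auto simp: O'_def) (auto simp: bigcell_def)
    qed
    moreover have "?r \<in> poly_fun"
      unfolding mn_def by (intro poly_fun.mult poly_fun_diff tr[OF nd2(1)] poly_fun_matrix_mult poly_fun.const poly_fun.entry)
    ultimately show "\<exists>W. openin zariski W \<and> O' = W \<inter> Sp4" using openin_zariski_nonzero by blast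
  qed
  have regO: "regular_on_cosets (Psi ` Sp4) (Psi ` B4) (cs ` O') g"
  proof (rule regular_flagsI)
    show "(\<lambda>A. n1 (adj u ** A) * d2 (adj u ** A)) \<in> poly_fun" "(\<lambda>A. d1 (adj u ** A) * n2 (adj u ** A)) \<in> poly_fun"
      by (intro poly_fun.mult tr nd1 nd2)+
    fix A assume "A \<in> pre (cs ` O')"
    then have A: "A \<in> Sp4" "adj u ** A \<in> bigcell" "q' (psi4 (adj u ** A)) \<noteq> 0" unfolding preO by (auto simp: O'_def)
    then show "d1 (adj u ** A) * n2 (adj u ** A) \<noteq> 0 \<and>
       g (cs A) = (n1 (adj u ** A) * d2 (adj u ** A)) / (d1 (adj u ** A) * n2 (adj u ** A))"
      using nd1(3)[OF A(2)] nd2(3)[OF A(2)] g[OF A(1)] by auto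
  qed
  have Oo: "openin (subtopology flags (cs ` Z)) (cs ` O' \<inter> cs ` Z)"
    using openO by (auto simp: openin_subtopology)
  have R1: "regular_on_subvariety (Psi ` Sp4) (Psi ` B4) (cs ` Z) (cs ` O' \<inter> cs ` Z) g"
    unfolding regular_on_subvariety_def using Oo openO regO by blast
  have R2: "y \<in> cs ` O' \<inter> cs ` Z"
  proof -
    have k: "adj u ** m x0 = low4 (\<kappa> x0)" by (simp add: m_def adj_cancel uS)
    have "q' (\<kappa> x0) \<noteq> 0"
    proof (rule pq'(3))
      fix x' assume "\<kappa> x' = \<kappa> x0"
      then have "m x' = m x0" by (simp add: m_def)
      then show "q x' \<noteq> 0" using V(1) ym by (intro pq(3)) (simp add: Vm_def)
    qed
    then have "m x0 \<in> O'" using mS k low4_bigcell psi4_low4 by (simp add: O'_def)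
    then show ?thesis using ym mZ by blast
  qed
  have R3: "g z = f z" if z: "z \<in> U \<inter> (cs ` O' \<inter> cs ` Z)" for z
  proof -
    obtain A where A: "A \<in> O'" "z = cs A" using z by blast
    have AS: "A \<in> Sp4" "adj u ** A \<in> bigcell" "q' (psi4 (adj u ** A)) \<noteq> 0" using A(1) by (auto simp: O'_def)
    have "A \<in> pre (cs ` Z)" using z A AS by (auto simp: pre_def)
    then have AZ: "A \<in> Z" using preZ by simp
    have AZ': "adj u ** A \<in> Z" using Z' AZ B4_adj[OF uB] by blast
    have AS': "adj u ** A \<in> Sp4" using AZ' Z' by blast
    obtain b where b: "b \<in> B4" "adj u ** A ** b = low4 (psi4 (adj u ** A))" using bigcell_low4[OF AS' AS(2)] by blast
    have "adj u ** A ** b \<in> Z" using Z' AZ' b(1) by blast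
    then obtain x where x: "\<kappa> x = psi4 (adj u ** A)" using Z' b(2) by auto
    have "m x = A ** b" unfolding m_def x b(2)[symmetric] by (simp add: matrix_mul_assoc[symmetric] adj_cancel uS)
    then have cz: "cs (m x) = z" using cs_right[OF b(1)] A(2) by simp
    have "f z * q' (\<kappa> x) = p' (\<kappa> x)"
    proof (rule pq'(4))
      fix x' assume "\<kappa> x' = \<kappa> x"
      then have "cs (m x') = z" using cz by (simp add: m_def)
      then show "f z * q x' = p x'" using pq(4)[of x'] z by (simp add: Dm_def)
    qed
    moreover have "g z * q' (\<kappa> x) = p' (\<kappa> x)" using g[OF AS(1)] AS(3) A(2) x by simp
    ultimately have "g z * q' (\<kappa> x) = f z * q' (\<kappa> x)" by simp
    then show ?thesis using AS(3) x by simp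
  qed
  show "\<exists>V g. y \<in> V \<and> regular_on_subvariety (Psi ` Sp4) (Psi ` B4) (cs ` Z) V g \<and> (\<forall>z\<in>U \<inter> V. g z = f z)"
    by (rule exI, rule exI, rule conjI[OF R2 conjI[OF R1]], rule ballI, rule R3)
qed

end

section \<open>Parabolic subgroups and their Levi subgroups\<close>

text \<open>An element \<open>z\<close> of the centre of \<open>L\<close> with trivial centraliser in \<open>U\<close> forces a complement of \<open>U\<close> in \<open>P\<close>
  that contains the torus to be \<open>L\<close>.\<close>

definition levi_data :: "(complex^4^4) set \<Rightarrow> (complex^4^4) set \<Rightarrow> (complex^4^4) set \<Rightarrow> complex^4^4 \<Rightarrow> bool" where
  "levi_data P L U z \<longleftrightarrow> group4 P \<and> group4 L \<and> group4 U \<and> L \<subseteq> P \<and> U \<subseteq> P \<and>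
     (\<forall>p\<in>P. \<forall>u\<in>U. p ** u ** adj p \<in> U) \<and> (\<forall>p\<in>P. \<exists>l\<in>L. \<exists>u\<in>U. p = l ** u) \<and> L \<inter> U = {mat 1} \<and>
     z \<in> T4 \<and> (\<forall>l\<in>L. z ** l = l ** z) \<and> (\<forall>u\<in>U. z ** u = u ** z \<longrightarrow> u = mat 1)"

lemma levi_unique:
  assumes D: "levi_data P L U z" and L0: "group4 L0" "L0 \<subseteq> P" "T4 \<subseteq> L0" "\<And>p. p \<in> P \<Longrightarrow> \<exists>l\<in>L0. \<exists>u\<in>U. p = l ** u"
    "L0 \<inter> U \<subseteq> {mat 1}"
  shows "L0 = L"
proof -
  note d = D[unfolded levi_data_def]
  have PS: "P \<subseteq> Sp4" and US: "U \<subseteq> Sp4" and LS: "L \<subseteq> Sp4" and L0S: "L0 \<subseteq> Sp4"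
    using d L0(1) by (auto simp: group4_def)
  have Lm: "a ** b \<in> L" if "a \<in> L" "b \<in> L" for a b using that d by (auto simp: group4_def)
  have L0m: "a ** b \<in> L0" "adj a \<in> L0" if "a \<in> L0" "b \<in> L0" for a b using that L0(1) by (auto simp: group4_def)
  have Um: "a ** b \<in> U" "adj a \<in> U" if "a \<in> U" "b \<in> U" for a b using that d by (auto simp: group4_def)
  have zL0: "z \<in> L0" using d L0(3) by blast
  then have zS: "z \<in> Sp4" using L0S by blast
  have sub: "L0 \<subseteq> L"
  proof
    fix p assume p: "p \<in> L0"
    obtain l u where lu: "l \<in> L" "u \<in> U" "p = l ** u" using d p L0(2) by blast
    have S: "l \<in> Sp4" "u \<in> Sp4" "p \<in> Sp4" using lu LS US p L0S by auto
    have zl: "z ** l = l ** z" using d lu by blast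
    let ?u = "z ** u ** adj z ** adj u"
    have "z \<in> P" using zL0 L0(2) by blast
    then have "z ** u ** adj z \<in> U" using d lu by blast
    then have u1: "?u \<in> U" by (rule Um(1)[OF _ Um(2)[OF lu(2) lu(2)]])
    \<comment> \<open>As z commutes with l, the commutator of z and p = l u is a conjugate of that
      of z and u. The first lies in \<open>L0\<close>, the second in \<open>U\<close>, so both are
      trivial and z centralises u.\<close>
    have e: "z ** p ** adj z ** adj p = l ** ?u ** adj l"
    proof -
      have "z ** p ** adj z ** adj p = (z ** l) ** u ** adj z ** adj u ** adj l"
        by (simp only: lu(3) adj_mult matrix_mul_assoc)
      also have "\<dots> = l ** ?u ** adj l" unfolding zl by (simp only: matrix_mul_assoc)
      finally show ?thesis .
    qed
    have "l \<in> P" using lu d by blast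
    then have "l ** ?u ** adj l \<in> U" using d u1 by blast
    moreover have "z ** p ** adj z ** adj p \<in> L0"
      by (rule L0m(1)[OF L0m(1)[OF L0m(1)[OF zL0 p] L0m(2)[OF zL0 zL0]] L0m(2)[OF p p]])
    then have "l ** ?u ** adj l \<in> L0" by (simp only: e)
    ultimately have "l ** ?u ** adj l \<in> L0 \<inter> U" by (rule IntI[rotated])
    then have one: "l ** ?u ** adj l = mat 1" using L0(5) by blast
    have "?u = adj l ** (l ** ?u ** adj l) ** l"
      by (simp add: matrix_mul_assoc[symmetric] adj_cancel adj_left S)
    also have "\<dots> = mat 1" unfolding one by (simp add: adj_left S)
    finally have "?u = mat 1" .
    then have "?u ** (u ** z) = u ** z" by simp
    moreover have "?u ** (u ** z) = z ** u"
      by (simp add: matrix_mul_assoc[symmetric] adj_cancel adj_left S zS)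
    ultimately have "z ** u = u ** z" by simp
    then have "u = mat 1" using d lu by blast
    then show "p \<in> L" using lu by simp
  qed
  have "L \<subseteq> L0"
  proof
    fix l assume l: "l \<in> L"
    then have "l \<in> P" using d by blast
    then obtain l0 u where lu: "l0 \<in> L0" "u \<in> U" "l = l0 ** u" using L0(4) by blast
    have S: "l0 \<in> Sp4" using lu L0S by blast
    have "adj l0 ** l = u" unfolding lu(3) by (simp add: adj_cancel S)
    moreover have "adj l0 ** l \<in> L" by (rule Lm[OF subsetD[OF sub L0m(2)[OF lu(1) lu(1)]] l])
    ultimately have "u = mat 1" using d lu(2) by blast
    then show "l \<in> L0" using lu by simp
  qed
  then show ?thesis using sub by blast
qed

lemma tor_T4_Sp4: "a \<noteq> 0 \<Longrightarrow> b \<noteq> 0 \<Longrightarrow> tor a b \<in> Sp4"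
  using tor_T4 by (auto simp: T4_def)

lemma U_sub: "U4 \<subseteq> B4" "Ua4 \<subseteq> Pa4" "Ub4 \<subseteq> Pb4"
  by (auto simp: subgroup4_defs)

text \<open>The positive roots take the values 2/3, 9, 6, 4 at \<open>tor 2 3\<close>, none of them
  1, so only the identity of \<open>U4\<close> commutes with it. For the parabolic subgroups below,
  \<open>tor 2 1\<close> and \<open>tor 2 2\<close> are killed by the root of the Levi subgroup and
  have value 2 or 4 at the roots of the radical.\<close>

lemma levi_data_B4: "levi_data B4 T4 U4 (tor 2 3)"
  unfolding levi_data_def
proof (intro conjI ballI)
  show "p ** u ** adj p \<in> U4" if "p \<in> B4" "u \<in> U4" for p u
    using normal_unipotent_standard(1) that by (auto simp: normal_unipotent_def)
  show "\<exists>l\<in>T4. \<exists>u\<in>U4. p = l ** u" if "p \<in> B4" for p using B4_decomp[OF that] by blast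
  show "T4 \<inter> U4 = {mat 1}"
  proof
    show "T4 \<inter> U4 \<subseteq> {mat 1}" by (auto simp: subgroup4_defs mat4_eq_iff mat_nth)
  qed (use group4_standard in \<open>auto simp: group4_def\<close>)
  show "tor 2 3 \<in> T4" by (rule tor_T4) auto
  show "tor 2 3 ** l = l ** tor 2 3" if "l \<in> T4" for l
    using T4_tor[OF that] by (metis tor_tor mult.commute)
  show "tor 2 3 ** u = u ** tor 2 3 \<longrightarrow> u = mat 1" if "u \<in> U4" for u
    using that by (auto simp: U4_def mat4_eq_iff mult4 tor_def mat_nth)
qed (use group4_standard U_sub in \<open>auto simp: T4_def B4_def\<close>)

lemma levi_data_Pa4: "levi_data Pa4 La4 Ua4 (tor 2 1)"
  unfolding levi_data_def
proof (intro conjI ballI)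
  show "p ** u ** adj p \<in> Ua4" if "p \<in> Pa4" "u \<in> Ua4" for p u
    using normal_unipotent_standard(2) that by (auto simp: normal_unipotent_def)
  show "\<exists>l\<in>La4. \<exists>u\<in>Ua4. p = l ** u" if p: "p \<in> Pa4" for p
  proof -
    let ?l = "mat4 (p$1$1) 0 0 0  0 (p$2$2) (p$2$3) 0  0 (p$3$2) (p$3$3) 0  0 0 0 (p$4$4)"
    have c: "p$1$1 * p$4$4 = 1" "p$2$2 * p$3$3 - p$3$2 * p$2$3 = 1" "p \<in> Sp4" using p by (auto simp: Pa4_def Sp4_cols)
    have l: "?l \<in> La4" using c by (simp add: La4_def Sp4_cols)
    then have lS: "?l \<in> Sp4" by (simp add: La4_def)
    have "adj ?l ** p \<in> Sp4" using lS c by (intro Sp4_mult Sp4_adj_closed)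
    then have "adj ?l ** p \<in> Ua4" using p c by (simp add: Ua4_def Pa4_def mult4 algebra_simps)
    moreover have "p = ?l ** (adj ?l ** p)" by (simp only: adj_cancel(2)[OF lS])
    ultimately show ?thesis using l by blast
  qed
  show "La4 \<inter> Ua4 = {mat 1}"
  proof
    show "La4 \<inter> Ua4 \<subseteq> {mat 1}" by (auto simp: subgroup4_defs mat4_eq_iff mat_nth)
  qed (use group4_standard in \<open>auto simp: group4_def\<close>)
  show "tor 2 1 \<in> T4" by (rule tor_T4) auto
  show "tor 2 1 ** l = l ** tor 2 1" if "l \<in> La4" for l
    using that by (simp add: La4_def mat4_eq_iff mult4 tor_def)
  show "tor 2 1 ** u = u ** tor 2 1 \<longrightarrow> u = mat 1" if "u \<in> Ua4" for u
    using that by (auto simp: Ua4_def mat4_eq_iff mult4 tor_def mat_nth)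
qed (use group4_standard U_sub La4_Pa4 in auto)

lemma levi_data_Pb4: "levi_data Pb4 Lb4 Ub4 (tor 2 2)"
  unfolding levi_data_def
proof (intro conjI ballI)
  show "p ** u ** adj p \<in> Ub4" if "p \<in> Pb4" "u \<in> Ub4" for p u
    using normal_unipotent_standard(3) that by (auto simp: normal_unipotent_def)
  show "\<exists>l\<in>Lb4. \<exists>u\<in>Ub4. p = l ** u" if p: "p \<in> Pb4" for p
  proof -
    let ?l = "mat4 (p$1$1) (p$1$2) 0 0  (p$2$1) (p$2$2) 0 0  0 0 (p$3$3) (p$3$4)  0 0 (p$4$3) (p$4$4)"
    have pS: "p \<in> Sp4" and z: "p$3$1 = 0" "p$4$1 = 0" "p$3$2 = 0" "p$4$2 = 0" using p by (auto simp: Pb4_def)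
    note c = Sp4_cols[THEN iffD1, OF pS] Sp4_rows[OF pS]
    have l: "?l \<in> Lb4" using c z by (simp add: Lb4_def Sp4_cols)
    then have lS: "?l \<in> Sp4" by (simp add: Lb4_def)
    have "adj ?l ** p \<in> Sp4" using lS pS by (intro Sp4_mult Sp4_adj_closed)
    then have "adj ?l ** p \<in> Ub4" using z c by (simp add: Ub4_def mult4 algebra_simps)
    moreover have "p = ?l ** (adj ?l ** p)" by (simp only: adj_cancel(2)[OF lS])
    ultimately show ?thesis using l by blast
  qed
  show "Lb4 \<inter> Ub4 = {mat 1}"
  proof
    show "Lb4 \<inter> Ub4 \<subseteq> {mat 1}" by (auto simp: subgroup4_defs mat4_eq_iff mat_nth)
  qed (use group4_standard in \<open>auto simp: group4_def\<close>)
  show "tor 2 2 \<in> T4" by (rule tor_T4) auto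
  show "tor 2 2 ** l = l ** tor 2 2" if "l \<in> Lb4" for l
    using that by (simp add: Lb4_def mat4_eq_iff mult4 tor_def)
  show "tor 2 2 ** u = u ** tor 2 2 \<longrightarrow> u = mat 1" if "u \<in> Ub4" for u
    using that by (auto simp: Ub4_def mat4_eq_iff mult4 tor_def mat_nth)
qed (use group4_standard U_sub Lb4_Pb4 in auto)

lemma levi_data_Sp4: "levi_data Sp4 Sp4 {mat 1} (mat 1)"
  unfolding levi_data_def
  using group4_standard by (auto simp: group4_def adj_one adj_right Sp4_one T4_def)

text \<open>The bounds on normal unipotent subgroups, applied to the Levi subgroup itself, place N
  in the unipotent radical of the parabolic, which meets the Levi subgroup trivially.\<close>

lemma unipotent_Levi:
  "normal_unipotent T4 N \<Longrightarrow> N \<subseteq> {mat 1}" "normal_unipotent La4 N \<Longrightarrow> N \<subseteq> {mat 1}"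
  "normal_unipotent Lb4 N \<Longrightarrow> N \<subseteq> {mat 1}"
proof -
  have sub: "N \<subseteq> L" if "normal_unipotent L N" for L using that by (simp add: normal_unipotent_def)
  have TB: "T4 \<subseteq> B4" by (auto simp: T4_def B4_def)
  show "normal_unipotent T4 N \<Longrightarrow> N \<subseteq> {mat 1}"
    using normal_unipotent_sub_B4[OF _ TB] sub levi_data_B4 unfolding levi_data_def by blast
  show "normal_unipotent La4 N \<Longrightarrow> N \<subseteq> {mat 1}"
    using normal_unipotent_between_Pa4[OF _ order_refl La4_Pa4] sub levi_data_Pa4 unfolding levi_data_def by blast
  show "normal_unipotent Lb4 N \<Longrightarrow> N \<subseteq> {mat 1}"
    using normal_unipotent_between_Pb4[OF _ order_refl Lb4_Pb4] sub levi_data_Pb4 unfolding levi_data_def by blast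
qed

text \<open>The connectedness of the symplectic group: it is the product of the two opposite unipotent groups and
  the Borel subgroup.\<close>

lemma connected_Sp4: "connectedin zariski Sp4"
proof -
  let ?lo = "(\<lambda>x::complex \<times> complex \<times> complex \<times> complex. low (fst x) (fst (snd x)) (fst (snd (snd x))) (snd (snd (snd x)))) ` UNIV"
  have lo: "connectedin zariski ?lo"
    unfolding low_def by (intro connectedin_mat4_image continuous_intros convex_connected[OF convex_UNIV])
  have one: "mat 1 \<in> ?lo"
    by (rule image_eqI[of _ _ "(0, 0, 0, 0)"]) (simp_all add: low_def mat4_eq_iff mat_nth)
  have oneB: "mat 1 \<in> B4" using group4_standard by (simp add: group4_def)
  let ?LB = "{x ** y | x y. x \<in> ?lo \<and> y \<in> B4}"
  have oneLB: "mat 1 \<in> ?LB" using one oneB by (metis (mono_tags, lifting) matrix_mul_lid mem_Collect_eq)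
  have c: "connectedin zariski {x ** y | x y. x \<in> U4 \<and> y \<in> ?LB}"
    by (intro connectedin_zariski_product connected_U4 lo connected_B4 oneB oneLB)
  have "{x ** y | x y. x \<in> U4 \<and> y \<in> ?LB} = Sp4"
  proof (intro equalityI subsetI)
    fix A assume A: "A \<in> Sp4"
    obtain u where u: "u \<in> U4" "u ** A \<in> bigcell" using translate_bigcell[OF A] by blast
    have uS: "u \<in> Sp4" using u by (simp add: U4_def)
    have AS: "u ** A \<in> Sp4" using uS A Sp4_mult by blast
    note d = bigcell_decomp[OF AS u(2)]
    have "low4 (psi4 (u ** A)) \<in> ?lo"
      by (rule image_eqI[of _ _ "(psi4 (u ** A) $ 1, psi4 (u ** A) $ 2, psi4 (u ** A) $ 3, psi4 (u ** A) $ 4)"])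
        (simp_all add: low4_def)
    then have LB: "u ** A \<in> ?LB" using d by blast
    have "adj u \<in> U4" using u group4_standard by (simp add: group4_def)
    moreover have "A = adj u ** (u ** A)" by (simp add: adj_cancel uS)
    ultimately show "A \<in> {x ** y | x y. x \<in> U4 \<and> y \<in> ?LB}" using LB by blast
  next
    fix A assume "A \<in> {x ** y | x y. x \<in> U4 \<and> y \<in> ?LB}"
    then obtain x l b where A: "A = x ** (l ** b)" "x \<in> U4" "l \<in> ?lo" "b \<in> B4" by blast
    have "l \<in> Sp4" using A(3) low_Sp4 by auto
    then show "A \<in> Sp4" using A by (auto simp: U4_def B4_def intro!: Sp4_mult)
  qed
  then show ?thesis using c by simp
qed

lemma Ka4_Kb4_group: "group4 Ka4" "group4 Kb4"
  using group4_standard by (auto simp: group4_def Ka4_def Kb4_def)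

lemma Ka4_Kb4_closed: "closedin zariski Ka4" "closedin zariski Kb4"
  using closedin_standard by (auto simp: Ka4_def Kb4_def)

context sp4_rep
begin

lemma reductive_Levi:
  "connected_reductive (Psi ` T4)" "connected_reductive (Psi ` La4)" "connected_reductive (Psi ` Lb4)"
  "connected_reductive (Psi ` Sp4)"
proof -
  have *: "connected_reductive (Psi ` L)" if "group4 L" "closedin zariski L" "connectedin zariski L"
    "\<And>N. normal_unipotent L N \<Longrightarrow> N \<subseteq> {mat 1}" for L
  proof -
    have LS: "L \<subseteq> Sp4" using that(1) by (simp add: group4_def)
    have one: "normal_unipotent L {mat 1}"
      using normal_unipotent_standard(4) that(1) LS
      by (auto simp: normal_unipotent_def group4_def)
    have "closedin zariski {mat 1 :: complex^4^4}"
    proof -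
      have "{mat 1 :: complex^4^4} = {A. \<forall>f\<in>range (\<lambda>(i, j) A. A $ i $ j - mat 1 $ i $ j). f A = 0}"
        by (auto simp: vec_eq_iff)
      then show ?thesis
        by (rule closedin_zariskiI[rotated]) (auto intro!: poly_fun_diff poly_fun.entry poly_fun.const)
    qed
    then have "\<Union>{N. normal_unipotent L N \<and> closedin zariski N \<and> connectedin zariski N} = {mat 1}"
      using one that(4) by (auto simp: connectedin_sing)
    then show ?thesis
      using that LS by (simp add: connected_reductive_def connected_algebraic_Psi unipotent_radical_Psi Psi_one)
  qed
  show "connected_reductive (Psi ` T4)" "connected_reductive (Psi ` La4)" "connected_reductive (Psi ` Lb4)"
    by (intro * group4_standard closedin_standard connected_T4 connected_La4_Ka4 connected_Lb4_Kb4 unipotent_Levi; assumption)+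
  show "connected_reductive (Psi ` Sp4)"
    by (intro * group4_standard closedin_Sp4 connected_Sp4 normal_unipotent_Sp4)
qed

lemma borel_of_Levi:
  assumes K: "group4 K" "closedin zariski K" "connectedin zariski K" "K \<subseteq> B4" "K \<subseteq> L" "L \<subseteq> Sp4"
    and max: "\<And>H. group4 H \<Longrightarrow> connectedin zariski H \<Longrightarrow> solvable (sub_group H) \<Longrightarrow> H \<subseteq> L \<Longrightarrow> K \<subseteq> H \<Longrightarrow> H \<subseteq> K"
  shows "borel_subgroup (Psi ` L) (Psi ` K)"
  unfolding borel_subgroup_def
proof (intro conjI allI impI)
  have KS: "K \<subseteq> Sp4" using K by blast
  show "Psi ` K \<subseteq> Psi ` L" using K by blast
  show "connected_algebraic_group (Psi ` K)" using K KS connected_algebraic_Psi by blast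
  have "solvable (sub_group K)"
    by (rule solvable_sub_group_mono[OF group4_subgroup[OF group4_standard(2)] group4_subgroup[OF K(1)] K(4) solvable_B4])
  then show "solvable (sub_group (Psi ` K))" using solvable_Psi[OF K(1)] by simp
  fix B' assume B': "B' \<subseteq> Psi ` L \<and> connected_algebraic_group B' \<and> solvable (sub_group B') \<and> Psi ` K \<subseteq> B'"
  then obtain H where H: "H \<subseteq> L" "B' = Psi ` H" by (meson subset_imageE)
  then have HS: "H \<subseteq> Sp4" using K by blast
  have "group4 H" "connectedin zariski H" using B' H(2) connected_algebraic_Psi[OF HS] by auto
  moreover have "solvable (sub_group H)" using B' H(2) solvable_Psi[OF \<open>group4 H\<close>] by simp
  moreover have "K \<subseteq> H"
  proof
    fix k assume "k \<in> K"
    then have "Psi k \<in> Psi ` H" using B' H(2) by blast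
    then show "k \<in> H" by simp
  qed
  ultimately have "H \<subseteq> K" using max H(1) by blast
  then show "B' = Psi ` K" using H(2) \<open>K \<subseteq> H\<close> by blast
qed

text \<open>A connected solvable group between K and L has a common eigenvector in the two by two
  block. The group contains a nontrivial unipotent upper triangular element, whose only eigenline is
  the first axis; so the whole block is upper triangular.\<close>

lemma borel_Levi:
  "borel_subgroup (Psi ` T4) (Psi ` T4)" "borel_subgroup (Psi ` La4) (Psi ` Ka4)"
  "borel_subgroup (Psi ` Lb4) (Psi ` Kb4)"
proof -
  have S: "T4 \<subseteq> Sp4" "La4 \<subseteq> Sp4" "Lb4 \<subseteq> Sp4" "T4 \<subseteq> B4" by (auto simp: subgroup4_defs)
  show "borel_subgroup (Psi ` T4) (Psi ` T4)"
    by (rule borel_of_Levi) (use group4_standard closedin_standard connected_T4 S in auto)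
  show "borel_subgroup (Psi ` La4) (Psi ` Ka4)"
  proof (rule borel_of_Levi[OF Ka4_Kb4_group(1) Ka4_Kb4_closed(1) connected_La4_Ka4(2)])
    fix H assume H: "group4 H" "connectedin zariski H" "solvable (sub_group H)" "H \<subseteq> La4" "Ka4 \<subseteq> H"
    have "\<exists>w. w \<noteq> 0 \<and> (\<forall>h\<in>H. \<exists>c. middle_block h *v w = c *s w)"
    proof (rule lie_kolchin_image[OF H(1-3)])
      show "(\<lambda>A. middle_block A $ i $ j) \<in> poly_fun" for i j
        unfolding middle_block_def by (simp add: poly_fun.entry)
      show "middle_block (A ** B) = middle_block A ** middle_block B" if "A \<in> H" "B \<in> H" for A B
        using that H(4) La4_Pa4 by (intro block_mult) auto
    qed (rule block_one)
    then obtain w where w: "w \<noteq> 0" "\<And>h. h \<in> H \<Longrightarrow> \<exists>c. middle_block h *v w = c *s w" by blast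
    have "xb 1 \<in> H" using H(5) one_param_in by (auto simp: Ka4_def)
    then obtain c where "middle_block (xb 1) *v w = c *s w" using w(2) by blast
    then have "w$1 + w$2 = c * w$1" "w$2 = c * w$2"
      using block_mult_vec(1,2)[of "xb 1" w] by (simp_all add: xb_def upp_def)
    then have w2: "w$2 = 0" by (cases "c = 1") auto
    then have w1: "w$1 \<noteq> 0" using w(1) by (auto simp: vec_eq_iff forall_2)
    show "H \<subseteq> Ka4"
    proof
      fix h assume h: "h \<in> H"
      then obtain c where "middle_block h *v w = c *s w" using w(2) by blast
      then have "h$3$2 = 0" using block_mult_vec(2)[of h w] w1 w2 by simp
      then show "h \<in> Ka4" using h H(4) by (auto simp: Ka4_def La4_def B4_def)
    qed
  qed (use S in \<open>auto simp: Ka4_def\<close>)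
  show "borel_subgroup (Psi ` Lb4) (Psi ` Kb4)"
  proof (rule borel_of_Levi[OF Ka4_Kb4_group(2) Ka4_Kb4_closed(2) connected_Lb4_Kb4(2)])
    fix H assume H: "group4 H" "connectedin zariski H" "solvable (sub_group H)" "H \<subseteq> Lb4" "Kb4 \<subseteq> H"
    have "\<exists>w. w \<noteq> 0 \<and> (\<forall>h\<in>H. \<exists>c. top_block h *v w = c *s w)"
    proof (rule lie_kolchin_image[OF H(1-3)])
      show "(\<lambda>A. top_block A $ i $ j) \<in> poly_fun" for i j
        unfolding top_block_def by (simp add: poly_fun.entry)
      show "top_block (A ** B) = top_block A ** top_block B" if "A \<in> H" "B \<in> H" for A B
        using that H(4) Lb4_Pb4 by (intro block_mult) auto
    qed (rule block_one)
    then obtain w where w: "w \<noteq> 0" "\<And>h. h \<in> H \<Longrightarrow> \<exists>c. top_block h *v w = c *s w" by blast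
    have "xa 1 \<in> H" using H(5) one_param_in by (auto simp: Kb4_def)
    then obtain c where "top_block (xa 1) *v w = c *s w" using w(2) by blast
    then have "w$1 + w$2 = c * w$1" "w$2 = c * w$2"
      using block_mult_vec(3,4)[of "xa 1" w] by (simp_all add: xa_def upp_def)
    then have w2: "w$2 = 0" by (cases "c = 1") auto
    then have w1: "w$1 \<noteq> 0" using w(1) by (auto simp: vec_eq_iff forall_2)
    show "H \<subseteq> Kb4"
    proof
      fix h assume h: "h \<in> H"
      then obtain c where "top_block h *v w = c *s w" using w(2) by blast
      then have "h$2$1 = 0" using block_mult_vec(4)[of h w] w1 w2 by simp
      then show "h \<in> Kb4" using h H(4) unfolding Kb4_def B4_eq Lb4_def by auto
    qed
  qed (use S in \<open>auto simp: Kb4_def\<close>)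
qed

lemma levi_subgroup_eq:
  assumes D: "levi_data P L U z" and U: "unipotent_radical (Psi ` P) = Psi ` U"
    and L: "levi_subgroup (Psi ` P) L'" "Psi ` T4 \<subseteq> L'"
  shows "L' = Psi ` L"
proof -
  have PS: "P \<subseteq> Sp4" using D by (simp add: levi_data_def group4_def)
  note l = L(1)[unfolded levi_subgroup_def U]
  obtain L0 where L0: "L0 \<subseteq> P" "L' = Psi ` L0" using l by (meson subset_imageE)
  have "L0 = L"
  proof (rule levi_unique[OF D])
    show "group4 L0" using l L0 PS linear_algebraic_Psi[of L0] by auto
    show "T4 \<subseteq> L0"
    proof
      fix t assume "t \<in> T4"
      then have "Psi t \<in> Psi ` L0" using L(2) L0(2) by blast
      then show "t \<in> L0" by simp
    qed
    show "\<exists>l\<in>L0. \<exists>u\<in>U. p = l ** u" if p: "p \<in> P" for p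
    proof -
      have "Psi p \<in> Psi ` L0 <#>\<^bsub>GL\<^esub> Psi ` U" using l p L0(2) by blast
      then obtain a b where "a \<in> L0" "b \<in> U" "Psi p = Psi a ** Psi b" by (auto simp: set_mult_def)
      then have "Psi p = Psi (a ** b)" by (simp add: Psi_mult)
      then show ?thesis using \<open>a \<in> L0\<close> \<open>b \<in> U\<close> by auto
    qed
    show "L0 \<inter> U \<subseteq> {mat 1}"
    proof
      fix x assume "x \<in> L0 \<inter> U"
      then have "Psi x \<in> Psi ` L0 \<inter> Psi ` U" by blast
      then have "Psi x = Psi (mat 1)" using l L0(2) Psi_one by auto
      then show "x \<in> {mat 1}" by simp
    qed
  qed (rule L0(1))
  then show ?thesis using L0 by simp
qed

end

section \<open>Sphericity from explicit orbits\<close>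

context sp4_rep
begin

definition standard_parabolic :: "(complex^4^4) set \<Rightarrow> (complex^4^4) set \<Rightarrow> (complex^4^4) set \<Rightarrow> bool" where
  "standard_parabolic P L K \<longleftrightarrow> (\<exists>U z. levi_data P L U z \<and> unipotent_radical (Psi ` P) = Psi ` U) \<and>
     connected_reductive (Psi ` L) \<and> borel_subgroup (Psi ` L) (Psi ` K)"

lemma standard_parabolics:
  "standard_parabolic B4 T4 T4" "standard_parabolic Pa4 La4 Ka4" "standard_parabolic Pb4 Lb4 Kb4"
  "borel_subgroup (Psi ` Sp4) (Psi ` B4) \<Longrightarrow> standard_parabolic Sp4 Sp4 B4"
proof -
  have *: "standard_parabolic P L K" if "levi_data P L U z" "unipotent_radical (Psi ` P) = Psi ` U"
    "connected_reductive (Psi ` L)" "borel_subgroup (Psi ` L) (Psi ` K)" for P L K U z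
    unfolding standard_parabolic_def using that by blast
  show "standard_parabolic B4 T4 T4" "standard_parabolic Pa4 La4 Ka4" "standard_parabolic Pb4 Lb4 Kb4"
    by (rule * levi_data_B4 levi_data_Pa4 levi_data_Pb4 unipotent_radical_standard reductive_Levi borel_Levi)+
  show "standard_parabolic Sp4 Sp4 B4" if "borel_subgroup (Psi ` Sp4) (Psi ` B4)"
    by (rule *[OF levi_data_Sp4 _ reductive_Levi(4) that]) (simp add: unipotent_radical_standard(4) Psi_one)
qed

lemma nonvanishing_locus_open:
  assumes Z: "schubert_chart Z \<kappa>" and q: "q \<in> poly_fun"
    and qr: "\<And>A b. A \<in> Sp4 \<Longrightarrow> b \<in> B4 \<Longrightarrow> q (A ** b) = 0 \<longleftrightarrow> q A = 0"
  shows "closedin flags (cs ` {A \<in> Sp4. q A = 0})"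
    "openin (subtopology flags (cs ` Z)) (cs ` {A \<in> Z. q A \<noteq> 0})"
proof -
  have p: "pre (cs ` {A \<in> Sp4. q A = 0}) = {A. A \<in> Sp4 \<and> q A = 0}"
    by (subst pre_cs_image) (auto simp: qr Sp4_mult B4_Sp4)
  have "closedin zariski {A. A \<in> Sp4 \<and> q A = 0}"
    using closedin_Sp4 q by (intro closedin_zariski_conj closedin_zariski_zero) simp_all
  then show c: "closedin flags (cs ` {A \<in> Sp4. q A = 0})" unfolding closedin_flags p by auto
  have ZS: "Z \<subseteq> Sp4" using Z by (simp add: schubert_chart_def)
  have "q A = 0 \<longleftrightarrow> q A' = 0" if AA: "A \<in> Sp4" "A' \<in> Sp4" "cs A = cs A'" for A A'
    using cs_eqD[OF AA(3)] qr[OF AA(1)] by auto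
  note inv = this
  have "cs ` {A \<in> Z. q A \<noteq> 0} = (cs ` Sp4 - cs ` {A \<in> Sp4. q A = 0}) \<inter> cs ` Z"
  proof (intro equalityI subsetI)
    fix c assume "c \<in> cs ` {A \<in> Z. q A \<noteq> 0}"
    then obtain A where A: "A \<in> Z" "q A \<noteq> 0" "c = cs A" by blast
    have "c \<notin> cs ` {A \<in> Sp4. q A = 0}"
    proof
      assume "c \<in> cs ` {A \<in> Sp4. q A = 0}"
      then obtain A' where "A' \<in> Sp4" "q A' = 0" "c = cs A'" by blast
      then show False using inv[of A A'] A ZS by auto
    qed
    then show "c \<in> (cs ` Sp4 - cs ` {A \<in> Sp4. q A = 0}) \<inter> cs ` Z" using A ZS by blast
  next
    fix c assume c: "c \<in> (cs ` Sp4 - cs ` {A \<in> Sp4. q A = 0}) \<inter> cs ` Z"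
    then obtain A where "A \<in> Z" "c = cs A" by blast
    then show "c \<in> cs ` {A \<in> Z. q A \<noteq> 0}" using c ZS by blast
  qed
  moreover have "openin flags (cs ` Sp4 - cs ` {A \<in> Sp4. q A = 0})"
    using openin_diff[OF openin_topspace c] by (simp only: topspace_flags)
  ultimately show "openin (subtopology flags (cs ` Z)) (cs ` {A \<in> Z. q A \<noteq> 0})"
    unfolding openin_subtopology by blast
qed

text \<open>The closure of X and the zero locus of q cover Z. By irreducibility one of them contains
  Z, and \<open>n\<close> shows that it is not the zero locus.\<close>

lemma closure_of_cell:
  assumes Z: "schubert_chart Z \<kappa>" and q: "q \<in> poly_fun"
    and qr: "\<And>A b. A \<in> Sp4 \<Longrightarrow> b \<in> B4 \<Longrightarrow> q (A ** b) = 0 \<longleftrightarrow> q A = 0"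
    and X: "X \<subseteq> Z" "{A \<in> Z. q A \<noteq> 0} \<subseteq> X" "n \<in> Z" "q n \<noteq> 0"
  shows "flags closure_of (cs ` X) = cs ` Z"
proof
  have ZS: "Z \<subseteq> Sp4" using Z by (simp add: schubert_chart_def)
  show "flags closure_of (cs ` X) \<subseteq> cs ` Z"
    using schubert_chart_closed[OF Z] X(1) by (intro closure_of_minimal) auto
  let ?D = "cs ` {A \<in> Sp4. q A = 0}"
  have sub: "cs ` X \<subseteq> flags closure_of (cs ` X)"
    using X(1) ZS by (intro closure_of_subset) (auto simp: topspace_flags)
  then have "cs ` Z \<subseteq> flags closure_of (cs ` X) \<union> ?D" using X(2) ZS by blast
  from schubert_chart_irreducible[OF Z closedin_closure_of nonvanishing_locus_open(1)[OF Z q qr] this]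
  have "cs ` Z \<subseteq> flags closure_of (cs ` X) \<or> cs ` Z \<subseteq> ?D" by blast
  moreover have "\<not> cs ` Z \<subseteq> ?D"
  proof
    assume "cs ` Z \<subseteq> ?D"
    then obtain A where A: "A \<in> Sp4" "q A = 0" "cs A = cs n" using X(3) by blast
    then obtain b where "b \<in> B4" "n = A ** b" using cs_eqD by blast
    then show False using qr A X(4) by auto
  qed
  ultimately show "cs ` Z \<subseteq> flags closure_of (cs ` X)" by blast
qed

lemma spherical_of_orbit:
  assumes Z: "schubert_chart Z \<kappa>" and q: "q \<in> poly_fun"
    and qr: "\<And>A b. A \<in> Sp4 \<Longrightarrow> b \<in> B4 \<Longrightarrow> q (A ** b) = 0 \<longleftrightarrow> q A = 0"
    and orb: "\<And>A. A \<in> Z \<Longrightarrow> q A \<noteq> 0 \<longleftrightarrow> (\<exists>k\<in>K. \<exists>b\<in>B4. A = k ** y ** b)"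
    and y: "y \<in> Z" "q y \<noteq> 0"
    and L: "K \<subseteq> L" "L \<subseteq> Sp4" "\<And>l A. l \<in> L \<Longrightarrow> A \<in> Z \<Longrightarrow> l ** A \<in> Z"
    and red: "connected_reductive (Psi ` L)" and bor: "borel_subgroup (Psi ` L) (Psi ` K)"
  shows "spherical_subvariety (Psi ` Sp4) (Psi ` B4) (Psi ` L) (cs ` Z)"
proof -
  have orbit: "(\<lambda>k. k <#\<^bsub>GL\<^esub> cs y) ` (Psi ` K) = cs ` {A \<in> Z. q A \<noteq> 0}"
  proof (intro equalityI subsetI)
    fix c assume "c \<in> (\<lambda>k. k <#\<^bsub>GL\<^esub> cs y) ` (Psi ` K)"
    then obtain k where k: "k \<in> K" "c = cs (k ** y)" by (auto simp: cs_act)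
    have "k ** y \<in> Z" using L k y by blast
    moreover have "k ** y = k ** y ** mat 1" by simp
    then have "q (k ** y) \<noteq> 0" using orb[OF \<open>k ** y \<in> Z\<close>] k(1) B4_one by blast
    ultimately show "c \<in> cs ` {A \<in> Z. q A \<noteq> 0}" using k by blast
  next
    fix c assume "c \<in> cs ` {A \<in> Z. q A \<noteq> 0}"
    then obtain A where A: "A \<in> Z" "q A \<noteq> 0" "c = cs A" by blast
    then obtain k b where kb: "k \<in> K" "b \<in> B4" "A = k ** y ** b" using orb by blast
    then have "c = Psi k <#\<^bsub>GL\<^esub> cs y" using A(3) cs_right by (simp add: cs_act)
    then show "c \<in> (\<lambda>k. k <#\<^bsub>GL\<^esub> cs y) ` (Psi ` K)" using kb(1) by blast
  qed
  have op: "openin (subtopology flags (cs ` Z)) (cs ` {A \<in> Z. q A \<noteq> 0})"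
    by (rule nonvanishing_locus_open(2)[OF Z q qr])
  have "flags closure_of (cs ` {A \<in> Z. q A \<noteq> 0}) = cs ` Z"
    by (rule closure_of_cell[OF Z q qr _ _ y]) auto
  moreover have "cs ` Z \<inter> cs ` {A \<in> Z. q A \<noteq> 0} = cs ` {A \<in> Z. q A \<noteq> 0}" by blast
  ultimately have dense: "subtopology flags (cs ` Z) closure_of (cs ` {A \<in> Z. q A \<noteq> 0}) = cs ` Z"
    by (simp add: closure_of_subtopology)
  have st: "\<forall>h\<in>Psi ` L. \<forall>x\<in>cs ` Z. h <#\<^bsub>GL\<^esub> x \<in> cs ` Z" using L(3) by (auto simp: cs_act)
  have ex: "\<exists>x\<in>cs ` Z. let orbit = (\<lambda>k. k <#\<^bsub>GL\<^esub> x) ` (Psi ` K) in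
        openin (subtopology flags (cs ` Z)) orbit \<and> subtopology flags (cs ` Z) closure_of orbit = cs ` Z"
    by (rule bexI[of _ "cs y"]) (use op dense y in \<open>simp_all add: orbit\<close>)
  show ?thesis
    unfolding spherical_subvariety_def
    using red L(2) normal_chart[OF Z] st bor ex by (intro conjI exI[of _ "Psi ` K"] image_mono)
qed

lemma schubert_stabilizer_eq:
  assumes Z: "schubert_chart Z \<kappa>" and w: "schubert_variety (Psi ` Sp4) (Psi ` B4) w = cs ` Z"
    and P: "group4 P" "\<And>p A. p \<in> P \<Longrightarrow> A \<in> Z \<Longrightarrow> p ** A \<in> Z"
      "\<And>g. g \<in> Sp4 \<Longrightarrow> (\<And>A. A \<in> Z \<Longrightarrow> g ** A \<in> Z) \<Longrightarrow> g \<in> P"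
  shows "schubert_stabilizer (Psi ` Sp4) (Psi ` B4) w = Psi ` P"
proof -
  have ZS: "Z \<subseteq> Sp4" and pZ: "pre (cs ` Z) = Z"
    using Z schubert_chart_pre by (auto simp: schubert_chart_def)
  have PS: "P \<subseteq> Sp4" using P(1) by (simp add: group4_def)
  have act: "(\<lambda>y. Psi g <#\<^bsub>GL\<^esub> y) ` cs ` Z = cs ` ((**) g ` Z)" for g
    by (simp add: image_image cs_act)
  have iff: "(\<lambda>y. Psi g <#\<^bsub>GL\<^esub> y) ` (cs ` Z) = cs ` Z \<longleftrightarrow> g \<in> P" if g: "g \<in> Sp4" for g
    unfolding act
  proof
    assume e: "cs ` ((**) g ` Z) = cs ` Z"
    show "g \<in> P"
    proof (rule P(3)[OF g])
      fix A assume A: "A \<in> Z"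
      then have "cs (g ** A) \<in> cs ` Z" using e by blast
      moreover have "g ** A \<in> Sp4" using g A ZS by (intro Sp4_mult) auto
      ultimately have "g ** A \<in> pre (cs ` Z)" by (simp add: pre_def)
      then show "g ** A \<in> Z" using pZ by simp
    qed
  next
    assume gP: "g \<in> P"
    have "(**) g ` Z = Z"
    proof
      show "(**) g ` Z \<subseteq> Z" using P(2)[OF gP] by blast
      have "adj g \<in> P" using gP P(1) by (simp add: group4_def)
      then have "A = g ** (adj g ** A)" "adj g ** A \<in> Z" if "A \<in> Z" for A
        using P(2) that by (simp_all add: adj_cancel g)
      then show "Z \<subseteq> (**) g ` Z" by blast
    qed
    then show "cs ` ((**) g ` Z) = cs ` Z" by simp
  qed
  show ?thesis unfolding schubert_stabilizer_def w
  proof (intro equalityI subsetI)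
    fix h assume "h \<in> {h \<in> Psi ` Sp4. (\<lambda>y. h <#\<^bsub>GL\<^esub> y) ` (cs ` Z) = cs ` Z}"
    then obtain g where "g \<in> Sp4" "h = Psi g" "(\<lambda>y. Psi g <#\<^bsub>GL\<^esub> y) ` (cs ` Z) = cs ` Z" by blast
    then show "h \<in> Psi ` P" using iff by blast
  next
    fix h assume "h \<in> Psi ` P"
    then obtain g where g: "g \<in> P" "h = Psi g" by blast
    then have "(\<lambda>y. h <#\<^bsub>GL\<^esub> y) ` (cs ` Z) = cs ` Z" using iff PS by blast
    then show "h \<in> {h \<in> Psi ` Sp4. (\<lambda>y. h <#\<^bsub>GL\<^esub> y) ` (cs ` Z) = cs ` Z}" using g PS by blast
  qed
qed

text \<open>Two semi-invariants do the work: q is nonzero exactly on the Bruhat cell, with a fixed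
  representative \<open>N\<close> in the double coset of the given \<open>n\<close>, and q' is
  nonzero exactly on the open orbit of the Borel subgroup K of the Levi subgroup, with base point
  \<open>y\<close>.\<close>

lemma schubert_case:
  assumes Z: "schubert_chart Z \<kappa>" and q: "q \<in> poly_fun"
    and qr: "\<And>A b. A \<in> Sp4 \<Longrightarrow> b \<in> B4 \<Longrightarrow> q (A ** b) = 0 \<longleftrightarrow> q A = 0"
    and cell: "\<And>A. A \<in> Z \<Longrightarrow> q A \<noteq> 0 \<Longrightarrow> \<exists>u\<in>B4. \<exists>b\<in>B4. A = u ** N ** b"
    and n: "n \<in> Z" "q n \<noteq> 0"
    and w: "schubert_variety (Psi ` Sp4) (Psi ` B4) w = flags closure_of (cs ` {b ** n ** b' | b b'. b \<in> B4 \<and> b' \<in> B4})"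
    and P: "standard_parabolic P L K" "K \<subseteq> L"
      "\<And>p A. p \<in> P \<Longrightarrow> A \<in> Z \<Longrightarrow> p ** A \<in> Z"
      "\<And>g. g \<in> Sp4 \<Longrightarrow> (\<And>A. A \<in> Z \<Longrightarrow> g ** A \<in> Z) \<Longrightarrow> g \<in> P"
    and q': "q' \<in> poly_fun" "\<And>A b. A \<in> Sp4 \<Longrightarrow> b \<in> B4 \<Longrightarrow> q' (A ** b) = 0 \<longleftrightarrow> q' A = 0"
      "\<And>A k. A \<in> Sp4 \<Longrightarrow> k \<in> K \<Longrightarrow> q' (k ** A) = 0 \<longleftrightarrow> q' A = 0"
      "\<And>A. A \<in> Z \<Longrightarrow> q' A \<noteq> 0 \<Longrightarrow> \<exists>k\<in>K. \<exists>b\<in>B4. A = k ** y ** b" "y \<in> Z" "q' y \<noteq> 0"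
    and L': "levi_subgroup (schubert_stabilizer (Psi ` Sp4) (Psi ` B4) w) L'" "Psi ` T4 \<subseteq> L'"
  shows "spherical_subvariety (Psi ` Sp4) (Psi ` B4) L' (schubert_variety (Psi ` Sp4) (Psi ` B4) w)"
proof -
  obtain U z where U: "levi_data P L U z" "unipotent_radical (Psi ` P) = Psi ` U"
    using P(1) unfolding standard_parabolic_def by blast
  have PG: "group4 P" and LP: "L \<subseteq> P" using U(1) by (auto simp: levi_data_def)
  then have LS: "L \<subseteq> Sp4" by (auto simp: group4_def)
  have ZS: "Z \<subseteq> Sp4" and Zb: "\<And>A b. A \<in> Z \<Longrightarrow> b \<in> B4 \<Longrightarrow> A ** b \<in> Z \<and> b ** A \<in> Z"
    using Z by (auto simp: schubert_chart_def)
  have "{A \<in> Z. q A \<noteq> 0} \<subseteq> {b ** n ** b' | b b'. b \<in> B4 \<and> b' \<in> B4}"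
  proof
    fix A assume "A \<in> {A \<in> Z. q A \<noteq> 0}"
    then obtain u b where A: "u \<in> B4" "b \<in> B4" "A = u ** N ** b" using cell by blast
    obtain u' b' where n': "u' \<in> B4" "b' \<in> B4" "n = u' ** N ** b'" using cell[OF n] by blast
    have S: "u' \<in> Sp4" "b' \<in> Sp4" using n' B4_Sp4 by auto
    have "(u ** adj u') ** n ** (adj b' ** b) = u ** (adj u' ** (u' ** (N ** (b' ** (adj b' ** b)))))"
      by (simp only: n'(3) matrix_mul_assoc)
    also have "\<dots> = u ** (N ** b)" by (simp add: adj_cancel S)
    also have "\<dots> = A" by (simp only: A(3) matrix_mul_assoc)
    finally have "A = (u ** adj u') ** n ** (adj b' ** b)" by simp
    moreover have "u ** adj u' \<in> B4" "adj b' ** b \<in> B4" using A n' B4_mult B4_adj by auto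
    ultimately show "A \<in> {b ** n ** b' | b b'. b \<in> B4 \<and> b' \<in> B4}" by blast
  qed
  moreover have "{b ** n ** b' | b b'. b \<in> B4 \<and> b' \<in> B4} \<subseteq> Z" using Zb n(1) by blast
  ultimately have sv: "schubert_variety (Psi ` Sp4) (Psi ` B4) w = cs ` Z"
    unfolding w by (intro closure_of_cell[OF Z q qr _ _ n]) auto
  have "schubert_stabilizer (Psi ` Sp4) (Psi ` B4) w = Psi ` P"
    by (rule schubert_stabilizer_eq[OF Z sv PG P(3,4)])
  then have "L' = Psi ` L" using levi_subgroup_eq[OF U] L' by simp
  moreover have "spherical_subvariety (Psi ` Sp4) (Psi ` B4) (Psi ` L) (cs ` Z)"
  proof (rule spherical_of_orbit[OF Z q'(1,2)])
    show "K \<subseteq> L" by fact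
    fix A assume A: "A \<in> Z"
    show "q' A \<noteq> 0 \<longleftrightarrow> (\<exists>k\<in>K. \<exists>b\<in>B4. A = k ** y ** b)"
    proof
      assume "\<exists>k\<in>K. \<exists>b\<in>B4. A = k ** y ** b"
      then obtain k b where kb: "k \<in> K" "b \<in> B4" "A = k ** y ** b" by blast
      have yS: "y \<in> Sp4" using q'(5) ZS by blast
      have "k \<in> Sp4" using kb(1) P(2) LS by blast
      then have "k ** y \<in> Sp4" using yS by (rule Sp4_mult)
      then show "q' A \<noteq> 0" using q'(2)[OF _ kb(2)] q'(3)[OF yS kb(1)] q'(6) kb(3) by simp
    qed (rule q'(4)[OF A])
  qed (use q' LP P LS in \<open>auto simp: standard_parabolic_def\<close>)
  ultimately show ?thesis using sv by simp
qed

end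

section \<open>The eight Schubert varieties\<close>

text \<open>Since \<open>\<kappa> x\<close> lies in its own fibre, the functions p and q themselves
  can serve as p' and q'.\<close>

lemma descends_retract:
  assumes "\<And>i. (\<lambda>x. \<kappa> x $ i) \<in> PF" "\<And>x. \<kappa> (\<kappa> x) = \<kappa> x" shows "descends \<kappa>"
  unfolding descends_def
proof (intro ballI impI)
  fix p q r assume "p \<in> PF" "q \<in> PF"
  then show "\<exists>p'\<in>PF. \<exists>q'\<in>PF. (\<forall>x. (\<forall>x'. \<kappa> x' = \<kappa> x \<longrightarrow> q x' \<noteq> 0) \<longrightarrow> q' (\<kappa> x) \<noteq> 0) \<and>
        (\<forall>x c. (\<forall>x'. \<kappa> x' = \<kappa> x \<longrightarrow> c * q x' = p x') \<longrightarrow> c * q' (\<kappa> x) = p' (\<kappa> x))"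
    using assms(2) by (intro bexI[of _ p] bexI[of _ q]) auto
qed

lemma PF_vec4:
  assumes "a \<in> PF" "b \<in> PF" "c \<in> PF" "d \<in> PF" shows "(\<lambda>x. vec4 (a x) (b x) (c x) (d x) $ i) \<in> PF"
  using exhaust_4[of i] assms by auto

text \<open>The coordinates 2, 3, 4 parametrise the cone by products of two parameters; the fourth
  argument is a dummy that brings the source to four-space.\<close>

definition cone_map :: "complex^4 \<Rightarrow> complex^4" where
  "cone_map x = vec4 (x $ 1) (x $ 2 * x $ 2) (x $ 2 * x $ 3) (x $ 3 * x $ 3)"

text \<open>The even functions are the functions on the quadric cone.\<close>

lemma descends_cone: "descends cone_map"
  unfolding descends_def
proof (intro ballI impI)
  fix p q r :: "complex^4 \<Rightarrow> complex"
  assume pq: "p \<in> PF" "q \<in> PF" and r: "r \<in> PF" "\<exists>x. r x \<noteq> 0"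
    and cross: "\<forall>x x'. cone_map x = cone_map x' \<longrightarrow> r x \<noteq> 0 \<longrightarrow> p x * q x' = p x' * q x"
  \<comment> \<open>The sign change that generates the symmetry of the cone parametrisation,
    combined with setting the dummy coordinate to 0; \<open>\<pi>\<close> does only the
    latter.\<close>
  define \<sigma> where "\<sigma> x = vec4 (x $ 1) (- x $ 2) (- x $ 3) 0" for x :: "complex^4"
  define \<pi> where "\<pi> x = vec4 (x $ 1) (x $ 2) (x $ 3) 0" for x :: "complex^4"
  have PFs: "(\<lambda>x. \<sigma> x $ i) \<in> PF" "(\<lambda>x. \<pi> x $ i) \<in> PF" for i
    unfolding \<sigma>_def \<pi>_def by (intro PF_vec4 PF.coord PF_uminus PF.const)+
  have comp: "(\<lambda>x. f (\<sigma> x)) \<in> PF" "(\<lambda>x. f (\<pi> x)) \<in> PF" if "f \<in> PF" for f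
    using PF_comp[OF that PFs(1)] PF_comp[OF that PFs(2)] by auto
  have cs: "cone_map (\<sigma> x) = cone_map x" "cone_map (\<pi> x) = cone_map x" for x
    by (simp_all add: cone_map_def \<sigma>_def \<pi>_def)
  \<comment> \<open>Polynomials in the two parameters are generated by 1, x2 and x3 as a module over
    the functions on the cone: products of two parameters are cone coordinates. An even function has
    only the component at 1.\<close>
  have split: "\<exists>R0\<in>PF. \<exists>R1\<in>PF. \<exists>R2\<in>PF. \<forall>x. f (\<pi> x) = R0 (cone_map x) + x $ 2 * R1 (cone_map x) + x $ 3 * R2 (cone_map x)"
    if "f \<in> PF" for f
    using that
  proof induction
    case (const c)
    show ?case by (rule bexI[of _ "\<lambda>_. c"], rule bexI[of _ "\<lambda>_. 0"], rule bexI[of _ "\<lambda>_. 0"]) (auto intro: PF.const)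
  next
    case (coord i)
    consider "i = 1" | "i = 2" | "i = 3" | "i = 4" using exhaust_4 by blast
    then show ?case
    proof cases
      case 1 then show ?thesis
        by (intro bexI[of _ "\<lambda>y. y $ 1"] bexI[of _ "\<lambda>_. 0"]) (auto intro: PF.intros simp: \<pi>_def cone_map_def)
    next
      case 2 then show ?thesis
        by (intro bexI[of _ "\<lambda>_. 0" PF] bexI[of _ "\<lambda>_. 1" PF] bexI[of _ "\<lambda>_. 0" PF]) (auto intro: PF.intros simp: \<pi>_def)
    next
      case 3 then show ?thesis
        by (intro bexI[of _ "\<lambda>_. 0" PF] bexI[of _ "\<lambda>_. 0" PF] bexI[of _ "\<lambda>_. 1" PF]) (auto intro: PF.intros simp: \<pi>_def)
    next
      case 4 then show ?thesis
        by (intro bexI[of _ "\<lambda>_. 0" PF]) (auto intro: PF.intros simp: \<pi>_def)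
    qed
  next
    case (add f g)
    then obtain A0 A1 A2 B0 B1 B2 where h: "A0 \<in> PF" "A1 \<in> PF" "A2 \<in> PF" "B0 \<in> PF" "B1 \<in> PF" "B2 \<in> PF"
      "\<And>x. f (\<pi> x) = A0 (cone_map x) + x $ 2 * A1 (cone_map x) + x $ 3 * A2 (cone_map x)"
      "\<And>x. g (\<pi> x) = B0 (cone_map x) + x $ 2 * B1 (cone_map x) + x $ 3 * B2 (cone_map x)" by metis
    show ?case
      by (rule bexI[of _ "\<lambda>y. A0 y + B0 y"], rule bexI[of _ "\<lambda>y. A1 y + B1 y"], rule bexI[of _ "\<lambda>y. A2 y + B2 y"])
        (simp_all add: h PF.add algebra_simps)
  next
    case (mult f g)
    then obtain A0 A1 A2 B0 B1 B2 where h: "A0 \<in> PF" "A1 \<in> PF" "A2 \<in> PF" "B0 \<in> PF" "B1 \<in> PF" "B2 \<in> PF"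
      "\<And>x. f (\<pi> x) = A0 (cone_map x) + x $ 2 * A1 (cone_map x) + x $ 3 * A2 (cone_map x)"
      "\<And>x. g (\<pi> x) = B0 (cone_map x) + x $ 2 * B1 (cone_map x) + x $ 3 * B2 (cone_map x)" by metis
    show ?case
      by (rule bexI[of _ "\<lambda>y. A0 y * B0 y + y $ 2 * (A1 y * B1 y) + y $ 3 * (A1 y * B2 y + A2 y * B1 y) + y $ 4 * (A2 y * B2 y)"],
          rule bexI[of _ "\<lambda>y. A0 y * B1 y + A1 y * B0 y"], rule bexI[of _ "\<lambda>y. A0 y * B2 y + A2 y * B0 y"])
        (simp add: h cone_map_def algebra_simps, (intro PF.add PF.mult PF.coord h)+)
  qed
  have even: "\<exists>R\<in>PF. \<forall>x. f (\<pi> x) = R (cone_map x)" if f: "f \<in> PF" "\<And>x. f (\<sigma> x) = f (\<pi> x)" for f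
  proof -
    obtain R0 R1 R2 where R: "R0 \<in> PF" "\<And>x. f (\<pi> x) = R0 (cone_map x) + x $ 2 * R1 (cone_map x) + x $ 3 * R2 (cone_map x)"
      using split[OF f(1)] by blast
    have "f (\<pi> x) = R0 (cone_map x)" for x
    proof -
      have "\<pi> (\<sigma> x) = \<sigma> x" by (simp add: \<pi>_def \<sigma>_def)
      then have "f (\<sigma> x) = R0 (cone_map x) - x $ 2 * R1 (cone_map x) - x $ 3 * R2 (cone_map x)"
        using R(2)[of "\<sigma> x"] cs(1)[of x] by (simp add: \<sigma>_def)
      then have "2 * f (\<pi> x) = 2 * R0 (cone_map x)" using f(2)[of x] R(2)[of x] by (simp add: algebra_simps)
      then show ?thesis by simp
    qed
    then show ?thesis using R(1) by blast
  qed
  have sym: "p (\<pi> x) * q (\<sigma> x) = p (\<sigma> x) * q (\<pi> x)" for x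
  proof -
    obtain p1 where p1: "(\<lambda>x. p (\<pi> x) * q (\<sigma> x)) = eval4 p1" using PF_eval4[OF PF.mult[OF comp(2)[OF pq(1)] comp(1)[OF pq(2)]]] by blast
    obtain p2 where p2: "(\<lambda>x. p (\<sigma> x) * q (\<pi> x)) = eval4 p2" using PF_eval4[OF PF.mult[OF comp(1)[OF pq(1)] comp(2)[OF pq(2)]]] by blast
    obtain r1 where r1: "r = eval4 r1" using PF_eval4[OF r(1)] by blast
    obtain qe where qe: "q = eval4 qe" using PF_eval4[OF pq(2)] by blast
    show ?thesis
    proof (cases "qe = 0")
      case True then show ?thesis using qe by simp
    next
      case False
      have "p1 = p2"
      proof (rule eval4_eq_on_open[of "r1 * qe"])
        show "r1 * qe \<noteq> 0" using False r(2) r1 by auto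
        fix x assume "eval4 (r1 * qe) x \<noteq> 0"
        then have x: "r x \<noteq> 0" "q x \<noteq> 0" using r1 qe by auto
        have "p x * q (\<pi> x) = p (\<pi> x) * q x" "p x * q (\<sigma> x) = p (\<sigma> x) * q x"
          using cross x(1) cs by metis+
        then have "(p (\<pi> x) * q (\<sigma> x)) * q x = (p (\<sigma> x) * q (\<pi> x)) * q x"
          by (metis mult.assoc mult.commute)
        then have "p (\<pi> x) * q (\<sigma> x) = p (\<sigma> x) * q (\<pi> x)" using x(2) by simp
        then show "eval4 p1 x = eval4 p2 x" using p1 p2 by metis
      qed
      then show ?thesis using p1 p2 by metis
    qed
  qed
  have ss: "\<sigma> (\<sigma> x) = \<pi> x" "\<sigma> (\<pi> x) = \<sigma> x" "\<pi> (\<sigma> x) = \<sigma> x" "\<pi> (\<pi> x) = \<pi> x" for x by (simp_all add: \<sigma>_def \<pi>_def)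
  \<comment> \<open>Numerator and denominator are multiplied by the conjugate denominator. Then q'
    is a norm, which is nonzero where q vanishes nowhere on the fibre, and p' is even by the
    compatibility of p and q.\<close>
  obtain p' where p': "p' \<in> PF" "\<And>x. p (\<pi> (\<pi> x)) * q (\<sigma> (\<pi> x)) = p' (cone_map x)"
    using even[OF PF.mult[OF comp(2)[OF pq(1)] comp(1)[OF pq(2)]]] sym by (auto simp: ss)
  obtain q' where q': "q' \<in> PF" "\<And>x. q (\<pi> (\<pi> x)) * q (\<sigma> (\<pi> x)) = q' (cone_map x)"
    using even[OF PF.mult[OF comp(2)[OF pq(2)] comp(1)[OF pq(2)]]] by (auto simp: ss mult.commute)
  show "\<exists>p'\<in>PF. \<exists>q'\<in>PF. (\<forall>x. (\<forall>x'. cone_map x' = cone_map x \<longrightarrow> q x' \<noteq> 0) \<longrightarrow> q' (cone_map x) \<noteq> 0) \<and>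
        (\<forall>x c. (\<forall>x'. cone_map x' = cone_map x \<longrightarrow> c * q x' = p x') \<longrightarrow> c * q' (cone_map x) = p' (cone_map x))"
  proof (rule bexI[OF _ p'(1)], rule bexI[OF _ q'(1)], intro conjI allI impI)
    fix x assume "\<forall>x'. cone_map x' = cone_map x \<longrightarrow> q x' \<noteq> 0"
    then have "q (\<pi> x) \<noteq> 0" "q (\<sigma> x) \<noteq> 0" using cs by blast+
    then show "q' (cone_map x) \<noteq> 0" using q'(2)[of x] by (auto simp: ss)
  next
    fix x c assume "\<forall>x'. cone_map x' = cone_map x \<longrightarrow> c * q x' = p x'"
    then have "c * q (\<pi> x) = p (\<pi> x)" using cs by blast
    then show "c * q' (cone_map x) = p' (cone_map x)" using q'(2)[of x] p'(2)[of x] by (metis mult.assoc ss(4))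
  qed
qed

text \<open>For flags of a line in a plane: in \<open>Z24\<close> the line lies in the standard
  plane, in \<open>Z31\<close> the plane contains the standard line, in \<open>Z34\<close> the line
  is orthogonal to the standard line, in \<open>Z42\<close> the plane meets the standard plane. The
  remaining four varieties come from \<open>B4\<close>, \<open>Pa4\<close>, \<open>Pb4\<close> and
  \<open>Sp4\<close>.\<close>

definition "Z24 = {A \<in> Sp4. A$3$1 = 0 \<and> A$4$1 = 0}"
definition "Z31 = {A \<in> Sp4. A$4$1 = 0 \<and> A$4$2 = 0 \<and> mn A 2 3 = 0}"
definition "Z34 = {A \<in> Sp4. A$4$1 = 0}"
definition "Z42 = {A \<in> Sp4. mn A 3 4 = 0}"

lemma left_stable:
  "p \<in> B4 \<Longrightarrow> A \<in> B4 \<Longrightarrow> p ** A \<in> B4"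
  "p \<in> Pa4 \<Longrightarrow> A \<in> Pa4 \<Longrightarrow> p ** A \<in> Pa4"
  "p \<in> Pb4 \<Longrightarrow> A \<in> Pb4 \<Longrightarrow> p ** A \<in> Pb4"
  "p \<in> Pb4 \<Longrightarrow> A \<in> Z24 \<Longrightarrow> p ** A \<in> Z24"
  "p \<in> Pa4 \<Longrightarrow> A \<in> Z31 \<Longrightarrow> p ** A \<in> Z31"
  "p \<in> Pa4 \<Longrightarrow> A \<in> Z34 \<Longrightarrow> p ** A \<in> Z34"
  "p \<in> Pb4 \<Longrightarrow> A \<in> Z42 \<Longrightarrow> p ** A \<in> Z42"
proof -
  show "p \<in> B4 \<Longrightarrow> A \<in> B4 \<Longrightarrow> p ** A \<in> B4" "p \<in> Pa4 \<Longrightarrow> A \<in> Pa4 \<Longrightarrow> p ** A \<in> Pa4"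
    "p \<in> Pb4 \<Longrightarrow> A \<in> Pb4 \<Longrightarrow> p ** A \<in> Pb4"
    using group4_standard by (auto simp: group4_def)
  show "p \<in> Pb4 \<Longrightarrow> A \<in> Z24 \<Longrightarrow> p ** A \<in> Z24" "p \<in> Pa4 \<Longrightarrow> A \<in> Z34 \<Longrightarrow> p ** A \<in> Z34"
    by (auto simp: Z24_def Z34_def Pa4_def Pb4_def Sp4_mult mult4)
  show "p ** A \<in> Z31" if p: "p \<in> Pa4" and A: "A \<in> Z31"
  proof -
    have z: "A$4$1 = 0" "A$4$2 = 0" using A by (auto simp: Z31_def)
    have "mn (p ** A) 2 3 = (p$2$2 * p$3$3 - p$2$3 * p$3$2) * mn A 2 3"
      using p by (simp add: mn_def mult4 Pa4_def z algebra_simps)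
    then show ?thesis using p A by (auto simp: Z31_def Pa4_def Sp4_mult mult4)
  qed
  show "p ** A \<in> Z42" if p: "p \<in> Pb4" and A: "A \<in> Z42"
  proof -
    have "mn (p ** A) 3 4 = (p$3$3 * p$4$4 - p$3$4 * p$4$3) * mn A 3 4"
      using p by (simp add: mn_def mult4 Pb4_def algebra_simps)
    then show ?thesis using p A by (auto simp: Z42_def Pb4_def Sp4_mult)
  qed
qed

lemma B4_sub_P: "B4 \<subseteq> Pa4" "B4 \<subseteq> Pb4"
  by (auto simp: subgroup4_defs)

lemma right_stable:
  assumes "b \<in> B4"
  shows "A \<in> Pa4 \<Longrightarrow> A ** b \<in> Pa4" "A \<in> Pb4 \<Longrightarrow> A ** b \<in> Pb4"
    "A \<in> Z24 \<Longrightarrow> A ** b \<in> Z24" "A \<in> Z31 \<Longrightarrow> A ** b \<in> Z31"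
    "A \<in> Z34 \<Longrightarrow> A ** b \<in> Z34" "A \<in> Z42 \<Longrightarrow> A ** b \<in> Z42"
proof -
  have bS: "b \<in> Sp4" using assms by (simp add: B4_def)
  show "A \<in> Pa4 \<Longrightarrow> A ** b \<in> Pa4" "A \<in> Pb4 \<Longrightarrow> A ** b \<in> Pb4"
    using assms B4_sub_P group4_standard by (auto simp: group4_def)
  show "A \<in> Z24 \<Longrightarrow> A ** b \<in> Z24" "A \<in> Z34 \<Longrightarrow> A ** b \<in> Z34" "A \<in> Z42 \<Longrightarrow> A ** b \<in> Z42"
    using assms bS by (auto simp: Z24_def Z34_def Z42_def Sp4_mult B4_right_mult)
  show "A ** b \<in> Z31" if A: "A \<in> Z31"
  proof -
    have "(A ** b) $ 4 $ 2 = 0" using A assms by (simp add: mult4 Z31_def B4_def)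
    then show ?thesis using A assms bS by (simp add: Z31_def Sp4_mult B4_right_mult)
  qed
qed

lemma closed_Z: "closedin zariski Z24" "closedin zariski Z31" "closedin zariski Z34" "closedin zariski Z42"
proof -
  have *: "closedin zariski {A. A \<in> Sp4}" using closedin_Sp4 by simp
  show "closedin zariski Z24" "closedin zariski Z31" "closedin zariski Z34" "closedin zariski Z42"
    unfolding Z24_def Z31_def Z34_def Z42_def mn_def
    by (intro * closedin_zariski_conj closedin_zariski_eq poly_fun_diff poly_fun.mult poly_fun.entry poly_fun.const)+
qed

lemma low4_nth: "low4 y $ i $ j = low (y $ 1) (y $ 2) (y $ 3) (y $ 4) $ i $ j"
  by (simp add: low4_def)

lemma low4_mem:
  "low4 y \<in> B4 \<longleftrightarrow> y = 0" "low4 y \<in> Pa4 \<longleftrightarrow> y$1 = 0 \<and> y$3 = 0 \<and> y$4 = 0"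
  "low4 y \<in> Pb4 \<longleftrightarrow> y$2 = 0 \<and> y$3 = 0 \<and> y$4 = 0"
  "low4 y \<in> Z24 \<longleftrightarrow> y$3 = - (y$1 * y$2) \<and> y$4 = y$1 * y$1 * y$2"
  "low4 y \<in> Z31 \<longleftrightarrow> y$3 = 0 \<and> y$4 = 0" "low4 y \<in> Z34 \<longleftrightarrow> y$4 = - (y$1 * y$3)"
  "low4 y \<in> Z42 \<longleftrightarrow> y$3 * y$3 = y$4 * y$2"
  using low4_Sp4[of y]
  by (auto simp: B4_def Pa4_def Pb4_def Z24_def Z31_def Z34_def Z42_def low4_nth low_def mn_def vec4_eq_iff
      add_eq_0_iff2 algebra_simps)

lemma chart_retract:
  assumes "Z \<subseteq> Sp4" "closedin zariski Z" "\<And>A b. b \<in> B4 \<Longrightarrow> A \<in> Z \<Longrightarrow> A ** b \<in> Z"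
    "\<And>A b. b \<in> B4 \<Longrightarrow> A \<in> Z \<Longrightarrow> b ** A \<in> Z" "\<And>i. (\<lambda>x. \<kappa> x $ i) \<in> PF"
    "\<And>x. \<kappa> (\<kappa> x) = \<kappa> x" "\<And>y. low4 y \<in> Z \<longleftrightarrow> \<kappa> y = y"
  shows "schubert_chart Z \<kappa>"
  unfolding schubert_chart_def using assms descends_retract[OF assms(5,6)] by blast

lemma charts:
  "schubert_chart B4 (\<lambda>x. vec4 0 0 0 0)"
  "schubert_chart Pa4 (\<lambda>x. vec4 0 (x$2) 0 0)"
  "schubert_chart Pb4 (\<lambda>x. vec4 (x$1) 0 0 0)"
  "schubert_chart Z24 (\<lambda>x. vec4 (x$1) (x$2) (- (x$1 * x$2)) (x$1 * x$1 * x$2))"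
  "schubert_chart Z31 (\<lambda>x. vec4 (x$1) (x$2) 0 0)"
  "schubert_chart Z34 (\<lambda>x. vec4 (x$1) (x$2) (x$3) (- (x$1 * x$3)))"
  "schubert_chart Sp4 (\<lambda>x. x)"
proof -
  have BP: "b \<in> Pa4" "b \<in> Pb4" "b \<in> Sp4" if "b \<in> B4" for b using that B4_sub_P by (auto simp: B4_def)
  have sub: "B4 \<subseteq> Sp4" "Pa4 \<subseteq> Sp4" "Pb4 \<subseteq> Sp4" "Z24 \<subseteq> Sp4" "Z31 \<subseteq> Sp4" "Z34 \<subseteq> Sp4"
    by (auto simp: B4_def Pa4_def Pb4_def Z24_def Z31_def Z34_def)
  note [intro] = PF.intros PF_uminus
  show "schubert_chart B4 (\<lambda>x. vec4 0 0 0 0)"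
    by (rule chart_retract[OF sub(1) closedin_standard(1)])
      (auto simp: low4_mem vec4_eq_iff left_stable intro!: PF_vec4)
  show "schubert_chart Pa4 (\<lambda>x. vec4 0 (x$2) 0 0)"
    by (rule chart_retract[OF sub(2) closedin_standard(2)])
      (auto simp: low4_mem vec4_eq_iff left_stable right_stable BP intro!: PF_vec4)
  show "schubert_chart Pb4 (\<lambda>x. vec4 (x$1) 0 0 0)"
    by (rule chart_retract[OF sub(3) closedin_standard(3)])
      (auto simp: low4_mem vec4_eq_iff left_stable right_stable BP intro!: PF_vec4)
  show "schubert_chart Z24 (\<lambda>x. vec4 (x$1) (x$2) (- (x$1 * x$2)) (x$1 * x$1 * x$2))"
    by (rule chart_retract[OF sub(4) closed_Z(1)])
      (auto simp: low4_mem vec4_eq_iff left_stable right_stable BP intro!: PF_vec4 PF_uminus PF.mult PF.coord)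
  show "schubert_chart Z31 (\<lambda>x. vec4 (x$1) (x$2) 0 0)"
    by (rule chart_retract[OF sub(5) closed_Z(2)])
      (auto simp: low4_mem vec4_eq_iff left_stable right_stable BP intro!: PF_vec4)
  show "schubert_chart Z34 (\<lambda>x. vec4 (x$1) (x$2) (x$3) (- (x$1 * x$3)))"
    by (rule chart_retract[OF sub(6) closed_Z(3)])
      (auto simp: low4_mem vec4_eq_iff left_stable right_stable BP intro!: PF_vec4 PF_uminus PF.mult PF.coord)
  show "schubert_chart Sp4 (\<lambda>x. x)"
    by (rule chart_retract[OF order_refl closedin_Sp4]) (auto simp: low4_Sp4 Sp4_mult BP)
qed

lemma chart_cone: "schubert_chart Z42 cone_map"
proof -
  have BP: "b \<in> Pb4" if "b \<in> B4" for b using that B4_sub_P by auto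
  have pf: "(\<lambda>x. cone_map x $ i) \<in> PF" for i
    unfolding cone_map_def by (intro PF_vec4 PF.coord PF.mult)
  have "\<exists>x. cone_map x = y" if y: "low4 y \<in> Z42" for y
  proof -
    define s t where "s = csqrt (y$2)" and "t = csqrt (y$4)"
    have st: "s * s = y$2" "t * t = y$4"
      unfolding s_def t_def by (metis power2_csqrt power2_eq_square)+
    have "(s * t) * (s * t) = y$3 * y$3" using y st unfolding low4_mem by (simp add: mult_ac)
    \<comment> \<open>The product of the chosen square roots is right only up to sign; the second
      case changes the sign of t.\<close>
    then have "s * t = y$3 \<or> s * t = - y$3" by (simp add: square_eq_iff)
    then show ?thesis
    proof
      assume "s * t = y$3"
      then show ?thesis using st by (intro exI[of _ "vec4 (y$1) s t 0"]) (simp add: cone_map_def vec4_eq_iff)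
    next
      assume "s * t = - y$3"
      then show ?thesis using st by (intro exI[of _ "vec4 (y$1) s (- t) 0"]) (simp add: cone_map_def vec4_eq_iff)
    qed
  qed
  moreover have "low4 (cone_map x) \<in> Z42" for x unfolding low4_mem by (simp add: cone_map_def)
  ultimately show ?thesis
    unfolding schubert_chart_def
    using closed_Z(4) left_stable(7) right_stable(6) BP pf descends_cone
    by (auto simp: Z42_def[THEN eqset_imp_iff])
qed

text \<open>An isotropic flag is determined by its line and plane. The coefficients c, d, e express
  the first two columns of \<open>A\<close> by those of \<open>M\<close>; for the remaining columns
  the symplectic relations suffice.\<close>

lemma same_flag:
  assumes "A \<in> Sp4" "M \<in> Sp4"
    and "A$1$1 = c * M$1$1" "A$2$1 = c * M$2$1" "A$3$1 = c * M$3$1" "A$4$1 = c * M$4$1"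
    and "A$1$2 = d * M$1$1 + e * M$1$2" "A$2$2 = d * M$2$1 + e * M$2$2"
      "A$3$2 = d * M$3$1 + e * M$3$2" "A$4$2 = d * M$4$1 + e * M$4$2"
  shows "\<exists>b\<in>B4. A = M ** b"
proof
  have "(adj M ** A) $ i $ 1 = c * (adj M ** M) $ i $ 1"
    "(adj M ** A) $ i $ 2 = d * (adj M ** M) $ i $ 1 + e * (adj M ** M) $ i $ 2" for i
    by (simp_all only: mult4 assms(3-10)) (simp_all add: algebra_simps)
  then show "adj M ** A \<in> B4"
    using assms(1,2) by (simp add: B4_eq Sp4_mult Sp4_adj_closed adj_left mat_nth)
  show "A = M ** (adj M ** A)" by (simp add: adj_cancel assms(2))
qed

lemma Sp4_first_columns: "A \<in> Sp4 \<Longrightarrow> A$1$1 * A$4$2 + A$2$1 * A$3$2 - A$3$1 * A$2$2 - A$4$1 * A$1$2 = 0"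
  by (simp add: Sp4_cols)

text \<open>The digits are the rows of the nonzero entries in columns 1 and 2; the signs make the
  permutation matrices symplectic.\<close>

definition "n13 = mat4 1 0 0 0  0 0 (-1) 0  0 1 0 0  (0::complex) 0 0 1"
definition "n21 = mat4 0 1 0 0  1 0 0 0  0 0 0 1  (0::complex) 0 1 0"
definition "n24 = mat4 0 0 (-1) 0  1 0 0 0  0 0 0 1  (0::complex) 1 0 0"
definition "n31 = mat4 0 1 0 0  0 0 0 (-1)  1 0 0 0  (0::complex) 0 1 0"
definition "n34 = mat4 0 0 (-1) 0  0 0 0 (-1)  1 0 0 0  (0::complex) 1 0 0"
definition "n42 = mat4 0 0 0 (-1)  0 1 0 0  0 0 1 0  (1::complex) 0 0 0"
definition "n43 = mat4 0 0 0 (-1)  0 0 (-1) 0  0 1 0 0  (1::complex) 0 0 0"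

lemmas weyl_defs = n13_def n21_def n24_def n31_def n34_def n42_def n43_def

lemma weyl_Sp4: "n13 \<in> Sp4" "n21 \<in> Sp4" "n24 \<in> Sp4" "n31 \<in> Sp4" "n34 \<in> Sp4" "n42 \<in> Sp4" "n43 \<in> Sp4"
  by (simp_all add: Sp4_cols weyl_defs)

lemma upp_B4: "upp a d e f \<in> B4" and upp_Sp4: "upp a d e f \<in> Sp4"
  using upp_U4[of a d e f] by (auto simp: U4_def B4_def)

lemma Borel_Levi_elements:
  "xb d \<in> Ka4" "xa a \<in> Kb4"
  "r \<noteq> 0 \<Longrightarrow> s \<noteq> 0 \<Longrightarrow> xb d ** tor r s \<in> Ka4" "r \<noteq> 0 \<Longrightarrow> s \<noteq> 0 \<Longrightarrow> xa a ** tor r s \<in> Kb4"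
proof -
  have T: "r \<noteq> 0 \<Longrightarrow> s \<noteq> 0 \<Longrightarrow> tor r s \<in> Ka4 \<inter> Kb4"
    using tor_T4[of r s] by (auto simp: Ka4_def Kb4_def subgroup4_defs)
  show x: "xb d \<in> Ka4" "xa a \<in> Kb4" using one_param_in by (auto simp: Ka4_def Kb4_def)
  show "r \<noteq> 0 \<Longrightarrow> s \<noteq> 0 \<Longrightarrow> xb d ** tor r s \<in> Ka4" "r \<noteq> 0 \<Longrightarrow> s \<noteq> 0 \<Longrightarrow> xa a ** tor r s \<in> Kb4"
    using T x Ka4_Kb4_group by (auto simp: group4_def)
qed

section \<open>Semi-invariants of the Borel subgroups\<close>

lemma Ka4_left_mult:
  assumes "k \<in> Ka4"
  shows "(k ** A) $ 1 $ i = k$1$1 * A$1$i" "(k ** A) $ 3 $ i = k$3$3 * A$3$i" "(k ** A) $ 4 $ i = k$4$4 * A$4$i"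
    "mn (k ** A) 1 3 = k$1$1 * k$3$3 * mn A 1 3" "mn (k ** A) 3 4 = k$3$3 * k$4$4 * mn A 3 4"
  using assms by (simp_all add: Ka4_def B4_def La4_def mn_def mult4 algebra_simps)

lemma Kb4_left_mult:
  assumes "k \<in> Kb4"
  shows "(k ** A) $ 2 $ i = k$2$2 * A$2$i" "(k ** A) $ 4 $ i = k$4$4 * A$4$i"
    "mn (k ** A) 1 2 = k$1$1 * k$2$2 * mn A 1 2" "mn (k ** A) 2 4 = k$2$2 * k$4$4 * mn A 2 4"
  using assms by (simp_all add: Kb4_def B4_def Lb4_def mn_def mult4 algebra_simps)

lemma B4_left_mult:
  assumes "k \<in> B4"
  shows "(k ** A) $ 4 $ i = k$4$4 * A$4$i" "mn (k ** A) 3 4 = k$3$3 * k$4$4 * mn A 3 4"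
  using assms by (simp_all add: B4_def mn_def mult4 algebra_simps)

lemma K_diag:
  assumes "k \<in> Ka4 \<or> k \<in> Kb4 \<or> k \<in> B4"
  shows "k$1$1 \<noteq> 0" "k$2$2 \<noteq> 0" "k$3$3 \<noteq> 0" "k$4$4 \<noteq> 0"
  using assms B4_diag[of k] by (auto simp: Ka4_def Kb4_def)

lemma poly_fun_mn: "(\<lambda>A. mn A i j) \<in> poly_fun"
  unfolding mn_def by (intro poly_fun_diff poly_fun.mult poly_fun.entry)

subsection \<open>Bruhat cells and orbits\<close>

lemma orbit_13:
  assumes A: "A \<in> Pa4" "A$3$2 \<noteq> 0"
  shows "\<exists>k\<in>Ka4. \<exists>b\<in>B4. A = k ** n13 ** b"
proof -
  define s where "s = A$2$2 / A$3$2"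
  have e: "A$2$2 = A$3$2 * s" using A by (simp add: s_def)
  have AS: "A \<in> Sp4" using A by (simp add: Pa4_def)
  have "\<exists>b\<in>B4. A = xb s ** n13 ** b"
    by (rule same_flag[where c = "A$1$1" and d = "A$1$2" and e = "A$3$2", OF AS Sp4_mult[OF one_param_in(9) weyl_Sp4(1)]])
      (use A(1) in \<open>simp_all add: Pa4_def e mult4 xb_def upp_def n13_def\<close>)
  then show ?thesis using Borel_Levi_elements(1) by blast
qed

lemma orbit_21:
  assumes A: "A \<in> Pb4" "A$2$1 \<noteq> 0"
  shows "\<exists>k\<in>Kb4. \<exists>b\<in>B4. A = k ** n21 ** b"
proof -
  define s where "s = A$1$1 / A$2$1"
  have "A$1$1 = A$2$1 * s" using A by (simp add: s_def)
  note e = this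
  have AS: "A \<in> Sp4" using A by (simp add: Pb4_def)
  have "\<exists>b\<in>B4. A = xa s ** n21 ** b"
    by (rule same_flag[where c = "A$2$1" and d = "A$2$2" and e = "A$1$2 - s * A$2$2", OF AS Sp4_mult[OF one_param_in(7) weyl_Sp4(2)]])
      (use A(1) in \<open>simp_all add: Pb4_def e mult4 xa_def upp_def n21_def\<close>)
  then show ?thesis using Borel_Levi_elements(2) by blast
qed

text \<open>a and f are the coordinates of the Bruhat cell, given by translating \<open>n24\<close>
  by \<open>upp a 0 0 f\<close>. The value of A$3$2 follows from isotropy of the plane.\<close>

lemma cell_24:
  assumes A: "A \<in> Z24" and q: "mn A 2 4 \<noteq> 0"
  obtains a f where "A$2$1 \<noteq> 0" "A$4$2 \<noteq> 0" "A$3$1 = 0" "A$4$1 = 0"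
    "A$1$1 = A$2$1 * a" "A$1$2 = A$2$2 * a + A$4$2 * f" "A$3$2 = - (A$4$2 * a)"
proof
  have AS: "A \<in> Sp4" and z: "A$3$1 = 0" "A$4$1 = 0" using A by (auto simp: Z24_def)
  show nz: "A$2$1 \<noteq> 0" "A$4$2 \<noteq> 0" using q z by (auto simp: mn_def)
  show "A$3$1 = 0" "A$4$1 = 0" by fact+
  show "A$1$1 = A$2$1 * (A$1$1 / A$2$1)" using nz by simp
  show "A$1$2 = A$2$2 * (A$1$1 / A$2$1) + A$4$2 * ((A$1$2 - A$2$2 * (A$1$1 / A$2$1)) / A$4$2)" using nz by simp
  have "A$2$1 * A$3$2 = - (A$1$1 * A$4$2)" using Sp4_first_columns[OF AS] z by (simp add: eq_neg_iff_add_eq_0 algebra_simps)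
  then show "A$3$2 = - (A$4$2 * (A$1$1 / A$2$1))" using nz by (simp add: field_simps)
qed

lemma orbit_24:
  assumes A: "A \<in> Z24"
  shows "mn A 2 4 \<noteq> 0 \<Longrightarrow> \<exists>u\<in>B4. \<exists>b\<in>B4. A = u ** n24 ** b"
    "mn A 2 4 * mn A 1 2 \<noteq> 0 \<Longrightarrow> \<exists>k\<in>Kb4. \<exists>b\<in>B4. A = k ** (upp 0 0 0 1 ** n24) ** b"
proof -
  have AS: "A \<in> Sp4" using A by (simp add: Z24_def)
  show "\<exists>u\<in>B4. \<exists>b\<in>B4. A = u ** n24 ** b" if "mn A 2 4 \<noteq> 0"
  proof -
    from cell_24[OF A that] obtain a f where e: "A$3$1 = 0" "A$4$1 = 0"
      "A$1$1 = A$2$1 * a" "A$1$2 = A$2$2 * a + A$4$2 * f" "A$3$2 = - (A$4$2 * a)" by metis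
    have "\<exists>b\<in>B4. A = upp a 0 0 f ** n24 ** b"
      by (rule same_flag[where c = "A$2$1" and d = "A$2$2" and e = "A$4$2", OF AS Sp4_mult[OF upp_Sp4 weyl_Sp4(3)]])
        (simp_all add: e mult4 upp_def n24_def)
    then show ?thesis using upp_B4 by blast
  qed
  show "\<exists>k\<in>Kb4. \<exists>b\<in>B4. A = k ** (upp 0 0 0 1 ** n24) ** b" if q: "mn A 2 4 * mn A 1 2 \<noteq> 0"
  proof -
    have "mn A 2 4 \<noteq> 0" using q by simp
    from cell_24[OF A this] obtain a f where e: "A$3$1 = 0" "A$4$1 = 0"
      "A$1$1 = A$2$1 * a" "A$1$2 = A$2$2 * a + A$4$2 * f" "A$3$2 = - (A$4$2 * a)" by metis
    \<comment> \<open>On this cell \<open>mn A 1 2\<close> is a nonzero multiple of f, so f is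
      nonzero. The factor \<open>xa a\<close> accounts for a, and the torus scales f by the square
      of its first parameter.\<close>
    define r where "r = csqrt f"
    have r: "f = r * r" by (simp add: r_def power2_eq_square[symmetric])
    have "r \<noteq> 0" using q e r by (auto simp: mn_def)
    have MS: "xa a ** tor r 1 ** (upp 0 0 0 1 ** n24) \<in> Sp4"
      using \<open>r \<noteq> 0\<close> by (intro Sp4_mult upp_Sp4 one_param_in weyl_Sp4 tor_T4_Sp4) auto
    have "\<exists>b\<in>B4. A = (xa a ** tor r 1) ** (upp 0 0 0 1 ** n24) ** b"
      by (rule same_flag[where c = "A$2$1" and d = "A$2$2" and e = "A$4$2 * r", OF AS MS])
        (use \<open>r \<noteq> 0\<close> in \<open>simp_all add: e r mult4 upp_def xa_def tor_def n24_def\<close>)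
    moreover have "xa a ** tor r 1 \<in> Kb4" using \<open>r \<noteq> 0\<close> by (intro Borel_Levi_elements) auto
    ultimately show ?thesis by blast
  qed
qed

lemma cell_31:
  assumes A: "A \<in> Z31" and q: "A$3$1 \<noteq> 0"
  obtains d e where "A$4$1 = 0" "A$4$2 = 0" "A$1$1 = A$3$1 * e" "A$2$1 = A$3$1 * d" "A$2$2 = A$3$2 * d"
proof
  show z: "A$4$1 = 0" "A$4$2 = 0" using A by (auto simp: Z31_def)
  show "A$1$1 = A$3$1 * (A$1$1 / A$3$1)" "A$2$1 = A$3$1 * (A$2$1 / A$3$1)" using q by simp_all
  have "A$2$1 * A$3$2 = A$3$1 * A$2$2" using A by (simp add: Z31_def mn_def)
  then show "A$2$2 = A$3$2 * (A$2$1 / A$3$1)" using q by (simp add: field_simps)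
qed

lemma orbit_31:
  assumes A: "A \<in> Z31"
  shows "A$3$1 \<noteq> 0 \<Longrightarrow> \<exists>u\<in>B4. \<exists>b\<in>B4. A = u ** n31 ** b"
    "A$3$1 * A$1$1 \<noteq> 0 \<Longrightarrow> \<exists>k\<in>Ka4. \<exists>b\<in>B4. A = k ** (upp 0 0 1 0 ** n31) ** b"
proof -
  have AS: "A \<in> Sp4" using A by (simp add: Z31_def)
  show "\<exists>u\<in>B4. \<exists>b\<in>B4. A = u ** n31 ** b" if "A$3$1 \<noteq> 0"
  proof -
    from cell_31[OF A that] obtain d e where e: "A$4$1 = 0" "A$4$2 = 0"
      "A$1$1 = A$3$1 * e" "A$2$1 = A$3$1 * d" "A$2$2 = A$3$2 * d" by metis
    have "\<exists>b\<in>B4. A = upp 0 d e 0 ** n31 ** b"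
      by (rule same_flag[where c = "A$3$1" and d = "A$3$2" and e = "A$1$2 - A$3$2 * e", OF AS Sp4_mult[OF upp_Sp4 weyl_Sp4(4)]])
        (simp_all add: e mult4 upp_def n31_def)
    then show ?thesis using upp_B4 by blast
  qed
  show "\<exists>k\<in>Ka4. \<exists>b\<in>B4. A = k ** (upp 0 0 1 0 ** n31) ** b" if q: "A$3$1 * A$1$1 \<noteq> 0"
  proof -
    have "A$3$1 \<noteq> 0" using q by simp
    from cell_31[OF A this] obtain d e where e: "A$4$1 = 0" "A$4$2 = 0"
      "A$1$1 = A$3$1 * e" "A$2$1 = A$3$1 * d" "A$2$2 = A$3$2 * d" by metis
    \<comment> \<open>The factor A$1$1 of the semi-invariant detects e, which the torus scales by
      the product of its two parameters; \<open>xb d\<close> takes care of d.\<close>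
    have "e \<noteq> 0" using q e(3) by auto
    have MS: "xb d ** tor e 1 ** (upp 0 0 1 0 ** n31) \<in> Sp4"
      using \<open>e \<noteq> 0\<close> by (intro Sp4_mult upp_Sp4 one_param_in weyl_Sp4 tor_T4_Sp4) auto
    have "\<exists>b\<in>B4. A = (xb d ** tor e 1) ** (upp 0 0 1 0 ** n31) ** b"
      by (rule same_flag[where c = "A$3$1" and d = "A$3$2" and e = "(A$1$2 - A$3$2 * e) / e", OF AS MS])
        (use \<open>e \<noteq> 0\<close> in \<open>simp_all add: e mult4 upp_def xb_def tor_def n31_def\<close>)
    moreover have "xb d ** tor e 1 \<in> Ka4" using \<open>e \<noteq> 0\<close> by (intro Borel_Levi_elements) auto
    ultimately show ?thesis by blast
  qed
qed

lemma cell_34: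
  assumes A: "A \<in> Z34" and q: "mn A 3 4 \<noteq> 0"
  obtains d e f where "A$3$1 \<noteq> 0" "A$4$2 \<noteq> 0" "A$4$1 = 0" "A$1$1 = A$3$1 * e" "A$2$1 = A$3$1 * d"
    "A$1$2 = A$3$2 * e + A$4$2 * f" "A$2$2 = A$3$2 * d + A$4$2 * e"
proof
  have AS: "A \<in> Sp4" using A by (auto simp: Z34_def)
  show z: "A$4$1 = 0" using A by (auto simp: Z34_def)
  show nz: "A$3$1 \<noteq> 0" "A$4$2 \<noteq> 0" using q z by (auto simp: mn_def)
  show "A$1$1 = A$3$1 * (A$1$1 / A$3$1)" "A$2$1 = A$3$1 * (A$2$1 / A$3$1)" using nz by simp_all
  show "A$1$2 = A$3$2 * (A$1$1 / A$3$1) + A$4$2 * ((A$1$2 - A$3$2 * (A$1$1 / A$3$1)) / A$4$2)" using nz by simp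
  have "A$3$1 * A$2$2 = A$2$1 * A$3$2 + A$1$1 * A$4$2" using Sp4_first_columns[OF AS] z by (simp add: algebra_simps)
  then show "A$2$2 = A$3$2 * (A$2$1 / A$3$1) + A$4$2 * (A$1$1 / A$3$1)" using nz by (simp add: field_simps)
qed

lemma orbit_34:
  assumes A: "A \<in> Z34"
  shows "mn A 3 4 \<noteq> 0 \<Longrightarrow> \<exists>u\<in>B4. \<exists>b\<in>B4. A = u ** n34 ** b"
    "A$1$1 * mn A 1 3 * mn A 3 4 \<noteq> 0 \<Longrightarrow> \<exists>k\<in>Ka4. \<exists>b\<in>B4. A = k ** (upp 0 0 1 1 ** n34) ** b"
proof -
  have AS: "A \<in> Sp4" using A by (simp add: Z34_def)
  show "\<exists>u\<in>B4. \<exists>b\<in>B4. A = u ** n34 ** b" if "mn A 3 4 \<noteq> 0"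
  proof -
    from cell_34[OF A that] obtain d e f where e: "A$4$1 = 0" "A$1$1 = A$3$1 * e" "A$2$1 = A$3$1 * d"
      "A$1$2 = A$3$2 * e + A$4$2 * f" "A$2$2 = A$3$2 * d + A$4$2 * e" by metis
    have "\<exists>b\<in>B4. A = upp 0 d e f ** n34 ** b"
      by (rule same_flag[where c = "A$3$1" and d = "A$3$2" and e = "A$4$2", OF AS Sp4_mult[OF upp_Sp4 weyl_Sp4(5)]])
        (simp_all add: e mult4 upp_def n34_def)
    then show ?thesis using upp_B4 by blast
  qed
  show "\<exists>k\<in>Ka4. \<exists>b\<in>B4. A = k ** (upp 0 0 1 1 ** n34) ** b" if q: "A$1$1 * mn A 1 3 * mn A 3 4 \<noteq> 0"
  proof -
    have "mn A 3 4 \<noteq> 0" using q by simp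
    from cell_34[OF A this] obtain d e f where e: "A$4$1 = 0" "A$1$1 = A$3$1 * e" "A$2$1 = A$3$1 * d"
      "A$1$2 = A$3$2 * e + A$4$2 * f" "A$2$2 = A$3$2 * d + A$4$2 * e" by metis
    \<comment> \<open>The torus scales f by r^2 and e by r s, which gives r and s = e / r. The
      factor \<open>mn A 1 3\<close> detects f and A$1$1 detects e.\<close>
    define r where "r = csqrt f"
    have r: "f = r * r" by (simp add: r_def power2_eq_square[symmetric])
    have nz: "r \<noteq> 0" "e \<noteq> 0" using q e r by (auto simp: mn_def)
    have MS: "xb d ** tor r (e / r) ** (upp 0 0 1 1 ** n34) \<in> Sp4"
      using nz by (intro Sp4_mult upp_Sp4 one_param_in weyl_Sp4 tor_T4_Sp4) auto
    have "\<exists>b\<in>B4. A = (xb d ** tor r (e / r)) ** (upp 0 0 1 1 ** n34) ** b"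
      by (rule same_flag[where c = "A$3$1 * e / r" and d = "A$3$2 * e / r" and e = "A$4$2 * r", OF AS MS])
        (use nz in \<open>simp_all add: e r mult4 upp_def xb_def tor_def n34_def\<close>)
    moreover have "xb d ** tor r (e / r) \<in> Ka4" using nz by (intro Borel_Levi_elements) auto
    ultimately show ?thesis by blast
  qed
qed

lemma first_column_4:
  fixes A :: "complex^4^4"
  assumes "A$4$1 \<noteq> 0"
  obtains a e f where "A$3$1 = - (A$4$1 * a)" "A$2$1 = A$4$1 * e" "A$1$1 = A$4$1 * (f + a * e)"
proof
  show "A$3$1 = - (A$4$1 * (- A$3$1 / A$4$1))" "A$2$1 = A$4$1 * (A$2$1 / A$4$1)"
    "A$1$1 = A$4$1 * ((A$1$1 / A$4$1 - (- A$3$1 / A$4$1) * (A$2$1 / A$4$1)) + (- A$3$1 / A$4$1) * (A$2$1 / A$4$1))"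
    using assms by simp_all
qed

lemma cell_42:
  assumes A: "A \<in> Z42" and q: "A$4$1 \<noteq> 0"
  obtains a e f where "A$3$1 = - (A$4$1 * a)" "A$2$1 = A$4$1 * e" "A$1$1 = A$4$1 * (f + a * e)"
    "A$3$2 = - (A$4$2 * a)" "A$1$2 = A$4$2 * f + A$2$2 * a"
proof -
  have AS: "A \<in> Sp4" and m: "A$3$1 * A$4$2 = A$4$1 * A$3$2" using A by (auto simp: Z42_def mn_def)
  from first_column_4[OF q] obtain a e f where c: "A$3$1 = - (A$4$1 * a)" "A$2$1 = A$4$1 * e" "A$1$1 = A$4$1 * (f + a * e)"
    by metis
  have "A$4$1 * A$3$2 = A$4$1 * (- (A$4$2 * a))" using m c(1) by (simp add: algebra_simps)
  then have c2: "A$3$2 = - (A$4$2 * a)" using q by (simp only: mult_cancel_left) simp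
  have "A$4$1 * A$1$2 = A$4$1 * (A$4$2 * f + A$2$2 * a)"
    using Sp4_first_columns[OF AS] by (simp add: c c2 algebra_simps)
  then have "A$1$2 = A$4$2 * f + A$2$2 * a" using q by (simp only: mult_cancel_left) simp
  then show ?thesis using that c c2 by blast
qed

lemma orbit_42:
  assumes A: "A \<in> Z42"
  shows "A$4$1 \<noteq> 0 \<Longrightarrow> \<exists>u\<in>B4. \<exists>b\<in>B4. A = u ** n42 ** b"
    "A$4$1 * A$2$1 * mn A 1 2 \<noteq> 0 \<Longrightarrow> \<exists>k\<in>Kb4. \<exists>b\<in>B4. A = k ** (upp 0 0 1 1 ** n42) ** b"
proof -
  have AS: "A \<in> Sp4" using A by (simp add: Z42_def)
  show "\<exists>u\<in>B4. \<exists>b\<in>B4. A = u ** n42 ** b" if "A$4$1 \<noteq> 0"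
  proof -
    from cell_42[OF A that] obtain a e f where e: "A$3$1 = - (A$4$1 * a)" "A$2$1 = A$4$1 * e" "A$1$1 = A$4$1 * (f + a * e)"
      "A$3$2 = - (A$4$2 * a)" "A$1$2 = A$4$2 * f + A$2$2 * a" by metis
    have "\<exists>b\<in>B4. A = upp a 0 e f ** n42 ** b"
      by (rule same_flag[where c = "A$4$1" and d = "A$4$2" and e = "A$2$2 - A$4$2 * e", OF AS Sp4_mult[OF upp_Sp4 weyl_Sp4(6)]])
        (simp_all add: e mult4 upp_def n42_def algebra_simps)
    then show ?thesis using upp_B4 by blast
  qed
  show "\<exists>k\<in>Kb4. \<exists>b\<in>B4. A = k ** (upp 0 0 1 1 ** n42) ** b" if q: "A$4$1 * A$2$1 * mn A 1 2 \<noteq> 0"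
  proof -
    have "A$4$1 \<noteq> 0" using q by simp
    from cell_42[OF A this] obtain a e f where e: "A$3$1 = - (A$4$1 * a)" "A$2$1 = A$4$1 * e" "A$1$1 = A$4$1 * (f + a * e)"
      "A$3$2 = - (A$4$2 * a)" "A$1$2 = A$4$2 * f + A$2$2 * a" by metis
    \<comment> \<open>As for the other threefold, f is scaled by r^2 and e by r s. Here A$2$1
      detects e, and f divides \<open>mn A 1 2\<close>.\<close>
    define r where "r = csqrt f"
    have r: "f = r * r" by (simp add: r_def power2_eq_square[symmetric])
    have nz: "r \<noteq> 0" "e \<noteq> 0" using q e r by (auto simp: mn_def)
    define s mu where "s = e / r" and "mu = (A$2$2 - A$4$2 * e) / s"
    have s: "s \<noteq> 0" "e = r * s" and mu: "A$2$2 = A$4$2 * (r * s) + mu * s" using nz by (simp_all add: s_def mu_def)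
    have MS: "xa a ** tor r s ** (upp 0 0 1 1 ** n42) \<in> Sp4"
      using nz s(1) by (intro Sp4_mult upp_Sp4 one_param_in weyl_Sp4 tor_T4_Sp4) auto
    have "\<exists>b\<in>B4. A = (xa a ** tor r s) ** (upp 0 0 1 1 ** n42) ** b"
      by (rule same_flag[where c = "A$4$1 * r" and d = "A$4$2 * r" and e = mu, OF AS MS])
        (use nz s(1) in \<open>simp_all add: e r s(2) mu mult4 upp_def xa_def tor_def n42_def distrib_left distrib_right mult_ac\<close>)
    moreover have "xa a ** tor r s \<in> Kb4" using nz s by (intro Borel_Levi_elements) auto
    ultimately show ?thesis by blast
  qed
qed

text \<open>For the full flag variety the Levi subgroup is the whole group, so the open orbit of its
  Borel subgroup is the open Bruhat cell.\<close>

lemma orbit_43: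
  assumes AS: "A \<in> Sp4" and q: "A$4$1 * mn A 3 4 \<noteq> 0"
  shows "\<exists>u\<in>B4. \<exists>b\<in>B4. A = u ** n43 ** b"
proof -
  have q1: "A$4$1 \<noteq> 0" using q by simp
  from first_column_4[OF q1] obtain a e f where c: "A$3$1 = - (A$4$1 * a)" "A$2$1 = A$4$1 * e" "A$1$1 = A$4$1 * (f + a * e)"
    by metis
  define nu where "nu = A$3$2 + A$4$2 * a"
  have "mn A 3 4 = - (A$4$1 * nu)" by (simp add: mn_def c nu_def algebra_simps)
  then have nz: "nu \<noteq> 0" using q by auto
  define d where "d = (A$2$2 - A$4$2 * e) / nu"
  have c3: "A$3$2 = nu - A$4$2 * a" by (simp add: nu_def)
  have c2: "A$2$2 = nu * d + A$4$2 * e" using nz by (simp add: d_def)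
  have "A$4$1 * A$1$2 = A$4$1 * (A$4$2 * (f + a * e) + nu * (e + a * d))"
    using Sp4_first_columns[OF AS] by (simp add: c c2 c3 algebra_simps)
  then have c1: "A$1$2 = A$4$2 * (f + a * e) + nu * (e + a * d)" using q1 by (simp only: mult_cancel_left) simp
  have "\<exists>b\<in>B4. A = upp a d e f ** n43 ** b"
    by (rule same_flag[where c = "A$4$1" and d = "A$4$2" and e = nu, OF AS Sp4_mult[OF upp_Sp4 weyl_Sp4(7)]])
      (simp_all add: c c1 c2 c3 mult4 upp_def n43_def)
  then show ?thesis using upp_B4 by blast
qed

subsection \<open>Stabilisers\<close>

text \<open>Stability is tested on a few elements of Z: permutation matrices and, for
  \<open>Z42\<close>, one unipotent translate. The resulting equations already force the parabolic
  form.\<close>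

lemma stabilizer_in:
  assumes g: "g \<in> Sp4" and st: "\<And>A. A \<in> Z \<Longrightarrow> g ** A \<in> Z"
  shows "Z = B4 \<Longrightarrow> g \<in> B4" "Z = Pa4 \<Longrightarrow> g \<in> Pa4" "Z = Pb4 \<Longrightarrow> g \<in> Pb4" "Z = Z24 \<Longrightarrow> g \<in> Pb4"
    "Z = Z31 \<Longrightarrow> g \<in> Pa4" "Z = Z34 \<Longrightarrow> g \<in> Pa4" "Z = Z42 \<Longrightarrow> g \<in> Pb4"
proof -
  have one: "mat 1 \<in> B4" "mat 1 \<in> Pa4" "mat 1 \<in> Pb4" using group4_standard by (auto simp: group4_def)
  show "Z = B4 \<Longrightarrow> g \<in> B4" "Z = Pa4 \<Longrightarrow> g \<in> Pa4" "Z = Pb4 \<Longrightarrow> g \<in> Pb4"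
    using st[of "mat 1"] one by auto
  show "g \<in> Pb4" if Z: "Z = Z24"
  proof -
    have "mat 1 \<in> Z" "n21 \<in> Z" by (simp_all add: Z Z24_def Sp4_cols mat_nth n21_def)
    then have "g ** mat 1 \<in> Z" "g ** n21 \<in> Z" by (blast intro: st)+
    then show ?thesis by (simp add: Z Z24_def Pb4_def mult4 n21_def)
  qed
  show "g \<in> Pa4" if Z: "Z = Z34"
  proof -
    have "mat 1 \<in> Z" "n21 \<in> Z" "n31 \<in> Z" by (simp_all add: Z Z34_def Sp4_cols mat_nth n21_def n31_def)
    then have "g ** mat 1 \<in> Z" "g ** n21 \<in> Z" "g ** n31 \<in> Z" by (blast intro: st)+
    then have z: "g$4$1 = 0" "g$4$2 = 0" "g$4$3 = 0" by (simp_all add: Z Z34_def mult4 n21_def n31_def)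
    then show ?thesis using g Sp4_rows[OF g] by (auto simp: Pa4_eq)
  qed
  show "g \<in> Pa4" if Z: "Z = Z31"
  proof -
    have "mat 1 \<in> Z" "n13 \<in> Z" by (simp_all add: Z Z31_def Sp4_cols mat_nth n13_def mn_def)
    then have "g ** mat 1 \<in> Z" "g ** n13 \<in> Z" by (blast intro: st)+
    then have z: "g$4$1 = 0" "g$4$2 = 0" "g$4$3 = 0" "g$2$1 * g$3$2 - g$3$1 * g$2$2 = 0" "g$2$1 * g$3$3 - g$3$1 * g$2$3 = 0"
      by (simp_all add: Z Z31_def mult4 n13_def mn_def)
    have D: "g$2$2 * g$3$3 - g$3$2 * g$2$3 = 1" using g z(1-3) by (simp add: Sp4_cols)
    have "g$2$1 * (g$2$2 * g$3$3 - g$3$2 * g$2$3) =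
        g$2$2 * (g$2$1 * g$3$3 - g$3$1 * g$2$3) - g$2$3 * (g$2$1 * g$3$2 - g$3$1 * g$2$2)"
      "g$3$1 * (g$2$2 * g$3$3 - g$3$2 * g$2$3) =
        g$3$2 * (g$2$1 * g$3$3 - g$3$1 * g$2$3) - g$3$3 * (g$2$1 * g$3$2 - g$3$1 * g$2$2)"
      by (simp_all add: algebra_simps)
    then show ?thesis using g z(1) unfolding D z(4,5) by (simp add: Pa4_eq)
  qed
  show "g \<in> Pb4" if Z: "Z = Z42"
  proof -
    let ?M = "\<lambda>i j. g$3$i * g$4$j - g$4$i * g$3$j"
    \<comment> \<open>The test elements yield the minors of the last two rows of g; the translated
      one yields the difference of the minors (1, 4) and (2, 3), whose sum is 0 by isotropy of the
      rows.\<close>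
    have "mat 1 \<in> Z" "n13 \<in> Z" "n24 \<in> Z" "xa 1 ** n24 \<in> Z"
      by (simp_all add: Z Z42_def Sp4_cols mat_nth n13_def n24_def mn_def xa_def upp_def mult4)
    then have "g ** mat 1 \<in> Z" "g ** n13 \<in> Z" "g ** n24 \<in> Z" "g ** (xa 1 ** n24) \<in> Z" by (blast intro: st)+
    then have M: "?M 1 2 = 0" "?M 1 3 = 0" "?M 2 4 = 0" "?M 1 4 - ?M 1 3 + ?M 2 4 - ?M 2 3 = 0"
      by (simp_all add: Z Z42_def mult4 weyl_defs mn_def xa_def upp_def algebra_simps)
    note R = Sp4_rows[OF g]
    have "?M 1 4 + ?M 2 3 = 0" using R by (simp add: algebra_simps)
    moreover have "?M 1 4 - ?M 2 3 = 0" using M by simp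
    moreover have "x = 0 \<and> y = 0" if "x + y = 0" "x - y = 0" for x y :: complex
    proof -
      have "x = y" using that(2) by simp
      then have "2 * x = 0" using that(1) by (simp only: mult_2)
      then show ?thesis using \<open>x = y\<close> by simp
    qed
    ultimately have "?M 1 4 = 0" "?M 2 3 = 0" by blast+
    note M = M(1-3) this
    define X13 X14 X23 X24 where
      "X13 = g$1$1 * g$3$4 + g$1$2 * g$3$3 - g$1$3 * g$3$2 - g$1$4 * g$3$1"
      and "X14 = g$1$1 * g$4$4 + g$1$2 * g$4$3 - g$1$3 * g$4$2 - g$1$4 * g$4$1"
      and "X23 = g$2$1 * g$3$4 + g$2$2 * g$3$3 - g$2$3 * g$3$2 - g$2$4 * g$3$1"
      and "X24 = g$2$1 * g$4$4 + g$2$2 * g$4$3 - g$2$3 * g$4$2 - g$2$4 * g$4$1"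
    have X: "X13 = 0" "X14 = 1" "X23 = 1" "X24 = 0" using R by (simp_all add: X13_def X14_def X23_def X24_def)
    \<comment> \<open>The X are pairings of the first two rows with the last two, so the left sides
      are, up to sign, the lower left entries of g; the right sides are combinations of vanishing
      minors.\<close>
    have "g$3$1 * X14 - g$4$1 * X13 = g$1$1 * ?M 1 4 + g$1$2 * ?M 1 3 - g$1$3 * ?M 1 2"
      "g$3$1 * X24 - g$4$1 * X23 = g$2$1 * ?M 1 4 + g$2$2 * ?M 1 3 - g$2$3 * ?M 1 2"
      "g$3$2 * X14 - g$4$2 * X13 = g$1$1 * ?M 2 4 + g$1$2 * ?M 2 3 + g$1$4 * ?M 1 2"
      "g$3$2 * X24 - g$4$2 * X23 = g$2$1 * ?M 2 4 + g$2$2 * ?M 2 3 + g$2$4 * ?M 1 2"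
      by (simp_all add: X13_def X14_def X23_def X24_def algebra_simps)
    then show ?thesis using g unfolding M X by (simp add: Pb4_def)
  qed
qed

subsection \<open>All Schubert varieties\<close>

context sp4_rep
begin

lemma weyl_representative:
  assumes "w \<in> carrier (weyl_group (Psi ` Sp4) (Psi ` T4))"
  obtains n where "n \<in> Sp4"
    "schubert_variety (Psi ` Sp4) (Psi ` B4) w = flags closure_of (cs ` {b ** n ** b' | b b'. b \<in> B4 \<and> b' \<in> B4})"
proof -
  obtain x where x: "x \<in> normalizer (sub_group (Psi ` Sp4)) (Psi ` T4)" "w = (\<lambda>t. t ** x) ` Psi ` T4"
    using assms by (auto simp: weyl_group_def FactGroup_def RCOSETS_def r_coset_def)
  have "x \<in> Psi ` Sp4" using x(1) by (simp add: normalizer_def stabilizer_def)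
  then obtain n where n: "n \<in> Sp4" "x = Psi n" by blast
  have T: "mat 1 \<in> T4" "\<And>b t. b \<in> B4 \<Longrightarrow> t \<in> T4 \<Longrightarrow> b ** t \<in> B4"
    using group4_standard(2,5) by (auto simp: group4_def T4_def B4_def)
  have "Psi ` B4 <#>\<^bsub>GL\<^esub> w <#>\<^bsub>GL\<^esub> Psi ` B4 = Psi ` {b ** n ** b' | b b'. b \<in> B4 \<and> b' \<in> B4}"
  proof (intro equalityI subsetI)
    fix X assume "X \<in> Psi ` B4 <#>\<^bsub>GL\<^esub> w <#>\<^bsub>GL\<^esub> Psi ` B4"
    then obtain b t b' where b: "b \<in> B4" "t \<in> T4" "b' \<in> B4" "X = Psi b ** (Psi t ** Psi n) ** Psi b'"
      by (auto simp: set_mult_def x(2) n(2))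
    then have "X = Psi ((b ** t) ** n ** b')" by (simp add: Psi_mult matrix_mul_assoc)
    then show "X \<in> Psi ` {b ** n ** b' | b b'. b \<in> B4 \<and> b' \<in> B4}" using b T(2) by blast
  next
    fix X assume "X \<in> Psi ` {b ** n ** b' | b b'. b \<in> B4 \<and> b' \<in> B4}"
    then obtain b b' where b: "b \<in> B4" "b' \<in> B4" "X = Psi b ** (Psi (mat 1) ** Psi n) ** Psi b'"
      by (auto simp: Psi_mult Psi_one)
    then show "X \<in> Psi ` B4 <#>\<^bsub>GL\<^esub> w <#>\<^bsub>GL\<^esub> Psi ` B4"
      using T(1) n(2) x(2) unfolding set_mult_def by auto
  qed
  then have "schubert_variety (Psi ` Sp4) (Psi ` B4) w = flags closure_of (cs ` {b ** n ** b' | b b'. b \<in> B4 \<and> b' \<in> B4})"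
    unfolding schubert_variety_def cs_def by (simp only: image_image)
  then show ?thesis using that n(1) by blast
qed

lemma spherical_standard:
  assumes B: "borel_subgroup (Psi ` Sp4) (Psi ` B4)"
    and w: "w \<in> carrier (weyl_group (Psi ` Sp4) (Psi ` T4))"
    and L: "levi_subgroup (schubert_stabilizer (Psi ` Sp4) (Psi ` B4) w) L'" "Psi ` T4 \<subseteq> L'"
  shows "spherical_subvariety (Psi ` Sp4) (Psi ` B4) L' (schubert_variety (Psi ` Sp4) (Psi ` B4) w)"
proof -
  from weyl_representative[OF w] obtain n where n: "n \<in> Sp4"
    and wn: "schubert_variety (Psi ` Sp4) (Psi ` B4) w = flags closure_of (cs ` {b ** n ** b' | b b'. b \<in> B4 \<and> b' \<in> B4})" .
  have sub: "Ka4 \<subseteq> La4" "Kb4 \<subseteq> Lb4" "B4 \<subseteq> Sp4" by (auto simp: Ka4_def Kb4_def B4_def)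
  have pf: "(\<lambda>A. A$i$1) \<in> poly_fun" "(\<lambda>A. mn A i j) \<in> poly_fun" "(\<lambda>A. A$i$1 * A$j$1) \<in> poly_fun"
    "(\<lambda>A. mn A i j * mn A k l) \<in> poly_fun" "(\<lambda>A. A$i$1 * mn A k l) \<in> poly_fun"
    "(\<lambda>A. A$i$1 * A$j$1 * mn A k l) \<in> poly_fun" "(\<lambda>A. A$i$1 * mn A i' j * mn A k l) \<in> poly_fun" for i i' j k l
    by (intro poly_fun.mult poly_fun.entry poly_fun_mn)+
  note case_rule = schubert_case[where w = w and n = n and L' = L', OF _ _ _ _ _ _ wn _ _ _ _ _ _ _ _ _ _ L]
  have diag: "b$1$1 \<noteq> 0" "b$2$2 \<noteq> 0" if "b \<in> B4" for b using B4_diag[OF that] by auto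
  note simps = B4_right_mult diag Ka4_left_mult Kb4_left_mult B4_left_mult K_diag
  have om: "n$1$1 * n$4$2 + n$2$1 * n$3$2 - n$3$1 * n$2$2 - n$4$1 * n$1$2 = 0" by (rule Sp4_first_columns[OF n])
  have c1: "n$1$1 \<noteq> 0" if "n$2$1 = 0" "n$3$1 = 0" "n$4$1 = 0"
    using Sp4_rows[OF n] Sp4_cols[of n] n that by auto
  consider (c43) "n$4$1 \<noteq> 0" "mn n 3 4 \<noteq> 0" | (c42) "n$4$1 \<noteq> 0" "mn n 3 4 = 0"
    | (c34) "n$4$1 = 0" "n$3$1 \<noteq> 0" "n$4$2 \<noteq> 0" | (c31) "n$4$1 = 0" "n$3$1 \<noteq> 0" "n$4$2 = 0"
    | (c24) "n$4$1 = 0" "n$3$1 = 0" "n$2$1 \<noteq> 0" "n$4$2 \<noteq> 0" | (c21) "n$4$1 = 0" "n$3$1 = 0" "n$2$1 \<noteq> 0" "n$4$2 = 0"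
    | (c13) "n$4$1 = 0" "n$3$1 = 0" "n$2$1 = 0" "n$3$2 \<noteq> 0" | (c12) "n$4$1 = 0" "n$3$1 = 0" "n$2$1 = 0" "n$3$2 = 0"
    by blast
  then show ?thesis
  proof cases
    case c43
    show ?thesis
      by (rule schubert_case[where n = n and q = "\<lambda>A. A$4$1 * mn A 3 4" and q' = "\<lambda>A. A$4$1 * mn A 3 4" and N = n43 and y = n43,
          OF charts(7) pf(5) _ orbit_43 n _ wn standard_parabolics(4)[OF B] sub(3) Sp4_mult _ pf(5) _ _ orbit_43 weyl_Sp4(7) _ L])
        (use c43 in \<open>simp_all add: simps, simp_all add: n43_def mn_def\<close>)
  next
    case c42
    then have nZ: "n \<in> Z42" using n by (simp add: Z42_def)
    have y: "upp 0 0 1 1 ** n42 \<in> Z42" using Sp4_mult[OF upp_Sp4 weyl_Sp4(6)]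
      by (simp add: Z42_def) (simp add: mult4 upp_def n42_def mn_def)
    show ?thesis
      by (rule schubert_case[where n = n and q = "\<lambda>A. A$4$1" and q' = "\<lambda>A. A$4$1 * A$2$1 * mn A 1 2" and N = n42 and y = "upp 0 0 1 1 ** n42",
          OF chart_cone pf(1) _ orbit_42(1) nZ c42(1) wn standard_parabolics(3) sub(2) left_stable(7) stabilizer_in(7)[OF _ _ refl]
            pf(6) _ _ orbit_42(2) y _ L])
        (simp_all add: simps, simp_all add: mult4 upp_def n42_def mn_def)
  next
    case c34
    then have nZ: "n \<in> Z34" "mn n 3 4 \<noteq> 0" using n by (auto simp: Z34_def mn_def)
    have y: "upp 0 0 1 1 ** n34 \<in> Z34" using Sp4_mult[OF upp_Sp4 weyl_Sp4(5)]
      by (simp add: Z34_def) (simp add: mult4 upp_def n34_def mn_def)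
    show ?thesis
      by (rule schubert_case[where n = n and q = "\<lambda>A. mn A 3 4" and q' = "\<lambda>A. A$1$1 * mn A 1 3 * mn A 3 4" and N = n34 and y = "upp 0 0 1 1 ** n34",
          OF charts(6) pf(2) _ orbit_34(1) nZ wn standard_parabolics(2) sub(1) left_stable(6) stabilizer_in(6)[OF _ _ refl]
            pf(7) _ _ orbit_34(2) y _ L])
        (simp_all add: simps, simp_all add: mult4 upp_def n34_def mn_def)
  next
    case c31
    \<comment> \<open>With both fourth entries zero, isotropy of the first two columns is the
      remaining equation of \<open>Z31\<close>.\<close>
    then have "n$2$1 * n$3$2 - n$3$1 * n$2$2 = 0" using om by simp
    then have nZ: "n \<in> Z31" "n$3$1 \<noteq> 0" using n c31 by (auto simp: Z31_def mn_def)
    have y: "upp 0 0 1 0 ** n31 \<in> Z31" using Sp4_mult[OF upp_Sp4 weyl_Sp4(4)]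
      by (simp add: Z31_def) (simp add: mult4 upp_def n31_def mn_def)
    show ?thesis
      by (rule schubert_case[where n = n and q = "\<lambda>A. A$3$1" and q' = "\<lambda>A. A$3$1 * A$1$1" and N = n31 and y = "upp 0 0 1 0 ** n31",
          OF charts(5) pf(1) _ orbit_31(1) nZ wn standard_parabolics(2) sub(1) left_stable(5) stabilizer_in(5)[OF _ _ refl]
            pf(3) _ _ orbit_31(2) y _ L])
        (simp_all add: simps, simp_all add: mult4 upp_def n31_def mn_def)
  next
    case c24
    then have nZ: "n \<in> Z24" "mn n 2 4 \<noteq> 0" using n by (auto simp: Z24_def mn_def)
    have y: "upp 0 0 0 1 ** n24 \<in> Z24" using Sp4_mult[OF upp_Sp4 weyl_Sp4(3)]
      by (simp add: Z24_def) (simp add: mult4 upp_def n24_def mn_def)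
    show ?thesis
      by (rule schubert_case[where n = n and q = "\<lambda>A. mn A 2 4" and q' = "\<lambda>A. mn A 2 4 * mn A 1 2" and N = n24 and y = "upp 0 0 0 1 ** n24",
          OF charts(4) pf(2) _ orbit_24(1) nZ wn standard_parabolics(3) sub(2) left_stable(4) stabilizer_in(4)[OF _ _ refl]
            pf(4) _ _ orbit_24(2) y _ L])
        (simp_all add: simps, simp_all add: mult4 upp_def n24_def mn_def)
  next
    case c21
    then have "n$3$2 = 0" using om by simp
    then have nZ: "n \<in> Pb4" "n$2$1 \<noteq> 0" using n c21 by (auto simp: Pb4_def)
    have K: "\<exists>u\<in>B4. \<exists>b\<in>B4. A = u ** n21 ** b" if "A \<in> Pb4" "A$2$1 \<noteq> 0" for A
      using orbit_21[OF that] by (auto simp: Kb4_def)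
    have y: "n21 \<in> Pb4" using weyl_Sp4 by (simp add: Pb4_def) (simp add: n21_def)
    show ?thesis
      by (rule schubert_case[where n = n and q = "\<lambda>A. A$2$1" and q' = "\<lambda>A. A$2$1" and N = n21 and y = n21,
          OF charts(3) pf(1) _ K nZ wn standard_parabolics(3) sub(2) left_stable(3) stabilizer_in(3)[OF _ _ refl]
            pf(1) _ _ orbit_21 y _ L])
        (simp_all add: simps, simp_all add: n21_def)
  next
    case c13
    \<comment> \<open>The entry A$3$2 is not a semi-invariant for right multiplication by
      \<open>B4\<close> on all of \<open>Sp4\<close>; the minor is, and on \<open>Pa4\<close> it
      differs from the entry by a nonzero factor.\<close>
    have q: "A$1$1 \<noteq> 0 \<and> mn A 1 3 = A$1$1 * A$3$2" if "A \<in> Pa4" for A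
      using that by (auto simp: Pa4_def Sp4_cols mn_def)
    have nZ: "n \<in> Pa4" "mn n 1 3 \<noteq> 0" using n c13 q[of n] by (auto simp: Pa4_eq)
    have K: "\<exists>k\<in>Ka4. \<exists>b\<in>B4. A = k ** n13 ** b" if "A \<in> Pa4" "mn A 1 3 \<noteq> 0" for A
      using orbit_13[of A] that q[of A] by simp
    have K': "\<exists>u\<in>B4. \<exists>b\<in>B4. A = u ** n13 ** b" if "A \<in> Pa4" "mn A 1 3 \<noteq> 0" for A
      using K[OF that] by (auto simp: Ka4_def)
    have y: "n13 \<in> Pa4" using weyl_Sp4 by (simp add: Pa4_def) (simp add: n13_def)
    show ?thesis
      by (rule schubert_case[where n = n and q = "\<lambda>A. mn A 1 3" and q' = "\<lambda>A. mn A 1 3" and N = n13 and y = n13,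
          OF charts(2) pf(2) _ K' nZ wn standard_parabolics(2) sub(1) left_stable(2) stabilizer_in(2)[OF _ _ refl]
            pf(2) _ _ K y _ L])
        (simp_all add: simps, simp_all add: n13_def mn_def)
  next
    case c12
    then have nZ: "n \<in> B4" using n by (simp add: B4_eq)
    have K: "\<exists>u\<in>B4. \<exists>b\<in>B4. A = u ** mat 1 ** b" "\<exists>u\<in>T4. \<exists>b\<in>B4. A = u ** mat 1 ** b" if "A \<in> B4" for A
    proof -
      have "A = mat 1 ** mat 1 ** A" by simp
      moreover have "mat 1 \<in> T4" using group4_standard(5) by (simp add: group4_def)
      ultimately show "\<exists>u\<in>B4. \<exists>b\<in>B4. A = u ** mat 1 ** b" "\<exists>u\<in>T4. \<exists>b\<in>B4. A = u ** mat 1 ** b"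
        using that B4_one by blast+
    qed
    show ?thesis
      by (rule schubert_case[where n = n and q = "\<lambda>_. 1" and q' = "\<lambda>_. 1" and N = "mat 1" and y = "mat 1",
          OF charts(1) poly_fun.const _ K(1) nZ _ wn standard_parabolics(1) order_refl left_stable(1) stabilizer_in(1)[OF _ _ refl]
            poly_fun.const _ _ K(2) B4_one _ L]) simp_all
  qed
qed

end

lemma B4_conj_image:
  assumes b: "b \<in> B4" shows "(\<lambda>A. b ** A ** adj b) ` B4 = B4"
proof (intro equalityI subsetI)
  have B: "adj b \<in> B4" "b \<in> Sp4" and m: "\<And>x y. x \<in> B4 \<Longrightarrow> y \<in> B4 \<Longrightarrow> x ** y \<in> B4"
    using b group4_standard(2) by (auto simp: group4_def)
  fix A
  show "A \<in> B4" if "A \<in> (\<lambda>A. b ** A ** adj b) ` B4" using that b B m by auto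
  assume "A \<in> B4"
  then have "adj b ** A ** b \<in> B4" using b B m by blast
  moreover have "A = b ** (adj b ** A ** b) ** adj b"
    by (simp add: matrix_mul_assoc[symmetric] adj_cancel adj_right B)
  ultimately show "A \<in> (\<lambda>A. b ** A ** adj b) ` B4" by blast
qed

text \<open>Two conjugations: the first makes the Borel subgroup standard, the second, by an element
  of \<open>B4\<close>, makes the torus standard and keeps the Borel subgroup.\<close>

lemma Spin5_standard:
  assumes B: "borel_subgroup Spin5 B" and T: "maximal_torus Spin5 T" "T \<subseteq> B"
  shows "\<exists>Psi rho. sp4_rep Psi rho \<and> Spin5 = Psi ` Sp4 \<and> B = Psi ` B4 \<and> T = Psi ` T4"
proof -
  obtain g where g: "g \<in> Sp4" "B = (\<lambda>A. spin_embed (g ** A ** adj g)) ` B4"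
    using sp4_rep.borel_conj[OF sp4_rep_spin] B unfolding Spin5_eq by blast
  define P1 where "P1 = (\<lambda>A. spin_embed (g ** A ** adj g))"
  obtain r1 where P1: "sp4_rep P1 r1" unfolding P1_def using sp4_rep_conj[OF sp4_rep_spin g(1)] by blast
  have "P1 ` Sp4 = spin_embed ` ((\<lambda>A. g ** A ** adj g) ` Sp4)" by (simp add: P1_def image_image)
  then have S1: "Spin5 = P1 ` Sp4" using conj_Sp4[OF g(1)] by (simp add: Spin5_eq)
  have B1: "B = P1 ` B4" using g(2) by (simp add: P1_def)
  have T': "maximal_torus (P1 ` Sp4) T" "T \<subseteq> P1 ` B4" using T by (simp_all only: S1 B1)
  \<comment> \<open>Two distinct indices of the matrix size carry the two parameters of the
    torus.\<close>
  have "{} \<noteq> (UNIV :: 5 set)" by simp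
  from sp4_rep.maximal_torus_conj[OF P1 T' this]
  obtain b where b: "b \<in> B4" "T = (\<lambda>A. P1 (b ** A ** adj b)) ` T4" by (rule bexE)
  have bS: "b \<in> Sp4" using b(1) by (simp add: B4_def)
  define P2 where "P2 = (\<lambda>A. P1 (b ** A ** adj b))"
  obtain r2 where P2: "sp4_rep P2 r2" unfolding P2_def using sp4_rep_conj[OF P1 bS] by blast
  have "P2 ` X = P1 ` ((\<lambda>A. b ** A ** adj b) ` X)" for X by (simp add: P2_def image_image)
  then have "Spin5 = P2 ` Sp4" "B = P2 ` B4" using S1 B1 conj_Sp4[OF bS] B4_conj_image[OF b(1)] by simp_all
  moreover have "T = P2 ` T4" using b(2) by (simp add: P2_def)
  ultimately show ?thesis using P2 by blast
qed

theorem theorem7p1: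
  fixes B T L w :: "(complex^(5 set)^(5 set)) set"
  assumes "borel_subgroup Spin5 B"
    and "maximal_torus Spin5 T" and "T \<subseteq> B"
    and "w \<in> carrier (weyl_group Spin5 T)"
    and "levi_subgroup (schubert_stabilizer Spin5 B w) L" and "T \<subseteq> L"
  shows "spherical_subvariety Spin5 B L (schubert_variety Spin5 B w)"
proof -
  obtain Psi rho where P: "sp4_rep Psi rho" "Spin5 = Psi ` Sp4" "B = Psi ` B4" "T = Psi ` T4"
    using Spin5_standard[OF assms(1-3)] by blast
  show ?thesis
    unfolding P(2-4) by (rule sp4_rep.spherical_standard[OF P(1)]) (use assms in \<open>simp_all only: P(2-4)\<close>)
qed

end
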